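(* Let $u \in L^\infty(\mathbb{B}_n)$. The following are equivalent: (a) $T_u$ acts compactly on $\mathcal{A}^p_{\sigma_b}$ for some $p \in (1,\infty)$ and some $b \in (-1,p-1)$; (b) $T_u$ acts compactly on $\mathcal{A}^p_{\sigma_b}$ for all $p \in (1,\infty)$ and all $b \in (-1,p-1)$; (c) $\widetilde{T_u}(z)\rightarrow 0$ as $|z|\rightarrow 1^{-}$.
   Context: $\mathbb{B}_n$ is the open unit ball of $\mathbb{C}^n$, $V$ is normalized Lebesgue measure on $\mathbb{B}_n$, $z\overline{w}=\sum_{j=1}^n z_j\overline{w}_j$. For $u\in L^\infty$ the (unweighted) Toeplitz operator is $T_uf(z)=\int_{\mathbb{B}_n}\frac{u(w)f(w)}{(1-z\overline{w})^{n+1}}\,dV(w)$. Its Berezin transform is $\widetilde{T_u}(z)=\langle T_uk_z,k_z\rangle$ (inner product of $L^2(V)$), where $k_z(w)=\frac{(1-|z|^2)^{(n+1)/2}}{(1-\overline{z}w)^{n+1}}$. For $b>-1$, $\sigma_b(z)=c_b(1-|z|^2)^b$, where $c_b$ is the normalizing constant making $\int_{\mathbb{B}_n}\sigma_b\,dV=1$. For a weight $\sigma$, $\mathcal{A}^p_{\sigma}$ is the space of holomorphic functions $f$ on $\mathbb{B}_n$ with $\|f\|_{L^p_\sigma}^p=\int_{\mathbb{B}_n}|f|^p\sigma\,dV<\infty$. *)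

theory Defs
  imports "HOL-Analysis.Analysis"
begin

(* Points of C^n are vectors of type complex^'n with n = CARD('n); norm is the Euclidean norm
   of C^n, so the open unit ball B_n is ball 0 1. Functions on B_n are represented by total
   functions, of which only the values on the ball are ever used. *)

definition herm_prod :: "complex^'n \<Rightarrow> complex^'n \<Rightarrow> complex" where
  "herm_prod z w = (\<Sum>j\<in>UNIV. z $ j * cnj (w $ j))"

(* The Lebesgue measure is restricted to the ball first, so that measurability and
   integrability do not depend on the values of a function outside the ball. *)
definition ball_measure :: "(complex^'n) measure" where
  "ball_measure = uniform_measure (lebesgue_on (ball 0 1)) (ball 0 1)"

definition Linfty_ball :: "(complex^'n \<Rightarrow> complex) set" where
  "Linfty_ball = {u. u \<in> borel_measurable ball_measure \<and>
     (\<exists>C::real. AE z in ball_measure. norm (u z) \<le> C)}"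

(* Complex Frechet differentiability at every point of the ball: the real derivative exists
   and is complex linear. *)
definition holomorphic_ball :: "(complex^'n \<Rightarrow> complex) \<Rightarrow> bool" where
  "holomorphic_ball f \<longleftrightarrow>
     (\<forall>z\<in>ball 0 1. \<exists>D. (f has_derivative D) (at z) \<and> (\<forall>c v. D (c *s v) = c * D v))"

definition weighted_norm :: "real \<Rightarrow> (complex^'n \<Rightarrow> real) \<Rightarrow> (complex^'n \<Rightarrow> complex) \<Rightarrow> real" where
  "weighted_norm p \<sigma> f = (LINT z|ball_measure. norm (f z) powr p * \<sigma> z) powr (1 / p)"

definition bergman_space :: "real \<Rightarrow> (complex^'n \<Rightarrow> real) \<Rightarrow> (complex^'n \<Rightarrow> complex) set" where
  "bergman_space p \<sigma> =
     {f. holomorphic_ball f \<and> integrable ball_measure (\<lambda>z. norm (f z) powr p * \<sigma> z)}"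

definition standard_weight :: "real \<Rightarrow> complex^'n \<Rightarrow> real" where
  "standard_weight b z =
     (1 - (norm z)\<^sup>2) powr b / (LINT w|(ball_measure :: (complex^'n) measure). (1 - (norm w)\<^sup>2) powr b)"

definition toeplitz :: "(complex^'n \<Rightarrow> complex) \<Rightarrow> (complex^'n \<Rightarrow> complex) \<Rightarrow> complex^'n \<Rightarrow> complex" where
  "toeplitz u f z =
     (LINT w|ball_measure. u w * f w / (1 - herm_prod z w) ^ (CARD('n) + 1))"

definition norm_kernel :: "complex^'n \<Rightarrow> complex^'n \<Rightarrow> complex" where
  "norm_kernel z w =
     complex_of_real ((1 - (norm z)\<^sup>2) powr ((real CARD('n) + 1) / 2))
       / (1 - herm_prod w z) ^ (CARD('n) + 1)"

definition L2_inner :: "(complex^'n \<Rightarrow> complex) \<Rightarrow> (complex^'n \<Rightarrow> complex) \<Rightarrow> complex" where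
  "L2_inner f g = (LINT w|ball_measure. f w * cnj (g w))"

definition berezin :: "(complex^'n \<Rightarrow> complex) \<Rightarrow> complex^'n \<Rightarrow> complex" where
  "berezin u z = L2_inner (toeplitz u (norm_kernel z)) (norm_kernel z)"

(* Compactness of an operator T on the space X with norm N: T maps X into itself, and the image
   of every N-bounded sequence has a subsequence converging in X. Linearity is not part of the
   definition; it is used for the linear operator T = toeplitz u. *)
definition compact_operator_on ::
  "(('a \<Rightarrow> complex) \<Rightarrow> 'a \<Rightarrow> complex) \<Rightarrow> ('a \<Rightarrow> complex) set \<Rightarrow> (('a \<Rightarrow> complex) \<Rightarrow> real) \<Rightarrow> bool" where
  "compact_operator_on T X N \<longleftrightarrow>
     (\<forall>f\<in>X. T f \<in> X) \<and>
     (\<forall>f :: nat \<Rightarrow> 'a \<Rightarrow> complex. (\<forall>k. f k \<in> X) \<and> bdd_above (range (\<lambda>k. N (f k))) \<longrightarrow>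
        (\<exists>r g. strict_mono r \<and> g \<in> X \<and>
           (\<lambda>k. N (\<lambda>z. T (f (r k)) z - g z)) \<longlonglongrightarrow> 0))"

definition toeplitz_compact :: "(complex^'n \<Rightarrow> complex) \<Rightarrow> real \<Rightarrow> real \<Rightarrow> bool" where
  "toeplitz_compact u p b \<longleftrightarrow>
     compact_operator_on (toeplitz u)
       (bergman_space p (standard_weight b)) (weighted_norm p (standard_weight b))"

end

theory Submission
  imports Defs "HOL-Complex_Analysis.Complex_Analysis"
begin

text \<open>
Write \<open>N = n + 1\<close>, \<open>K\<^sub>z(w) = 1 / (1 - <w,z>)^N\<close> and
\<open>k(z,w) = T\<^sub>u K\<^sub>z (w)\<close> (\<open>toeplitz_kernel\<close>). The reproducing property of \<open>K\<^sub>z\<close> gives two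
identities: \<open>T\<^sub>u f (w)\<close> is the integral of \<open>f(z) k(z,w)\<close> over \<open>z\<close>, and the Berezin transform at \<open>z\<close> is
the normalized diagonal value \<open>(1 - |z|^2)^N k(z,z)\<close>. So the theorem says that compactness can be read
off from the diagonal of \<open>k\<close>.

From (c) to (b). The diagonal first controls the kernel near the diagonal: as \<open>|z|\<close> tends to 1,
\<open>k(z,w) |1 - <z,w>|^N\<close> tends to 0 uniformly for \<open>w\<close> in a fixed pseudohyperbolic ball about \<open>z\<close>
(\<open>toeplitz_kernel_small\<close>). After the substitution by the automorphism \<open>\<phi>\<^sub>z\<close> that exchanges \<open>z\<close> and 0, with
\<open>w = \<phi>\<^sub>z(\<eta>)\<close>, this quantity is in absolute value the integral of \<open>h(<\<eta>, \<phi>\<^sub>z(x)>)\<close> against \<open>u\<close> times a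
density whose mass is bounded independently of \<open>z\<close>, for \<open>h(\<tau>) = (1 - \<tau>)^(-N)\<close>; the normalized diagonal
values at the points \<open>\<phi>\<^sub>z(l \<eta>)\<close>, \<open>|l| \<le> 1\<close>, are multiples of the same integral for \<open>h(\<tau>) = |1 - l \<tau>|^(-2 N)\<close>.
Linear combinations of the latter functions approximate the former uniformly on discs \<open>|\<tau>| \<le> R < 1\<close>
(\<open>approximable_bergman_kernel\<close>), and the points \<open>\<phi>\<^sub>z(l \<eta>)\<close> approach the sphere together with \<open>z\<close>.

Far from the diagonal, \<open>|k|\<close> is at most \<open>U\<close> times the composition of \<open>|K|\<close> with itself, and the composition
gains a small factor there: with \<open>\<rho>(z,w) = (1 - |z|^2)(1 - |w|^2) / |1 - <z,w>|^2\<close> one has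
\<open>\<rho>(z,x) \<rho>(x,w) \<le> 4 \<rho>(z,w)\<close>, so for \<open>\<rho>(z,w) < \<delta>\<close> it is bounded by \<open>(4 \<delta>)^\<epsilon>\<close> times the composition of the
slightly more singular kernels \<open>\<rho>^(-\<epsilon>) |K|\<close> (\<open>kcomp_kb_dominate\<close>). By the Forelli-Rudin estimate all these
kernels pass the Schur test on the weighted Lebesgue space, and the exponents that this test needs exist
exactly because \<open>-1 < b < p - 1\<close>. Hence \<open>T\<^sub>u\<close> is an operator that sees only the values of \<open>f\<close> on a
compact ball, up to an operator of small norm, and it maps bounded sequences that converge to 0 pointwise to null
sequences (\<open>toeplitz_null_sequence\<close>). Bounded sequences have locally convergent subsequences, which yields
compactness.

From (a) to (c). With \<open>\<gamma> = (N + b) / p\<close> the functions \<open>f\<^sub>z = (1 - |z|^2)^(N - \<gamma>) K\<^sub>z\<close> are bounded in the weighted Bergman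
space, and the Berezin transform at \<open>z\<close> is \<open>(1 - |z|^2)^\<gamma> T\<^sub>u f\<^sub>z (z)\<close>. Evaluation at \<open>z\<close> has norm at most a constant times
\<open>(1 - |z|^2)^(-\<gamma>)\<close>, and \<open>(1 - |z|^2)^\<gamma> g(z)\<close> tends to 0 at the sphere for each single \<open>g\<close> in the space. If \<open>T\<^sub>u f\<^sub>z\<close>
converges to \<open>g\<close> along a sequence of points approaching the sphere, then the Berezin transform therefore tends to 0
along it. The step from (b) to (a) specializes to \<open>p = 2\<close>, \<open>b = 0\<close>.
\<close>

section \<open>The Hermitian product\<close>

lemma herm_prod_add_left: "herm_prod (x + y) w = herm_prod x w + herm_prod y w"
  by (simp add: herm_prod_def algebra_simps sum.distrib)

lemma herm_prod_diff_left: "herm_prod (x - y) w = herm_prod x w - herm_prod y w"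
  by (simp add: herm_prod_def algebra_simps sum_subtractf)

lemma herm_prod_smult_left: "herm_prod (c *s x) w = c * herm_prod x w"
  by (simp add: herm_prod_def algebra_simps sum_distrib_left)

lemma cnj_herm_prod: "cnj (herm_prod z w) = herm_prod w z"
  by (simp add: herm_prod_def mult.commute)

lemma herm_prod_add_right: "herm_prod w (x + y) = herm_prod w x + herm_prod w y"
  by (simp add: herm_prod_def algebra_simps sum.distrib)

lemma herm_prod_diff_right: "herm_prod w (x - y) = herm_prod w x - herm_prod w y"
  by (simp add: herm_prod_def algebra_simps sum_subtractf)

lemma herm_prod_smult_right: "herm_prod w (c *s x) = cnj c * herm_prod w x"
  by (simp add: herm_prod_def algebra_simps sum_distrib_left)

lemma herm_prod_zero [simp]: "herm_prod 0 w = 0" "herm_prod w 0 = 0"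
  by (simp_all add: herm_prod_def)

lemma scaleR_eq_smult: "r *\<^sub>R (x::complex^'n) = complex_of_real r *s x"
  by (simp add: vec_eq_iff) (simp add: scaleR_conv_of_real)

lemmas herm_prod_simps = herm_prod_add_left herm_prod_diff_left herm_prod_smult_left
  herm_prod_add_right herm_prod_diff_right herm_prod_smult_right

lemma Re_herm_prod: "Re (herm_prod z w) = inner z w"
  by (simp add: herm_prod_def inner_vec_def inner_complex_def)

lemma herm_prod_self: "herm_prod z z = complex_of_real ((norm z)\<^sup>2)"
proof -
  have "Im (herm_prod z z) = 0"
    by (simp add: herm_prod_def mult.commute)
  moreover have "Re (herm_prod z z) = (norm z)\<^sup>2"
    by (simp add: Re_herm_prod power2_norm_eq_inner)
  ultimately show ?thesis by (simp add: complex_eq_iff)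
qed

lemma norm_smult: "norm (c *s (x::complex^'n)) = norm c * norm x"
proof -
  have "complex_of_real ((norm (c *s x))\<^sup>2) = (c * cnj c) * complex_of_real ((norm x)\<^sup>2)"
    unfolding herm_prod_self[symmetric] by (simp add: herm_prod_smult_left herm_prod_smult_right)
  also have "\<dots> = complex_of_real ((norm c * norm x)\<^sup>2)"
    by (simp add: complex_norm_square[symmetric] power_mult_distrib)
  finally have "(norm (c *s x))\<^sup>2 = (norm c * norm x)\<^sup>2" using of_real_eq_iff by blast
  thus ?thesis by (simp add: power2_eq_iff_nonneg)
qed

text \<open>Rotating \<open>z\<close> by a unimodular scalar makes the Hermitian product real, so that it equals the
real inner product and the real Cauchy-Schwarz inequality applies.\<close>

lemma norm_herm_prod_le: "norm (herm_prod z w) \<le> norm z * norm w"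
proof (cases "herm_prod z w = 0")
  case False
  define c where "c = cnj (sgn (herm_prod z w))"
  have n: "norm c = 1" using False by (simp add: c_def norm_sgn)
  have "c * herm_prod z w = complex_of_real (norm (herm_prod z w))"
    using False by (simp add: c_def sgn_eq complex_norm_square[symmetric] power2_eq_square field_simps)
  hence "norm (herm_prod z w) = Re (herm_prod (c *s z) w)"
    by (simp add: herm_prod_smult_left)
  also have "\<dots> \<le> norm (c *s z) * norm w"
    by (simp add: Re_herm_prod norm_cauchy_schwarz)
  finally show ?thesis by (simp add: norm_smult n)
qed simp

lemma bounded_linear_herm_prod_left: "bounded_linear (\<lambda>z. herm_prod z w)"
proof
  show "\<exists>K. \<forall>x. norm (herm_prod x w) \<le> norm x * K"
    using norm_herm_prod_le by blast
qed (simp_all add: herm_prod_add_left scaleR_eq_smult herm_prod_smult_left scaleR_conv_of_real)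

lemma continuous_on_herm_prod [continuous_intros]:
  assumes "continuous_on S f" "continuous_on S g"
  shows "continuous_on S (\<lambda>x. herm_prod (f x) (g x))"
  unfolding herm_prod_def by (intro continuous_intros assms)

lemma borel_measurable_herm_prod [measurable]:
  fixes f g :: "'a \<Rightarrow> complex^'n"
  assumes [measurable]: "f \<in> borel_measurable M" "g \<in> borel_measurable M"
  shows "(\<lambda>x. herm_prod (f x) (g x)) \<in> borel_measurable M"
proof -
  have "continuous_on UNIV (\<lambda>p::(complex^'n) \<times> (complex^'n). herm_prod (fst p) (snd p))"
    by (intro continuous_intros)
  hence [measurable]: "(\<lambda>p::(complex^'n) \<times> (complex^'n). herm_prod (fst p) (snd p)) \<in> borel_measurable borel"
    by (rule borel_measurable_continuous_onI)
  have "(\<lambda>x. (f x, g x)) \<in> borel_measurable M" by (intro borel_measurable_Pair assms)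
  from measurable_compose[OF this, of "\<lambda>p. herm_prod (fst p) (snd p)" borel] show ?thesis by simp
qed

lemma norm_herm_prod_less:
  "norm z < 1 \<Longrightarrow> norm w \<le> 1 \<Longrightarrow> norm (herm_prod z w) < 1"
  "norm z \<le> 1 \<Longrightarrow> norm w < 1 \<Longrightarrow> norm (herm_prod z w) < 1"
proof -
  show "norm z < 1 \<Longrightarrow> norm w \<le> 1 \<Longrightarrow> norm (herm_prod z w) < 1"
    using norm_herm_prod_le[of z w] mult_left_le[of "norm w" "norm z"] by simp
  show "norm z \<le> 1 \<Longrightarrow> norm w < 1 \<Longrightarrow> norm (herm_prod z w) < 1"
    using norm_herm_prod_le[of z w] mult_right_le_one_le[of "norm w" "norm z"] by simp (metis mult.commute mult_right_le_one_le norm_ge_zero order_le_less_trans)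
qed

lemma norm_one_minus_herm_prod_ge:
  assumes "norm w \<le> 1" shows "1 - norm z \<le> norm (1 - herm_prod z w)"
proof -
  have "norm (herm_prod z w) \<le> norm z"
    using norm_herm_prod_le[of z w] mult_left_le[of "norm w" "norm z"] assms by simp
  moreover have "1 - norm (herm_prod z w) \<le> norm (1 - herm_prod z w)"
    using norm_triangle_ineq2[of 1 "herm_prod z w"] by simp
  ultimately show ?thesis by linarith
qed

lemma one_minus_herm_prod_nonzero:
  "norm z < 1 \<Longrightarrow> norm w \<le> 1 \<Longrightarrow> 1 - herm_prod z w \<noteq> 0"
  "norm z \<le> 1 \<Longrightarrow> norm w < 1 \<Longrightarrow> 1 - herm_prod z w \<noteq> 0"
  using norm_herm_prod_less[of z w] by fastforce+

lemma norm_one_minus_herm_prod_commute: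
  "norm (1 - herm_prod z w) = norm (1 - herm_prod w z)"
  by (metis cnj_herm_prod complex_cnj_diff complex_cnj_one complex_mod_cnj)

section \<open>Normalized volume of the ball\<close>

lemma nn_integral_lborel_translate:
  fixes f :: "'a::euclidean_space \<Rightarrow> ennreal"
  assumes [measurable]: "f \<in> borel_measurable borel"
  shows "(\<integral>\<^sup>+x. f (c + x) \<partial>lborel) = (\<integral>\<^sup>+x. f x \<partial>lborel)"
  by (subst (2) lborel_distr_plus[of c, symmetric]) (simp add: nn_integral_distr)

lemma nn_integral_lborel_scale:
  fixes f :: "'a::euclidean_space \<Rightarrow> ennreal"
  assumes [measurable]: "f \<in> borel_measurable borel" and "c \<noteq> 0"
  shows "(\<integral>\<^sup>+x. f x \<partial>lborel) = ennreal (\<bar>c\<bar> ^ DIM('a)) * (\<integral>\<^sup>+x. f (c *\<^sub>R x) \<partial>lborel)"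
  by (subst lborel_affine[OF assms(2), of 0])
     (simp add: nn_integral_density nn_integral_distr nn_integral_cmult)

lemma emeasure_lborel_unit_ball:
  "emeasure lborel (ball (0::'a::euclidean_space) 1) \<noteq> 0"
  "emeasure lborel (ball (0::'a::euclidean_space) 1) \<noteq> \<infinity>"
  using emeasure_bounded_finite[of "ball (0::'a) 1"] unit_ball_vol_pos[of "real DIM('a)"]
  by (simp_all add: emeasure_ball del: unit_ball_vol_pos)

text \<open>A measure that is invariant under translations is Lebesgue measure up to a factor, and an
isometry fixes the unit ball, so the factor is 1. The proof runs the uniqueness argument directly: for a
Borel set \<open>A\<close> the double integral of the indicator of \<open>A\<close> at \<open>U x + y\<close> over \<open>x\<close> in the unit ball and all \<open>y\<close> is
computed in both orders.\<close>

lemma lborel_distr_isometry: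
  fixes U :: "'a::euclidean_space \<Rightarrow> 'a"
  assumes lin: "linear U" and iso: "\<And>x. norm (U x) = norm x"
  shows "distr lborel borel U = lborel"
proof -
  have [measurable]: "U \<in> borel_measurable borel"
    using lin by (intro borel_measurable_continuous_onI linear_continuous_on) (simp add: linear_linear)
  have inj: "inj U"
    using iso by (simp add: linear_injective_0[OF lin]) (metis norm_eq_zero)
  have surj: "surj U" using linear_injective_imp_surjective[OF lin] inj by simp
  have meas_B: "emeasure lborel {y. norm (c - y) < 1} = emeasure lborel (ball (0::'a) 1)" for c :: 'a
  proof -
    have "emeasure lborel {y. norm (c - y) < 1} = (\<integral>\<^sup>+y. indicator {y. norm (c - y) < 1} y \<partial>lborel)"
      by simp
    also have "\<dots> = (\<integral>\<^sup>+y. indicator {y. norm (c - y) < 1} (c + y) \<partial>lborel)"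
      by (rule nn_integral_lborel_translate[symmetric]) measurable
    also have "\<dots> = (\<integral>\<^sup>+y. indicator (ball (0::'a) 1) y \<partial>lborel)"
      by (intro nn_integral_cong) (simp add: indicator_def)
    finally show ?thesis by simp
  qed
  show ?thesis
  proof (rule measure_eqI)
    fix A assume "A \<in> sets (distr lborel borel U)"
    hence [measurable]: "A \<in> sets borel" by simp
    let ?B = "ball (0::'a) 1"
    have [measurable]: "ball y 1 \<in> sets borel" for y :: 'a by simp
    have "emeasure lborel A * emeasure lborel ?B = (\<integral>\<^sup>+x. emeasure lborel A * indicator ?B x \<partial>lborel)"
      by (subst nn_integral_cmult_indicator) auto
    also have "\<dots> = (\<integral>\<^sup>+x. (\<integral>\<^sup>+y. indicator A (U x + y) * indicator ?B x \<partial>lborel) \<partial>lborel)"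
    proof (rule nn_integral_cong)
      fix x
      have "(\<integral>\<^sup>+y. indicator A (U x + y) \<partial>lborel) = emeasure lborel A"
        using nn_integral_lborel_translate[of "indicator A" "U x"] by simp
      thus "emeasure lborel A * indicator ?B x = (\<integral>\<^sup>+y. indicator A (U x + y) * indicator ?B x \<partial>lborel)"
        by (subst nn_integral_multc) (auto intro!: measurable_compose[OF _ borel_measurable_indicator])
    qed
    also have "\<dots> = (\<integral>\<^sup>+y. (\<integral>\<^sup>+x. indicator A (U x + y) * indicator ?B x \<partial>lborel) \<partial>lborel)"
      by (rule lborel_pair.Fubini') measurable
    also have "\<dots> = (\<integral>\<^sup>+y. (\<integral>\<^sup>+x. indicator A (U x) * indicator {y. norm (U x - y) < 1} y \<partial>lborel) \<partial>lborel)"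
    proof (rule nn_integral_cong)
      fix y
      obtain v where v: "U v = y" using surj by (metis surjD)
      define g where "g x = (indicator A (U x) * indicator {y. norm (U x - y) < 1} y :: ennreal)" for x
      have g: "g = (\<lambda>x. indicator A (U x) * indicator (ball y 1) (U x))"
        by (auto simp: g_def indicator_def dist_norm norm_minus_commute fun_eq_iff)
      have [measurable]: "g \<in> borel_measurable borel" unfolding g by measurable
      have "(\<integral>\<^sup>+x. g x \<partial>lborel) = (\<integral>\<^sup>+x. g (v + x) \<partial>lborel)"
        by (rule nn_integral_lborel_translate[symmetric]) measurable
      also have "\<dots> = (\<integral>\<^sup>+x. indicator A (U x + y) * indicator ?B x \<partial>lborel)"
        by (intro nn_integral_cong) (auto simp: g_def linear_add[OF lin] v indicator_def iso add.commute)
      finally show "(\<integral>\<^sup>+x. indicator A (U x + y) * indicator ?B x \<partial>lborel) =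
          (\<integral>\<^sup>+x. indicator A (U x) * indicator {y. norm (U x - y) < 1} y \<partial>lborel)"
        by (simp add: g_def)
    qed
    also have "\<dots> = (\<integral>\<^sup>+x. (\<integral>\<^sup>+y. indicator A (U x) * indicator {y. norm (U x - y) < 1} y \<partial>lborel) \<partial>lborel)"
    proof (rule lborel_pair.Fubini'[symmetric])
      have "(\<lambda>(x, y). indicator A (U y) * indicator {p. norm (U (snd p) - fst p) < 1} (x,y) :: ennreal)
         \<in> borel_measurable (lborel \<Otimes>\<^sub>M lborel)" by measurable
      thus "(\<lambda>(y, x). indicator A (U x) * indicator {y. norm (U x - y) < 1} y :: ennreal)
         \<in> borel_measurable (lborel \<Otimes>\<^sub>M lborel)" by (simp add: indicator_def)
    qed
    also have "\<dots> = (\<integral>\<^sup>+x. indicator A (U x) * emeasure lborel ?B \<partial>lborel)"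
      by (intro nn_integral_cong) (simp add: nn_integral_cmult meas_B)
    also have "\<dots> = (\<integral>\<^sup>+x. indicator A (U x) \<partial>lborel) * emeasure lborel ?B"
      by (rule nn_integral_multc) measurable
    also have "(\<integral>\<^sup>+x. indicator A (U x) \<partial>lborel) = emeasure (distr lborel borel U) A"
      using nn_integral_distr[of U lborel borel "indicator A"] by simp
    finally have *: "emeasure (distr lborel borel U) A * emeasure lborel ?B = emeasure lborel A * emeasure lborel ?B" ..
    have "emeasure lborel ?B \<noteq> \<infinity>" using emeasure_bounded_finite[of ?B] by simp
    moreover have "emeasure lborel ?B \<noteq> 0"
      by (rule emeasure_lborel_unit_ball)
    ultimately show "emeasure (distr lborel borel U) A = emeasure lborel A"
      using * by (metis ennreal_mult_cancel_left infinity_ennreal_def mult.commute)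
  qed simp
qed

lemma nn_integral_lborel_isometry:
  fixes U :: "'a::euclidean_space \<Rightarrow> 'a"
  assumes "linear U" "\<And>x. norm (U x) = norm x" and [measurable]: "f \<in> borel_measurable borel"
  shows "(\<integral>\<^sup>+x. f (U x) \<partial>lborel) = (\<integral>\<^sup>+x. f x \<partial>lborel)"
proof -
  have [measurable]: "U \<in> borel_measurable borel"
    using assms(1) by (intro borel_measurable_continuous_onI linear_continuous_on) (simp add: linear_linear)
  show ?thesis
    by (subst (2) lborel_distr_isometry[OF assms(1,2), symmetric]) (simp_all add: nn_integral_distr)
qed

lemma space_ball_measure [simp]: "space ball_measure = ball 0 1"
  by (simp add: ball_measure_def)

lemma sets_ball_measure: "sets ball_measure = sets (lebesgue_on (ball 0 1))"
  by (simp add: ball_measure_def)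

lemma measurable_ball_measure_cong:
  "measurable ball_measure M = measurable (lebesgue_on (ball 0 1)) M"
  by (rule measurable_cong_sets) (simp_all add: sets_ball_measure)

lemma emeasure_lebesgue_on_ball:
  "A \<in> sets borel \<Longrightarrow> emeasure (lebesgue_on (ball 0 1)) (A \<inter> ball 0 1) = emeasure lborel (A \<inter> ball (0::'a::euclidean_space) 1)"
  by (subst emeasure_restrict_space) auto

lemma emeasure_ball_measure_UNIV [simp]: "emeasure ball_measure (ball (0::complex^'n) 1) = 1"
proof -
  have "emeasure (lebesgue_on (ball 0 1)) (ball (0::complex^'n) 1) = emeasure lborel (ball (0::complex^'n) 1)"
    using emeasure_lebesgue_on_ball[of UNIV] by simp
  thus ?thesis
    using emeasure_lborel_unit_ball[where 'a="complex^'n"]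
    unfolding ball_measure_def
    by (subst emeasure_uniform_measure)
       (auto simp: zero_less_iff_neq_zero less_top sets_restrict_space ennreal_divide_self image_iff intro!: exI[of _ UNIV])
qed

interpretation ball_measure: finite_measure "ball_measure :: (complex^'n) measure"
  by standard simp

text \<open>The ball measure is defined on the Lebesgue sets of the ball; this rule makes Borel measurable functions
available on it.\<close>

lemma measurable_id_ball_measure [measurable (raw)]: "(\<lambda>x. x) \<in> ball_measure \<rightarrow>\<^sub>M borel"
  unfolding measurable_ball_measure_cong
  by (intro measurable_restrict_space1 measurable_completion) simp

lemma borel_imp_measurable_ball:
  "f \<in> borel_measurable borel \<Longrightarrow> f \<in> borel_measurable ball_measure"
  using measurable_compose[OF measurable_id_ball_measure] by blast

lemma continuous_on_imp_measurable_ball: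
  fixes f :: "complex^'n \<Rightarrow> 'b::{topological_space, second_countable_topology, metric_space}"
  assumes "continuous_on (ball 0 1) f"
  shows "f \<in> borel_measurable ball_measure"
proof -
  have "f \<in> borel_measurable (restrict_space borel (ball 0 1))"
    using assms by (rule borel_measurable_continuous_on_restrict)
  moreover have "(\<lambda>x::complex^'n. x) \<in> ball_measure \<rightarrow>\<^sub>M restrict_space borel (ball 0 1)"
    by (rule measurable_restrict_space2) auto
  ultimately show ?thesis using measurable_compose by blast
qed

text \<open>Borel integrands only see the Borel trace of the ball measure, and that trace is normalized
Borel-Lebesgue measure.\<close>

lemma distr_ball_measure:
  "distr ball_measure borel (\<lambda>x. x) = uniform_measure lborel (ball (0::complex^'n) 1)"
proof (rule measure_eqI)
  fix A :: "(complex^'n) set" assume "A \<in> sets (distr ball_measure borel (\<lambda>x. x))"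
  hence [measurable]: "A \<in> sets borel" by simp
  have "emeasure (lebesgue_on (ball 0 1)) (ball (0::complex^'n) 1) = emeasure lborel (ball (0::complex^'n) 1)"
    using emeasure_lebesgue_on_ball[of UNIV] by simp
  moreover have "A \<inter> ball 0 1 \<in> sets (lebesgue_on (ball (0::complex^'n) 1))"
    by (auto simp: sets_restrict_space)
  moreover have "emeasure (distr ball_measure borel (\<lambda>x. x)) A = emeasure ball_measure (A \<inter> ball 0 1)"
    by (subst emeasure_distr) (auto simp: Int_commute)
  ultimately show "emeasure (distr ball_measure borel (\<lambda>x. x)) A = emeasure (uniform_measure lborel (ball (0::complex^'n) 1)) A"
    using emeasure_lebesgue_on_ball[of A]
    by (simp add: ball_measure_def Int_commute Int_absorb1 Int_absorb2 sets.top)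
qed simp

lemma nn_integral_ball_measure:
  fixes f :: "complex^'n \<Rightarrow> ennreal"
  assumes [measurable]: "f \<in> borel_measurable borel"
  shows "(\<integral>\<^sup>+x. f x \<partial>ball_measure) =
    (\<integral>\<^sup>+x. f x * indicator (ball 0 1) x \<partial>lborel) / emeasure lborel (ball (0::complex^'n) 1)"
proof -
  have "(\<integral>\<^sup>+x. f x \<partial>ball_measure) = (\<integral>\<^sup>+x. f x \<partial>distr ball_measure borel (\<lambda>x. x))"
    by (subst nn_integral_distr) auto
  thus ?thesis unfolding distr_ball_measure by (simp add: nn_integral_uniform_measure)
qed

lemma distr_ball_measure_isometry:
  fixes U :: "complex^'n \<Rightarrow> complex^'n"
  assumes lin: "linear U" and iso: "\<And>x. norm (U x) = norm x"
  shows "distr ball_measure borel U = distr ball_measure borel (\<lambda>x. x)"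
proof (rule measure_eqI)
  have [measurable]: "U \<in> borel_measurable borel"
    using lin by (intro borel_measurable_continuous_onI linear_continuous_on) (simp add: linear_linear)
  have [measurable]: "U \<in> borel_measurable ball_measure" by (rule borel_imp_measurable_ball) simp
  fix A :: "(complex^'n) set" assume "A \<in> sets (distr ball_measure borel U)"
  hence [measurable]: "A \<in> sets borel" by simp
  have "(\<integral>\<^sup>+x. indicator A (U x) \<partial>ball_measure) = (\<integral>\<^sup>+x. indicator A x \<partial>(ball_measure :: (complex^'n) measure))"
  proof -
    have [measurable]: "ball (0::complex^'n) 1 \<in> sets borel" by simp
    have "(\<integral>\<^sup>+x. indicator A (U x) * indicator (ball 0 1) x \<partial>lborel) =
          (\<integral>\<^sup>+x. indicator A (U x) * indicator (ball 0 1) (U x) \<partial>lborel)"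
      by (intro nn_integral_cong) (simp add: indicator_def iso)
    also have "\<dots> = (\<integral>\<^sup>+x. indicator A x * indicator (ball 0 1) x \<partial>lborel)"
      by (rule nn_integral_lborel_isometry[OF assms, of "\<lambda>x. indicator A x * indicator (ball 0 1) x"]) measurable
    finally show ?thesis
      by (simp add: nn_integral_ball_measure)
  qed
  moreover have "emeasure (distr ball_measure borel U) A = (\<integral>\<^sup>+x. indicator A (U x) \<partial>ball_measure)"
    using nn_integral_distr[of U ball_measure borel "indicator A"] by simp
  moreover have "emeasure (distr ball_measure borel (\<lambda>x. x)) A = (\<integral>\<^sup>+x. indicator A x \<partial>(ball_measure :: (complex^'n) measure))"
    using nn_integral_distr[of "\<lambda>x. x" ball_measure borel "indicator A"] by simp
  ultimately show "emeasure (distr ball_measure borel U) A = emeasure (distr ball_measure borel (\<lambda>x. x)) A"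
    by simp
qed simp

text \<open>A holomorphic integrand is only known on the ball, so it is first cut off by the indicator of the
ball, which the isometry preserves.\<close>

lemma integral_ball_measure_isometry:
  fixes U :: "complex^'n \<Rightarrow> complex^'n" and f :: "complex^'n \<Rightarrow> complex"
  assumes lin: "linear U" and iso: "\<And>x. norm (U x) = norm x" and f: "continuous_on (ball 0 1) f"
  shows "(LINT x|ball_measure. f (U x)) = (LINT x|ball_measure. f x)"
proof -
  define g where "g x = indicator (ball 0 1) x *\<^sub>R f x" for x
  have [measurable]: "g \<in> borel_measurable borel"
    unfolding g_def by (rule borel_measurable_continuous_on_indicator[OF _ f]) simp
  have [measurable]: "U \<in> borel_measurable borel"
    using lin by (intro borel_measurable_continuous_onI linear_continuous_on) (simp add: linear_linear)
  have "(LINT x|ball_measure. f (U x)) = (LINT x|ball_measure. g (U x))"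
    by (intro Bochner_Integration.integral_cong) (auto simp: g_def iso indicator_def)
  also have "\<dots> = (LINT x|distr ball_measure borel U. g x)"
    by (subst integral_distr) auto
  also have "\<dots> = (LINT x|distr ball_measure borel (\<lambda>x. x). g x)"
    by (simp add: distr_ball_measure_isometry[OF lin iso])
  also have "\<dots> = (LINT x|ball_measure. g x)"
    by (subst integral_distr) auto
  also have "\<dots> = (LINT x|ball_measure. f x)"
    by (intro Bochner_Integration.integral_cong) (auto simp: g_def indicator_def)
  finally show ?thesis .
qed

lemma integral_ball_measure_rotation:
  fixes f :: "complex^'n \<Rightarrow> complex"
  assumes f: "continuous_on (ball 0 1) f" and c: "norm c = 1"
  shows "(LINT x|ball_measure. f (c *s x)) = (LINT x|ball_measure. f x)"
proof (rule integral_ball_measure_isometry[OF _ _ f])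
  show "linear (\<lambda>x::complex^'n. c *s x)"
    by (rule linearI) (simp_all add: vector_add_ldistrib scaleR_eq_smult vector_smult_assoc mult.commute)
qed (simp add: norm_smult c)

section \<open>Moments of the ball\<close>

text \<open>Shrinking the two real coordinates of \<open>w $ j\<close> by \<open>sqrt (1 - t)\<close> turns the stretched Gaussian into the
standard one; the Jacobian of this real-linear map is \<open>1 - t\<close>.\<close>

lemma nn_integral_stretched_Gaussian_axis:
  fixes j :: "'n::finite" and t :: real
  assumes "t < 1"
  shows "ennreal (1 - t) * (\<integral>\<^sup>+w. ennreal (exp (- (norm (w::complex^'n))\<^sup>2 + t * (norm (w $ j))\<^sup>2)) \<partial>lborel)
    = (\<integral>\<^sup>+w. ennreal (exp (- (norm (w::complex^'n))\<^sup>2)) \<partial>lborel)"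
proof -
  define \<alpha> where "\<alpha> = sqrt (1 - t)"
  have \<alpha>: "\<alpha> > 0" "\<alpha>\<^sup>2 = 1 - t" using assms by (auto simp: \<alpha>_def)
  define P where "P = {axis j 1, axis j \<i> :: complex^'n}"
  have ne: "axis j 1 \<noteq> (axis j \<i> :: complex^'n)" by (simp add: axis_eq_axis complex_eq_iff)
  have PB: "P \<subseteq> Basis"
    by (auto simp: P_def Basis_vec_def Basis_complex_def)
  define c where "c b = (if b \<in> P then \<alpha> else 1)" for b :: "complex^'n"
  define T where "T x = 0 + (\<Sum>b\<in>Basis. (c b * (x \<bullet> b)) *\<^sub>R b)" for x :: "complex^'n"
  have [measurable]: "T \<in> borel_measurable borel" by (simp add: T_def[abs_def])
  have cP: "(\<Prod>b\<in>Basis. \<bar>c b\<bar>) = 1 - t"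
  proof -
    have "(\<Prod>b\<in>Basis. \<bar>c b\<bar>) = (\<Prod>b\<in>P. \<bar>c b\<bar>)"
      by (rule prod.mono_neutral_right) (use PB in \<open>auto simp: c_def\<close>)
    also have "\<dots> = 1 - t" using ne \<alpha> by (simp add: P_def c_def power2_eq_square)
    finally show ?thesis .
  qed
  have inner_axis: "x \<bullet> axis j 1 = Re (x $ j)" "x \<bullet> axis j \<i> = Im (x $ j)" for x :: "complex^'n"
    by (simp_all add: inner_axis inner_complex_def)
  have nT: "(norm (T x))\<^sup>2 = (norm x)\<^sup>2 - t * (norm (x $ j))\<^sup>2" for x
  proof -
    have Tb: "T x \<bullet> b = c b * (x \<bullet> b)" if "b \<in> Basis" for b
      using that by (simp add: T_def inner_sum_left inner_Basis if_distrib[of "\<lambda>a. _ * a"] cong: if_cong)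
    have "(norm (T x))\<^sup>2 = (\<Sum>b\<in>Basis. (c b * (x \<bullet> b))\<^sup>2)"
      unfolding power2_norm_eq_inner by (subst euclidean_inner) (simp add: Tb power2_eq_square)
    also have "\<dots> = (\<Sum>b\<in>Basis. (x \<bullet> b)\<^sup>2 - (if b \<in> P then t * (x \<bullet> b)\<^sup>2 else 0))"
      by (intro sum.cong) (auto simp: c_def power_mult_distrib \<alpha> algebra_simps)
    also have "\<dots> = (norm x)\<^sup>2 - (\<Sum>b\<in>P. t * (x \<bullet> b)\<^sup>2)"
      unfolding power2_norm_eq_inner using PB
      by (subst (3) euclidean_inner) (simp add: sum_subtractf sum.If_cases Int_absorb1 power2_eq_square)
    also have "(\<Sum>b\<in>P. t * (x \<bullet> b)\<^sup>2) = t * (norm (x $ j))\<^sup>2"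
      using ne by (simp add: P_def inner_axis cmod_power2 distrib_left)
    finally show ?thesis .
  qed
  have "(\<integral>\<^sup>+w. ennreal (exp (- (norm (w::complex^'n))\<^sup>2)) \<partial>lborel) =
     (\<integral>\<^sup>+w. ennreal (exp (- (norm (w::complex^'n))\<^sup>2)) \<partial>density (distr lborel borel T) (\<lambda>_. ennreal (\<Prod>b\<in>Basis. \<bar>c b\<bar>)))"
    unfolding T_def using \<alpha> by (subst lborel_affine_euclidean[of c 0]) (auto simp: c_def)
  also have "\<dots> = ennreal (1 - t) * (\<integral>\<^sup>+w. ennreal (exp (- (norm (T w))\<^sup>2)) \<partial>lborel)"
    unfolding cP by (simp add: nn_integral_density nn_integral_distr nn_integral_cmult)
  finally show ?thesis by (simp add: nT)
qed

text \<open>A complex Householder reflection. Multiplying the axis vector by a unimodular \<open>c\<close> first makes the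
Hermitian product of \<open>e\<close> and \<open>a = c e\<^sub>j\<close> real, and then the reflection along \<open>e - a\<close> exchanges \<open>e\<close> and \<open>a\<close>.\<close>

lemma unitary_to_axis:
  fixes e :: "complex^'n"
  assumes e: "norm e = 1"
  obtains U :: "complex^'n \<Rightarrow> complex^'n" where "linear U" "\<And>x. norm (U x) = norm x"
    "\<And>x. norm (U x $ j) = norm (herm_prod x e)"
proof -
  define c where "c = (if e $ j = 0 then 1 else sgn (e $ j))"
  have c: "norm c = 1" by (simp add: c_def norm_sgn)
  have cc: "cnj c * c = 1" using complex_norm_square[of c] c by (simp add: mult.commute)
  define a where "a = c *s axis j (1::complex)"
  have ha: "herm_prod x a = cnj c * x $ j" for x
    by (simp add: a_def herm_prod_smult_right herm_prod_def axis_def if_distrib[of cnj] if_distrib[of "\<lambda>a. _ * a"] cong: if_cong)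
  define \<rho> where "\<rho> = norm (e $ j)"
  have ea: "herm_prod e a = of_real \<rho>"
    unfolding ha c_def \<rho>_def by (auto simp: sgn_eq complex_norm_square[symmetric] power2_eq_square mult.commute)
  have ae: "herm_prod a e = of_real \<rho>" using cnj_herm_prod[of e a] ea by simp
  have aa: "herm_prod a a = 1"
    using norm_smult[of c "axis j 1"] by (simp add: herm_prod_self a_def c)
  have ee: "herm_prod e e = 1" by (simp add: herm_prod_self e)
  define v where "v = e - a"
  have vv: "herm_prod v v = of_real (2 - 2 * \<rho>)"
    by (simp add: v_def herm_prod_simps ea ae aa ee)
  have va: "herm_prod v a = of_real (\<rho> - 1)"
    by (simp add: v_def herm_prod_simps ea aa)
  have hae: "norm (herm_prod x a) = norm (x $ j)" for x by (simp add: ha norm_mult c)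
  show ?thesis
  proof (cases "v = 0")
    case True
    hence "e = a" by (simp add: v_def)
    show ?thesis by (rule that[of "\<lambda>x. x"]) (simp_all add: hae \<open>e = a\<close> linearI)
  next
    case False
    hence "herm_prod v v \<noteq> 0" by (simp add: herm_prod_self)
    hence \<rho>1: "\<rho> \<noteq> 1" using vv by auto
    \<comment> \<open>2 / <v,v>, the coefficient of the reflection along v\<close>
    define \<kappa> where "\<kappa> = 1 / (1 - \<rho>)"
    have "\<kappa> * (\<rho> - 1) = -1" using \<rho>1 by (simp add: \<kappa>_def divide_simps)
    hence "of_real (\<kappa> * (\<rho> - 1)) = (of_real (-1) :: complex)" by (rule arg_cong)
    hence \<kappa>: "of_real \<kappa> * of_real (\<rho> - 1) = (-1::complex)" by (simp only: of_real_mult of_real_minus of_real_1)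
    define U where "U w = w - (of_real \<kappa> * herm_prod w v) *s v" for w
    have "linear U"
      by (rule linearI) (simp_all add: U_def herm_prod_simps scaleR_eq_smult vec_eq_iff algebra_simps)
    moreover have "herm_prod (U x) (U x) = herm_prod x x" for x
    proof -
      have "herm_prod (U x) (U x) = herm_prod x x - 2 * of_real \<kappa> * herm_prod x v * herm_prod v x
          + of_real \<kappa> * herm_prod x v * (of_real \<kappa> * herm_prod v v) * herm_prod v x"
        unfolding U_def herm_prod_simps by (simp add: cnj_herm_prod) (simp add: algebra_simps)
      also have "of_real \<kappa> * herm_prod v v = 2"
      proof -
        have "herm_prod v v = (-2) * of_real (\<rho> - 1)" unfolding vv by (simp add: algebra_simps)
        thus ?thesis using \<kappa> by (metis mult.left_commute mult_minus1_right minus_minus)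
      qed
      finally show ?thesis by (simp add: algebra_simps)
    qed
    hence "norm (U x) = norm x" for x
      using of_real_eq_iff[where 'a=complex, of "(norm (U x))\<^sup>2" "(norm x)\<^sup>2"] by (simp add: herm_prod_self power2_eq_iff_nonneg)
    moreover have "herm_prod (U x) a = herm_prod x e" for x
    proof -
      have "herm_prod (U x) a = herm_prod x a - herm_prod x v * (of_real \<kappa> * herm_prod v a)"
        by (simp add: U_def herm_prod_simps algebra_simps)
      also have "of_real \<kappa> * herm_prod v a = -1" unfolding va by (rule \<kappa>)
      finally show ?thesis by (simp add: v_def herm_prod_simps)
    qed
    hence "norm (U x $ j) = norm (herm_prod x e)" for x using hae[of "U x"] by simp
    ultimately show ?thesis using that by blast
  qed
qed

lemma nn_integral_stretched_Gaussian:
  fixes e :: "complex^'n" and t :: real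
  assumes "t < 1" and e: "norm e = 1"
  shows "ennreal (1 - t) * (\<integral>\<^sup>+w. ennreal (exp (- (norm w)\<^sup>2 + t * (norm (herm_prod w e))\<^sup>2)) \<partial>lborel)
    = (\<integral>\<^sup>+w. ennreal (exp (- (norm (w::complex^'n))\<^sup>2)) \<partial>lborel)"
proof -
  fix j :: 'n
  obtain U :: "complex^'n \<Rightarrow> complex^'n" where U: "linear U" "\<And>x. norm (U x) = norm x"
    "\<And>x. norm (U x $ j) = norm (herm_prod x e)" using unitary_to_axis[OF e] by blast
  have "(\<integral>\<^sup>+w. ennreal (exp (- (norm w)\<^sup>2 + t * (norm (herm_prod w e))\<^sup>2)) \<partial>lborel)
      = (\<integral>\<^sup>+w. ennreal (exp (- (norm (U w))\<^sup>2 + t * (norm (U w $ j))\<^sup>2)) \<partial>lborel)"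
    by (simp add: U)
  also have "\<dots> = (\<integral>\<^sup>+w. ennreal (exp (- (norm (w::complex^'n))\<^sup>2 + t * (norm (w $ j))\<^sup>2)) \<partial>lborel)"
    by (rule nn_integral_lborel_isometry[OF U(1,2), where f = "\<lambda>w. ennreal (exp (- (norm w)\<^sup>2 + t * (norm (w $ j))\<^sup>2))"])
       (intro measurable_compose[OF _ measurable_ennreal] borel_measurable_continuous_onI continuous_intros)
  finally show ?thesis by (simp only: nn_integral_stretched_Gaussian_axis[OF assms(1)])
qed

text \<open>Integration in polar coordinates without a surface measure. The image of the measure with density
\<open>|<w,e>|^(2k)\<close> under \<open>|w|^2\<close> gives \<open>[0,x)\<close> the mass \<open>H x^(n+k)\<close> by scaling, hence it has the density
\<open>H (n+k) r^(n+k-1)\<close>.\<close>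

lemma nn_integral_polar:
  fixes e :: "complex^'n" and \<phi> :: "real \<Rightarrow> ennreal" and k :: nat
  assumes [measurable]: "\<phi> \<in> borel_measurable borel"
  defines "H \<equiv> \<integral>\<^sup>+w. ennreal (norm (herm_prod w e) ^ (2*k)) * indicator (ball 0 1) w \<partial>lborel"
  shows "(\<integral>\<^sup>+w. \<phi> ((norm w)\<^sup>2) * ennreal (norm (herm_prod w e) ^ (2*k)) \<partial>lborel)
    = H * (\<integral>\<^sup>+r. \<phi> r * ennreal (real (CARD('n) + k) * r ^ (CARD('n) + k - 1)) * indicator {0..} r \<partial>lborel)"
proof -
  define h where "h w = ennreal (norm (herm_prod w e) ^ (2*k))" for w
  have [measurable]: "h \<in> borel_measurable borel" unfolding h_def by measurable
  define n where "n = CARD('n)"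
  have n: "n > 0" by (simp add: n_def)
  have [measurable]: "ball (0::complex^'n) 1 \<in> sets borel" by simp
  have H_fin: "H < \<infinity>"
  proof -
    have "H \<le> (\<integral>\<^sup>+w. ennreal (norm e ^ (2*k)) * indicator (ball (0::complex^'n) 1) w \<partial>lborel)"
      unfolding H_def
    proof (intro nn_integral_mono)
      fix w :: "complex^'n"
      show "ennreal (norm (herm_prod w e) ^ (2 * k)) * indicator (ball 0 1) w
         \<le> ennreal (norm e ^ (2*k)) * indicator (ball (0::complex^'n) 1) w"
      proof (cases "norm w < 1")
        case True
        hence "norm (herm_prod w e) \<le> norm e" 
          using norm_herm_prod_le[of w e] mult_left_le_one_le[of "norm e" "norm w"] by simp
        thus ?thesis using True by (auto intro!: ennreal_leI power_mono)
      qed simp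
    qed
    also have "\<dots> < \<infinity>"
      using emeasure_lborel_unit_ball[where 'a="complex^'n"]
      by (simp add: nn_integral_cmult_indicator ennreal_mult_less_top less_top)
    finally show ?thesis .
  qed
  define M where "M = distr (density lborel h) borel (\<lambda>w::complex^'n. (norm w)\<^sup>2)"
  define g where "g r = H * (ennreal (real (n + k) * r ^ (n + k - 1)) * indicator {0..} r)" for r :: real
  have [measurable]: "g \<in> borel_measurable borel" unfolding g_def by measurable
  define N where "N = density lborel g"
  have emM: "emeasure M {..<x} = H * ennreal (x ^ (n + k))" if "x > 0" for x
  proof -
    have "emeasure M {..<x} = (\<integral>\<^sup>+w. h w * indicator {w. (norm w)\<^sup>2 < x} w \<partial>lborel)"
    proof -
      have "emeasure M {..<x} = emeasure (density lborel h) ((\<lambda>w. (norm w)\<^sup>2) -` {..<x})"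
        unfolding M_def by (subst emeasure_distr) auto
      also have "\<dots> = (\<integral>\<^sup>+w. h w * indicator ((\<lambda>w. (norm w)\<^sup>2) -` {..<x}) w \<partial>lborel)"
      proof (rule emeasure_density)
        have "(\<lambda>w::complex^'n. (norm w)\<^sup>2) -` {..<x} \<inter> space borel \<in> sets borel"
          by (rule measurable_sets[where A = borel]) auto
        thus "(\<lambda>w::complex^'n. (norm w)\<^sup>2) -` {..<x} \<in> sets lborel" by simp
      qed simp
      finally show ?thesis by (simp add: vimage_def)
    qed
    also have "\<dots> = ennreal (\<bar>sqrt x\<bar> ^ DIM(complex^'n)) *
        (\<integral>\<^sup>+w. h (sqrt x *\<^sub>R w) * indicator {w. (norm w)\<^sup>2 < x} (sqrt x *\<^sub>R w) \<partial>lborel)"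
      by (rule nn_integral_lborel_scale) (use that in auto)
    also have "(\<integral>\<^sup>+w. h (sqrt x *\<^sub>R w) * indicator {w. (norm w)\<^sup>2 < x} (sqrt x *\<^sub>R w) \<partial>lborel) =
        (\<integral>\<^sup>+w. ennreal (x ^ k) * (h w * indicator (ball 0 1) w) \<partial>lborel)"
    proof (intro nn_integral_cong)
      fix w :: "complex^'n"
      have "norm (herm_prod (sqrt x *\<^sub>R w) e) ^ (2*k) = x ^ k * norm (herm_prod w e) ^ (2*k)"
        using that by (simp add: scaleR_eq_smult herm_prod_smult_left norm_mult power_mult_distrib power_mult)
      moreover have "(norm (sqrt x *\<^sub>R w))\<^sup>2 < x \<longleftrightarrow> norm w < 1"
      proof -
        have "(norm (sqrt x *\<^sub>R w))\<^sup>2 = x * (norm w)\<^sup>2" using that by (simp add: power_mult_distrib)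
        thus ?thesis using that by (auto simp: power2_less_1_iff intro: less_le_trans[OF _ norm_ge_zero])
      qed
      ultimately show "h (sqrt x *\<^sub>R w) * indicator {w. (norm w)\<^sup>2 < x} (sqrt x *\<^sub>R w) = ennreal (x ^ k) * (h w * indicator (ball 0 1) w)"
        using that by (simp add: h_def ennreal_mult indicator_def)
    qed
    also have "\<dots> = ennreal (x ^ k) * H"
      by (subst nn_integral_cmult) (auto simp: H_def h_def)
    also have "\<bar>sqrt x\<bar> ^ DIM(complex^'n) = x ^ n"
      using that by (simp add: n_def power_mult mult.commute[of _ 2])
    finally show ?thesis using that
      by (simp add: power_add ennreal_mult mult_ac)
  qed
  have emN: "emeasure N {..<x} = H * ennreal (x ^ (n + k))" if "x > 0" for x
  proof -
    have "emeasure N {..<x} = (\<integral>\<^sup>+r. g r * indicator {..<x} r \<partial>lborel)"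
      unfolding N_def by (simp add: emeasure_density)
    also have "\<dots> = (\<integral>\<^sup>+r. H * (ennreal (real (n + k) * r ^ (n + k - 1)) * indicator {0..x} r) \<partial>lborel)"
      using AE_lborel_singleton[of x]
      by (intro nn_integral_cong_AE) (auto simp: g_def indicator_def)
    also have "\<dots> = H * (\<integral>\<^sup>+r. (ennreal (real (n + k) * r ^ (n + k - 1)) * indicator {0..x} r) \<partial>lborel)"
      by (rule nn_integral_cmult) measurable
    also have "(\<integral>\<^sup>+r. (ennreal (real (n + k) * r ^ (n + k - 1)) * indicator {0..x} r) \<partial>lborel)
       = ennreal (x ^ (n + k) - 0 ^ (n + k))"
    proof (rule nn_integral_FTC_Icc[where F = "\<lambda>r. r ^ (n + k)"])
      fix r :: real assume "r \<in> {0..x}"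
      show "((\<lambda>r. r ^ (n + k)) has_real_derivative real (n + k) * r ^ (n + k - 1)) (at r)"
        by (auto intro!: derivative_eq_intros simp: mult_ac)
    qed (use that in auto)
    finally show ?thesis using n by (simp add: power_0_left)
  qed
  have eq: "emeasure M {..<x} = emeasure N {..<x}" for x
  proof (cases "x > 0")
    case False
    have "emeasure M {..<x} = 0"
    proof -
      have "(\<lambda>w::complex^'n. (norm w)\<^sup>2) -` {..<x} = {}" using False by (auto simp: not_less) (meson less_le_trans not_less zero_le_power2 order_trans)
      thus ?thesis unfolding M_def by (subst emeasure_distr) auto
    qed
    moreover have "emeasure N {..<x} = 0"
    proof -
      have "emeasure N {..<x} = (\<integral>\<^sup>+r. g r * indicator {..<x} r \<partial>lborel)"
        unfolding N_def by (simp add: emeasure_density)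
      also have "\<dots> = (\<integral>\<^sup>+(r::real). 0 \<partial>lborel)"
        using False by (intro nn_integral_cong) (auto simp: g_def indicator_def)
      finally show ?thesis by simp
    qed
    ultimately show ?thesis by simp
  qed (simp add: emM emN)
  have "M = N"
  proof (rule measure_eqI_generator_eq[where E = "range lessThan" and \<Omega> = UNIV and A = "\<lambda>i. {..<real i + 1}"])
    show "Int_stable (range lessThan :: real set set)"
    proof -
      have "{..<a} \<inter> {..<b} = {..<min a b}" for a b :: real by auto
      thus ?thesis by (auto simp: Int_stable_def)
    qed
    show "sets M = sigma_sets UNIV (range lessThan)" "sets N = sigma_sets UNIV (range lessThan)"
      by (simp_all add: M_def N_def borel_Iio)
    show "(\<Union>i. {..<real i + 1}) = UNIV"
    proof -
      have "\<exists>i. x < real i + 1" for x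
        using reals_Archimedean2[of x] by (meson less_add_one order_less_trans)
      thus ?thesis by auto
    qed
    show "emeasure M {..<real i + 1} \<noteq> \<infinity>" for i
      using H_fin by (simp add: emM ennreal_mult_eq_top_iff)
  qed (auto simp: eq)
  hence "(\<integral>\<^sup>+r. \<phi> r \<partial>M) = (\<integral>\<^sup>+r. \<phi> r \<partial>N)" by simp
  moreover have "(\<integral>\<^sup>+r. \<phi> r \<partial>M) = (\<integral>\<^sup>+w. \<phi> ((norm w)\<^sup>2) * h w \<partial>lborel)"
    unfolding M_def by (simp add: nn_integral_distr nn_integral_density mult.commute)
  moreover have "(\<integral>\<^sup>+r. \<phi> r \<partial>N) = (\<integral>\<^sup>+r. H * (\<phi> r * ennreal (real (n + k) * r ^ (n + k - 1)) * indicator {0..} r) \<partial>lborel)"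
    unfolding N_def by (subst nn_integral_density) (auto simp: g_def mult_ac)
  moreover have "\<dots> = H * (\<integral>\<^sup>+r. (\<phi> r * ennreal (real (n + k) * r ^ (n + k - 1)) * indicator {0..} r) \<partial>lborel)"
    by (rule nn_integral_cmult) measurable
  ultimately show ?thesis by (simp add: h_def n_def)
qed

lemma nn_integral_Gamma_nat:
  assumes "m > 0"
  shows "(\<integral>\<^sup>+r. ennreal (exp (- r)) * ennreal (real m * r ^ (m - 1)) * indicator {0..} r \<partial>lborel) = ennreal (fact m)"
proof -
  have "(\<integral>\<^sup>+r. ennreal (exp (- r)) * ennreal (real m * r ^ (m - 1)) * indicator {0..} r \<partial>lborel)
     = (\<integral>\<^sup>+r. ennreal (real m) * ennreal (indicator {0..} r * r powr (real m - 1) / exp r) \<partial>lborel)"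
  proof (rule nn_integral_cong_AE)
    show "AE r in lborel. ennreal (exp (- r)) * ennreal (real m * r ^ (m - 1)) * indicator {0..} r
        = ennreal (real m) * ennreal (indicator {0..} r * r powr (real m - 1) / exp r)"
      using AE_lborel_singleton[of 0]
    proof eventually_elim
      case (elim r)
      show ?case
      proof (cases "r > 0")
        case True
        have "r powr (real m - 1) = r ^ (m - 1)"
          using assms True by (simp flip: powr_realpow add: of_nat_diff)
        thus ?thesis using True
          by (simp add: ennreal_mult[symmetric] exp_minus field_simps del: of_nat_add)
      qed (use elim in auto)
    qed
  qed
  also have "\<dots> = ennreal (real m) * ennreal (Gamma (real m))"
    using assms by (simp add: nn_integral_cmult Gamma_conv_nn_integral_real)
  also have "\<dots> = ennreal (fact m)"
    using assms Gamma_fact[of "m - 1", where 'a=real]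
    by (simp add: ennreal_mult[symmetric] of_nat_diff fact_reduce[of m])
  finally show ?thesis .
qed

text \<open>Instead of integrating in coordinates, the generating function of the moments is compared with the
stretched Gaussian integral. Expanding \<open>exp (t |<w,e>|^2)\<close> and using polar coordinates for each term gives
\<open>(1 - t) (\<Sum>k. a k t^k) = a 0\<close> with \<open>a k = h k (n+k)! / k!\<close>, where \<open>h k\<close> is the unnormalized moment; so all \<open>a k\<close> are equal.\<close>

lemma moment_ball_measure_unit:
  fixes e :: "complex^'n"
  assumes e: "norm e = 1"
  shows "(\<integral>\<^sup>+w. ennreal (norm (herm_prod w e) ^ (2*k)) \<partial>ball_measure)
    = ennreal (fact CARD('n) * fact k / fact (CARD('n) + k))"
proof -
  define n where "n = CARD('n)"
  have n: "n > 0" by (simp add: n_def)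
  have [measurable]: "ball (0::complex^'n) 1 \<in> sets borel" by simp
  define H where "H k = (\<integral>\<^sup>+w. ennreal (norm (herm_prod w e) ^ (2*k)) * indicator (ball 0 1) w \<partial>lborel)" for k
  have Hle: "H k \<le> emeasure lborel (ball (0::complex^'n) 1)" for k
  proof -
    have "H k \<le> (\<integral>\<^sup>+w. indicator (ball (0::complex^'n) 1) w \<partial>lborel)"
      unfolding H_def
    proof (intro nn_integral_mono)
      fix w :: "complex^'n"
      show "ennreal (norm (herm_prod w e) ^ (2 * k)) * indicator (ball 0 1) w \<le> indicator (ball (0::complex^'n) 1) w"
        using norm_herm_prod_less(1)[of w e] e by (auto simp: indicator_def intro!: power_le_one)
    qed
    thus ?thesis by simp
  qed
  define h where "h k = enn2real (H k)" for k
  have Hh: "H k = ennreal (h k)" and h0: "h k \<ge> 0" for k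
    unfolding h_def using Hle[of k] emeasure_lborel_unit_ball(2)[where 'a="complex^'n"]
    by (auto simp: less_top le_less_trans)
  have H0: "H 0 = emeasure lborel (ball (0::complex^'n) 1)" by (simp add: H_def)
  have hpos: "h 0 > 0"
    using emeasure_lborel_unit_ball(1)[where 'a="complex^'n"] Hh[of 0] h0[of 0] H0
    by (metis ennreal_0 less_eq_real_def)
  have gauss_moment: "(\<integral>\<^sup>+w. ennreal (exp (- (norm w)\<^sup>2)) * ennreal (norm (herm_prod w e) ^ (2*k)) \<partial>lborel)
      = ennreal (h k * fact (n + k))" for k
  proof -
    have "n + k > 0" using n by simp
    note G = nn_integral_Gamma_nat[OF this]
    show ?thesis
      by (subst nn_integral_polar[of "\<lambda>r. ennreal (exp (- r))" e k], simp,
          unfold n_def[symmetric] G H_def[symmetric] Hh) (simp add: ennreal_mult h0)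
  qed
  define a where "a k = h k * fact (n + k) / fact k" for k
  have a0: "a k \<ge> 0" for k using h0[of k] by (simp add: a_def)
  have sums: "(\<lambda>k. a k * t ^ k) sums (a 0 / (1 - t))" if t: "0 \<le> t" "t < 1" for t
  proof -
    have "(\<integral>\<^sup>+w. ennreal (exp (- (norm w)\<^sup>2 + t * (norm (herm_prod w e))\<^sup>2)) \<partial>lborel)
       = (\<integral>\<^sup>+w. (\<Sum>k. ennreal (t ^ k / fact k) * (ennreal (exp (- (norm w)\<^sup>2)) * ennreal (norm (herm_prod w e) ^ (2*k)))) \<partial>lborel)"
    proof (rule nn_integral_cong)
      fix w :: "complex^'n"
      define B where "B = t * (norm (herm_prod w e))\<^sup>2"
      have B: "B \<ge> 0" using t by (simp add: B_def)
      have "(\<Sum>k. ennreal (t ^ k / fact k) * (ennreal (exp (- (norm w)\<^sup>2)) * ennreal (norm (herm_prod w e) ^ (2*k))))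
          = (\<Sum>k. ennreal (exp (- (norm w)\<^sup>2) * (B ^ k /\<^sub>R fact k)))"
        using t by (intro suminf_cong) (simp add: ennreal_mult[symmetric] B_def power_mult_distrib power_mult, simp add: divide_inverse mult_ac)
      also have "\<dots> = ennreal (\<Sum>k. exp (- (norm w)\<^sup>2) * (B ^ k /\<^sub>R fact k))"
        using B summable_exp_generic[of B] by (intro suminf_ennreal2) (auto intro!: summable_mult)
      also have "\<dots> = ennreal (exp (- (norm w)\<^sup>2 + B))"
      proof -
        have "(\<Sum>k. B ^ k /\<^sub>R fact k) = exp B" by (simp add: exp_def)
        moreover have "exp (- (norm w)\<^sup>2) * exp B = exp (- (norm w)\<^sup>2 + B)" by (rule exp_add[symmetric])
        ultimately show ?thesis using summable_exp_generic[of B] by (subst suminf_mult) simp_all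
      qed
      finally show "ennreal (exp (- (norm w)\<^sup>2 + t * (norm (herm_prod w e))\<^sup>2)) = 
         (\<Sum>k. ennreal (t ^ k / fact k) * (ennreal (exp (- (norm w)\<^sup>2)) * ennreal (norm (herm_prod w e) ^ (2*k))))"
        by (simp add: B_def)
    qed
    also have "\<dots> = (\<Sum>k. (\<integral>\<^sup>+w. ennreal (t ^ k / fact k) * (ennreal (exp (- (norm w)\<^sup>2)) * ennreal (norm (herm_prod w e) ^ (2*k))) \<partial>lborel))"
      by (rule nn_integral_suminf) measurable
    also have "\<dots> = (\<Sum>k. ennreal (a k * t ^ k))"
    proof (rule suminf_cong)
      fix k
      have "(\<integral>\<^sup>+w. ennreal (t ^ k / fact k) * (ennreal (exp (- (norm w)\<^sup>2)) * ennreal (norm (herm_prod w e) ^ (2*k))) \<partial>lborel)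
        = ennreal (t ^ k / fact k) * ennreal (h k * fact (n + k))"
        unfolding gauss_moment[symmetric] by (rule nn_integral_cmult) measurable
      also have "\<dots> = ennreal ((t ^ k / fact k) * (h k * fact (n + k)))"
        using t h0 by (intro ennreal_mult[symmetric]) auto
      finally show "(\<integral>\<^sup>+w. ennreal (t ^ k / fact k) * (ennreal (exp (- (norm w)\<^sup>2)) * ennreal (norm (herm_prod w e) ^ (2*k))) \<partial>lborel)
        = ennreal (a k * t ^ k)" by (simp add: a_def field_simps)
    qed
    finally have "ennreal (1 - t) * (\<Sum>k. ennreal (a k * t ^ k)) = (\<integral>\<^sup>+w. ennreal (exp (- (norm (w::complex^'n))\<^sup>2)) \<partial>lborel)"
      using nn_integral_stretched_Gaussian[OF t(2) e] by simp
    also have "\<dots> = ennreal (a 0)"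
      using gauss_moment[of 0] by (simp add: a_def)
    finally have eq: "ennreal (1 - t) * (\<Sum>k. ennreal (a k * t ^ k)) = ennreal (a 0)" .
    hence fin: "(\<Sum>k. ennreal (a k * t ^ k)) \<noteq> top"
      using t by (auto simp: ennreal_mult_top)
    have nn: "0 \<le> a k * t ^ k" for k using a0 t by simp
    have sm: "summable (\<lambda>k. a k * t ^ k)" by (rule summable_suminf_not_top[OF nn fin])
    from eq have "ennreal ((1 - t) * (\<Sum>k. a k * t ^ k)) = ennreal (a 0)"
      using t suminf_ennreal2[OF nn sm] suminf_nonneg[OF sm nn] by (simp add: ennreal_mult)
    hence "(1 - t) * (\<Sum>k. a k * t ^ k) = a 0"
      using a0[of 0] t suminf_nonneg[OF sm nn] by (subst (asm) ennreal_inj) auto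
    thus ?thesis using sm t by (simp add: sums_iff field_simps)
  qed
  have "a m = a 0" for m
  proof (rule ccontr)
    assume "a m \<noteq> a 0"
    hence m: "a m - a 0 \<noteq> 0" "m > 0" by (auto intro: Nat.gr0I)
    have s0: "(\<lambda>k. (a k - a 0) * t ^ k) sums 0" if "0 \<le> t" "t < 1" for t
    proof -
      have "(\<lambda>k. a 0 * t ^ k) sums (a 0 * (1 / (1 - t)))"
        using that by (intro sums_mult geometric_sums) auto
      from sums_diff[OF sums[OF that] this] show ?thesis by (simp add: algebra_simps)
    qed
    have "(\<lambda>k. (a k - a 0) * (x - 0) ^ k) sums (\<Sum>k. (a k - a 0) * x ^ k)" if "norm (x - 0) < 1/2" for x
    proof -
      have "summable (\<lambda>k. (a k - a 0) * (1/2) ^ k)" using s0[of "1/2"] by (auto simp: sums_iff)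
      from powser_inside[OF this, of x] that show ?thesis by (simp add: summable_sums)
    qed
    from powser_0_nonzero[OF _ this, of "1/2" m] m
    obtain s where s: "s > 0" "\<And>z. z \<in> cball 0 s - {0} \<Longrightarrow> (\<Sum>k. (a k - a 0) * z ^ k) \<noteq> 0"
      by (auto simp: power_0_left suminf_finite[where N="{0}"] if_distrib)
    define z where "z = min s (1/2)"
    have "(\<Sum>k. (a k - a 0) * z ^ k) = 0"
      using s0[of z] s(1) by (auto simp: sums_iff z_def)
    moreover have "z \<in> cball 0 s - {0}" using s(1) by (auto simp: z_def min_def)
    ultimately show False using s(2) by blast
  qed
  from this[of k] have hk: "h k / h 0 = fact n * fact k / fact (n + k)"
    using hpos by (simp add: a_def field_simps)
  have "(\<integral>\<^sup>+w. ennreal (norm (herm_prod w e) ^ (2*k)) \<partial>ball_measure) = H k / H 0"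
    by (subst nn_integral_ball_measure) (simp_all add: H_def)
  also have "\<dots> = ennreal (h k / h 0)"
    unfolding Hh using hpos h0[of k] by (simp add: divide_ennreal)
  finally show ?thesis unfolding hk by (simp add: n_def)
qed

lemma moment_ball_measure:
  fixes z :: "complex^'n"
  shows "(\<integral>\<^sup>+w. ennreal (norm (herm_prod w z) ^ (2*k)) \<partial>ball_measure)
    = ennreal (norm z ^ (2*k) * (fact CARD('n) * fact k / fact (CARD('n) + k)))"
proof -
  obtain e :: "complex^'n" where e: "norm e = 1" "z = of_real (norm z) *s e"
  proof (cases "z = 0")
    case True
    fix j :: 'n
    show ?thesis using that[of "axis j 1"] True by simp
  next
    case False
    have "norm ((1 / of_real (norm z)) *s z) = 1" using False by (simp add: norm_smult norm_divide)
    moreover have "z = of_real (norm z) *s ((1 / of_real (norm z)) *s z)" using False by simp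
    ultimately show ?thesis using that by blast
  qed
  have "(\<integral>\<^sup>+w. ennreal (norm (herm_prod w z) ^ (2*k)) \<partial>ball_measure)
     = (\<integral>\<^sup>+w. ennreal (norm z ^ (2*k)) * ennreal (norm (herm_prod w e) ^ (2*k)) \<partial>ball_measure)"
    by (subst e(2)) (simp add: herm_prod_smult_right norm_mult power_mult_distrib ennreal_mult)
  also have "\<dots> = ennreal (norm z ^ (2*k)) * (\<integral>\<^sup>+w. ennreal (norm (herm_prod w e) ^ (2*k)) \<partial>ball_measure)"
    by (rule nn_integral_cmult) measurable
  finally show ?thesis by (simp add: moment_ball_measure_unit[OF e(1)] ennreal_mult[symmetric])
qed

text \<open>Polar coordinates reduce the weighted moment to the unweighted one times a Beta integral.\<close>

lemma weighted_moment_ball_measure: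
  fixes z :: "complex^'n"
  assumes t: "t > -1"
  shows "(\<integral>\<^sup>+w. ennreal ((1 - (norm w)\<^sup>2) powr t * norm (herm_prod w z) ^ (2*k)) \<partial>ball_measure)
    = ennreal (norm z ^ (2*k) * (fact CARD('n) * fact k * Gamma (t + 1) / Gamma (real CARD('n) + real k + t + 1)))"
proof -
  define n where "n = CARD('n)"
  have n: "n > 0" by (simp add: n_def)
  have [measurable]: "ball (0::complex^'n) 1 \<in> sets borel" by simp
  define \<phi> where "\<phi> r = ennreal ((1 - r) powr t) * indicator {..<1} r" for r :: real
  have [measurable]: "\<phi> \<in> borel_measurable borel" unfolding \<phi>_def by measurable
  have "(\<integral>\<^sup>+r. \<phi> r * ennreal (real (n + k) * r ^ (n + k - 1)) * indicator {0..} r \<partial>lborel)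
     = (\<integral>\<^sup>+r. ennreal (real (n + k)) * ennreal (r powr (real (n + k) - 1) * (1 - r) powr ((t + 1) - 1) * indicator {0..1} r) \<partial>lborel)"
  proof (rule nn_integral_cong_AE)
    show "AE r in lborel. \<phi> r * ennreal (real (n + k) * r ^ (n + k - 1)) * indicator {0..} r
        = ennreal (real (n + k)) * ennreal (r powr (real (n + k) - 1) * (1 - r) powr ((t + 1) - 1) * indicator {0..1} r)"
      using AE_lborel_singleton[of 0] AE_lborel_singleton[of 1]
    proof eventually_elim
      case (elim r)
      show ?case
      proof (cases "r > 0 \<and> r < 1")
        case True
        have "r powr (real (n + k) - 1) = r ^ (n + k - 1)"
          using n True by (simp flip: powr_realpow add: of_nat_diff)
        thus ?thesis using True
          by (simp add: \<phi>_def ennreal_mult[symmetric] mult_ac del: of_nat_add)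
      qed (use elim in \<open>auto simp: \<phi>_def\<close>)
    qed
  qed
  also have "\<dots> = ennreal (real (n + k)) * (\<integral>\<^sup>+r. ennreal (r powr (real (n + k) - 1) * (1 - r) powr ((t + 1) - 1) * indicator {0..1} r) \<partial>lborel)"
    by (rule nn_integral_cmult) measurable
  also have "(\<integral>\<^sup>+r. ennreal (r powr (real (n + k) - 1) * (1 - r) powr ((t + 1) - 1) * indicator {0..1} r) \<partial>lborel) = ennreal (Beta (real (n+k)) (t+1))"
    using nn_integral_has_integral_lebesgue[OF _ has_integral_Beta_real[of "real (n+k)" "t+1"]] n t
    by (simp add: mult_ac)
  also have "ennreal (real (n + k)) * ennreal (Beta (real (n + k)) (t + 1)) = 
     ennreal (fact (n + k) * Gamma (t + 1) / Gamma (real n + real k + t + 1))"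
  proof -
    define m where "m = n + k"
    have m: "m > 0" "real n + real k = real m" using n by (simp_all add: m_def)
    have "real m * Gamma (real m) = fact m"
      using m(1) Gamma_fact[of "m - 1", where 'a=real] by (simp add: of_nat_diff fact_reduce[of m])
    hence "real m * Beta (real m) (t + 1) = fact m * Gamma (t + 1) / Gamma (real m + t + 1)"
      by (simp add: Beta_def add_ac)
    thus ?thesis unfolding m(2) m_def[symmetric] by (simp add: ennreal_mult'[symmetric])
  qed
  finally have 1: "(\<integral>\<^sup>+r. \<phi> r * ennreal (real (n + k) * r ^ (n + k - 1)) * indicator {0..} r \<partial>lborel) = \<dots>" .
  have G: "Gamma (t + 1) > 0" "Gamma (real n + real k + t + 1) > 0" using t n by (auto intro!: Gamma_real_pos)
  have "(\<integral>\<^sup>+w. ennreal ((1 - (norm w)\<^sup>2) powr t * norm (herm_prod w z) ^ (2*k)) \<partial>ball_measure)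
    = (\<integral>\<^sup>+w. ennreal ((1 - (norm w)\<^sup>2) powr t * norm (herm_prod w z) ^ (2*k)) * indicator (ball 0 1) w \<partial>lborel) / emeasure lborel (ball (0::complex^'n) 1)"
    by (rule nn_integral_ball_measure) measurable
  also have "\<dots> = (\<integral>\<^sup>+w. \<phi> ((norm w)\<^sup>2) * ennreal (norm (herm_prod w z) ^ (2*k)) \<partial>lborel) / emeasure lborel (ball (0::complex^'n) 1)"
    by (intro arg_cong2[of _ _ _ _ "(/)"] refl nn_integral_cong)
       (auto simp: \<phi>_def indicator_def power2_less_1_iff ennreal_mult intro: less_le_trans[OF _ norm_ge_zero])
  also have "\<dots> = (\<integral>\<^sup>+w. ennreal (norm (herm_prod w z) ^ (2*k)) \<partial>ball_measure) * ennreal (fact (n + k) * Gamma (t + 1) / Gamma (real n + real k + t + 1))"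
    by (subst nn_integral_polar, simp, subst nn_integral_ball_measure, simp,
        unfold n_def[symmetric] 1) (simp add: divide_ennreal_def mult_ac)
  also have "\<dots> = ennreal (norm z ^ (2*k) * (fact n * fact k / fact (n + k)) * (fact (n + k) * Gamma (t + 1) / Gamma (real n + real k + t + 1)))"
    by (simp add: moment_ball_measure n_def[symmetric] ennreal_mult''[symmetric] G less_imp_le)
  finally show ?thesis by (simp add: n_def mult.assoc)
qed

section \<open>Forelli-Rudin estimates\<close>

lemma binomial_series_complex:
  fixes x :: complex and c :: real
  assumes "norm x < 1" "c > 0"
  shows "(\<lambda>k. of_real (Gamma (real k + c) / (Gamma c * fact k)) * x ^ k) sums ((1 - x) powr of_real (- c))"
proof -
  have eq: "(of_real (- c) gchoose k) * (- x) ^ k = of_real (Gamma (real k + c) / (Gamma c * fact k)) * x ^ k" for k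
  proof -
    have "(of_real (- c) gchoose k :: complex) = of_real ((- c) gchoose k)"
      by (simp add: gbinomial_prod_rev)
    also have "(- c) gchoose k = (-1) ^ k * (Gamma (real k + c) / (Gamma c * fact k))"
      using assms(2) pochhammer_Gamma[of c k]
      by (simp add: gbinomial_pochhammer nonpos_Ints_def add.commute)
    finally show ?thesis
      by (simp add: power_minus[of x])
  qed
  have "(\<lambda>k. (of_real (- c) gchoose k) * (- x) ^ k) sums ((1 + - x) powr of_real (- c))"
    by (rule gen_binomial_complex) (use assms in simp)
  thus ?thesis unfolding eq by simp
qed

lemma norm_powr_of_real:
  fixes z :: complex
  assumes "z \<noteq> 0"
  shows "norm (z powr of_real c) = norm z powr c"
  using assms by (simp add: powr_def)

lemma binomial_series_real:
  fixes x c :: real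
  assumes "\<bar>x\<bar> < 1" "c > 0"
  shows "(\<lambda>k. Gamma (real k + c) / fact k * x ^ k) sums (Gamma c * (1 - x) powr (- c))"
proof -
  have G: "Gamma c > 0" using assms by simp
  have eq: "((- c) gchoose k) * (- x) ^ k = Gamma (real k + c) / (Gamma c * fact k) * x ^ k" for k
  proof -
    have "(- c) gchoose k = (-1) ^ k * (Gamma (real k + c) / (Gamma c * fact k))"
      using assms(2) pochhammer_Gamma[of c k]
      by (simp add: gbinomial_pochhammer nonpos_Ints_def add.commute)
    thus ?thesis by (simp add: power_minus[of x])
  qed
  have "(\<lambda>k. ((- c) gchoose k) * (- x) ^ k) sums ((1 + - x) powr (- c))"
    by (rule gen_binomial_real) (use assms in simp)
  hence "(\<lambda>k. Gamma c * (Gamma (real k + c) / (Gamma c * fact k) * x ^ k)) sums (Gamma c * (1 - x) powr (- c))"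
    unfolding eq by (intro sums_mult) simp
  thus ?thesis using G by (simp add: field_simps)
qed

lemma Gamma_midpoint_le:
  fixes a b :: real
  assumes "a > 0" "b > 0"
  shows "(Gamma ((a + b) / 2))\<^sup>2 \<le> Gamma a * Gamma b"
proof -
  have G: "Gamma a > 0" "Gamma b > 0" "Gamma ((a+b)/2) > 0" using assms by simp_all
  have "(ln \<circ> Gamma) ((1 - 1/2) *\<^sub>R a + (1/2) *\<^sub>R b) \<le> (1 - 1/2) * (ln \<circ> Gamma) a + (1/2) * (ln \<circ> Gamma) b"
    using assms by (intro convex_onD[OF log_convex_Gamma_real]) auto
  hence "2 * ln (Gamma ((a+b)/2)) \<le> ln (Gamma a) + ln (Gamma b)" by (simp add: field_simps)
  hence "ln ((Gamma ((a+b)/2))\<^sup>2) \<le> ln (Gamma a * Gamma b)" using G by (simp add: ln_mult ln_realpow)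
  thus ?thesis using G by (subst (asm) ln_le_cancel_iff) auto
qed

lemma one_minus_norm2_pos: "norm w < 1 \<Longrightarrow> 0 < 1 - (norm w)\<^sup>2"
  using power_less_one_iff[of "norm w" 2] by simp

text \<open>The rotation by \<open>c = exp (i \<pi> / (j - k))\<close> preserves the measure and changes the sign of the integrand.\<close>

lemma radial_monomials_orthogonal:
  fixes z :: "complex^'n" and G :: "real \<Rightarrow> real"
  assumes G: "continuous_on {..<1} G" and "j \<noteq> k"
  shows "(LINT w|ball_measure. of_real (G ((norm w)\<^sup>2)) * (herm_prod w z ^ j * cnj (herm_prod w z) ^ k)) = 0"
proof -
  define f where "f w = of_real (G ((norm w)\<^sup>2)) * (herm_prod w z ^ j * cnj (herm_prod w z) ^ k)" for w
  define c where "c = cis (pi / (real j - real k))"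
  have c: "norm c = 1" by (simp add: c_def)
  have "c ^ j * cnj c ^ k = cis (real j * (pi / (real j - real k)) - real k * (pi / (real j - real k)))"
    unfolding c_def cis_cnj Complex.DeMoivre cis_mult by (simp add: algebra_simps)
  also have "real j * (pi / (real j - real k)) - real k * (pi / (real j - real k)) = pi"
    unfolding left_diff_distrib[symmetric] using assms(2) by simp
  finally have cc: "c ^ j * cnj c ^ k = -1" by simp
  have "continuous_on (ball 0 1) (\<lambda>w::complex^'n. G ((norm w)\<^sup>2))"
    by (rule continuous_on_compose2[OF G]) (auto intro!: continuous_intros simp: power_less_one_iff)
  hence "continuous_on (ball 0 1) f" unfolding f_def by (intro continuous_intros)
  from integral_ball_measure_rotation[OF this c]
  have "(LINT w|ball_measure. f w) = (LINT w|ball_measure. f (c *s w))" by simp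
  also have "\<dots> = (LINT w|ball_measure. - f w)"
  proof (rule Bochner_Integration.integral_cong[OF refl])
    fix w
    have "f (c *s w) = f w * (c ^ j * cnj c ^ k)"
      by (simp add: f_def norm_smult c herm_prod_smult_left power_mult_distrib mult_ac)
    thus "f (c *s w) = - f w" by (simp add: cc)
  qed
  also have "\<dots> = - (LINT w|ball_measure. f w)" by simp
  finally show ?thesis by (simp add: f_def)
qed

lemma integrable_weighted_moment:
  fixes z :: "complex^'n"
  assumes t: "t > -1"
  shows "integrable ball_measure (\<lambda>w. (1 - (norm w)\<^sup>2) powr t * norm (herm_prod w z) ^ (2*k))"
    and "(LINT w|ball_measure. (1 - (norm w)\<^sup>2) powr t * norm (herm_prod w z) ^ (2*k))
      = norm z ^ (2*k) * (fact CARD('n) * fact k * Gamma (t + 1) / Gamma (real CARD('n) + real k + t + 1))"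
proof -
  let ?c = "norm z ^ (2*k) * (fact CARD('n) * fact k * Gamma (t + 1) / Gamma (real CARD('n) + real k + t + 1))"
  have c: "?c \<ge> 0" using t by (intro mult_nonneg_nonneg divide_nonneg_nonneg less_imp_le[OF Gamma_real_pos]) auto
  have "has_bochner_integral ball_measure (\<lambda>w. (1 - (norm w)\<^sup>2) powr t * norm (herm_prod w z) ^ (2*k)) ?c"
    by (rule has_bochner_integral_nn_integral[OF _ _ c weighted_moment_ball_measure[OF t]]) auto
  thus "integrable ball_measure (\<lambda>w. (1 - (norm w)\<^sup>2) powr t * norm (herm_prod w z) ^ (2*k))"
    "(LINT w|ball_measure. (1 - (norm w)\<^sup>2) powr t * norm (herm_prod w z) ^ (2*k)) = ?c"
    by (simp_all add: has_bochner_integral_iff)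
qed

lemma integrable_weight:
  assumes t: "t > -1"
  shows "integrable ball_measure (\<lambda>w::complex^'n. (1 - (norm w)\<^sup>2) powr t)"
  using integrable_weighted_moment(1)[OF t, where k=0] by simp

lemma weighted_polynomial_norm:
  fixes z :: "complex^'n" and a :: "nat \<Rightarrow> real"
  assumes t: "t > -1" and z: "norm z \<le> 1"
  shows "(\<integral>\<^sup>+w. ennreal ((1 - (norm w)\<^sup>2) powr t * (norm (\<Sum>k<K. of_real (a k) * herm_prod w z ^ k))\<^sup>2) \<partial>ball_measure)
    = ennreal (\<Sum>k<K. (a k)\<^sup>2 * (norm z ^ (2*k) * (fact CARD('n) * fact k * Gamma (t + 1) / Gamma (real CARD('n) + real k + t + 1))))"
proof -
  define G where "G w = (1 - (norm w)\<^sup>2) powr t" for w :: "complex^'n"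
  have [measurable]: "G \<in> borel_measurable ball_measure" unfolding G_def by measurable
  have [measurable]: "(\<lambda>w. cnj (herm_prod w z)) \<in> borel_measurable ball_measure"
    unfolding cnj_herm_prod by measurable
  define S where "S w = (\<Sum>k<K. of_real (a k) * herm_prod w z ^ k)" for w
  have expand: "of_real (G w * (norm (S w))\<^sup>2) =
      (\<Sum>j<K. \<Sum>k<K. of_real (a j * a k) * (of_real (G w) * (herm_prod w z ^ j * cnj (herm_prod w z) ^ k)))" for w
  proof -
    have "of_real (G w * (norm (S w))\<^sup>2) = of_real (G w) * (S w * cnj (S w))"
      by (simp only: of_real_mult complex_norm_square)
    also have "S w * cnj (S w) = (\<Sum>j<K. \<Sum>k<K. (of_real (a j) * herm_prod w z ^ j) * (of_real (a k) * cnj (herm_prod w z) ^ k))"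
      unfolding S_def by (simp add: sum_product)
    finally show ?thesis by (simp add: sum_distrib_left mult_ac)
  qed
  have bnd: "norm (herm_prod w z) \<le> 1" if "w \<in> space ball_measure" for w
    using norm_herm_prod_less(1)[of w z] that z by simp
  have int: "integrable ball_measure (\<lambda>w. complex_of_real (G w) * (herm_prod w z ^ j * cnj (herm_prod w z) ^ k))" for j k
  proof (rule Bochner_Integration.integrable_bound[OF integrable_weight[OF t]])
    show "AE w in ball_measure. norm (complex_of_real (G w) * (herm_prod w z ^ j * cnj (herm_prod w z) ^ k)) \<le> norm ((1 - (norm w)\<^sup>2) powr t)"
    proof (rule AE_I2)
      fix w :: "complex^'n" assume w: "w \<in> space ball_measure"
      have "norm (herm_prod w z) ^ j * norm (herm_prod w z) ^ k \<le> 1"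
        using bnd[OF w] by (intro mult_le_one power_le_one) auto
      thus "norm (complex_of_real (G w) * (herm_prod w z ^ j * cnj (herm_prod w z) ^ k)) \<le> norm ((1 - (norm w)\<^sup>2) powr t)"
        by (simp add: norm_mult norm_power G_def mult_left_le)
    qed
  qed measurable
  have diag: "(LINT w|ball_measure. complex_of_real (G w) * (herm_prod w z ^ k * cnj (herm_prod w z) ^ k))
      = of_real (norm z ^ (2*k) * (fact CARD('n) * fact k * Gamma (t + 1) / Gamma (real CARD('n) + real k + t + 1)))" for k
  proof -
    have "(LINT w|ball_measure. complex_of_real (G w) * (herm_prod w z ^ k * cnj (herm_prod w z) ^ k))
       = (LINT w|ball_measure. complex_of_real (G w * norm (herm_prod w z) ^ (2*k)))"
      by (intro Bochner_Integration.integral_cong refl)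
         (simp only: power_mult of_real_mult of_real_power[of _ k] complex_norm_square power_mult_distrib)
    also have "\<dots> = of_real (LINT w|ball_measure. G w * norm (herm_prod w z) ^ (2*k))"
      by (rule integral_complex_of_real)
    finally show ?thesis unfolding G_def integrable_weighted_moment(2)[OF t] .
  qed
  have off: "(LINT w|ball_measure. complex_of_real (G w) * (herm_prod w z ^ j * cnj (herm_prod w z) ^ k)) = 0" if "j \<noteq> k" for j k
    unfolding G_def using that
    by (intro radial_monomials_orthogonal[of "\<lambda>r. (1 - r) powr t"]) (auto intro!: continuous_intros)
  have I: "integrable ball_measure (\<lambda>w. complex_of_real (G w * (norm (S w))\<^sup>2))"
    unfolding expand by (intro Bochner_Integration.integrable_sum integrable_mult_right int)
  have "complex_of_real (LINT w|ball_measure. G w * (norm (S w))\<^sup>2) = (LINT w|ball_measure. complex_of_real (G w * (norm (S w))\<^sup>2))"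
    by (rule integral_complex_of_real[symmetric])
  also have "\<dots> = (\<Sum>j<K. \<Sum>k<K. of_real (a j * a k) * (LINT w|ball_measure. (of_real (G w) * (herm_prod w z ^ j * cnj (herm_prod w z) ^ k))))"
    unfolding expand
    by (simp only: Bochner_Integration.integral_sum Bochner_Integration.integrable_sum integrable_mult_right int integral_mult_right_zero)
  also have "\<dots> = (\<Sum>j<K. \<Sum>k<K. if k = j then of_real (a j * a j) * (LINT w|ball_measure. (of_real (G w) * (herm_prod w z ^ j * cnj (herm_prod w z) ^ j))) else 0)"
    by (intro sum.cong refl) (auto simp: off)
  also have "\<dots> = of_real (\<Sum>k<K. (a k)\<^sup>2 * (norm z ^ (2*k) * (fact CARD('n) * fact k * Gamma (t + 1) / Gamma (real CARD('n) + real k + t + 1))))"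
    by (simp add: diag power2_eq_square)
  finally have val: "(LINT w|ball_measure. G w * (norm (S w))\<^sup>2) = (\<Sum>k<K. (a k)\<^sup>2 * (norm z ^ (2*k) * (fact CARD('n) * fact k * Gamma (t + 1) / Gamma (real CARD('n) + real k + t + 1))))"
    using of_real_eq_iff by blast
  have "integrable ball_measure (\<lambda>w. G w * (norm (S w))\<^sup>2)"
    using integrable_Re[OF I] by simp
  hence "(\<integral>\<^sup>+w. ennreal (G w * (norm (S w))\<^sup>2) \<partial>ball_measure) = ennreal (LINT w|ball_measure. G w * (norm (S w))\<^sup>2)"
    by (rule nn_integral_eq_integral) (simp add: G_def)
  thus ?thesis unfolding val by (simp add: G_def S_def)
qed

text \<open>With \<open>c = (n + 1 + t + s) / 2\<close> the integrand is the weight times the squared modulus of the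
binomial series of \<open>(1 - <w,z>)^(-c)\<close>. Monomials of different degree are orthogonal, so the integral is a power series
in \<open>|z|^2\<close> with coefficients \<open>\<Gamma>(k+c)^2 / (k! \<Gamma>(n+k+t+1))\<close> up to a constant. By log-convexity of \<open>\<Gamma>\<close> these are at most
\<open>\<Gamma>(k+s) / k!\<close>, the coefficients of the binomial series of \<open>(1 - |z|^2)^(-s)\<close>. Fatou's
lemma passes from partial sums to the limit.\<close>

theorem forelli_rudin:
  fixes t s :: real
  assumes t: "t > -1" and s: "s > 0"
  obtains C where "C > 0" "\<And>z::complex^'n. norm z < 1 \<Longrightarrow>
    (\<integral>\<^sup>+w. ennreal ((1 - (norm w)\<^sup>2) powr t * norm (1 - herm_prod z w) powr (- (real CARD('n) + 1 + t + s))) \<partial>ball_measure)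
      \<le> ennreal (C * (1 - (norm z)\<^sup>2) powr (- s))"
proof -
  define n where "n = real CARD('n)"
  define c where "c = (n + 1 + t + s) / 2"
  have n0: "n \<ge> 0" and c: "c > 0" using t s by (simp_all add: n_def c_def)
  define a where "a k = Gamma (real k + c) / (Gamma c * fact k)" for k
  define C where "C = fact CARD('n) * Gamma (t + 1) / (Gamma c)\<^sup>2 * Gamma s"
  have Gpos: "Gamma c > 0" "Gamma s > 0" "Gamma (t + 1) > 0" using c s t by simp_all
  have C: "C > 0" unfolding C_def using Gpos by simp
  show ?thesis
  proof (rule that[OF C])
    fix z :: "complex^'n" assume z: "norm z < 1"
    let ?m = "\<lambda>k. norm z ^ (2*k) * (fact CARD('n) * fact k * Gamma (t + 1) / Gamma (real CARD('n) + real k + t + 1))"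
    let ?S = "\<lambda>K w. (\<Sum>k<K. of_real (a k) * herm_prod w z ^ k)"
    have term_le: "(a k)\<^sup>2 * ?m k \<le> (fact CARD('n) * Gamma (t + 1) / (Gamma c)\<^sup>2) * (Gamma (real k + s) / fact k * ((norm z)\<^sup>2) ^ k)" for k
    proof -
      have "(real k + s + (n + real k + t + 1)) / 2 = real k + c" by (simp add: c_def)
      \<comment> \<open>the two arguments average to k + c by the choice of c\<close>
      hence le: "(Gamma (real k + c))\<^sup>2 \<le> Gamma (real k + s) * Gamma (n + real k + t + 1)"
        using Gamma_midpoint_le[of "real k + s" "n + real k + t + 1"] n0 s t by (simp only:)
      have G2: "Gamma (n + real k + t + 1) > 0" using n0 t by simp
      have "(a k)\<^sup>2 * ?m k = (fact CARD('n) * Gamma (t + 1) / (Gamma c)\<^sup>2 * ((norm z)\<^sup>2) ^ k / fact k) * ((Gamma (real k + c))\<^sup>2 / Gamma (n + real k + t + 1))"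
        by (simp add: a_def n_def[symmetric] power2_eq_square power_mult power_mult_distrib field_simps)
      also have "\<dots> \<le> (fact CARD('n) * Gamma (t + 1) / (Gamma c)\<^sup>2 * ((norm z)\<^sup>2) ^ k / fact k) * Gamma (real k + s)"
        using le G2 Gpos by (intro mult_left_mono) (simp_all add: pos_divide_le_eq)
      finally show ?thesis by (simp add: mult_ac)
    qed
    have sums: "(\<lambda>k. Gamma (real k + s) / fact k * ((norm z)\<^sup>2) ^ k) sums (Gamma s * (1 - (norm z)\<^sup>2) powr (- s))"
      by (rule binomial_series_real) (use one_minus_norm2_pos[OF z] s in auto)
    have bound: "(\<Sum>k<K. (a k)\<^sup>2 * ?m k) \<le> C * (1 - (norm z)\<^sup>2) powr (- s)" for K
    proof -
      have "(\<Sum>k<K. (a k)\<^sup>2 * ?m k) \<le> (\<Sum>k<K. (fact CARD('n) * Gamma (t + 1) / (Gamma c)\<^sup>2) * (Gamma (real k + s) / fact k * ((norm z)\<^sup>2) ^ k))"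
        by (intro sum_mono term_le)
      also have "\<dots> = (fact CARD('n) * Gamma (t + 1) / (Gamma c)\<^sup>2) * (\<Sum>k<K. Gamma (real k + s) / fact k * ((norm z)\<^sup>2) ^ k)"
        by (simp only: sum_distrib_left)
      also have "\<dots> \<le> (fact CARD('n) * Gamma (t + 1) / (Gamma c)\<^sup>2) * (Gamma s * (1 - (norm z)\<^sup>2) powr (- s))"
        using Gpos s sums by (intro mult_left_mono sum_le_suminf[of _ "{..<K}", THEN order_trans])
          (auto simp: sums_iff intro!: mult_nonneg_nonneg divide_nonneg_nonneg less_imp_le[OF Gamma_real_pos])
      finally show ?thesis by (simp add: C_def mult_ac)
    qed
    have lim: "(\<lambda>K. ennreal ((1 - (norm w)\<^sup>2) powr t * (norm (?S K w))\<^sup>2)) \<longlonglongrightarrow>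
        ennreal ((1 - (norm w)\<^sup>2) powr t * norm (1 - herm_prod z w) powr (- (real CARD('n) + 1 + t + s)))"
      if "w \<in> space ball_measure" for w :: "complex^'n"
    proof -
      have x: "norm (herm_prod w z) < 1" using norm_herm_prod_less(1)[of w z] that z by simp
      hence ne: "1 - herm_prod w z \<noteq> 0" by auto
      have "(\<lambda>K. ?S K w) \<longlonglongrightarrow> (1 - herm_prod w z) powr of_real (- c)"
        using binomial_series_complex[OF x c] by (simp add: a_def sums_def)
      hence "(\<lambda>K. (norm (?S K w))\<^sup>2) \<longlonglongrightarrow> (norm ((1 - herm_prod w z) powr of_real (- c)))\<^sup>2"
        by (intro tendsto_power tendsto_norm)
      also have "(norm ((1 - herm_prod w z) powr of_real (- c)))\<^sup>2 = norm (1 - herm_prod z w) powr (- (real CARD('n) + 1 + t + s))"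
        unfolding norm_powr_of_real[OF ne] norm_one_minus_herm_prod_commute[of z w]
        by (simp add: power2_eq_square powr_add[symmetric] c_def n_def)
      finally show ?thesis by (intro tendsto_ennrealI tendsto_mult tendsto_const)
    qed
    have "(\<integral>\<^sup>+w. ennreal ((1 - (norm w)\<^sup>2) powr t * norm (1 - herm_prod z w) powr (- (real CARD('n) + 1 + t + s))) \<partial>ball_measure)
       = (\<integral>\<^sup>+w. liminf (\<lambda>K. ennreal ((1 - (norm w)\<^sup>2) powr t * (norm (?S K w))\<^sup>2)) \<partial>ball_measure)"
      by (intro nn_integral_cong lim_imp_Liminf[symmetric] lim) simp
    also have "\<dots> \<le> liminf (\<lambda>K. \<integral>\<^sup>+w. ennreal ((1 - (norm w)\<^sup>2) powr t * (norm (?S K w))\<^sup>2) \<partial>ball_measure)"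
      by (rule nn_integral_liminf) measurable
    also have "\<dots> \<le> ennreal (C * (1 - (norm z)\<^sup>2) powr (- s))"
    proof -
      have "(\<lambda>K. \<integral>\<^sup>+w. ennreal ((1 - (norm w)\<^sup>2) powr t * (norm (?S K w))\<^sup>2) \<partial>ball_measure) = (\<lambda>K. ennreal (\<Sum>k<K. (a k)\<^sup>2 * ?m k))"
        using weighted_polynomial_norm[OF t, where z=z and a=a] z by (intro ext) simp
      moreover have "liminf (\<lambda>K. ennreal (\<Sum>k<K. (a k)\<^sup>2 * ?m k)) \<le> limsup (\<lambda>K. ennreal (\<Sum>k<K. (a k)\<^sup>2 * ?m k))"
        by (rule Liminf_le_Limsup) simp
      moreover have "limsup (\<lambda>K. ennreal (\<Sum>k<K. (a k)\<^sup>2 * ?m k)) \<le> ennreal (C * (1 - (norm z)\<^sup>2) powr (- s))"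
        by (rule Limsup_bounded, rule always_eventually, rule allI, rule ennreal_leI, rule bound)
      ultimately show ?thesis by simp
    qed
    finally show "(\<integral>\<^sup>+w. ennreal ((1 - (norm w)\<^sup>2) powr t * norm (1 - herm_prod z w) powr (- (real CARD('n) + 1 + t + s))) \<partial>ball_measure)
      \<le> ennreal (C * (1 - (norm z)\<^sup>2) powr (- s))" .
  qed
qed

section \<open>The Bergman reproducing formula\<close>

lemma roots_of_unity_sum:
  fixes k :: int
  assumes "M > 0" "\<not> int M dvd k"
  shows "(\<Sum>l<M. cis (2 * pi * of_int k * real l / real M)) = 0"
proof -
  define x where "x = cis (2 * pi * of_int k / real M)"
  have "x \<noteq> 1"
  proof
    assume "x = 1"
    hence "cos (2 * pi * of_int k / real M) = 1" by (simp add: x_def complex_eq_iff)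
    then obtain j :: int where "2 * pi * of_int k / real M = of_int j * 2 * pi"
      using cos_one_2pi_int by blast
    hence "real_of_int k = of_int (j * int M)" using assms(1) by (simp add: field_simps)
    hence "k = j * int M" by linarith
    thus False using assms(2) by simp
  qed
  moreover have "x ^ M = 1"
  proof -
    have "x ^ M = cis (2 * pi * of_int k)"
      unfolding x_def Complex.DeMoivre using assms(1) by simp
    thus ?thesis by (simp add: cis_multiple_2pi)
  qed
  ultimately have "(\<Sum>l<M. x ^ l) = 0"
    by (simp add: geometric_sum)
  moreover have "x ^ l = cis (2 * pi * of_int k * real l / real M)" for l
    unfolding x_def Complex.DeMoivre by (simp add: mult_ac)
  ultimately show ?thesis by simp
qed

text \<open>Averages over roots of unity replace the integral over the circle, so that a mean value over a group
of rotations can be taken inside a volume integral by linearity. The average annihilates the Taylor terms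
of degree \<open>1, ..., M\<close>, and only the tail of the Taylor series is left.\<close>

lemma mean_value_roots_of_unity:
  fixes g :: "complex \<Rightarrow> complex"
  assumes g: "g holomorphic_on ball 0 R" and R: "R > 1"
  shows "(\<lambda>M. (\<Sum>l<Suc M. g (cis (2 * pi * real l / real (Suc M)))) / of_nat (Suc M)) \<longlonglongrightarrow> g 0"
proof -
  define c where "c m = (deriv ^^ m) g 0 / fact m" for m
  have ps: "(\<lambda>m. c m * w ^ m) sums g w" if "norm w < R" for w
    using holomorphic_power_series[OF g, of w] that by (simp add: c_def)
  have c0: "c 0 = g 0" by (simp add: c_def)
  have sumc: "summable (\<lambda>m. norm (c m))"
  proof -
    obtain r where r: "1 < r" "r < R" using R dense by blast
    have "summable (\<lambda>m. c m * of_real r ^ m)" using ps[of "of_real r"] r by (auto simp: sums_iff)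
    from powser_insidea[OF this, of 1] r show ?thesis by simp
  qed
  define A where "A M = (\<Sum>l<Suc M. g (cis (2 * pi * real l / real (Suc M)))) / of_nat (Suc M)" for M
  have bound: "norm (A M - g 0) \<le> (\<Sum>m. norm (c (m + Suc M)))" for M
  proof -
    define e where "e m = (\<Sum>l<Suc M. cis (2 * pi * real l / real (Suc M)) ^ m) / of_nat (Suc M)" for m
    have e0: "e 0 = 1" by (simp add: e_def del: of_nat_Suc sum.lessThan_Suc)
    have e1: "e m = 0" if "0 < m" "m < Suc M" for m
    proof -
      have "\<not> int (Suc M) dvd int m" using that by (simp add: nat_dvd_not_less del: of_nat_Suc)
      from roots_of_unity_sum[OF _ this]
      have "(\<Sum>l<Suc M. cis (2 * pi * real m * real l / real (Suc M))) = 0" by simp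
      moreover have "cis (2 * pi * real l / real (Suc M)) ^ m = cis (2 * pi * real m * real l / real (Suc M))" for l
        unfolding Complex.DeMoivre by (simp add: mult_ac)
      ultimately show ?thesis by (simp add: e_def)
    qed
    have e2: "norm (e m) \<le> 1" for m
    proof -
      have "norm (\<Sum>l<Suc M. cis (2 * pi * real l / real (Suc M)) ^ m) \<le> (\<Sum>l<Suc M. 1)"
        by (rule order_trans[OF norm_sum], rule sum_mono) (simp add: norm_power)
      thus ?thesis by (simp add: e_def norm_divide del: of_nat_Suc sum.lessThan_Suc)
    qed
    have "(\<lambda>m. (\<Sum>l<Suc M. c m * cis (2 * pi * real l / real (Suc M)) ^ m) / of_nat (Suc M)) sums A M"
      unfolding A_def using R by (intro sums_divide sums_sum ps) simp
    hence s: "(\<lambda>m. c m * e m) sums A M"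
      by (simp add: e_def sum_distrib_left del: of_nat_Suc sum.lessThan_Suc)
    have sm: "summable (\<lambda>m. norm (c m * e m))"
      by (rule summable_comparison_test'[OF sumc]) (simp add: norm_mult mult_left_le e2)
    have "A M = (\<Sum>m. c (m + Suc M) * e (m + Suc M)) + (\<Sum>m<Suc M. c m * e m)"
      using s suminf_split_initial_segment[of "\<lambda>m. c m * e m" "Suc M"] by (simp only: sums_iff)
    also have "(\<Sum>m<Suc M. c m * e m) = (\<Sum>m<Suc M. if m = 0 then g 0 else 0)"
      by (intro sum.cong) (auto simp: e0 c0 e1)
    also have "\<dots> = g 0" by simp
    finally have "norm (A M - g 0) = norm (\<Sum>m. c (m + Suc M) * e (m + Suc M))" by simp
    also have "\<dots> \<le> (\<Sum>m. norm (c (m + Suc M) * e (m + Suc M)))"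
      by (rule summable_norm, rule summable_ignore_initial_segment[OF sm])
    also have "\<dots> \<le> (\<Sum>m. norm (c (m + Suc M)))"
      by (rule suminf_le[OF _ summable_ignore_initial_segment[OF sm] summable_ignore_initial_segment[OF sumc]])
         (simp add: norm_mult mult_left_le e2)
    finally show ?thesis .
  qed
  have "(\<lambda>M. \<Sum>m. norm (c (m + M))) \<longlonglongrightarrow> 0"
  proof -
    have "(\<lambda>M. \<Sum>m. norm (c (m + M))) = (\<lambda>M. (\<Sum>m. norm (c m)) - (\<Sum>m<M. norm (c m)))"
      by (rule ext) (rule suminf_minus_initial_segment[OF sumc])
    moreover have "\<dots> \<longlonglongrightarrow> (\<Sum>m. norm (c m)) - (\<Sum>m. norm (c m))"
      by (intro tendsto_diff tendsto_const summable_LIMSEQ sumc)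
    ultimately show ?thesis by simp
  qed
  hence "(\<lambda>M. \<Sum>m. norm (c (m + Suc M))) \<longlonglongrightarrow> 0" by (rule LIMSEQ_Suc)
  hence "(\<lambda>M. A M - g 0) \<longlonglongrightarrow> 0"
    by (rule Lim_null_comparison[rotated]) (intro always_eventually allI bound)
  thus ?thesis unfolding A_def by (rule LIM_zero_cancel)
qed

lemma holomorphic_ball_continuous: "holomorphic_ball f \<Longrightarrow> continuous_on (ball 0 1) f"
  unfolding holomorphic_ball_def
  by (intro continuous_at_imp_continuous_on ballI) (meson has_derivative_continuous)

lemma holomorphic_ball_measurable: "holomorphic_ball f \<Longrightarrow> f \<in> borel_measurable ball_measure"
  by (rule continuous_on_imp_measurable_ball) (rule holomorphic_ball_continuous)

lemma holomorphic_ball_slice: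
  fixes f :: "complex^'n \<Rightarrow> complex"
  assumes f: "holomorphic_ball f" and S: "\<And>x. x \<in> S \<Longrightarrow> norm (a + x *s v) < 1"
  shows "(\<lambda>x. f (a + x *s v)) holomorphic_on S"
  unfolding holomorphic_on_def
proof
  fix x assume "x \<in> S"
  hence "a + x *s v \<in> ball 0 1" using S by simp
  then obtain D where D: "(f has_derivative D) (at (a + x *s v))" "\<And>c v. D (c *s v) = c * D v"
    using f unfolding holomorphic_ball_def by blast
  have "bounded_linear (\<lambda>y::complex. y *s v)"
    by (intro linear_conv_bounded_linear[THEN iffD1] linearI)
       (simp_all add: vector_sadd_rdistrib scaleR_eq_smult vector_smult_assoc scaleR_conv_of_real)
  hence lin: "((\<lambda>y::complex. a + y *s v) has_derivative (\<lambda>y. y *s v)) (at x)"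
    by (auto intro!: derivative_eq_intros bounded_linear_imp_has_derivative)
  have "((f \<circ> (\<lambda>y. a + y *s v)) has_derivative (D \<circ> (\<lambda>y. y *s v))) (at x)"
    by (rule diff_chain_at[OF lin D(1)])
  moreover have "(D \<circ> (\<lambda>y. y *s v)) = (*) (D v)" by (auto simp: D(2) mult.commute)
  ultimately have "((\<lambda>y. f (a + y *s v)) has_field_derivative D v) (at x)"
    unfolding has_field_derivative_def o_def by simp
  thus "(\<lambda>x. f (a + x *s v)) field_differentiable at x within S"
    using field_differentiable_def field_differentiable_at_within by blast
qed

text \<open>Orthogonal projection of \<open>w\<close> onto the complex line spanned by \<open>z\<close>; it is 0 for \<open>z = 0\<close>.\<close>

definition line_proj :: "complex^'n \<Rightarrow> complex^'n \<Rightarrow> complex^'n" where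
  "line_proj z w = (herm_prod w z / herm_prod z z) *s z"

lemma herm_prod_line_proj: "herm_prod (line_proj z w) z = herm_prod w z"
  by (cases "z = 0") (simp_all add: line_proj_def herm_prod_smult_left herm_prod_self)

lemma norm_line_proj_pythagoras:
  "(norm (line_proj z w + x *s (w - line_proj z w)))\<^sup>2 = (norm (line_proj z w))\<^sup>2 + (norm x)\<^sup>2 * (norm (w - line_proj z w))\<^sup>2"
proof -
  let ?p = "line_proj z w"
  have orth: "herm_prod (w - ?p) ?p = 0"
  proof -
    have "herm_prod (w - ?p) z = 0" by (simp add: herm_prod_diff_left herm_prod_line_proj)
    thus ?thesis unfolding line_proj_def[of z w] by (simp add: herm_prod_smult_right)
  qed
  have orth': "herm_prod ?p (w - ?p) = 0" using orth cnj_herm_prod[of "w - ?p" ?p] by simp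
  have "of_real ((norm (?p + x *s (w - ?p)))\<^sup>2) = herm_prod ?p ?p + (x * cnj x) * herm_prod (w - ?p) (w - ?p)"
    unfolding herm_prod_self[symmetric] herm_prod_add_left herm_prod_add_right herm_prod_smult_left herm_prod_smult_right orth orth'
    by simp
  also have "\<dots> = of_real ((norm ?p)\<^sup>2 + (norm x)\<^sup>2 * (norm (w - ?p))\<^sup>2)"
    by (simp only: herm_prod_self complex_norm_square[symmetric] of_real_add of_real_mult)
  finally show ?thesis using of_real_eq_iff by blast
qed

lemma norm_line_proj_pythagoras1:
  "(norm w)\<^sup>2 = (norm (line_proj z w))\<^sup>2 + (norm (w - line_proj z w))\<^sup>2"
  using norm_line_proj_pythagoras[of z w 1] by simp

lemma linear_line_proj: "linear (line_proj z)"
  unfolding line_proj_def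
  by (rule linearI) (simp_all add: herm_prod_simps scaleR_eq_smult add_divide_distrib vector_sadd_rdistrib vector_smult_assoc)

lemma linear_continuous_on_vec:
  fixes L :: "'a::euclidean_space \<Rightarrow> 'b::real_normed_vector"
  shows "linear L \<Longrightarrow> continuous_on S L"
  by (intro linear_continuous_on) (simp add: linear_linear)

text \<open>A factor that depends on \<open>w\<close> only through \<open><w,z>\<close> is invariant under the unitary maps that fix \<open>z\<close> and
rotate its orthogonal complement. Averaging \<open>f\<close> over these rotations replaces \<open>f\<close> by its value on the line through \<open>z\<close>, by the
mean value property in one variable. The dilation by \<open>r < 1\<close> makes \<open>f\<close> bounded.\<close>

lemma integral_line_proj:
  fixes f :: "complex^'n \<Rightarrow> complex" and z :: "complex^'n"
  assumes f: "holomorphic_ball f" and r: "0 < r" "r < 1"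
    and H: "continuous_on (ball 0 1) H" "\<And>w. norm w < 1 \<Longrightarrow> norm (H (herm_prod w z)) \<le> B"
    and z: "norm z \<le> 1"
  shows "(LINT w|ball_measure. f (r *\<^sub>R w) * H (herm_prod w z))
    = (LINT w|ball_measure. f (r *\<^sub>R line_proj z w) * H (herm_prod w z))"
proof -
  let ?P = "line_proj z"
  \<comment> \<open>for unimodular x this fixes the line through z and rotates its orthogonal complement\<close>
  define U where "U x w = ?P w + x *s (w - ?P w)" for x w
  have linU: "linear (U x)" for x
  proof (rule linearI)
    show "U x (v + w) = U x v + U x w" for v w
      by (simp add: U_def linear_add[OF linear_line_proj] vec_eq_iff algebra_simps)
    show "U x (c *\<^sub>R w) = c *\<^sub>R U x w" for c w
      by (simp add: U_def linear_scale[OF linear_line_proj] vec_eq_iff algebra_simps)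
  qed
  have isoU: "norm (U x w) = norm w" if "norm x = 1" for x w
  proof -
    have "(norm (U x w))\<^sup>2 = (norm w)\<^sup>2"
      using norm_line_proj_pythagoras[of z w x] norm_line_proj_pythagoras1[of w z] that by (simp add: U_def)
    thus ?thesis by (simp add: power2_eq_iff_nonneg)
  qed
  have UH: "herm_prod (U x w) z = herm_prod w z" for x w
    by (simp add: U_def herm_prod_simps herm_prod_line_proj)
  have rball: "norm (r *\<^sub>R w) < 1" if "norm w < 1" for w :: "complex^'n"
    using that r mult_strict_mono[of r 1 "norm w" 1] by simp
  have "compact (cball (0::complex^'n) r)" by simp
  moreover have "continuous_on (cball 0 r) f"
    using holomorphic_ball_continuous[OF f] by (rule continuous_on_subset) (use r in auto)
  ultimately have "bounded (f ` cball 0 r)" using compact_continuous_image compact_imp_bounded by blast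
  then obtain A where "\<forall>w\<in>cball 0 r. norm (f w) \<le> A" unfolding bounded_iff by auto
  hence A: "norm (f w) \<le> A" if "norm w \<le> r" for w using that by simp
  have A1: "norm (f (r *\<^sub>R w)) \<le> A" if "norm w < 1" for w
    using that r by (intro A) (simp add: mult_left_le)
  have fr: "continuous_on (ball 0 1) (\<lambda>w. f (r *\<^sub>R w))"
    by (rule continuous_on_compose2[OF holomorphic_ball_continuous[OF f]]) (use rball in \<open>auto intro!: continuous_intros\<close>)
  have Hc: "continuous_on (ball 0 1) (\<lambda>w. H (herm_prod w z))"
    by (rule continuous_on_compose2[OF H(1)])
       (use z norm_herm_prod_less(1)[of _ z] in \<open>auto intro!: continuous_intros\<close>)
  have cont: "continuous_on (ball 0 1) (\<lambda>w. f (r *\<^sub>R w) * H (herm_prod w z))"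
    by (intro continuous_intros fr Hc)
  have [measurable]: "(\<lambda>w. H (herm_prod w z)) \<in> borel_measurable ball_measure"
    using Hc by (rule continuous_on_imp_measurable_ball)
  have Uball: "norm (U x w) < 1" if "norm x = 1" "norm w < 1" for x w using isoU that by simp
  have contU: "continuous_on (ball 0 1) (\<lambda>w. f (r *\<^sub>R U x w))" if "norm x = 1" for x
    by (rule continuous_on_compose2[OF fr linear_continuous_on_vec[OF linU]]) (use Uball[OF that] in auto)
  define \<omega> where "\<omega> M l = cis (2 * pi * real l / real (Suc M))" for M l
  have \<omega>: "norm (\<omega> M l) = 1" for M l by (simp add: \<omega>_def)
  define Av where "Av M w = (\<Sum>l<Suc M. f (r *\<^sub>R U (\<omega> M l) w)) / of_nat (Suc M)" for M w
  have measAv [measurable]: "Av M \<in> borel_measurable ball_measure" for M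
    unfolding Av_def
    by (intro continuous_on_imp_measurable_ball continuous_intros contU \<omega>) (simp del: of_nat_Suc)
  have bndU: "norm (f (r *\<^sub>R U (\<omega> M l) w) * H (herm_prod w z)) \<le> A * B" if "norm w < 1" for M l w
    using A1[OF Uball[OF \<omega> that]] H(2)[OF that] by (auto simp: norm_mult intro!: mult_mono intro: order_trans[OF norm_ge_zero])
  have int: "integrable ball_measure (\<lambda>w. f (r *\<^sub>R U (\<omega> M l) w) * H (herm_prod w z))" for M l
    by (rule ball_measure.integrable_const_bound[where B = "A * B"])
       (use bndU contU[OF \<omega>] in \<open>auto intro!: AE_I2 continuous_on_imp_measurable_ball continuous_on_mult Hc\<close>)
  have const: "(LINT w|ball_measure. Av M w * H (herm_prod w z)) = (LINT w|ball_measure. f (r *\<^sub>R w) * H (herm_prod w z))" for M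
  proof -
    have "(LINT w|ball_measure. Av M w * H (herm_prod w z))
      = (LINT w|ball_measure. (\<Sum>l<Suc M. f (r *\<^sub>R U (\<omega> M l) w) * H (herm_prod w z)) / of_nat (Suc M))"
      by (simp add: Av_def sum_distrib_right del: sum.lessThan_Suc of_nat_Suc)
    also have "\<dots> = (\<Sum>l<Suc M. (LINT w|ball_measure. f (r *\<^sub>R U (\<omega> M l) w) * H (herm_prod w z))) / of_nat (Suc M)"
      by (simp add: Bochner_Integration.integral_sum int del: sum.lessThan_Suc of_nat_Suc)
    also have "\<dots> = (\<Sum>l<Suc M. (LINT w|ball_measure. f (r *\<^sub>R w) * H (herm_prod w z))) / of_nat (Suc M)"
      using integral_ball_measure_isometry[OF linU isoU[OF \<omega>] cont, of M] by (simp only: UH)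
    finally show ?thesis by (simp del: of_nat_Suc sum.lessThan_Suc)
  qed
  have lim: "(\<lambda>M. Av M w) \<longlonglongrightarrow> f (r *\<^sub>R ?P w)" if w: "norm w < 1" for w
  proof -
    define g where "g x = f (r *\<^sub>R ?P w + x *s (r *\<^sub>R (w - ?P w)))" for x
    have g: "g x = f (r *\<^sub>R U x w)" for x
      by (simp add: g_def U_def scaleR_right_distrib scaleR_eq_smult vector_smult_assoc mult.commute vector_add_ldistrib)
    have "g holomorphic_on ball 0 (1/r)"
      unfolding g_def
    proof (rule holomorphic_ball_slice[OF f])
      fix x :: complex assume "x \<in> ball 0 (1/r)"
      hence x: "norm x * r \<le> 1" using r by (simp add: field_simps)
      have "(norm (r *\<^sub>R U x w))\<^sup>2 = r\<^sup>2 * (norm (?P w))\<^sup>2 + (norm x * r)\<^sup>2 * (norm (w - ?P w))\<^sup>2"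
      proof -
        have "(norm (r *\<^sub>R U x w))\<^sup>2 = r\<^sup>2 * (norm (U x w))\<^sup>2" by (simp add: power_mult_distrib)
        thus ?thesis unfolding U_def norm_line_proj_pythagoras
          by (simp add: power_mult_distrib distrib_left mult_ac)
      qed
      also have "\<dots> \<le> 1 * (norm (?P w))\<^sup>2 + 1 * (norm (w - ?P w))\<^sup>2"
        using r x by (intro add_mono mult_right_mono) (auto intro!: power_le_one)
      also have "\<dots> < 1" using norm_line_proj_pythagoras1[of w z] one_minus_norm2_pos[OF w] by simp
      finally have "norm (r *\<^sub>R U x w) < 1" by (simp add: power_less_one_iff)
      moreover have "r *\<^sub>R ?P w + x *s (r *\<^sub>R (w - ?P w)) = r *\<^sub>R U x w"
        by (simp add: U_def scaleR_right_distrib scaleR_eq_smult vector_smult_assoc mult.commute vector_add_ldistrib)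
      ultimately show "norm (r *\<^sub>R ?P w + x *s (r *\<^sub>R (w - ?P w))) < 1" by simp
    qed
    from mean_value_roots_of_unity[OF this] r
    have "(\<lambda>M. (\<Sum>l<Suc M. g (\<omega> M l)) / of_nat (Suc M)) \<longlonglongrightarrow> g 0" by (simp add: \<omega>_def)
    moreover have "g 0 = f (r *\<^sub>R ?P w)" by (simp add: g_def)
    ultimately show ?thesis by (simp add: Av_def g)
  qed
  have AvB: "norm (Av M w) \<le> A" if "norm w < 1" for M w
  proof -
    have "norm (\<Sum>l<Suc M. f (r *\<^sub>R U (\<omega> M l) w)) \<le> (\<Sum>l<Suc M. A)"
      by (rule order_trans[OF norm_sum], rule sum_mono) (rule A1[OF Uball[OF \<omega> that]])
    thus ?thesis by (simp add: Av_def norm_divide field_simps del: of_nat_Suc sum.lessThan_Suc)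
  qed
  have "(\<lambda>M. LINT w|ball_measure. Av M w * H (herm_prod w z)) \<longlonglongrightarrow> (LINT w|ball_measure. f (r *\<^sub>R ?P w) * H (herm_prod w z))"
  proof (rule integral_dominated_convergence[where w = "\<lambda>_. A * B"])
    show "AE w in ball_measure. (\<lambda>M. Av M w * H (herm_prod w z)) \<longlonglongrightarrow> f (r *\<^sub>R ?P w) * H (herm_prod w z)"
      by (intro AE_I2 tendsto_mult lim tendsto_const) simp
    show "AE w in ball_measure. norm (Av M w * H (herm_prod w z)) \<le> A * B" for M
      using AvB H(2) by (intro AE_I2) (auto simp: norm_mult intro!: mult_mono intro: order_trans[OF norm_ge_zero])
    have "norm (?P w) < 1" if "norm w < 1" for w
    proof -
      have "(norm (?P w))\<^sup>2 \<le> (norm w)\<^sup>2" using norm_line_proj_pythagoras1[of w z] by simp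
      thus ?thesis using that by (simp add: abs_le_square_iff[symmetric])
    qed
    hence "continuous_on (ball 0 1) (\<lambda>w. f (r *\<^sub>R ?P w))"
      by (intro continuous_on_compose2[OF fr linear_continuous_on_vec[OF linear_line_proj]]) auto
    hence [measurable]: "(\<lambda>w. f (r *\<^sub>R ?P w)) \<in> borel_measurable ball_measure" by (rule continuous_on_imp_measurable_ball)
    show "(\<lambda>w. f (r *\<^sub>R ?P w) * H (herm_prod w z)) \<in> borel_measurable ball_measure" by measurable
  qed auto
  thus ?thesis unfolding const by (simp add: LIMSEQ_const_iff)
qed

lemma measure_ball_measure [simp]: "measure ball_measure (ball (0::complex^'n) 1) = 1"
  by (simp add: measure_def)

lemma norm_bergman_kernel_le:
  assumes "norm z < 1" "norm w < 1"
  shows "norm (1 / (1 - herm_prod z w) ^ m) \<le> 1 / (1 - norm z) ^ m"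
proof -
  have "(1 - norm z) ^ m \<le> norm (1 - herm_prod z w) ^ m"
    using norm_one_minus_herm_prod_ge[of w z] assms by (intro power_mono) auto
  hence "1 / norm (1 - herm_prod z w) ^ m \<le> 1 / (1 - norm z) ^ m"
    using assms by (intro frac_le) auto
  thus ?thesis by (simp add: norm_divide norm_power)
qed

lemma integral_monomials:
  fixes z :: "complex^'n"
  assumes "norm z \<le> 1"
  shows "integrable ball_measure (\<lambda>w. herm_prod w z ^ j * cnj (herm_prod w z) ^ k)"
    and "(LINT w|ball_measure. herm_prod w z ^ j * cnj (herm_prod w z) ^ k)
      = (if j = k then of_real (norm z ^ (2*k) * (fact CARD('n) * fact k / fact (CARD('n) + k))) else 0)"
proof -
  have [measurable]: "(\<lambda>w. cnj (herm_prod w z)) \<in> borel_measurable ball_measure"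
    unfolding cnj_herm_prod by measurable
  have bnd: "norm (herm_prod w z) \<le> 1" if "w \<in> space ball_measure" for w
    using norm_herm_prod_less(1)[of w z] that assms by simp
  show int: "integrable ball_measure (\<lambda>w. herm_prod w z ^ j * cnj (herm_prod w z) ^ k)" for j k
    by (rule ball_measure.integrable_const_bound[where B = 1])
       (use bnd in \<open>auto intro!: AE_I2 mult_le_one power_le_one simp: norm_mult norm_power\<close>)
  show "(LINT w|ball_measure. herm_prod w z ^ j * cnj (herm_prod w z) ^ k)
      = (if j = k then of_real (norm z ^ (2*k) * (fact CARD('n) * fact k / fact (CARD('n) + k))) else 0)"
  proof (cases "j = k")
    case False
    thus ?thesis using radial_monomials_orthogonal[of "\<lambda>_. 1" j k z] by simp
  next
    case True
    have m: "has_bochner_integral ball_measure (\<lambda>w. norm (herm_prod w z) ^ (2*k)) (norm z ^ (2*k) * (fact CARD('n) * fact k / fact (CARD('n) + k)))"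
      by (rule has_bochner_integral_nn_integral[OF _ _ _ moment_ball_measure]) auto
    have "(LINT w|ball_measure. herm_prod w z ^ j * cnj (herm_prod w z) ^ k)
       = (LINT w|ball_measure. complex_of_real (norm (herm_prod w z) ^ (2*k)))"
      unfolding True by (intro Bochner_Integration.integral_cong refl)
         (simp only: power_mult of_real_power[of _ k] complex_norm_square power_mult_distrib)
    also have "\<dots> = of_real (LINT w|ball_measure. norm (herm_prod w z) ^ (2*k))"
      by (rule integral_complex_of_real)
    finally show ?thesis using m True by (simp add: has_bochner_integral_iff)
  qed
qed

text \<open>The coefficients are the inverses of the moments in \<open>integral_monomials\<close>; this is why the
kernel reproduces.\<close>

lemma bergman_kernel_series:
  fixes x :: complex
  assumes "norm x < 1"
  shows "(\<lambda>k. of_real (fact (n + k) / (fact n * fact k)) * x ^ k) sums (1 / (1 - x) ^ (n + 1))"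
proof -
  have "(1 - x) powr of_real (- real (n + 1)) = 1 / (1 - x) ^ (n + 1)"
  proof -
    have "1 - x \<noteq> 0" using assms by auto
    hence "(1 - x) powr (of_nat (n + 1)) = (1 - x) ^ (n + 1)" by (intro powr_nat') auto
    moreover have "of_real (- real (n + 1)) = - (of_nat (n + 1) :: complex)" by simp
    ultimately show ?thesis by (simp only: powr_minus) (simp add: divide_inverse)
  qed
  moreover have "Gamma (real k + real (n + 1)) / (Gamma (real (n + 1)) * fact k) = fact (n + k) / (fact n * fact k)" for k
    using Gamma_fact[of "n + k", where 'a=real] Gamma_fact[of n, where 'a=real] by (simp add: add_ac)
  ultimately show ?thesis using binomial_series_complex[OF assms, of "real (n + 1)"] by simp
qed

text \<open>The reduction \<open>integral_line_proj\<close> leaves a function of one variable on the line through \<open>z\<close>. Its Taylor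
series and the series of the kernel are integrated termwise; orthogonality keeps the diagonal terms, whose moments cancel the
coefficients of the kernel.\<close>

lemma reproducing_dilate:
  fixes f :: "complex^'n \<Rightarrow> complex"
  assumes f: "holomorphic_ball f" and r: "0 < r" "r < 1" and z: "norm z < 1"
  shows "(LINT w|ball_measure. f (r *\<^sub>R w) / (1 - herm_prod z w) ^ (CARD('n) + 1)) = f (r *\<^sub>R z)"
proof -
  define H where "H x = 1 / (1 - cnj x) ^ (CARD('n) + 1)" for x
  have H: "1 / (1 - herm_prod z w) ^ (CARD('n) + 1) = H (herm_prod w z)" for w
    by (simp add: H_def cnj_herm_prod)
  have ne: "1 - cnj x \<noteq> 0" if "norm x < 1" for x :: complex
    using that by (metis complex_cnj_cancel_iff complex_cnj_one eq_iff_diff_eq_0 less_irrefl norm_one)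
  have Hc: "continuous_on (ball 0 1) H"
    unfolding H_def using ne by (auto intro!: continuous_intros)
  have HB: "norm (H (herm_prod w z)) \<le> 1 / (1 - norm z) ^ (CARD('n) + 1)" if "norm w < 1" for w
    unfolding H[symmetric] by (rule norm_bergman_kernel_le[OF z that])
  have "(LINT w|ball_measure. f (r *\<^sub>R w) / (1 - herm_prod z w) ^ (CARD('n) + 1)) = (LINT w|ball_measure. f (r *\<^sub>R w) * H (herm_prod w z))"
    by (simp add: H[symmetric])
  also have "\<dots> = (LINT w|ball_measure. f (r *\<^sub>R line_proj z w) * H (herm_prod w z))"
    by (rule integral_line_proj[OF f r Hc HB]) (use z in auto)
  also have "\<dots> = f (r *\<^sub>R z)"
  proof (cases "z = 0")
    case True
    thus ?thesis by (simp add: line_proj_def H_def)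
  next
    case False
    define \<rho> where "\<rho> = norm z"
    have \<rho>: "0 < \<rho>" "\<rho> < 1" using False z by (simp_all add: \<rho>_def)
    \<comment> \<open>g is holomorphic on a disc of radius larger than 1 / \<rho>, so its Taylor series converges absolutely at all points used\<close>
    define R where "R = 1 / (r * \<rho>)"
    have R1: "1 / \<rho> < R" using r \<rho> by (simp add: R_def field_simps)
    define g where "g x = f (0 + x *s (r *\<^sub>R z))" for x
    have hol: "g holomorphic_on ball 0 R"
      unfolding g_def
    proof (rule holomorphic_ball_slice[OF f])
      fix x :: complex assume "x \<in> ball 0 R"
      hence "norm x * (r * \<rho>) < 1" using r \<rho> by (simp add: R_def field_simps)
      thus "norm (0 + x *s r *\<^sub>R z) < 1" using r by (simp add: norm_smult \<rho>_def)
    qed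
    define b where "b m = (deriv ^^ m) g 0 / fact m" for m
    have ps: "(\<lambda>m. b m * x ^ m) sums g x" if "norm x < R" for x
      using holomorphic_power_series[OF hol, of x] that by (simp add: b_def)
    define a where "a k = (fact (CARD('n) + k) / (fact CARD('n) * fact k) :: real)" for k :: nat
    have fg: "f (r *\<^sub>R line_proj z w) = g (herm_prod w z / of_real (\<rho>\<^sup>2))" for w
      by (simp add: g_def line_proj_def herm_prod_self \<rho>_def scaleR_eq_smult vector_smult_assoc mult.commute)
    have x\<rho>: "norm (herm_prod w z) \<le> \<rho>" if "norm w < 1" for w
      using norm_herm_prod_le[of w z] mult_right_mono[of "norm w" 1 "norm z"] that by (simp add: \<rho>_def)
    have x\<rho>2: "norm (herm_prod w z / of_real (\<rho>\<^sup>2)) \<le> 1 / \<rho>" if "norm w < 1" for w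
    proof -
      have "norm (herm_prod w z / of_real (\<rho>\<^sup>2)) = norm (herm_prod w z) / \<rho>\<^sup>2" by (simp add: norm_divide norm_power)
      also have "\<dots> \<le> \<rho> / \<rho>\<^sup>2" by (rule divide_right_mono[OF x\<rho>[OF that]]) simp
      finally show ?thesis using \<rho> by (simp add: power2_eq_square)
    qed
    define S where "S K w = (\<Sum>m<K. b m * (herm_prod w z / of_real (\<rho>\<^sup>2)) ^ m)" for K w
    define T where "T K w = (\<Sum>k<K. of_real (a k) * cnj (herm_prod w z) ^ k)" for K w
    have Slim: "(\<lambda>K. S K w) \<longlonglongrightarrow> f (r *\<^sub>R line_proj z w)" if "norm w < 1" for w
      unfolding S_def fg using ps[of "herm_prod w z / of_real (\<rho>\<^sup>2)"] x\<rho>2[OF that] R1 by (simp add: sums_def)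
    have Tlim: "(\<lambda>K. T K w) \<longlonglongrightarrow> H (herm_prod w z)" if "norm w < 1" for w
      unfolding T_def H_def a_def using bergman_kernel_series[of "cnj (herm_prod w z)" "CARD('n)"] x\<rho>[OF that] \<rho> by (simp add: sums_def)
    define SB where "SB = (\<Sum>m. norm (b m * of_real (1/\<rho>) ^ m))"
    define TB where "TB = (\<Sum>k. a k * \<rho> ^ k)"
    have sumS: "summable (\<lambda>m. norm (b m * of_real (1/\<rho>) ^ m))"
    proof -
      obtain q where q: "1/\<rho> < q" "q < R" using R1 dense by blast
      have q0: "q > 0" using q(1) \<rho> by (meson less_trans zero_less_divide_1_iff)
      have "summable (\<lambda>m. b m * of_real q ^ m)" using ps[of "of_real q"] q q0 by (auto simp: sums_iff)
      thus ?thesis by (rule powser_insidea) (use q q0 \<rho> in \<open>auto simp: norm_divide\<close>)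
    qed
    have sumT: "summable (\<lambda>k. a k * \<rho> ^ k)"
    proof -
      have "(\<lambda>k. of_real (a k) * of_real \<rho> ^ k :: complex) sums (1 / (1 - of_real \<rho>) ^ (CARD('n) + 1))"
        unfolding a_def by (rule bergman_kernel_series) (use \<rho> in simp)
      hence "summable (\<lambda>k. complex_of_real (a k * \<rho> ^ k))" by (simp add: sums_iff)
      thus ?thesis by (simp only: summable_complex_of_real)
    qed
    have a0: "a k \<ge> 0" for k by (simp add: a_def)
    have SB: "norm (S K w) \<le> SB" if "norm w < 1" for K w
    proof -
      have "norm (S K w) \<le> (\<Sum>m<K. norm (b m * of_real (1/\<rho>) ^ m))"
        unfolding S_def
      proof (rule order_trans[OF norm_sum], rule sum_mono)
        fix m
        show "norm (b m * (herm_prod w z / of_real (\<rho>\<^sup>2)) ^ m) \<le> norm (b m * of_real (1/\<rho>) ^ m)"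
        proof -
          have n1: "norm (complex_of_real (1/\<rho>)) = 1/\<rho>" using \<rho> by (simp add: norm_divide)
          show ?thesis unfolding norm_mult norm_power n1
            by (intro mult_left_mono power_mono x\<rho>2[OF that]) auto
        qed
      qed
      also have "\<dots> \<le> SB" unfolding SB_def by (rule sum_le_suminf[OF sumS]) auto
      finally show ?thesis .
    qed
    have TB: "norm (T K w) \<le> TB" if "norm w < 1" for K w
    proof -
      have "norm (T K w) \<le> (\<Sum>k<K. a k * \<rho> ^ k)"
        unfolding T_def
      proof (rule order_trans[OF norm_sum], rule sum_mono)
        fix k
        show "norm (of_real (a k) * cnj (herm_prod w z) ^ k) \<le> a k * \<rho> ^ k"
          using power_mono[OF x\<rho>[OF that], of k] \<rho> a0[of k] by (simp add: norm_mult norm_power mult_left_mono)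
      qed
      also have "\<dots> \<le> TB" unfolding TB_def using a0 \<rho> by (intro sum_le_suminf[OF sumT]) auto
      finally show ?thesis .
    qed
    have val: "(LINT w|ball_measure. S K w * T K w) = (\<Sum>k<K. b k * 1 ^ k)" for K
    proof -
      note M = integral_monomials[of z]
      have z1: "norm z \<le> 1" using z by simp
      have "S K w * T K w = (\<Sum>m<K. \<Sum>k<K. (b m / of_real (\<rho>\<^sup>2) ^ m * of_real (a k)) * (herm_prod w z ^ m * cnj (herm_prod w z) ^ k))" for w
        unfolding S_def T_def sum_product by (intro sum.cong refl) (simp add: power_divide mult_ac)
      hence "(LINT w|ball_measure. S K w * T K w) = (\<Sum>m<K. \<Sum>k<K. (b m / of_real (\<rho>\<^sup>2) ^ m * of_real (a k)) * (LINT w|ball_measure. herm_prod w z ^ m * cnj (herm_prod w z) ^ k))"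
        by (simp only: Bochner_Integration.integral_sum Bochner_Integration.integrable_sum integrable_mult_right M(1)[OF z1] integral_mult_right_zero)
      also have "\<dots> = (\<Sum>m<K. \<Sum>k<K. if k = m then (b m / of_real (\<rho>\<^sup>2) ^ m * of_real (a m)) * of_real (norm z ^ (2*m) * (fact CARD('n) * fact m / fact (CARD('n) + m))) else 0)"
        unfolding M(2)[OF z1] by (intro sum.cong refl) auto
      also have "\<dots> = (\<Sum>m<K. (b m / of_real (\<rho>\<^sup>2) ^ m * of_real (a m)) * of_real (norm z ^ (2*m) * (fact CARD('n) * fact m / fact (CARD('n) + m))))"
        by simp
      also have "\<dots> = (\<Sum>k<K. b k * 1 ^ k)"
      proof (rule sum.cong[OF refl])
        fix m
        have "a m * (norm z ^ (2*m) * (fact CARD('n) * fact m / fact (CARD('n) + m))) = (\<rho>\<^sup>2) ^ m"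
          by (simp add: a_def \<rho>_def power_mult)
        hence "of_real (a m) * of_real (norm z ^ (2*m) * (fact CARD('n) * fact m / fact (CARD('n) + m))) = (of_real (\<rho>\<^sup>2) ^ m :: complex)"
          by (simp only: of_real_mult[symmetric] of_real_power[symmetric])
        thus "(b m / of_real (\<rho>\<^sup>2) ^ m * of_real (a m)) * of_real (norm z ^ (2*m) * (fact CARD('n) * fact m / fact (CARD('n) + m))) = b m * 1 ^ m"
          using \<rho> by (simp only: mult.assoc) simp
      qed
      finally show ?thesis .
    qed
    have "(\<lambda>K. LINT w|ball_measure. S K w * T K w) \<longlonglongrightarrow> (LINT w|ball_measure. f (r *\<^sub>R line_proj z w) * H (herm_prod w z))"
    proof (rule integral_dominated_convergence[where w = "\<lambda>_. SB * TB"])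
      have [measurable]: "(\<lambda>w. cnj (herm_prod w z)) \<in> borel_measurable ball_measure"
        unfolding cnj_herm_prod by measurable
      show meas: "(\<lambda>w. S K w * T K w) \<in> borel_measurable ball_measure" for K
        unfolding S_def T_def by measurable
      show lim: "AE w in ball_measure. (\<lambda>K. S K w * T K w) \<longlonglongrightarrow> f (r *\<^sub>R line_proj z w) * H (herm_prod w z)"
        by (intro AE_I2 tendsto_mult Slim Tlim) simp_all
      show "AE w in ball_measure. norm (S K w * T K w) \<le> SB * TB" for K
        using SB TB by (intro AE_I2) (auto simp: norm_mult intro!: mult_mono intro: order_trans[OF norm_ge_zero])
      show "(\<lambda>w. f (r *\<^sub>R line_proj z w) * H (herm_prod w z)) \<in> borel_measurable ball_measure"
        by (rule borel_measurable_LIMSEQ_metric[where f = "\<lambda>K w. S K w * T K w", OF meas]) (auto intro!: tendsto_mult Slim Tlim)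
    qed simp
    moreover have "(\<lambda>K. \<Sum>k<K. b k * 1 ^ k) \<longlonglongrightarrow> g 1"
    proof -
      have "1 < R" using R1 \<rho> by (meson less_trans less_divide_eq_1_pos)
      thus ?thesis using ps[of 1] by (simp add: sums_def)
    qed
    ultimately have "(LINT w|ball_measure. f (r *\<^sub>R line_proj z w) * H (herm_prod w z)) = g 1"
      unfolding val by (rule LIMSEQ_unique)
    thus ?thesis by (simp add: g_def)
  qed
  finally show ?thesis .
qed

lemma integral_uniform_ball:
  fixes f :: "complex^'n \<Rightarrow> complex"
  assumes f: "continuous_on (ball 0 1) f"
  shows "(LINT w|ball_measure. f w) = (LINT w|lborel. indicator (ball 0 1) w *\<^sub>R f w) /\<^sub>R measure lborel (ball (0::complex^'n) 1)"
    and "integrable ball_measure f \<Longrightarrow> integrable lborel (\<lambda>w. indicator (ball 0 1) w *\<^sub>R f w)"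
proof -
  define g where "g x = indicator (ball 0 1) x *\<^sub>R f x" for x
  define V where "V = measure lborel (ball (0::complex^'n) 1)"
  have [measurable]: "ball (0::complex^'n) 1 \<in> sets borel" by simp
  have eV: "emeasure lborel (ball (0::complex^'n) 1) = ennreal V"
    using emeasure_lborel_unit_ball(2)[where 'a="complex^'n"] by (simp add: V_def measure_def less_top)
  have V: "V > 0" using eV emeasure_lborel_unit_ball(1)[where 'a="complex^'n"] by (metis ennreal_0 less_eq_real_def measure_nonneg V_def)
  have [measurable]: "g \<in> borel_measurable borel"
    unfolding g_def by (rule borel_measurable_continuous_on_indicator[OF _ f]) simp
  have dens: "distr ball_measure borel (\<lambda>x. x) = density lborel (\<lambda>x. ennreal (indicator (ball (0::complex^'n) 1) x / V))"
    unfolding distr_ball_measure uniform_measure_def eV using V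
    by (intro arg_cong[where f = "density lborel"] ext) (auto simp: indicator_def divide_ennreal[of 1 V, simplified])
  have gi: "(indicator (ball 0 1) x / V) *\<^sub>R g x = g x /\<^sub>R V" for x
    by (simp add: g_def indicator_def divide_inverse)
  have "(LINT w|ball_measure. f w) = (LINT w|ball_measure. g w)"
    by (intro Bochner_Integration.integral_cong) (auto simp: g_def)
  also have "\<dots> = (LINT w|distr ball_measure borel (\<lambda>x. x). g w)"
    by (subst integral_distr) auto
  also have "\<dots> = (LINT w|lborel. (indicator (ball 0 1) w / V) *\<^sub>R g w)"
    unfolding dens using V by (intro integral_density) auto
  also have "\<dots> = (LINT w|lborel. g w) /\<^sub>R V" unfolding gi by simp
  finally show "(LINT w|ball_measure. f w) = (LINT w|lborel. indicator (ball 0 1) w *\<^sub>R f w) /\<^sub>R measure lborel (ball (0::complex^'n) 1)"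
    by (simp add: g_def V_def)
  assume "integrable ball_measure f"
  hence "integrable ball_measure g"
    by (subst Bochner_Integration.integrable_cong[of ball_measure ball_measure g f]) (auto simp: g_def)
  hence "integrable (distr ball_measure borel (\<lambda>x. x)) g"
    by (subst integrable_distr_eq) auto
  hence "integrable lborel (\<lambda>w. g w /\<^sub>R V)"
    unfolding dens using V by (subst (asm) integrable_density) (auto simp: gi)
  hence "integrable lborel (\<lambda>w. V *\<^sub>R (g w /\<^sub>R V))" by (rule integrable_scaleR_right)
  moreover have "(\<lambda>w. V *\<^sub>R (g w /\<^sub>R V)) = g" using V by (simp add: fun_eq_iff)
  ultimately show "integrable lborel (\<lambda>w. indicator (ball 0 1) w *\<^sub>R f w)" by (simp add: g_def[abs_def])
qed

text \<open>The formula for dilates \<open>f(r w)\<close> is rewritten by the substitution \<open>v = r w\<close> as an integral of \<open>f\<close> over the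
ball of radius \<open>r\<close>. The kernel is bounded for fixed \<open>z\<close>, so \<open>|f|\<close> times a constant dominates as \<open>r\<close> tends to 1; for \<open>f\<close> that is only
integrable the dilates themselves have no obvious majorant.\<close>

theorem bergman_reproducing:
  fixes f :: "complex^'n \<Rightarrow> complex"
  assumes f: "holomorphic_ball f" and int: "integrable ball_measure f" and z: "norm z < 1"
  shows "(LINT w|ball_measure. f w / (1 - herm_prod z w) ^ (CARD('n) + 1)) = f z"
proof -
  define N where "N = CARD('n) + 1"
  define V where "V = measure lborel (ball (0::complex^'n) 1)"
  define k where "k w = 1 / (1 - herm_prod z w) ^ N" for w
  have cf: "continuous_on (ball 0 1) f" by (rule holomorphic_ball_continuous[OF f])
  have ck: "continuous_on (ball 0 1) k"
    unfolding k_def using one_minus_herm_prod_nonzero(1)[OF z] by (auto intro!: continuous_intros)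
  have kB: "norm (k w) \<le> 1 / (1 - norm z) ^ N" if "norm w < 1" for w
    unfolding k_def by (rule norm_bergman_kernel_le[OF z that])
  define r where "r m = 1 - 1 / real (m + 2)" for m
  have r: "0 < r m" "r m < 1" for m by (auto simp: r_def field_simps)
  have rlim: "r \<longlonglongrightarrow> 1"
  proof -
    have "(\<lambda>m. 1 / real (m + 2)) \<longlonglongrightarrow> 0" using LIMSEQ_ignore_initial_segment[OF lim_1_over_n, of 2] by simp
    hence "(\<lambda>m. 1 - 1 / real (m + 2)) \<longlonglongrightarrow> 1 - 0" by (intro tendsto_diff tendsto_const)
    thus ?thesis by (simp add: r_def[abs_def])
  qed
  define \<phi> where "\<phi> m v = indicator (ball 0 (r m)) v *\<^sub>R (f v * k (v /\<^sub>R r m))" for m v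
  have small: "norm (v /\<^sub>R r m) < 1" if "norm v < r m" for v :: "complex^'n" and m
    using that r[of m] by (simp add: field_simps)
  have [measurable]: "\<phi> m \<in> borel_measurable borel" for m
    unfolding \<phi>_def
  proof (rule borel_measurable_continuous_on_indicator)
    have "continuous_on (ball 0 (r m)) (\<lambda>v. k (v /\<^sub>R r m))"
      by (rule continuous_on_compose2[OF ck]) (use small r in \<open>auto intro!: continuous_intros\<close>)
    moreover have "continuous_on (ball 0 (r m)) f"
      by (rule continuous_on_subset[OF cf]) (use r[of m] in \<open>auto intro: less_trans\<close>)
    ultimately show "continuous_on (ball 0 (r m)) (\<lambda>v. f v * k (v /\<^sub>R r m))" by (rule continuous_on_mult[rotated])
  qed simp
  have dil: "(LINT w|lborel. indicator (ball 0 1) w *\<^sub>R (f (r m *\<^sub>R w) * k w)) * of_real (r m ^ DIM(complex^'n)) = (LINT v|lborel. \<phi> m v)" for m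
  proof -
    have *: "\<phi> m (r m *\<^sub>R w) = indicator (ball 0 1) w *\<^sub>R (f (r m *\<^sub>R w) * k w)" for w
    proof -
      have "norm (r m *\<^sub>R w) < r m \<longleftrightarrow> norm w < 1" using r[of m] by simp
      thus ?thesis using r[of m] by (simp add: \<phi>_def indicator_def)
    qed
    have "(LINT v|lborel. \<phi> m v) = (LINT v|density (distr lborel borel (\<lambda>x. 0 + r m *\<^sub>R x)) (\<lambda>_. ennreal (\<bar>r m\<bar> ^ DIM(complex^'n))). \<phi> m v)"
      using lborel_affine[of "r m" "0 :: complex^'n"] r[of m] by simp
    also have "\<dots> = (LINT v|distr lborel borel (\<lambda>x. 0 + r m *\<^sub>R x). (\<bar>r m\<bar> ^ DIM(complex^'n)) *\<^sub>R \<phi> m v)"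
      by (rule integral_density) auto
    also have "\<dots> = (LINT w|lborel. (\<bar>r m\<bar> ^ DIM(complex^'n)) *\<^sub>R \<phi> m (0 + r m *\<^sub>R w))"
      by (rule integral_distr) auto
    finally show ?thesis using r[of m] by (simp add: * scaleR_conv_of_real[where 'a=complex] mult.commute del: DIM_cart)
  qed
  have rep: "f (r m *\<^sub>R z) * of_real (r m ^ DIM(complex^'n)) = (LINT v|lborel. \<phi> m v) /\<^sub>R V" for m
  proof -
    have "continuous_on (ball 0 1) (\<lambda>w. f (r m *\<^sub>R w))"
      by (rule continuous_on_compose2[OF cf])
         (use r[of m] mult_strict_mono[of "r m" 1] in \<open>auto intro!: continuous_intros intro: le_less_trans[OF mult_left_le_one_le]\<close>)
    hence c: "continuous_on (ball 0 1) (\<lambda>w. f (r m *\<^sub>R w) * k w)" by (intro continuous_on_mult ck)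
    have "f (r m *\<^sub>R z) = (LINT w|ball_measure. f (r m *\<^sub>R w) * k w)"
      using reproducing_dilate[OF f r(1)[of m] r(2)[of m] z] by (simp add: k_def N_def)
    also have "\<dots> = (LINT w|lborel. indicator (ball 0 1) w *\<^sub>R (f (r m *\<^sub>R w) * k w)) /\<^sub>R V"
      unfolding V_def by (rule integral_uniform_ball(1)[OF c])
    finally show ?thesis using dil[of m] by simp
  qed
  have "(\<lambda>m. LINT v|lborel. \<phi> m v) \<longlonglongrightarrow> (LINT v|lborel. indicator (ball 0 1) v *\<^sub>R (f v * k v))"
  proof (rule integral_dominated_convergence[where w = "\<lambda>v. norm (indicator (ball 0 1) v *\<^sub>R f v) * (1 / (1 - norm z) ^ N)"])
    show "(\<lambda>v. indicator (ball 0 1) v *\<^sub>R (f v * k v)) \<in> borel_measurable lborel"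
      using borel_measurable_continuous_on_indicator[OF _ continuous_on_mult[OF cf ck]] by simp
    show "integrable lborel (\<lambda>v. norm (indicator (ball 0 1) v *\<^sub>R f v) * (1 / (1 - norm z) ^ N))"
      by (intro integrable_mult_left integrable_norm integral_uniform_ball(2)[OF cf int])
    show "AE v in lborel. (\<lambda>m. \<phi> m v) \<longlonglongrightarrow> indicator (ball 0 1) v *\<^sub>R (f v * k v)"
    proof (rule AE_I2)
      fix v
      show "(\<lambda>m. \<phi> m v) \<longlonglongrightarrow> indicator (ball 0 1) v *\<^sub>R (f v * k v)"
      proof (cases "norm v < 1")
        case True
        have "eventually (\<lambda>m. norm v < r m) sequentially"
          using order_tendstoD(1)[OF rlim True] .
        hence ev: "eventually (\<lambda>m. f v * k (v /\<^sub>R r m) = \<phi> m v) sequentially"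
          by eventually_elim (simp add: \<phi>_def)
        have "(\<lambda>m. v /\<^sub>R r m) \<longlonglongrightarrow> v /\<^sub>R 1"
          by (intro tendsto_intros rlim) simp
        hence "(\<lambda>m. k (v /\<^sub>R r m)) \<longlonglongrightarrow> k v"
          using True by (intro isCont_tendsto_compose[of v k]) (auto intro: continuous_on_interior[OF ck])
        hence "(\<lambda>m. f v * k (v /\<^sub>R r m)) \<longlonglongrightarrow> f v * k v" by (intro tendsto_intros)
        hence "(\<lambda>m. \<phi> m v) \<longlonglongrightarrow> f v * k v" by (rule Lim_transform_eventually[OF _ ev])
        thus ?thesis using True by simp
      next
        case False
        hence "\<phi> m v = 0" for m using r(2)[of m] by (simp add: \<phi>_def)
        thus ?thesis using False by simp
      qed
    qed
    show "AE v in lborel. norm (\<phi> m v) \<le> norm (indicator (ball 0 1) v *\<^sub>R f v) * (1 / (1 - norm z) ^ N)" for m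
    proof (rule AE_I2)
      fix v :: "complex^'n"
      show "norm (\<phi> m v) \<le> norm (indicator (ball 0 1) v *\<^sub>R f v) * (1 / (1 - norm z) ^ N)"
      proof (cases "norm v < r m")
        case True
        hence "norm v < 1" using r(2)[of m] by simp
        thus ?thesis using True mult_left_mono[OF kB[OF small[OF True]], of "norm (f v)"] by (simp add: \<phi>_def norm_mult)
      qed (use z in \<open>simp add: \<phi>_def\<close>)
    qed
  qed measurable
  hence "(\<lambda>m. (LINT v|lborel. \<phi> m v) /\<^sub>R V) \<longlonglongrightarrow> (LINT v|lborel. indicator (ball 0 1) v *\<^sub>R (f v * k v)) /\<^sub>R V"
    by (intro tendsto_intros)
  also have "(LINT v|lborel. indicator (ball 0 1) v *\<^sub>R (f v * k v)) /\<^sub>R V = (LINT w|ball_measure. f w * k w)"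
    unfolding V_def by (rule integral_uniform_ball(1)[symmetric, OF continuous_on_mult[OF cf ck]])
  finally have 1: "(\<lambda>m. f (r m *\<^sub>R z) * of_real (r m ^ DIM(complex^'n))) \<longlonglongrightarrow> (LINT w|ball_measure. f w * k w)"
    unfolding rep .
  have "(\<lambda>m. r m *\<^sub>R z) \<longlonglongrightarrow> 1 *\<^sub>R z" by (intro tendsto_intros rlim)
  hence "(\<lambda>m. f (r m *\<^sub>R z)) \<longlonglongrightarrow> f z"
    using z by (intro isCont_tendsto_compose[of z f]) (auto intro: continuous_on_interior[OF cf])
  hence 2: "(\<lambda>m. f (r m *\<^sub>R z) * of_real (r m ^ DIM(complex^'n))) \<longlonglongrightarrow> f z * of_real (1 ^ DIM(complex^'n))"
    by (intro tendsto_intros rlim)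
  from LIMSEQ_unique[OF 1 2] show ?thesis by (simp add: k_def N_def)
qed

section \<open>Holomorphic integrals and the Hoelder inequality\<close>

text \<open>Complex Taylor formula on the half-plane \<open>Re x \<ge> \<eta>\<close>, which is convex and where the second derivative is
bounded.\<close>

lemma inverse_power_Taylor_bound:
  fixes x y :: complex
  assumes \<eta>: "\<eta> > 0" "Re x \<ge> \<eta>" "Re y \<ge> \<eta>"
  shows "norm (1 / y ^ N - 1 / x ^ N + of_nat N * (y - x) / x ^ (N + 1))
    \<le> (real N * (real N + 1) / \<eta> ^ (N + 2)) * (norm (y - x))\<^sup>2"
proof -
  define S where "S = {x :: complex. Re x \<ge> \<eta>}"
  have conv: "convex S" unfolding S_def by (rule convex_halfspace_Re_ge)
  have ne: "x \<noteq> 0" if "x \<in> S" for x using that \<eta>(1) by (auto simp: S_def)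
  define f where "f i x = (case i of 0 \<Rightarrow> inverse x ^ N | Suc 0 \<Rightarrow> - of_nat N * inverse x ^ (N + 1)
      | Suc (Suc _) \<Rightarrow> of_nat N * (of_nat N + 1) * inverse x ^ (N + 2))" for i :: nat and x :: complex
  have f_eq: "f 0 = (\<lambda>x. inverse x ^ N)" "f 1 = (\<lambda>x. - of_nat N * inverse x ^ (N + 1))"
    "f (Suc 0) = (\<lambda>x. - of_nat N * inverse x ^ (N + 1))"
    "f (Suc 1) = (\<lambda>x. of_nat N * (of_nat N + 1) * inverse x ^ (N + 2))"
    by (simp_all add: f_def fun_eq_iff)
  have "norm (f 0 y - (\<Sum>i\<le>1. f i x * (y - x) ^ i / fact i))
      \<le> (real N * (real N + 1) / \<eta> ^ (N + 2)) * norm (y - x) ^ Suc 1 / fact 1"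
  proof (rule field_Taylor[OF conv])
    fix i :: nat and x assume x: "x \<in> S" and "i \<le> 1"
    hence "i = 0 \<or> i = 1" by auto
    have n0: "inverse x \<noteq> 0" using ne[OF x] by simp
    have D: "((\<lambda>x. inverse x ^ m) has_field_derivative - of_nat m * inverse x ^ (m + 1)) (at x within S)" for m
    proof -
      have "((\<lambda>x. inverse x ^ m) has_field_derivative of_nat m * (- (inverse x ^ Suc (Suc 0)) * inverse x ^ (m - Suc 0))) (at x within S)"
        using ne[OF x] by (intro DERIV_power[where n=m] DERIV_inverse derivative_eq_intros) auto
      also have "of_nat m * (- (inverse x ^ Suc (Suc 0)) * inverse x ^ (m - Suc 0)) = - of_nat m * inverse x ^ (m + 1)"
        by (cases m) (auto simp: algebra_simps)
      finally show ?thesis .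
    qed
    show "(f i has_field_derivative f (Suc i) x) (at x within S)"
      using \<open>i = 0 \<or> i = 1\<close>
    proof
      assume "i = 0"
      thus ?thesis using D[of N] by (simp only: f_eq)
    next
      assume "i = 1"
      have "((\<lambda>x. - of_nat N * inverse x ^ (N + 1)) has_field_derivative - of_nat N * (- of_nat (N + 1) * inverse x ^ (N + 1 + 1))) (at x within S)"
        by (intro DERIV_cmult D)
      also have "- of_nat N * (- of_nat (N + 1) * inverse x ^ (N + 1 + 1)) = of_nat N * (of_nat N + 1) * inverse x ^ (N + 2)"
        by (simp add: algebra_simps)
      finally show ?thesis using \<open>i = 1\<close> by (simp only: f_eq)
    qed
  next
    fix x assume x: "x \<in> S"
    have "\<eta> \<le> norm x" using x complex_Re_le_cmod[of x] by (simp add: S_def)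
    hence "inverse (norm x) ^ (N + 2) \<le> inverse \<eta> ^ (N + 2)"
      using \<eta>(1) by (intro power_mono le_imp_inverse_le) auto
    hence "real N * (real N + 1) * inverse (norm x) ^ (N + 2) \<le> real N * (real N + 1) * inverse \<eta> ^ (N + 2)"
      by (intro mult_left_mono) auto
    moreover have "norm (of_nat N + 1 :: complex) = real N + 1"
      using norm_of_nat[of "N + 1", where 'a=complex] by (simp add: add.commute)
    ultimately show "norm (f (Suc 1) x) \<le> real N * (real N + 1) / \<eta> ^ (N + 2)"
      by (simp add: f_def norm_mult norm_power norm_inverse divide_inverse power_inverse)
  qed (use assms in \<open>auto simp: S_def\<close>)
  moreover have "f 0 y - (\<Sum>i\<le>1. f i x * (y - x) ^ i / fact i) = 1 / y ^ N - 1 / x ^ N + of_nat N * (y - x) / x ^ (N + 1)"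
    by (simp add: f_def divide_inverse power_inverse algebra_simps)
  ultimately show ?thesis by (simp add: power2_eq_square)
qed

lemma integrable_mult_bounded:
  fixes g k :: "'a \<Rightarrow> complex"
  assumes "integrable M g" "k \<in> borel_measurable M" "\<And>w. w \<in> space M \<Longrightarrow> norm (k w) \<le> B"
  shows "integrable M (\<lambda>w. g w * k w)"
proof (rule Bochner_Integration.integrable_bound[of _ "\<lambda>w. B * norm (g w)"])
  show "AE w in M. norm (g w * k w) \<le> norm (B * norm (g w))"
  proof (rule AE_I2)
    fix w assume w: "w \<in> space M"
    have "norm (g w) * norm (k w) \<le> norm (g w) * B" using assms(3)[OF w] by (rule mult_left_mono) simp
    also have "\<dots> \<le> \<bar>norm (g w) * B\<bar>" by simp
    finally show "norm (g w * k w) \<le> norm (B * norm (g w))" by (simp add: norm_mult mult.commute)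
  qed
qed (use assms in \<open>auto\<close>)

text \<open>Differentiation under the integral sign. The Taylor bound for the kernel is uniform in \<open>w\<close> because
\<open>Re (1 - <x,w>)\<close> stays at least \<open>(1 - |z|) / 2\<close> for \<open>x\<close> near \<open>z\<close>; the derivative is complex linear since the kernel depends linearly
on \<open>z\<close> through \<open><z,w>\<close>.\<close>

theorem holomorphic_ball_integral:
  fixes g :: "complex^'n \<Rightarrow> complex"
  assumes g: "integrable ball_measure g"
  shows "holomorphic_ball (\<lambda>z. LINT w|ball_measure. g w / (1 - herm_prod z w) ^ N)"
  unfolding holomorphic_ball_def
proof
  fix z :: "complex^'n" assume "z \<in> ball 0 1"
  hence z: "norm z < 1" by simp
  define \<eta> where "\<eta> = (1 - norm z) / 2"
  have \<eta>: "\<eta> > 0" using z by (simp add: \<eta>_def)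
  define F where "F z = (LINT w|ball_measure. g w / (1 - herm_prod z w) ^ N)" for z
  define L where "L v w = of_nat N * herm_prod v w / (1 - herm_prod z w) ^ (N + 1)" for v w
  have [measurable]: "g \<in> borel_measurable ball_measure" using g by auto
  have Re_ge: "Re (1 - herm_prod x w) \<ge> 1 - norm x" if "norm w < 1" for x w :: "complex^'n"
  proof -
    have "Re (herm_prod x w) \<le> norm (herm_prod x w)" by (rule complex_Re_le_cmod)
    also have "\<dots> \<le> norm x" using norm_herm_prod_le[of x w] mult_left_le[of "norm w" "norm x"] that by simp
    finally show ?thesis by simp
  qed
  have Lb: "norm (L v w) \<le> (real N / (1 - norm z) ^ (N + 1)) * norm v" if "norm w < 1" for v w
  proof -
    have "norm (herm_prod v w) \<le> norm v" using norm_herm_prod_le[of v w] mult_left_le[of "norm w" "norm v"] that by simp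
    moreover have "norm (1 / (1 - herm_prod z w) ^ (N+1)) \<le> 1 / (1 - norm z) ^ (N+1)" by (rule norm_bergman_kernel_le[OF z that])
    ultimately have "real N * norm (herm_prod v w) * norm (1 / (1 - herm_prod z w) ^ (N+1)) \<le> real N * norm v * (1 / (1 - norm z) ^ (N+1))"
      using z by (intro mult_mono) auto
    thus ?thesis by (simp add: L_def norm_mult norm_divide mult_ac)
  qed
  have Lm [measurable]: "L v \<in> borel_measurable ball_measure" for v unfolding L_def by measurable
  have intL: "integrable ball_measure (\<lambda>w. g w * L v w)" for v
    by (rule integrable_mult_bounded[OF g Lm]) (use Lb in auto)
  have intF: "integrable ball_measure (\<lambda>w. g w * (1 / (1 - herm_prod x w) ^ N))" if "norm x < 1" for x
    by (rule integrable_mult_bounded[OF g, where B = "1 / (1 - norm x) ^ N"]) (use norm_bergman_kernel_le[OF that] in auto)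
  define D where "D v = (LINT w|ball_measure. g w * L v w)" for v
  define G where "G = (LINT w|ball_measure. norm (g w))"
  have G0: "G \<ge> 0" by (simp add: G_def)
  have Dsmult: "D (c *s v) = c * D v" for c v
  proof -
    have "g w * L (c *s v) w = c * (g w * L v w)" for w by (simp add: L_def herm_prod_smult_left)
    thus ?thesis unfolding D_def by (simp only: integral_mult_right_zero)
  qed
  have "bounded_linear D"
  proof (rule bounded_linear_intro)
    show "D (v + w) = D v + D w" for v w
    proof -
      have "g x * L (v + w) x = g x * L v x + g x * L w x" for x
        by (simp add: L_def herm_prod_add_left distrib_left add_divide_distrib)
      thus ?thesis unfolding D_def by (simp add: Bochner_Integration.integral_add intL)
    qed
    show "D (r *\<^sub>R v) = r *\<^sub>R D v" for r v
      using Dsmult[of "of_real r" v] by (simp add: scaleR_eq_smult[symmetric] scaleR_conv_of_real[where 'a=complex])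
    show "norm (D v) \<le> norm v * ((real N / (1 - norm z) ^ (N + 1)) * G)" for v
    proof -
      have "norm (D v) \<le> (LINT w|ball_measure. norm (g w * L v w))" unfolding D_def by (rule integral_norm_bound)
      also have "\<dots> \<le> (LINT w|ball_measure. norm (g w) * ((real N / (1 - norm z) ^ (N + 1)) * norm v))"
      proof (rule integral_mono)
        show "norm (g w * L v w) \<le> norm (g w) * ((real N / (1 - norm z) ^ (N + 1)) * norm v)" if "w \<in> space ball_measure" for w
          unfolding norm_mult by (rule mult_left_mono[OF Lb]) (use that in auto)
      qed (intro integrable_norm intL integrable_mult_left g)+
      finally show ?thesis by (simp add: G_def mult_ac)
    qed
  qed
  moreover have "(\<lambda>v. norm (F (z + v) - F z - D v) / norm v) \<midarrow>0\<rightarrow> 0"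
  proof (rule LIM_I)
    fix e :: real assume e: "e > 0"
    define C where "C = (real N * (real N + 1) / \<eta> ^ (N + 2)) * G"
    have C0: "C \<ge> 0" using \<eta> G0 by (simp add: C_def)
    define s where "s = min \<eta> (e / (C + 1))"
    have s: "s > 0" using \<eta> e C0 by (simp add: s_def)
    show "\<exists>s>0. \<forall>v. v \<noteq> 0 \<and> norm (v - 0) < s \<longrightarrow> norm (norm (F (z + v) - F z - D v) / norm v - 0) < e"
    proof (intro exI[of _ s] conjI s allI impI)
      fix v :: "complex^'n" assume v: "v \<noteq> 0 \<and> norm (v - 0) < s"
      hence v\<eta>: "norm v < \<eta>" by (simp add: s_def)
      have zv: "norm (z + v) \<le> 1 - \<eta>" using norm_triangle_ineq[of z v] v\<eta> by (simp add: \<eta>_def field_simps)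
      hence zv1: "norm (z + v) < 1" using \<eta> by simp
      define K where "K w = 1 / (1 - herm_prod (z + v) w) ^ N - 1 / (1 - herm_prod z w) ^ N - L v w" for w
      have Km [measurable]: "K \<in> borel_measurable ball_measure" unfolding K_def by measurable
      have Kb: "norm (K w) \<le> (real N * (real N + 1) / \<eta> ^ (N + 2)) * (norm v)\<^sup>2" if "norm w < 1" for w
      proof -
        have diff: "(1 - herm_prod (z + v) w) - (1 - herm_prod z w) = - herm_prod v w" by (simp add: herm_prod_add_left)
        have K: "K w = 1 / (1 - herm_prod (z + v) w) ^ N - 1 / (1 - herm_prod z w) ^ N + of_nat N * ((1 - herm_prod (z + v) w) - (1 - herm_prod z w)) / (1 - herm_prod z w) ^ (N + 1)"
          unfolding K_def diff L_def by simp
        have "norm (K w) \<le> (real N * (real N + 1) / \<eta> ^ (N + 2)) * (norm ((1 - herm_prod (z + v) w) - (1 - herm_prod z w)))\<^sup>2"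
          unfolding K by (rule inverse_power_Taylor_bound[OF \<eta>])
            (rule order_trans[OF _ Re_ge[OF that]], use z zv in \<open>simp add: \<eta>_def field_simps\<close>)+
        also have "\<dots> \<le> (real N * (real N + 1) / \<eta> ^ (N + 2)) * (norm v)\<^sup>2"
        proof -
          have "norm (herm_prod v w) \<le> norm v" using norm_herm_prod_le[of v w] mult_left_le[of "norm w" "norm v"] that by simp
          thus ?thesis unfolding diff using \<eta> by (intro mult_left_mono) (auto intro!: power_mono)
        qed
        finally show ?thesis .
      qed
      have "F (z + v) - F z - D v = (LINT w|ball_measure. g w * (1 / (1 - herm_prod (z + v) w) ^ N)) - (LINT w|ball_measure. g w * (1 / (1 - herm_prod z w) ^ N)) - (LINT w|ball_measure. g w * L v w)"
        by (simp add: F_def D_def)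
      also have "\<dots> = (LINT w|ball_measure. g w * (1 / (1 - herm_prod (z + v) w) ^ N) - g w * (1 / (1 - herm_prod z w) ^ N) - g w * L v w)"
        using intF[OF zv1] intF[OF z] intL[of v] by (simp only: Bochner_Integration.integral_diff Bochner_Integration.integrable_diff)
      also have "\<dots> = (LINT w|ball_measure. g w * K w)" by (simp only: K_def right_diff_distrib)
      finally have eq: "F (z + v) - F z - D v = (LINT w|ball_measure. g w * K w)" .
      have "norm (F (z + v) - F z - D v) \<le> (LINT w|ball_measure. norm (g w * K w))"
        unfolding eq by (rule integral_norm_bound)
      also have "\<dots> \<le> (LINT w|ball_measure. norm (g w) * ((real N * (real N + 1) / \<eta> ^ (N + 2)) * (norm v)\<^sup>2))"
      proof (rule integral_mono)
        show "norm (g w * K w) \<le> norm (g w) * ((real N * (real N + 1) / \<eta> ^ (N + 2)) * (norm v)\<^sup>2)" if "w \<in> space ball_measure" for w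
          unfolding norm_mult by (rule mult_left_mono[OF Kb]) (use that in auto)
        show "integrable ball_measure (\<lambda>w. norm (g w * K w))"
          by (rule integrable_norm, rule integrable_mult_bounded[OF g Km], rule Kb) simp
      qed (intro integrable_norm integrable_mult_left g)
      also have "\<dots> = C * norm v * norm v" by (simp add: G_def C_def power2_eq_square mult_ac)
      finally have "norm (F (z + v) - F z - D v) / norm v \<le> C * norm v"
        using v by (simp add: divide_le_eq)
      also have "\<dots> \<le> (C + 1) * norm v" by (intro mult_right_mono) auto
      also have "\<dots> < (C + 1) * (e / (C + 1))" using v C0 by (intro mult_strict_left_mono) (auto simp: s_def)
      also have "\<dots> = e" using C0 by simp
      finally show "norm (norm (F (z + v) - F z - D v) / norm v - 0) < e" by simp
    qed
  qed
  ultimately have "(F has_derivative D) (at z)" by (simp add: has_derivative_at)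
  thus "\<exists>D. ((\<lambda>z. LINT w|ball_measure. g w / (1 - herm_prod z w) ^ N) has_derivative D) (at z) \<and> (\<forall>c v. D (c *s v) = c * D v)"
    using Dsmult unfolding F_def by blast
qed

text \<open>Hoelder's inequality with given bounds for the two integrals instead of their values; this
form combines directly with the estimates for kernels.\<close>

lemma nn_integral_Hoelder:
  fixes F G :: "'a \<Rightarrow> real"
  assumes pq: "p > 1" "q > 1" "1/p + 1/q = 1"
    and [measurable]: "F \<in> borel_measurable M" "G \<in> borel_measurable M"
    and nn: "\<And>x. F x \<ge> 0" "\<And>x. G x \<ge> 0"
    and A: "(\<integral>\<^sup>+x. ennreal (F x powr p) \<partial>M) \<le> ennreal A" "A \<ge> 0"
    and B: "(\<integral>\<^sup>+x. ennreal (G x powr q) \<partial>M) \<le> ennreal B" "B \<ge> 0"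
  shows "(\<integral>\<^sup>+x. ennreal (F x * G x) \<partial>M) \<le> ennreal (A powr (1/p) * B powr (1/q))"
proof (cases "A = 0 \<or> B = 0")
  case True
  have "AE x in M. F x * G x = 0"
  proof (cases "A = 0")
    case True
    hence "(\<integral>\<^sup>+x. ennreal (F x powr p) \<partial>M) = 0" using A by simp
    hence "AE x in M. ennreal (F x powr p) = 0" by (subst (asm) nn_integral_0_iff_AE) auto
    thus ?thesis by eventually_elim (auto simp: ennreal_eq_0_iff)
  next
    case False
    hence "(\<integral>\<^sup>+x. ennreal (G x powr q) \<partial>M) = 0" using B True by simp
    hence "AE x in M. ennreal (G x powr q) = 0" by (subst (asm) nn_integral_0_iff_AE) auto
    thus ?thesis by eventually_elim (auto simp: ennreal_eq_0_iff)
  qed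
  hence "(\<integral>\<^sup>+x. ennreal (F x * G x) \<partial>M) = (\<integral>\<^sup>+x. 0 \<partial>M)" by (intro nn_integral_cong_AE) auto
  thus ?thesis by simp
next
  case False
  hence pos: "A > 0" "B > 0" using A B by auto
  define a where "a = A powr (1/p)"
  define b where "b = B powr (1/q)"
  have ab: "a > 0" "b > 0" "a powr p = A" "b powr q = B"
    using pos pq by (auto simp: a_def b_def powr_powr)
  have pw: "F x * G x \<le> (a * b / (p * A)) * F x powr p + (a * b / (q * B)) * G x powr q" for x
  proof -
    have "(F x / a) * (G x / b) \<le> (F x / a) powr p / p + (G x / b) powr q / q"
      by (rule Youngs_inequality[OF pq]) (use nn ab in auto)
    also have "\<dots> = F x powr p / (p * A) + G x powr q / (q * B)"
      using nn ab by (simp add: powr_divide mult.commute)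
    finally have "a * b * ((F x / a) * (G x / b)) \<le> a * b * (F x powr p / (p * A) + G x powr q / (q * B))"
      using ab by (intro mult_left_mono) auto
    thus ?thesis using ab by (simp add: distrib_left)
  qed
  have "(\<integral>\<^sup>+x. ennreal (F x * G x) \<partial>M) \<le> (\<integral>\<^sup>+x. ennreal (a * b / (p * A)) * ennreal (F x powr p) + ennreal (a * b / (q * B)) * ennreal (G x powr q) \<partial>M)"
    using pw ab pos pq by (intro nn_integral_mono) (simp add: ennreal_mult'[symmetric] ennreal_plus[symmetric] ennreal_leI del: ennreal_plus)
  also have "\<dots> = ennreal (a * b / (p * A)) * (\<integral>\<^sup>+x. ennreal (F x powr p) \<partial>M) + ennreal (a * b / (q * B)) * (\<integral>\<^sup>+x. ennreal (G x powr q) \<partial>M)"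
    by (simp add: nn_integral_add nn_integral_cmult)
  also have "\<dots> \<le> ennreal (a * b / (p * A)) * ennreal A + ennreal (a * b / (q * B)) * ennreal B"
    by (intro add_mono mult_left_mono A B) auto
  also have "\<dots> = ennreal (a * b / p + a * b / q)"
    using ab pos pq by (simp add: ennreal_mult'[symmetric] ennreal_plus[symmetric] del: ennreal_plus)
  also have "a * b / p + a * b / q = a * b"
    using pq(3) by (metis distrib_left mult.right_neutral times_divide_eq_right)
  finally show ?thesis by (simp add: a_def b_def)
qed

section \<open>Bergman-type kernels and the Schur test\<close>

text \<open>This is \<open>1 - |\<phi>\<^sub>z(w)|^2\<close> for the automorphism \<open>\<phi>\<^sub>z\<close> exchanging \<open>z\<close> and 0, so \<open>rho z w \<ge> \<delta>\<close> says that \<open>w\<close> lies in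
a pseudohyperbolic ball about \<open>z\<close>, with a radius less than 1 that depends on \<open>\<delta>\<close>.\<close>

definition rho :: "complex^'n \<Rightarrow> complex^'n \<Rightarrow> real" where
  "rho z w = (1 - (norm z)\<^sup>2) * (1 - (norm w)\<^sup>2) / (norm (1 - herm_prod z w))\<^sup>2"

lemma rho_commute: "rho z w = rho w z"
  by (simp add: rho_def norm_one_minus_herm_prod_commute[of z w] mult.commute)

lemma norm_one_minus_herm_prod_pos: "norm z < 1 \<Longrightarrow> norm w < 1 \<Longrightarrow> 0 < norm (1 - herm_prod z w)"
  using one_minus_herm_prod_nonzero(1)[of z w] by simp

lemma rho_pos: "norm z < 1 \<Longrightarrow> norm w < 1 \<Longrightarrow> rho z w > 0"
  using one_minus_norm2_pos[of z] one_minus_norm2_pos[of w] norm_one_minus_herm_prod_pos[of z w]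
  by (simp add: rho_def)

text \<open>The modulus of the Bergman kernel, made more singular by a small negative power of \<open>rho\<close>.
The extra factor is large away from the diagonal.\<close>

definition bkernel :: "real \<Rightarrow> complex^'n \<Rightarrow> complex^'n \<Rightarrow> real" where
  "bkernel \<epsilon> z w = rho z w powr (- \<epsilon>) / norm (1 - herm_prod z w) ^ (CARD('n) + 1)"

lemma bkernel_commute: "bkernel \<epsilon> z w = bkernel \<epsilon> w z"
  by (simp add: bkernel_def rho_commute[of z w] norm_one_minus_herm_prod_commute[of z w])

lemma bkernel_nonneg: "bkernel \<epsilon> z w \<ge> 0"
  by (simp add: bkernel_def)

lemma bkernel_0: "norm z < 1 \<Longrightarrow> norm w < 1 \<Longrightarrow> bkernel 0 z w = 1 / norm (1 - herm_prod z w) ^ (CARD('n) + 1)"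
  for z w :: "complex^'n"
  using rho_pos[of z w] by (simp add: bkernel_def)

lemma measurable_fst_ball [measurable]: "fst \<in> borel_measurable (ball_measure \<Otimes>\<^sub>M ball_measure)"
  by (rule measurable_compose[OF measurable_fst measurable_id_ball_measure])

lemma measurable_snd_ball [measurable]: "snd \<in> borel_measurable (ball_measure \<Otimes>\<^sub>M ball_measure)"
  by (rule measurable_compose[OF measurable_snd measurable_id_ball_measure])

lemma measurable_bkernel [measurable]:
  assumes [measurable]: "f \<in> borel_measurable M" "g \<in> borel_measurable M"
  shows "(\<lambda>x. bkernel \<epsilon> (f x) (g x)) \<in> borel_measurable M"
  unfolding bkernel_def rho_def by measurable

interpretation ball_pair: pair_sigma_finite "ball_measure :: (complex^'n) measure" "ball_measure :: (complex^'n) measure"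
  by standard

text \<open>The test functions are the powers \<open>(1 - |w|^2)^(-\<alpha>)\<close>.\<close>

definition schur_bound :: "real \<Rightarrow> real \<Rightarrow> (complex^'n \<Rightarrow> complex^'n \<Rightarrow> ennreal) \<Rightarrow> bool" where
  "schur_bound \<alpha> M k \<longleftrightarrow> (\<forall>z. norm z < 1 \<longrightarrow>
     (\<integral>\<^sup>+w. k z w * ennreal ((1 - (norm w)\<^sup>2) powr (- \<alpha>)) \<partial>ball_measure) \<le> ennreal (M * (1 - (norm z)\<^sup>2) powr (- \<alpha>)))"

lemma schur_boundD: "schur_bound \<alpha> M k \<Longrightarrow> norm z < 1 \<Longrightarrow>
     (\<integral>\<^sup>+w. k z w * ennreal ((1 - (norm w)\<^sup>2) powr (- \<alpha>)) \<partial>ball_measure) \<le> ennreal (M * (1 - (norm z)\<^sup>2) powr (- \<alpha>))"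
  by (simp add: schur_bound_def)

text \<open>The Forelli-Rudin estimate with \<open>t = -\<alpha> - \<epsilon>\<close> and \<open>s = \<alpha> - \<epsilon>\<close>; its two conditions are the two upper
bounds on \<open>\<epsilon>\<close>.\<close>

lemma schur_bound_bkernel:
  assumes \<epsilon>: "0 \<le> \<epsilon>" "\<epsilon> < \<alpha>" "\<epsilon> < 1 - \<alpha>"
  obtains M where "M > 0" "schur_bound \<alpha> M (\<lambda>z w :: complex^'n. ennreal (bkernel \<epsilon> z w))"
proof -
  obtain C where C: "C > 0" "\<And>z::complex^'n. norm z < 1 \<Longrightarrow>
    (\<integral>\<^sup>+w. ennreal ((1 - (norm w)\<^sup>2) powr (-\<alpha> - \<epsilon>) * norm (1 - herm_prod z w) powr (- (real CARD('n) + 1 + (-\<alpha> - \<epsilon>) + (\<alpha> - \<epsilon>)))) \<partial>ball_measure)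
      \<le> ennreal (C * (1 - (norm z)\<^sup>2) powr (- (\<alpha> - \<epsilon>)))"
    using forelli_rudin[of "-\<alpha> - \<epsilon>" "\<alpha> - \<epsilon>", where 'n='n] \<epsilon> by auto
  show ?thesis
  proof (rule that[OF C(1)], unfold schur_bound_def, intro allI impI)
    fix z :: "complex^'n" assume z: "norm z < 1"
    have dz: "1 - (norm z)\<^sup>2 > 0" by (rule one_minus_norm2_pos[OF z])
    have "(\<integral>\<^sup>+w. ennreal (bkernel \<epsilon> z w) * ennreal ((1 - (norm w)\<^sup>2) powr (- \<alpha>)) \<partial>ball_measure)
      = (\<integral>\<^sup>+w. ennreal ((1 - (norm z)\<^sup>2) powr (- \<epsilon>)) * ennreal ((1 - (norm w)\<^sup>2) powr (-\<alpha> - \<epsilon>) * norm (1 - herm_prod z w) powr (- (real CARD('n) + 1 + (-\<alpha> - \<epsilon>) + (\<alpha> - \<epsilon>)))) \<partial>ball_measure)"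
    proof (rule nn_integral_cong)
      fix w :: "complex^'n" assume "w \<in> space ball_measure"
      hence w: "norm w < 1" by simp
      have dw: "1 - (norm w)\<^sup>2 > 0" by (rule one_minus_norm2_pos[OF w])
      define x where "x = norm (1 - herm_prod z w)"
      have x: "x > 0" unfolding x_def by (rule norm_one_minus_herm_prod_pos[OF z w])
      have "rho z w powr (- \<epsilon>) = (1 - (norm z)\<^sup>2) powr (- \<epsilon>) * (1 - (norm w)\<^sup>2) powr (- \<epsilon>) * x powr (2 * \<epsilon>)"
      proof -
        have "(x\<^sup>2) powr (- \<epsilon>) = (x powr 2) powr (- \<epsilon>)" using x by simp
        also have "\<dots> = x powr (- (2 * \<epsilon>))" unfolding powr_powr by simp
        finally show ?thesis using dz dw x unfolding rho_def x_def[symmetric]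
          by (simp add: powr_divide powr_mult powr_minus_divide)
      qed
      moreover have "1 / x ^ (CARD('n) + 1) = x powr (- (real CARD('n) + 1))"
      proof -
        have "x powr (- real (CARD('n) + 1)) = 1 / x powr real (CARD('n) + 1)" by (rule powr_minus_divide)
        also have "x powr real (CARD('n) + 1) = x ^ (CARD('n) + 1)" by (rule powr_realpow[OF x])
        finally show ?thesis by (simp add: add.commute)
      qed
      ultimately have "bkernel \<epsilon> z w * (1 - (norm w)\<^sup>2) powr (- \<alpha>) =
         (1 - (norm z)\<^sup>2) powr (- \<epsilon>) * (((1 - (norm w)\<^sup>2) powr (- \<epsilon>) * (1 - (norm w)\<^sup>2) powr (- \<alpha>)) * (x powr (2 * \<epsilon>) * x powr (- (real CARD('n) + 1))))"
        by (simp add: bkernel_def x_def[symmetric] divide_inverse mult_ac)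
      also have "(1 - (norm w)\<^sup>2) powr (- \<epsilon>) * (1 - (norm w)\<^sup>2) powr (- \<alpha>) = (1 - (norm w)\<^sup>2) powr (-\<alpha> - \<epsilon>)"
        by (simp add: powr_add[symmetric] add.commute)
      also have "x powr (2 * \<epsilon>) * x powr (- (real CARD('n) + 1)) = x powr (- (real CARD('n) + 1 + (-\<alpha> - \<epsilon>) + (\<alpha> - \<epsilon>)))"
        unfolding powr_add[symmetric] by (rule arg_cong[where f = "\<lambda>a. x powr a"]) simp
      finally show "ennreal (bkernel \<epsilon> z w) * ennreal ((1 - (norm w)\<^sup>2) powr (- \<alpha>)) = ennreal ((1 - (norm z)\<^sup>2) powr (- \<epsilon>)) * ennreal ((1 - (norm w)\<^sup>2) powr (-\<alpha> - \<epsilon>) * norm (1 - herm_prod z w) powr (- (real CARD('n) + 1 + (-\<alpha> - \<epsilon>) + (\<alpha> - \<epsilon>))))"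
        by (simp add: ennreal_mult'[symmetric] bkernel_nonneg x_def)
    qed
    also have "\<dots> = ennreal ((1 - (norm z)\<^sup>2) powr (- \<epsilon>)) * (\<integral>\<^sup>+w. ennreal ((1 - (norm w)\<^sup>2) powr (-\<alpha> - \<epsilon>) * norm (1 - herm_prod z w) powr (- (real CARD('n) + 1 + (-\<alpha> - \<epsilon>) + (\<alpha> - \<epsilon>)))) \<partial>ball_measure)"
      by (rule nn_integral_cmult) measurable
    also have "\<dots> \<le> ennreal ((1 - (norm z)\<^sup>2) powr (- \<epsilon>)) * ennreal (C * (1 - (norm z)\<^sup>2) powr (- (\<alpha> - \<epsilon>)))"
      by (rule mult_left_mono[OF C(2)[OF z]]) simp
    also have "\<dots> = ennreal (C * (1 - (norm z)\<^sup>2) powr (- \<alpha>))"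
      using C(1) by (simp add: ennreal_mult'[symmetric] powr_add[symmetric] mult.left_commute)
    finally show "(\<integral>\<^sup>+w. ennreal (bkernel \<epsilon> z w) * ennreal ((1 - (norm w)\<^sup>2) powr (- \<alpha>)) \<partial>ball_measure) \<le> ennreal (C * (1 - (norm z)\<^sup>2) powr (- \<alpha>))" .
  qed
qed

definition kcomp :: "(complex^'n \<Rightarrow> complex^'n \<Rightarrow> ennreal) \<Rightarrow> (complex^'n \<Rightarrow> complex^'n \<Rightarrow> ennreal) \<Rightarrow> complex^'n \<Rightarrow> complex^'n \<Rightarrow> ennreal" where
  "kcomp k l z w = (\<integral>\<^sup>+x. k z x * l x w \<partial>ball_measure)"

abbreviation kmeas :: "(complex^'n \<Rightarrow> complex^'n \<Rightarrow> ennreal) \<Rightarrow> bool" where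
  "kmeas k \<equiv> (\<lambda>(z, w). k z w) \<in> borel_measurable (ball_measure \<Otimes>\<^sub>M ball_measure)"

lemma kmeasD:
  assumes "kmeas k" and [measurable]: "f \<in> N \<rightarrow>\<^sub>M ball_measure" "g \<in> N \<rightarrow>\<^sub>M ball_measure"
  shows "(\<lambda>x. k (f x) (g x)) \<in> borel_measurable N"
  using measurable_compose[OF _ assms(1), of "\<lambda>x. (f x, g x)" N] by simp

lemma kmeas_slice:
  assumes k: "kmeas k" and z: "z \<in> space ball_measure"
  shows "k z \<in> borel_measurable ball_measure" "(\<lambda>w. k w z) \<in> borel_measurable ball_measure"
proof -
  show "k z \<in> borel_measurable ball_measure"
    by (rule kmeasD[OF k, of "\<lambda>_. z" ball_measure "\<lambda>x. x", OF measurable_const[OF z] measurable_ident_sets[OF refl]])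
  show "(\<lambda>w. k w z) \<in> borel_measurable ball_measure"
    by (rule kmeasD[OF k, of "\<lambda>x. x" ball_measure "\<lambda>_. z", OF measurable_ident_sets[OF refl] measurable_const[OF z]])
qed

lemma kmeas_kcomp:
  assumes k: "kmeas k" and l: "kmeas l"
  shows "kmeas (kcomp k l)"
proof -
  have "(\<lambda>(p, x). k (fst p) x * l x (snd p)) \<in> borel_measurable ((ball_measure \<Otimes>\<^sub>M ball_measure) \<Otimes>\<^sub>M ball_measure)"
    unfolding case_prod_unfold
    by (intro borel_measurable_times_ennreal kmeasD[OF k] kmeasD[OF l]) measurable
  hence "(\<lambda>p. \<integral>\<^sup>+x. k (fst p) x * l x (snd p) \<partial>ball_measure) \<in> borel_measurable (ball_measure \<Otimes>\<^sub>M ball_measure)"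
    by (rule ball_measure.borel_measurable_nn_integral)
  thus ?thesis by (simp add: kcomp_def case_prod_unfold)
qed

lemma kmeas_bkernel: "kmeas (\<lambda>z w. ennreal (bkernel \<epsilon> z w))"
  by (simp add: case_prod_unfold)

lemma schur_bound_kcomp:
  fixes k l :: "complex^'n \<Rightarrow> complex^'n \<Rightarrow> ennreal"
  assumes k: "kmeas k" "schur_bound \<alpha> M k" and l: "kmeas l" "schur_bound \<alpha> M' l" and M: "M' \<ge> 0"
  shows "schur_bound \<alpha> (M * M') (kcomp k l)"
  unfolding schur_bound_def
proof (intro allI impI)
  fix z :: "complex^'n" assume z: "norm z < 1"
  let ?d = "\<lambda>w::complex^'n. ennreal ((1 - (norm w)\<^sup>2) powr (- \<alpha>))"
  have zs: "z \<in> space ball_measure" using z by simp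
  have kz: "k z \<in> borel_measurable ball_measure"
    by (rule kmeas_slice(1)[OF k(1) zs])
  have l1: "l x \<in> borel_measurable ball_measure" if "x \<in> space ball_measure" for x
    by (rule kmeas_slice(1)[OF l(1) that])
  have l2: "(\<lambda>x. l x w) \<in> borel_measurable ball_measure" if "w \<in> space ball_measure" for w
    by (rule kmeas_slice(2)[OF l(1) that])
  have dm: "?d \<in> borel_measurable ball_measure" by measurable
  have "(\<integral>\<^sup>+w. kcomp k l z w * ?d w \<partial>ball_measure) = (\<integral>\<^sup>+w. (\<integral>\<^sup>+x. k z x * l x w * ?d w \<partial>ball_measure) \<partial>ball_measure)"
    unfolding kcomp_def by (intro nn_integral_cong nn_integral_multc[symmetric] borel_measurable_times_ennreal kz l2)
  also have "\<dots> = (\<integral>\<^sup>+x. (\<integral>\<^sup>+w. k z x * l x w * ?d w \<partial>ball_measure) \<partial>ball_measure)"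
  proof (rule ball_pair.Fubini')
    have "(\<lambda>p. k z (fst p) * l (fst p) (snd p) * ?d (snd p)) \<in> borel_measurable (ball_measure \<Otimes>\<^sub>M ball_measure)"
      by (intro borel_measurable_times_ennreal kmeasD[OF l(1)] measurable_fst measurable_snd
          measurable_compose[OF measurable_fst kz] measurable_compose[OF measurable_snd dm])
    thus "(\<lambda>(x, y). k z x * l x y * ?d y) \<in> borel_measurable (ball_measure \<Otimes>\<^sub>M ball_measure)"
      by (simp add: case_prod_unfold)
  qed
  also have "\<dots> = (\<integral>\<^sup>+x. k z x * (\<integral>\<^sup>+w. l x w * ?d w \<partial>ball_measure) \<partial>ball_measure)"
    unfolding mult.assoc by (intro nn_integral_cong nn_integral_cmult borel_measurable_times_ennreal l1 dm)
  also have "\<dots> \<le> (\<integral>\<^sup>+x. k z x * ennreal (M' * (1 - (norm x)\<^sup>2) powr (- \<alpha>)) \<partial>ball_measure)"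
    by (intro nn_integral_mono mult_left_mono schur_boundD[OF l(2)]) auto
  also have "\<dots> = (\<integral>\<^sup>+x. ennreal M' * (k z x * ?d x) \<partial>ball_measure)"
    using M by (intro nn_integral_cong) (simp add: ennreal_mult' mult_ac)
  also have "\<dots> = ennreal M' * (\<integral>\<^sup>+x. k z x * ?d x \<partial>ball_measure)"
    by (intro nn_integral_cmult borel_measurable_times_ennreal kz dm)
  also have "\<dots> \<le> ennreal M' * ennreal (M * (1 - (norm z)\<^sup>2) powr (- \<alpha>))"
    by (intro mult_left_mono schur_boundD[OF k(2) z]) simp
  also have "\<dots> = ennreal (M * M' * (1 - (norm z)\<^sup>2) powr (- \<alpha>))"
    using M by (simp add: ennreal_mult'[symmetric] mult_ac)
  finally show "(\<integral>\<^sup>+w. kcomp k l z w * ?d w \<partial>ball_measure) \<le> ennreal (M * M' * (1 - (norm z)\<^sup>2) powr (- \<alpha>))" .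
qed

lemma schur_bound_lincomb:
  fixes k l :: "complex^'n \<Rightarrow> complex^'n \<Rightarrow> ennreal"
  assumes k: "kmeas k" "schur_bound \<alpha> M k" and l: "kmeas l" "schur_bound \<alpha> M' l"
    and "a \<ge> 0" "b \<ge> 0" "M \<ge> 0" "M' \<ge> 0"
  shows "schur_bound \<alpha> (a * M + b * M') (\<lambda>z w. ennreal a * k z w + ennreal b * l z w)"
    and "kmeas (\<lambda>z w. ennreal a * k z w + ennreal b * l z w)"
proof -
  show "schur_bound \<alpha> (a * M + b * M') (\<lambda>z w. ennreal a * k z w + ennreal b * l z w)"
    unfolding schur_bound_def
  proof (intro allI impI)
    fix z :: "complex^'n" assume z: "norm z < 1"
    let ?d = "\<lambda>w::complex^'n. ennreal ((1 - (norm w)\<^sup>2) powr (- \<alpha>))"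
    have zs: "z \<in> space ball_measure" using z by simp
    have [measurable]: "k z \<in> borel_measurable ball_measure" "l z \<in> borel_measurable ball_measure"
      by (rule kmeas_slice(1)[OF k(1) zs], rule kmeas_slice(1)[OF l(1) zs])
    have "(\<integral>\<^sup>+w. (ennreal a * k z w + ennreal b * l z w) * ?d w \<partial>ball_measure)
      = (\<integral>\<^sup>+w. ennreal a * (k z w * ?d w) + ennreal b * (l z w * ?d w) \<partial>ball_measure)"
      by (simp add: distrib_right mult.assoc)
    also have "\<dots> = ennreal a * (\<integral>\<^sup>+w. k z w * ?d w \<partial>ball_measure) + ennreal b * (\<integral>\<^sup>+w. l z w * ?d w \<partial>ball_measure)"
      by (simp add: nn_integral_add nn_integral_cmult)
    also have "\<dots> \<le> ennreal a * ennreal (M * (1 - (norm z)\<^sup>2) powr (- \<alpha>)) + ennreal b * ennreal (M' * (1 - (norm z)\<^sup>2) powr (- \<alpha>))"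
      by (intro add_mono mult_left_mono schur_boundD[OF k(2) z] schur_boundD[OF l(2) z]) auto
    also have "\<dots> = ennreal ((a * M + b * M') * (1 - (norm z)\<^sup>2) powr (- \<alpha>))"
      using assms by (simp add: ennreal_mult'[symmetric] ennreal_plus[symmetric] distrib_right mult.assoc del: ennreal_plus)
    finally show "(\<integral>\<^sup>+w. (ennreal a * k z w + ennreal b * l z w) * ?d w \<partial>ball_measure) \<le> ennreal ((a * M + b * M') * (1 - (norm z)\<^sup>2) powr (- \<alpha>))" .
  qed
  show "kmeas (\<lambda>z w. ennreal a * k z w + ennreal b * l z w)"
    using k(1) l(1) by (simp add: case_prod_unfold)
qed

text \<open>Split \<open>f\<close> as \<open>(f d^s) d^(-s)\<close> with \<open>d(w) = 1 - |w|^2\<close> and apply Hoelder's inequality with respect to the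
measure with density \<open>k z\<close>. The factor \<open>d^(-s)\<close> is absorbed by the bound with exponent \<open>s q\<close>; after exchanging the
integrals the remaining integral over \<open>z\<close> of \<open>k(z,w) d(z)^(b - s p)\<close> is absorbed by the bound with exponent \<open>s p - b\<close>. The
function \<open>F\<close> will be the modulus of an image under the operator, or a truncation of it.\<close>

theorem schur_test:
  fixes k :: "complex^'n \<Rightarrow> complex^'n \<Rightarrow> ennreal" and f F :: "complex^'n \<Rightarrow> real"
  assumes k: "kmeas k" and sym: "\<And>z w. k z w = k w z"
    and pq: "p > 1" "q > 1" "1/p + 1/q = 1"
    and b1: "schur_bound (s * q) M k" and b2: "schur_bound (s * p - b) M k" and M: "M > 0"
    and f [measurable]: "f \<in> borel_measurable ball_measure" "\<And>w. f w \<ge> 0"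
    and F [measurable]: "F \<in> borel_measurable ball_measure"
    and F0: "\<And>w. F w \<ge> 0"
    and FI: "\<And>z. norm z < 1 \<Longrightarrow> ennreal (F z) \<le> (\<integral>\<^sup>+w. k z w * ennreal (f w) \<partial>ball_measure)"
  shows "(\<integral>\<^sup>+z. ennreal (F z powr p * (1 - (norm z)\<^sup>2) powr b) \<partial>ball_measure)
    \<le> ennreal (M powr p) * (\<integral>\<^sup>+w. ennreal (f w powr p * (1 - (norm w)\<^sup>2) powr b) \<partial>ball_measure)"
proof -
  define d where "d w = 1 - (norm w)\<^sup>2" for w :: "complex^'n"
  have [measurable]: "d \<in> borel_measurable ball_measure" unfolding d_def by measurable
  have dpos: "d w > 0" if "norm w < 1" for w using one_minus_norm2_pos[OF that] by (simp add: d_def)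
  have kz [measurable]: "k z \<in> borel_measurable ball_measure" if "z \<in> space ball_measure" for z
    by (rule kmeas_slice(1)[OF k that])
  define I where "I z = (\<integral>\<^sup>+w. k z w * ennreal (f w powr p * d w powr (s * p)) \<partial>ball_measure)" for z
  have pq': "p / q = p - 1" "p / q + 1 = p" using pq by (simp_all add: field_simps)
  have point: "ennreal (F z powr p) \<le> ennreal ((M * d z powr (- (s * q))) powr (p / q)) * I z" if z: "norm z < 1" for z
  proof (cases "I z = top")
    case True
    have "(M * d z powr (- (s * q))) powr (p / q) > 0" using M dpos[OF z] by simp
    thus ?thesis using True by (simp add: ennreal_mult_top)
  next
    case False
    then obtain i where i: "I z = ennreal i" "i \<ge> 0" by (cases "I z") auto
    have zs: "z \<in> space ball_measure" using z by simp
    note kz[OF zs, measurable]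
    define A where "A = M * d z powr (- (s * q))"
    have A: "A > 0" using M dpos[OF z] by (simp add: A_def)
    let ?D = "density ball_measure (k z)"
    have "(\<integral>\<^sup>+w. k z w * ennreal (f w) \<partial>ball_measure) = (\<integral>\<^sup>+w. ennreal (f w) \<partial>?D)"
      by (subst nn_integral_density) auto
    also have "\<dots> = (\<integral>\<^sup>+w. ennreal ((f w * d w powr s) * (d w powr (- s))) \<partial>?D)"
    proof (subst (1 2) nn_integral_density)
      show "(\<integral>\<^sup>+w. k z w * ennreal (f w) \<partial>ball_measure) = (\<integral>\<^sup>+w. k z w * ennreal ((f w * d w powr s) * (d w powr (- s))) \<partial>ball_measure)"
      proof (rule nn_integral_cong)
        fix w :: "complex^'n" assume "w \<in> space ball_measure"
        hence "d w > 0" by (intro dpos) simp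
        hence "(f w * d w powr s) * (d w powr (- s)) = f w" by (simp add: mult.assoc powr_add[symmetric])
        thus "k z w * ennreal (f w) = k z w * ennreal ((f w * d w powr s) * (d w powr (- s)))" by (simp only:)
      qed
    qed measurable
    also have "\<dots> \<le> ennreal (i powr (1/p) * A powr (1/q))"
    proof (rule nn_integral_Hoelder[OF pq])
      have "(\<integral>\<^sup>+w. ennreal ((f w * d w powr s) powr p) \<partial>?D) = I z"
        unfolding I_def
      proof (subst nn_integral_density)
        show "(\<integral>\<^sup>+w. k z w * ennreal ((f w * d w powr s) powr p) \<partial>ball_measure) = (\<integral>\<^sup>+w. k z w * ennreal (f w powr p * d w powr (s * p)) \<partial>ball_measure)"
          using f(2) by (intro nn_integral_cong) (simp add: powr_mult powr_powr)
      qed measurable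
      thus "(\<integral>\<^sup>+w. ennreal ((f w * d w powr s) powr p) \<partial>?D) \<le> ennreal i" using i by simp
      have "(\<integral>\<^sup>+w. ennreal ((d w powr (- s)) powr q) \<partial>?D) = (\<integral>\<^sup>+w. k z w * ennreal (d w powr (- (s * q))) \<partial>ball_measure)"
      proof (subst nn_integral_density)
        show "(\<integral>\<^sup>+w. k z w * ennreal ((d w powr (- s)) powr q) \<partial>ball_measure) = (\<integral>\<^sup>+w. k z w * ennreal (d w powr (- (s * q))) \<partial>ball_measure)"
          by (intro nn_integral_cong) (simp add: powr_powr)
      qed measurable
      also have "\<dots> \<le> ennreal A" using schur_boundD[OF b1 z] by (simp add: d_def A_def)
      finally show "(\<integral>\<^sup>+w. ennreal ((d w powr (- s)) powr q) \<partial>?D) \<le> ennreal A" .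
    qed (use f(2) i A in auto)
    finally have "ennreal (F z) \<le> ennreal (i powr (1/p) * A powr (1/q))" using FI[OF z] by (rule order_trans[rotated])
    hence "F z \<le> i powr (1/p) * A powr (1/q)" by (subst (asm) ennreal_le_iff) auto
    hence "F z powr p \<le> (i powr (1/p) * A powr (1/q)) powr p"
      using F0 pq by (intro powr_mono2) auto
    also have "\<dots> = A powr (p / q) * i" using i(2) pq by (simp add: powr_mult powr_powr)
    finally have "ennreal (F z powr p) \<le> ennreal (A powr (p / q) * i)" by (rule ennreal_leI)
    thus ?thesis using i by (simp add: A_def ennreal_mult)
  qed
  have Imeas [measurable]: "I \<in> borel_measurable ball_measure"
  proof -
    have "(\<lambda>(z, w). k z w * ennreal (f w powr p * d w powr (s * p))) \<in> borel_measurable (ball_measure \<Otimes>\<^sub>M ball_measure)"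
      using k by (simp add: case_prod_unfold)
    thus ?thesis unfolding I_def by (rule ball_measure.borel_measurable_nn_integral)
  qed
  have "(\<integral>\<^sup>+z. ennreal (F z powr p * d z powr b) \<partial>ball_measure)
     \<le> (\<integral>\<^sup>+z. ennreal (M powr (p / q)) * (ennreal (d z powr (- (s * p - b))) * I z) \<partial>ball_measure)"
  proof (rule nn_integral_mono)
    fix z :: "complex^'n" assume "z \<in> space ball_measure"
    hence z: "norm z < 1" by simp
    have "ennreal (F z powr p * d z powr b) = ennreal (F z powr p) * ennreal (d z powr b)" by (simp add: ennreal_mult)
    also have "\<dots> \<le> (ennreal ((M * d z powr (- (s * q))) powr (p / q)) * I z) * ennreal (d z powr b)"
      by (intro mult_right_mono point[OF z]) simp
    also have "(M * d z powr (- (s * q))) powr (p / q) = M powr (p/q) * d z powr (- (s * p))"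
      using M pq by (simp add: powr_mult powr_powr)
    also have "ennreal (M powr (p/q) * d z powr (- (s * p))) * I z * ennreal (d z powr b)
       = ennreal (M powr (p/q)) * (ennreal (d z powr (- (s * p)) * d z powr b) * I z)"
      by (simp add: ennreal_mult mult_ac)
    also have "d z powr (- (s * p)) * d z powr b = d z powr (- (s * p - b))"
      by (simp add: powr_add[symmetric])
    finally show "ennreal (F z powr p * d z powr b) \<le> ennreal (M powr (p / q)) * (ennreal (d z powr (- (s * p - b))) * I z)" .
  qed
  also have "\<dots> = ennreal (M powr (p / q)) * (\<integral>\<^sup>+z. ennreal (d z powr (- (s * p - b))) * I z \<partial>ball_measure)"
    by (rule nn_integral_cmult) measurable
  also have "(\<integral>\<^sup>+z. ennreal (d z powr (- (s * p - b))) * I z \<partial>ball_measure)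
     = (\<integral>\<^sup>+z. (\<integral>\<^sup>+w. ennreal (d z powr (- (s * p - b))) * (k z w * ennreal (f w powr p * d w powr (s * p))) \<partial>ball_measure) \<partial>ball_measure)"
    unfolding I_def by (intro nn_integral_cong nn_integral_cmult[symmetric]) auto
  also have "\<dots> = (\<integral>\<^sup>+w. (\<integral>\<^sup>+z. ennreal (d z powr (- (s * p - b))) * (k z w * ennreal (f w powr p * d w powr (s * p))) \<partial>ball_measure) \<partial>ball_measure)"
    by (rule ball_pair.Fubini'[symmetric]) (use k in \<open>simp add: case_prod_unfold\<close>)
  also have "\<dots> \<le> (\<integral>\<^sup>+w. ennreal M * ennreal (f w powr p * d w powr b) \<partial>ball_measure)"
  proof (rule nn_integral_mono)
    fix w :: "complex^'n" assume ws: "w \<in> space ball_measure"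
    hence w: "norm w < 1" by simp
    note kz[OF ws, measurable]
    have "(\<integral>\<^sup>+z. ennreal (d z powr (- (s * p - b))) * (k z w * ennreal (f w powr p * d w powr (s * p))) \<partial>ball_measure)
      = (\<integral>\<^sup>+z. (k w z * ennreal (d z powr (- (s * p - b)))) * ennreal (f w powr p * d w powr (s * p)) \<partial>ball_measure)"
      by (intro nn_integral_cong) (simp add: sym[of _ w] mult_ac)
    also have "\<dots> = (\<integral>\<^sup>+z. (k w z * ennreal (d z powr (- (s * p - b)))) \<partial>ball_measure) * ennreal (f w powr p * d w powr (s * p))"
      by (rule nn_integral_multc) measurable
    also have "\<dots> \<le> ennreal (M * d w powr (- (s * p - b))) * ennreal (f w powr p * d w powr (s * p))"
      using schur_boundD[OF b2 w] by (intro mult_right_mono) (auto simp: d_def)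
    also have "\<dots> = ennreal M * ennreal (f w powr p * (d w powr (- (s * p - b)) * d w powr (s * p)))"
      using M by (simp add: ennreal_mult'[symmetric] mult_ac)
    also have "d w powr (- (s * p - b)) * d w powr (s * p) = d w powr b"
      by (simp add: powr_add[symmetric])
    finally show "(\<integral>\<^sup>+z. ennreal (d z powr (- (s * p - b))) * (k z w * ennreal (f w powr p * d w powr (s * p))) \<partial>ball_measure)
      \<le> ennreal M * ennreal (f w powr p * d w powr b)" .
  qed
  also have "\<dots> = ennreal M * (\<integral>\<^sup>+w. ennreal (f w powr p * d w powr b) \<partial>ball_measure)"
    by (rule nn_integral_cmult) measurable
  finally have "(\<integral>\<^sup>+z. ennreal (F z powr p * d z powr b) \<partial>ball_measure)
     \<le> ennreal (M powr (p / q)) * (ennreal M * (\<integral>\<^sup>+w. ennreal (f w powr p * d w powr b) \<partial>ball_measure))"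
    by (simp add: mult_left_mono)
  also have "\<dots> = ennreal (M powr (p/q) * M) * (\<integral>\<^sup>+w. ennreal (f w powr p * d w powr b) \<partial>ball_measure)"
    using M by (simp add: ennreal_mult mult.assoc)
  also have "M powr (p/q) * M = M powr p"
  proof -
    have "M powr (p/q) * M = M powr (p/q) * M powr 1" using M by simp
    thus ?thesis unfolding powr_add[symmetric] pq'(2) .
  qed
  finally show ?thesis by (simp add: d_def)
qed

section \<open>Automorphisms of the ball\<close>

text \<open>The involutive automorphism of the ball that exchanges \<open>a\<close> and 0. The usual quotient
\<open>(1 - s) <z,a> / |a|^2\<close>, with \<open>s = sqrt (1 - |a|^2)\<close>, is written as \<open><z,a> / (1 + s)\<close>, which makes sense for \<open>a = 0\<close> as well.\<close>

definition mobius :: "complex^'n \<Rightarrow> complex^'n \<Rightarrow> complex^'n" where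
  "mobius a z = (1 / (1 - herm_prod z a)) *s
     (a - of_real (sqrt (1 - (norm a)\<^sup>2)) *s z - (herm_prod z a / of_real (1 + sqrt (1 - (norm a)\<^sup>2))) *s a)"

text \<open>The identity that moves the automorphism from one argument of \<open>1 - <z,x>\<close> to the other at the price of
explicit factors. Together with the involution property it yields the transformation law of \<open>1 - <z,w>\<close>.\<close>

lemma mobius_herm:
  assumes "1 - herm_prod z a \<noteq> 0" "1 - herm_prod x a \<noteq> 0"
  shows "1 - herm_prod (mobius a z) x = (1 - herm_prod z (mobius a x)) * (1 - herm_prod a x) / (1 - herm_prod z a)"
proof -
  define s where "s = sqrt (1 - (norm a)\<^sup>2)"
  define A where "A = herm_prod z a" define B where "B = herm_prod a x" define D where "D = herm_prod z x"
  have xa: "herm_prod x a = cnj B" by (simp add: B_def cnj_herm_prod)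
  have A: "1 - A \<noteq> 0" using assms(1) by (simp add: A_def)
  have B: "1 - B \<noteq> 0" using assms(2) unfolding xa by (metis complex_cnj_cnj complex_cnj_diff complex_cnj_one complex_cnj_zero)
  define t where "t = (1 / of_real (1 + s) :: complex)"
  have tc: "cnj t = t" by (simp add: t_def)
  have L: "herm_prod (mobius a z) x = (B - of_real s * D - A * t * B) / (1 - A)"
    unfolding mobius_def s_def[symmetric] herm_prod_smult_left herm_prod_diff_left A_def B_def D_def t_def by simp
  have R: "herm_prod z (mobius a x) = (A - of_real s * D - B * t * A) / (1 - B)"
    unfolding mobius_def s_def[symmetric] herm_prod_smult_right herm_prod_diff_right xa using tc
    by (simp add: A_def[symmetric] D_def[symmetric] t_def)
  have "(1 - herm_prod (mobius a z) x) * (1 - A) = (1 - herm_prod z (mobius a x)) * (1 - B)"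
  proof -
    have cancel: "(1 - u / c) * c = c - u" if "c \<noteq> 0" for u c :: complex
      using that by (simp add: left_diff_distrib)
    show ?thesis unfolding L R cancel[OF A] cancel[OF B] by (simp add: algebra_simps)
  qed
  thus ?thesis using A by (simp add: A_def B_def eq_divide_eq)
qed

lemma mobius_self: assumes "norm a < 1" shows "mobius a a = 0"
proof -
  define s where "s = sqrt (1 - (norm a)\<^sup>2)"
  have s: "s > 0" "s\<^sup>2 = 1 - (norm a)\<^sup>2" using one_minus_norm2_pos[OF assms] by (simp_all add: s_def)
  have "1 - s = (norm a)\<^sup>2 / (1 + s)"
    using s by (simp add: field_simps power2_eq_square)
  hence "1 - of_real s - herm_prod a a / of_real (1 + s) = (0::complex)"
    unfolding herm_prod_self by (metis (no_types, opaque_lifting) diff_self of_real_1 of_real_diff of_real_divide)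
  moreover have "a - of_real s *s a - (herm_prod a a / of_real (1 + s)) *s a = (1 - of_real s - herm_prod a a / of_real (1 + s)) *s a"
    by (simp add: vec_eq_iff algebra_simps)
  ultimately show ?thesis by (simp add: mobius_def s_def[symmetric])
qed

lemma mobius_herm_centre:
  assumes "norm a < 1" "norm z < 1"
  shows "1 - herm_prod (mobius a z) a = of_real (1 - (norm a)\<^sup>2) / (1 - herm_prod z a)"
  using mobius_herm[of z a a] mobius_self[OF assms(1)] one_minus_herm_prod_nonzero(1)[of z a] one_minus_herm_prod_nonzero(1)[of a a] assms
  by (simp add: herm_prod_self)

lemma mobius_involution:
  assumes a: "norm a < 1" and z: "norm z < 1"
  shows "mobius a (mobius a z) = z"
proof -
  define s where "s = sqrt (1 - (norm a)\<^sup>2)"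
  have s: "s > 0" "s\<^sup>2 = 1 - (norm a)\<^sup>2" using one_minus_norm2_pos[OF a] by (simp_all add: s_def)
  define A where "A = herm_prod z a"
  have A: "1 - A \<noteq> 0" using one_minus_herm_prod_nonzero(1)[of z a] a z by (simp add: A_def)
  define S where "S = complex_of_real s"
  have S: "S \<noteq> 0" "1 + S \<noteq> 0" using s by (simp_all add: S_def) (metis add_pos_pos less_irrefl of_real_1 of_real_add of_real_eq_0_iff zero_less_one)
  define y where "y = mobius a z"
  have y: "y = (1 / (1 - A)) *s (a - S *s z - (A / (1 + S)) *s a)"
    by (simp add: y_def mobius_def A_def S_def s_def)
  have c: "1 - herm_prod y a = S\<^sup>2 / (1 - A)"
    unfolding y_def mobius_herm_centre[OF a z] S_def of_real_power[symmetric] s(2) by (simp add: A_def)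
  have ya: "herm_prod y a = 1 - S\<^sup>2 / (1 - A)" using c by (simp add: algebra_simps)
  have "mobius a y = ((1 - A) / S\<^sup>2) *s (a - S *s y - ((1 - S\<^sup>2 / (1 - A)) / (1 + S)) *s a)"
    unfolding mobius_def c s_def[symmetric] S_def[symmetric] ya by (simp add: S_def)
  also have "\<dots> = z"
  proof (subst vec_eq_iff, rule allI)
    fix i
    have "(1 - A) * (a $ i - S * ((a $ i - S * z $ i - A * a $ i / (1 + S)) / (1 - A)) - (1 - S\<^sup>2 / (1 - A)) * a $ i / (1 + S)) = S\<^sup>2 * z $ i"
    proof -
      define t where "t = 1 / (1 + S)"
      have t: "t * (1 + S) = 1" using S(2) by (simp add: t_def)
      define u where "u = a $ i - S * z $ i - A * a $ i * t"
      have "(1 - A) * (a $ i - S * (u / (1 - A)) - (1 - S\<^sup>2 / (1 - A)) * (a $ i * t)) = (1 - A) * a $ i - S * u - ((1 - A) - S\<^sup>2) * (a $ i * t)"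
      proof -
        have d: "(1 - A) * (x - y - v) = (1 - A) * x - (1 - A) * y - (1 - A) * v" for x y v by (simp only: right_diff_distrib)
        have c1: "(1 - A) * (S * (u / (1 - A))) = S * u" using A by simp
        have c2: "(1 - A) * (1 - S\<^sup>2 / (1 - A)) = (1 - A) - S\<^sup>2" using A by (simp add: right_diff_distrib)
        show ?thesis unfolding d c1 mult.assoc[symmetric, of "1 - A" "1 - S\<^sup>2 / (1 - A)"] c2 ..
      qed
      also have "\<dots> = S\<^sup>2 * z $ i" unfolding u_def using t by algebra
      finally show ?thesis by (simp add: u_def t_def)
    qed
    moreover have "(((1 - A) / S\<^sup>2) *s (a - S *s y - ((1 - S\<^sup>2 / (1 - A)) / (1 + S)) *s a)) $ i
        = (1 - A) * (a $ i - S * ((a $ i - S * z $ i - A * a $ i / (1 + S)) / (1 - A)) - (1 - S\<^sup>2 / (1 - A)) * a $ i / (1 + S)) / S\<^sup>2"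
      by (simp only: y vector_smult_component vector_minus_component) simp
    ultimately show "(((1 - A) / S\<^sup>2) *s (a - S *s y - ((1 - S\<^sup>2 / (1 - A)) / (1 + S)) *s a)) $ i = z $ i"
      using S(1) by simp
  qed
  finally show ?thesis by (simp add: y_def)
qed

lemma mobius_centre_nonzero:
  assumes "norm a < 1" "norm z < 1"
  shows "1 - herm_prod (mobius a z) a \<noteq> 0"
  unfolding mobius_herm_centre[OF assms]
  using one_minus_herm_prod_nonzero(1)[of z a] one_minus_norm2_pos[OF assms(1)] assms
  by (metis divide_eq_0_iff less_irrefl less_imp_le of_real_eq_0_iff)

lemma mobius_herm_mobius:
  assumes a: "norm a < 1" and z: "norm z < 1" and w: "norm w < 1"
  shows "1 - herm_prod (mobius a z) (mobius a w) = (1 - herm_prod z w) * of_real (1 - (norm a)\<^sup>2) / ((1 - herm_prod a w) * (1 - herm_prod z a))"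
proof -
  have "1 - herm_prod (mobius a z) (mobius a w) = (1 - herm_prod z (mobius a (mobius a w))) * (1 - herm_prod a (mobius a w)) / (1 - herm_prod z a)"
    by (rule mobius_herm) (use one_minus_herm_prod_nonzero(1)[of z a] mobius_centre_nonzero[OF a w] a z in auto)
  also have "1 - herm_prod a (mobius a w) = cnj (1 - herm_prod (mobius a w) a)" by (simp add: cnj_herm_prod)
  also have "\<dots> = of_real (1 - (norm a)\<^sup>2) / (1 - herm_prod a w)"
    unfolding mobius_herm_centre[OF a w] by (simp add: cnj_herm_prod)
  finally show ?thesis by (simp add: mobius_involution[OF a w])
qed

lemma one_minus_norm2_mobius:
  assumes a: "norm a < 1" and z: "norm z < 1"
  shows "1 - (norm (mobius a z))\<^sup>2 = rho a z"
proof -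
  have "complex_of_real (1 - (norm (mobius a z))\<^sup>2) = 1 - herm_prod (mobius a z) (mobius a z)" by (simp add: herm_prod_self)
  also have "\<dots> = (1 - herm_prod z z) * of_real (1 - (norm a)\<^sup>2) / ((1 - herm_prod a z) * cnj (1 - herm_prod a z))"
    unfolding mobius_herm_mobius[OF a z z] by (simp add: cnj_herm_prod)
  also have "\<dots> = of_real (rho a z)"
    unfolding complex_norm_square[symmetric] by (simp add: herm_prod_self rho_def mult.commute)
  finally show ?thesis using of_real_eq_iff by blast
qed

lemma norm_mobius_less_1: "norm a < 1 \<Longrightarrow> norm z < 1 \<Longrightarrow> norm (mobius a z) < 1"
proof -
  assume "norm a < 1" "norm z < 1"
  hence "(norm (mobius a z))\<^sup>2 < 1" using one_minus_norm2_mobius[of a z] rho_pos[of a z] by linarith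
  thus ?thesis by (simp add: power_less_one_iff)
qed

text \<open>After moving \<open>x\<close> to 0 by its automorphism the inequality becomes \<open>|1 - <\<phi>\<^sub>x(z),\<phi>\<^sub>x(w)>| \<le> 2\<close>.\<close>

lemma rho_triangle:
  assumes x: "norm x < 1" and z: "norm z < 1" and w: "norm w < 1"
  shows "rho z x * rho x w \<le> 4 * rho z w"
proof -
  define X where "X = norm (1 - herm_prod x w)" define Z where "Z = norm (1 - herm_prod z x)" define W where "W = norm (1 - herm_prod z w)"
  have pos: "X > 0" "Z > 0" "W > 0" unfolding X_def Z_def W_def using norm_one_minus_herm_prod_pos x z w by auto
  define dx where "dx = 1 - (norm x)\<^sup>2" define dz where "dz = 1 - (norm z)\<^sup>2" define dw where "dw = 1 - (norm w)\<^sup>2"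
  have d: "dx > 0" "dz > 0" "dw > 0" unfolding dx_def dz_def dw_def using one_minus_norm2_pos x z w by auto
  have "norm (1 - herm_prod (mobius x z) (mobius x w)) = W * dx / (X * Z)"
    unfolding mobius_herm_mobius[OF x z w] dx_def[symmetric] using d by (simp add: norm_mult norm_divide W_def X_def Z_def)
  moreover have "norm (1 - herm_prod (mobius x z) (mobius x w)) \<le> 2"
    using norm_triangle_ineq4[of 1 "herm_prod (mobius x z) (mobius x w)"] norm_herm_prod_less(1)[of "mobius x z" "mobius x w"]
      norm_mobius_less_1[OF x z] norm_mobius_less_1[OF x w] by simp
  ultimately have "W * dx \<le> 2 * (X * Z)" using pos by (simp add: divide_le_eq)
  hence "(W * dx)\<^sup>2 \<le> (2 * (X * Z))\<^sup>2" using pos d by (intro power_mono) auto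
  hence "dz * dw * (W * dx)\<^sup>2 \<le> dz * dw * (2 * (X * Z))\<^sup>2"
    using d by (intro mult_left_mono) auto
  thus ?thesis using pos unfolding rho_def X_def[symmetric] Z_def[symmetric] W_def[symmetric] dx_def[symmetric] dz_def[symmetric] dw_def[symmetric]
    by (simp add: divide_simps power2_eq_square mult_ac)
qed

section \<open>Approximation by diagonal kernels\<close>

text \<open>Uniform approximation on the disc of radius \<open>R\<close> by linear combinations of the functions
\<open>|1 - l \<tau>|^(-2 N)\<close>, \<open>|l| \<le> 1\<close>. A list of pairs of coefficients and parameters represents the combination.\<close>

definition approximable :: "nat \<Rightarrow> real \<Rightarrow> (complex \<Rightarrow> complex) \<Rightarrow> bool" where
  "approximable N R f \<longleftrightarrow> (\<forall>\<epsilon>>0. \<exists>L. (\<forall>(c, l)\<in>set L. norm l \<le> 1) \<and>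
     (\<forall>\<tau>. norm \<tau> \<le> R \<longrightarrow> norm (f \<tau> - (\<Sum>(c, l)\<leftarrow>L. c / of_real (norm (1 - l * \<tau>) ^ (2 * N)))) \<le> \<epsilon>))"

lemma approximable_zero: "approximable N R (\<lambda>_. 0)"
  unfolding approximable_def by (intro allI impI exI[of _ "[]"]) auto

lemma approximable_add:
  assumes "approximable N R f" "approximable N R g"
  shows "approximable N R (\<lambda>\<tau>. f \<tau> + g \<tau>)"
  unfolding approximable_def
proof (intro allI impI)
  fix \<epsilon> :: real assume "\<epsilon> > 0"
  hence e: "\<epsilon> / 2 > 0" by simp
  define S where "S L \<tau> = (\<Sum>(c, l)\<leftarrow>L. c / complex_of_real (norm (1 - l * \<tau>) ^ (2 * N)))" for L :: "(complex \<times> complex) list" and \<tau> :: complex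
  obtain L where L: "\<forall>(c, l)\<in>set L. norm l \<le> 1" "\<And>\<tau>. norm \<tau> \<le> R \<Longrightarrow> norm (f \<tau> - S L \<tau>) \<le> \<epsilon> / 2"
    using assms(1) e unfolding approximable_def S_def by blast
  obtain L' where L': "\<forall>(c, l)\<in>set L'. norm l \<le> 1" "\<And>\<tau>. norm \<tau> \<le> R \<Longrightarrow> norm (g \<tau> - S L' \<tau>) \<le> \<epsilon> / 2"
    using assms(2) e unfolding approximable_def S_def by blast
  have "norm (f \<tau> + g \<tau> - S (L @ L') \<tau>) \<le> \<epsilon>" if "norm \<tau> \<le> R" for \<tau>
  proof -
    have "f \<tau> + g \<tau> - S (L @ L') \<tau> = (f \<tau> - S L \<tau>) + (g \<tau> - S L' \<tau>)" by (simp add: S_def)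
    hence "norm (f \<tau> + g \<tau> - S (L @ L') \<tau>) = norm ((f \<tau> - S L \<tau>) + (g \<tau> - S L' \<tau>))" by (simp only:)
    thus ?thesis using norm_triangle_ineq[of "f \<tau> - S L \<tau>" "g \<tau> - S L' \<tau>"] L(2)[OF that] L'(2)[OF that] by linarith
  qed
  thus "\<exists>L. (\<forall>(c, l)\<in>set L. norm l \<le> 1) \<and> (\<forall>\<tau>. norm \<tau> \<le> R \<longrightarrow> norm (f \<tau> + g \<tau> - (\<Sum>(c, l)\<leftarrow>L. c / of_real (norm (1 - l * \<tau>) ^ (2 * N)))) \<le> \<epsilon>)"
    using L(1) L'(1) unfolding S_def by (intro exI[of _ "L @ L'"]) auto
qed

lemma approximable_cmult:
  assumes "approximable N R f"
  shows "approximable N R (\<lambda>\<tau>. a * f \<tau>)"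
  unfolding approximable_def
proof (intro allI impI)
  fix \<epsilon> :: real assume "\<epsilon> > 0"
  hence e: "\<epsilon> / (norm a + 1) > 0" by (simp add: add_nonneg_pos)
  define S where "S L \<tau> = (\<Sum>(c, l)\<leftarrow>L. c / complex_of_real (norm (1 - l * \<tau>) ^ (2 * N)))" for L :: "(complex \<times> complex) list" and \<tau> :: complex
  obtain L where L: "\<forall>(c, l)\<in>set L. norm l \<le> 1" "\<And>\<tau>. norm \<tau> \<le> R \<Longrightarrow> norm (f \<tau> - S L \<tau>) \<le> \<epsilon> / (norm a + 1)"
    using assms(1) e unfolding approximable_def S_def by blast
  define L' where "L' = map (\<lambda>(c, l). (a * c, l)) L"
  have SL: "S L' \<tau> = a * S L \<tau>" for \<tau>
    unfolding S_def L'_def by (induction L) (auto simp: algebra_simps)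
  have "norm (a * f \<tau> - S L' \<tau>) \<le> \<epsilon>" if "norm \<tau> \<le> R" for \<tau>
  proof -
    have "norm (a * f \<tau> - S L' \<tau>) = norm a * norm (f \<tau> - S L \<tau>)" unfolding SL by (simp add: norm_mult flip: right_diff_distrib)
    also have "\<dots> \<le> (norm a + 1) * (\<epsilon> / (norm a + 1))" using L(2)[OF that] by (intro mult_mono) auto
    also have "\<dots> = \<epsilon>" by (simp add: add_nonneg_eq_0_iff)
    finally show ?thesis .
  qed
  moreover have "\<forall>(c, l)\<in>set L'. norm l \<le> 1" using L(1) by (auto simp: L'_def)
  ultimately show "\<exists>L. (\<forall>(c, l)\<in>set L. norm l \<le> 1) \<and> (\<forall>\<tau>. norm \<tau> \<le> R \<longrightarrow> norm (a * f \<tau> - (\<Sum>(c, l)\<leftarrow>L. c / of_real (norm (1 - l * \<tau>) ^ (2 * N)))) \<le> \<epsilon>)"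
    unfolding S_def by blast
qed

lemma approximable_sum:
  assumes "\<And>i. i \<in> I \<Longrightarrow> approximable N R (f i)"
  shows "approximable N R (\<lambda>\<tau>. \<Sum>i\<in>I. f i \<tau>)"
  using assms by (induction I rule: infinite_finite_induct) (auto intro: approximable_zero approximable_add)

lemma approximable_uniform_limit:
  assumes "\<And>\<epsilon>. \<epsilon> > 0 \<Longrightarrow> \<exists>g. approximable N R g \<and> (\<forall>\<tau>. norm \<tau> \<le> R \<longrightarrow> norm (f \<tau> - g \<tau>) \<le> \<epsilon>)"
  shows "approximable N R f"
  unfolding approximable_def
proof (intro allI impI)
  fix \<epsilon> :: real assume "\<epsilon> > 0"
  hence e: "\<epsilon> / 2 > 0" by simp
  define S where "S L \<tau> = (\<Sum>(c, l)\<leftarrow>L. c / complex_of_real (norm (1 - l * \<tau>) ^ (2 * N)))" for L :: "(complex \<times> complex) list" and \<tau> :: complex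
  obtain g where g: "approximable N R g" "\<And>\<tau>. norm \<tau> \<le> R \<Longrightarrow> norm (f \<tau> - g \<tau>) \<le> \<epsilon> / 2"
    using assms[OF e] by blast
  obtain L where L: "\<forall>(c, l)\<in>set L. norm l \<le> 1" "\<And>\<tau>. norm \<tau> \<le> R \<Longrightarrow> norm (g \<tau> - S L \<tau>) \<le> \<epsilon> / 2"
    using g(1) e unfolding approximable_def S_def by blast
  have "norm (f \<tau> - S L \<tau>) \<le> \<epsilon>" if "norm \<tau> \<le> R" for \<tau>
    using norm_triangle_ineq[of "f \<tau> - g \<tau>" "g \<tau> - S L \<tau>"] L(2)[OF that] g(2)[OF that] by simp
  thus "\<exists>L. (\<forall>(c, l)\<in>set L. norm l \<le> 1) \<and> (\<forall>\<tau>. norm \<tau> \<le> R \<longrightarrow> norm (f \<tau> - (\<Sum>(c, l)\<leftarrow>L. c / of_real (norm (1 - l * \<tau>) ^ (2 * N)))) \<le> \<epsilon>)"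
    using L(1) unfolding S_def by blast
qed

lemma bergman_kernel_tail:
  fixes n m :: nat
  obtains C where "C \<ge> 0" "\<And>x::complex. norm x \<le> 1/2 \<Longrightarrow>
    norm (1 / (1 - x) ^ (n + 1) - (\<Sum>k\<le>m. of_real (fact (n + k) / (fact n * fact k)) * x ^ k)) \<le> C * norm x ^ (m + 1)"
proof -
  define a where "a k = (fact (n + k) / (fact n * fact k) :: real)" for k :: nat
  have a0: "a k \<ge> 0" for k by (simp add: a_def)
  have ser: "(\<lambda>k. of_real (a k) * x ^ k) sums (1 / (1 - x) ^ (n + 1))" if "norm x < 1" for x :: complex
    unfolding a_def by (rule bergman_kernel_series[OF that])
  have sm: "summable (\<lambda>k. a k * (1/2) ^ k)"
  proof -
    have "summable (\<lambda>k. complex_of_real (a k * (1/2) ^ k))"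
      using ser[of "1/2"] by (simp add: sums_iff)
    thus ?thesis by (simp only: summable_complex_of_real)
  qed
  have sm': "summable (\<lambda>k. a (k + Suc m) * (1/2) ^ k)"
  proof -
    have "summable (\<lambda>k. 2 ^ Suc m * (a (k + Suc m) * (1/2) ^ (k + Suc m)))"
      by (intro summable_mult summable_ignore_initial_segment[OF sm])
    moreover have "2 ^ Suc m * (a (k + Suc m) * (1/2) ^ (k + Suc m)) = a (k + Suc m) * (1/2) ^ k" for k
    proof -
      have "2 ^ Suc m * (1/2::real) ^ (k + Suc m) = (1/2) ^ k"
        by (simp add: power_add power_one_over)
      thus ?thesis by (simp only: mult.left_commute[of "2 ^ Suc m"])
    qed
    ultimately show ?thesis by (simp only:)
  qed
  define C where "C = (\<Sum>k. a (k + Suc m) * (1/2) ^ k)"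
  show ?thesis
  proof (rule that[of C])
    show "C \<ge> 0" unfolding C_def using a0 by (intro suminf_nonneg[OF sm']) simp
    fix x :: complex assume x: "norm x \<le> 1/2"
    hence x1: "norm x < 1" by simp
    have bnd: "norm (of_real (a (k + Suc m)) * x ^ k) \<le> a (k + Suc m) * (1/2) ^ k" for k
      using power_mono[OF x, of k] a0[of "k + Suc m"] by (simp add: norm_mult norm_power mult_left_mono)
    have "1 / (1 - x) ^ (n + 1) = (\<Sum>k. of_real (a (k + Suc m)) * x ^ (k + Suc m)) + (\<Sum>k<Suc m. of_real (a k) * x ^ k)"
      using ser[OF x1] suminf_split_initial_segment[of "\<lambda>k. of_real (a k) * x ^ k" "Suc m"] by (simp only: sums_iff)
    hence "1 / (1 - x) ^ (n + 1) - (\<Sum>k\<le>m. of_real (a k) * x ^ k) = (\<Sum>k. of_real (a (k + Suc m)) * x ^ (k + Suc m))"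
      by (simp add: lessThan_Suc_atMost del: sum.lessThan_Suc)
    also have "\<dots> = (\<Sum>k. x ^ Suc m * (of_real (a (k + Suc m)) * x ^ k))"
      by (intro suminf_cong) (simp add: power_add mult_ac)
    also have "\<dots> = x ^ Suc m * (\<Sum>k. of_real (a (k + Suc m)) * x ^ k)"
      by (rule suminf_mult, rule summable_comparison_test'[OF sm' bnd])
    finally have "norm (1 / (1 - x) ^ (n + 1) - (\<Sum>k\<le>m. of_real (a k) * x ^ k)) = norm x ^ Suc m * norm (\<Sum>k. of_real (a (k + Suc m)) * x ^ k)"
      by (simp add: norm_mult norm_power)
    also have "norm x ^ Suc m * norm (\<Sum>k. of_real (a (k + Suc m)) * x ^ k) \<le> norm x ^ Suc m * C"
      unfolding C_def by (intro mult_left_mono norm_suminf_le[OF bnd sm']) simp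
    finally show "norm (1 / (1 - x) ^ (n + 1) - (\<Sum>k\<le>m. of_real (fact (n + k) / (fact n * fact k)) * x ^ k)) \<le> C * norm x ^ (m + 1)"
      by (simp add: a_def mult.commute)
  qed
qed

text \<open>Averaging over the roots of unity of order \<open>M = 2 m + 1\<close> with weight \<open>\<omega>^(-m)\<close> extracts the terms with
\<open>k - j = m\<close> modulo \<open>M\<close>. For \<open>k\<close> and \<open>j\<close> in \<open>{0..m}\<close> only \<open>k = m\<close>, \<open>j = 0\<close> qualifies.\<close>

lemma roots_of_unity_filter:
  fixes a :: "nat \<Rightarrow> real" and \<tau> :: complex and m :: nat
  defines "M \<equiv> 2 * m + 1"
  defines "\<omega> \<equiv> (\<lambda>l. cis (2 * pi * real l / real M))"
  shows "(\<Sum>l<M. cnj (\<omega> l) ^ m * ((\<Sum>k\<le>m. of_real (a k) * (of_real r * \<omega> l * \<tau>) ^ k) * cnj (\<Sum>j\<le>m. of_real (a j) * (of_real r * \<omega> l * \<tau>) ^ j)))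
     = of_nat M * (of_real (a 0 * a m * r ^ m) * \<tau> ^ m)"
proof -
  have M: "M > 0" by (simp add: M_def)
  define q where "q k j l = cis (2 * pi * of_int (int k - int j - int m) * real l / real M)" for k j l
  have wq: "cnj (\<omega> l) ^ m * (\<omega> l ^ k * cnj (\<omega> l) ^ j) = q k j l" for k j l
    unfolding \<omega>_def cis_cnj Complex.DeMoivre cis_mult q_def
    using M by (intro arg_cong[where f = cis]) (simp add: field_simps)
  have "(\<Sum>l<M. cnj (\<omega> l) ^ m * ((\<Sum>k\<le>m. of_real (a k) * (of_real r * \<omega> l * \<tau>) ^ k) * cnj (\<Sum>j\<le>m. of_real (a j) * (of_real r * \<omega> l * \<tau>) ^ j)))
    = (\<Sum>l<M. \<Sum>k\<le>m. \<Sum>j\<le>m. (of_real (a k * a j * r ^ (k + j)) * \<tau> ^ k * cnj \<tau> ^ j) * (cnj (\<omega> l) ^ m * (\<omega> l ^ k * cnj (\<omega> l) ^ j)))"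
    unfolding cnj_sum unfolding sum_product unfolding sum_distrib_left
    by (intro sum.cong refl) (simp add: power_mult_distrib power_add mult_ac)
  also have "\<dots> = (\<Sum>k\<le>m. \<Sum>j\<le>m. (of_real (a k * a j * r ^ (k + j)) * \<tau> ^ k * cnj \<tau> ^ j) * (\<Sum>l<M. q k j l))"
    unfolding wq sum_distrib_left by (subst sum.swap) (intro sum.cong refl sum.swap)
  also have "\<dots> = (\<Sum>k\<le>m. \<Sum>j\<le>m. if k = m \<and> j = 0 then (of_real (a m * a 0 * r ^ m) * \<tau> ^ m) * of_nat M else 0)"
  proof (intro sum.cong refl)
    fix k j assume kj: "k \<in> {..m}" "j \<in> {..m}"
    show "(of_real (a k * a j * r ^ (k + j)) * \<tau> ^ k * cnj \<tau> ^ j) * (\<Sum>l<M. q k j l) = (if k = m \<and> j = 0 then (of_real (a m * a 0 * r ^ m) * \<tau> ^ m) * of_nat M else 0)"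
    proof (cases "k = m \<and> j = 0")
      case True
      thus ?thesis by (simp add: q_def)
    next
      case False
      have "\<not> int M dvd (int k - int j - int m)"
      proof
        assume d: "int M dvd (int k - int j - int m)"
        have "int k - int j - int m \<noteq> 0" using False kj by auto
        hence "int M \<le> \<bar>int k - int j - int m\<bar>" using d by (metis dvd_imp_le_int abs_of_nat)
        thus False using kj by (simp add: M_def)
      qed
      hence "(\<Sum>l<M. q k j l) = 0" unfolding q_def by (rule roots_of_unity_sum[OF M])
      thus ?thesis using False by (simp only: mult_zero_right if_False)
    qed
  qed
  also have "\<dots> = (\<Sum>k\<le>m. if k = m then (of_real (a m * a 0 * r ^ m) * \<tau> ^ m) * of_nat M else 0)"
    by (intro sum.cong refl) auto
  also have "\<dots> = of_nat M * (of_real (a 0 * a m * r ^ m) * \<tau> ^ m)" by (simp add: mult_ac)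
  finally show ?thesis .
qed

text \<open>Put \<open>l = r \<omega>\<close> with a root of unity \<open>\<omega>\<close> and small \<open>r\<close>, and expand
\<open>|1 - l \<tau>|^(-2 N) = p(l \<tau>) cnj (p(l \<tau>))\<close> with \<open>p(x) = (1 - x)^(-N)\<close>. The weighted sum over the roots of unity extracts
\<open>\<tau>^m\<close> with the coefficient \<open>M a\<^sub>m r^m\<close>, and the error is of order \<open>r^(m+1)\<close>; after division by the coefficient it is of order
\<open>r\<close>.\<close>

lemma approximable_monomial:
  assumes R: "R \<le> 1"
  shows "approximable (n + 1) R (\<lambda>\<tau>. \<tau> ^ m)"
  unfolding approximable_def
proof (intro allI impI)
  fix \<epsilon> :: real assume \<epsilon>: "\<epsilon> > 0"
  define a where "a k = (fact (n + k) / (fact n * fact k) :: real)" for k :: nat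
  have a_pos: "a k > 0" for k by (simp add: a_def)
  have a_0: "a 0 = 1" by (simp add: a_def)
  obtain C where C: "C \<ge> 0" "\<And>x::complex. norm x \<le> 1/2 \<Longrightarrow>
    norm (1 / (1 - x) ^ (n + 1) - (\<Sum>k\<le>m. of_real (a k) * x ^ k)) \<le> C * norm x ^ (m + 1)"
    unfolding a_def by (rule bergman_kernel_tail[of n m]) auto
  define p where "p x = 1 / (1 - x) ^ (n + 1)" for x :: complex
  define P where "P x = (\<Sum>k\<le>m. of_real (a k) * x ^ k)" for x :: complex
  define B where "B = (\<Sum>k\<le>m. a k) + C"
  have B0: "B \<ge> 0" unfolding B_def using a_pos C(1) by (intro add_nonneg_nonneg sum_nonneg) (auto simp: less_imp_le)
  have P: "norm (P x) \<le> B" if "norm x \<le> 1/2" for x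
  proof -
    have "norm (P x) \<le> (\<Sum>k\<le>m. a k)"
      unfolding P_def
    proof (rule order_trans[OF norm_sum], rule sum_mono)
      fix k
      have "norm x ^ k \<le> 1" using that by (intro power_le_one) auto
      thus "norm (of_real (a k) * x ^ k) \<le> a k" using a_pos[of k] by (simp add: norm_mult norm_power mult_left_le)
    qed
    thus ?thesis using C(1) by (simp add: B_def)
  qed
  have p: "norm (p x) \<le> B" if "norm x \<le> 1/2" for x
  proof -
    have "norm (p x) \<le> norm (P x) + norm (p x - P x)" using norm_triangle_ineq[of "P x" "p x - P x"] by simp
    also have "norm (P x) \<le> (\<Sum>k\<le>m. a k)"
      unfolding P_def
    proof (rule order_trans[OF norm_sum], rule sum_mono)
      fix k
      have "norm x ^ k \<le> 1" using that by (intro power_le_one) auto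
      thus "norm (of_real (a k) * x ^ k) \<le> a k" using a_pos[of k] by (simp add: norm_mult norm_power mult_left_le)
    qed
    also have "norm (p x - P x) \<le> C * 1"
      using C(2)[OF that] mult_left_mono[OF power_le_one[of "norm x" "m + 1"] C(1)] that unfolding p_def P_def by simp
    finally show ?thesis by (simp add: B_def)
  qed
  have pP: "norm (p x * cnj (p x) - P x * cnj (P x)) \<le> 2 * B * C * norm x ^ (m + 1)" if "norm x \<le> 1/2" for x
  proof -
    have d: "norm (p x - P x) \<le> C * norm x ^ (m + 1)" using C(2)[OF that] by (simp add: p_def P_def)
    have "p x * cnj (p x) - P x * cnj (P x) = (p x - P x) * cnj (p x) + P x * cnj (p x - P x)" by (simp add: algebra_simps)
    also have "norm \<dots> \<le> norm (p x - P x) * norm (p x) + norm (P x) * norm (p x - P x)"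
      by (rule order_trans[OF norm_triangle_ineq]) (simp add: norm_mult flip: complex_cnj_diff)
    also have "\<dots> \<le> (C * norm x ^ (m + 1)) * B + B * (C * norm x ^ (m + 1))"
      using d p[OF that] P[OF that] B0 C(1) by (intro add_mono mult_mono) auto
    finally show ?thesis by (simp add: algebra_simps)
  qed
  define K where "K = 2 * B * C / a m"
  have K0: "K \<ge> 0" using B0 C(1) a_pos[of m] by (simp add: K_def)
  define r where "r = min (1/2) (\<epsilon> / (K + 1))"
  have r: "0 < r" "r \<le> 1/2" "K * r \<le> \<epsilon>"
  proof -
    show "0 < r" using \<epsilon> K0 by (auto simp: r_def)
    show "r \<le> 1/2" unfolding r_def by (rule min.cobounded1)
    have "K * r \<le> (K + 1) * (\<epsilon> / (K + 1))" using K0 \<epsilon> by (intro mult_mono) (auto simp: r_def)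
    thus "K * r \<le> \<epsilon>" using K0 by simp
  qed
  define M where "M = 2 * m + 1"
  define \<omega> where "\<omega> l = cis (2 * pi * real l / real M)" for l
  have \<omega>: "norm (\<omega> l) = 1" for l by (simp add: \<omega>_def)
  define \<kappa> where "\<kappa> = complex_of_real (real M * (a m * r ^ m))"
  have \<kappa>pos: "real M * (a m * r ^ m) > 0" using a_pos[of m] r(1) by (simp add: M_def)
  hence \<kappa>0: "\<kappa> \<noteq> 0" unfolding \<kappa>_def by (metis less_irrefl of_real_eq_0_iff)
  define L where "L = map (\<lambda>l. (cnj (\<omega> l) ^ m / \<kappa>, of_real r * \<omega> l)) [0..<M]"
  have SL: "(\<Sum>(c, l)\<leftarrow>L. c / of_real (norm (1 - l * \<tau>) ^ (2 * (n + 1)))) = (\<Sum>l<M. cnj (\<omega> l) ^ m * (p (of_real r * \<omega> l * \<tau>) * cnj (p (of_real r * \<omega> l * \<tau>)))) / \<kappa>" for \<tau>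
  proof -
    have pp: "c / of_real (norm (1 - x) ^ (2 * (n + 1))) = c * (p x * cnj (p x))" for c x
    proof -
      have "p x * cnj (p x) = of_real ((norm (p x))\<^sup>2)" by (rule complex_norm_square[symmetric])
      also have "(norm (p x))\<^sup>2 = 1 / norm (1 - x) ^ (2 * (n + 1))"
        by (simp add: p_def norm_divide norm_power power_divide power_mult[symmetric] mult.commute del: power_Suc)
      finally show ?thesis by simp
    qed
    have "(\<Sum>(c, l)\<leftarrow>L. c / of_real (norm (1 - l * \<tau>) ^ (2 * (n + 1)))) = (\<Sum>l\<leftarrow>[0..<M]. cnj (\<omega> l) ^ m / \<kappa> * (p (of_real r * \<omega> l * \<tau>) * cnj (p (of_real r * \<omega> l * \<tau>))))"
      unfolding L_def pp by (simp add: comp_def)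
    also have "\<dots> = (\<Sum>l<M. cnj (\<omega> l) ^ m / \<kappa> * (p (of_real r * \<omega> l * \<tau>) * cnj (p (of_real r * \<omega> l * \<tau>))))"
      by (subst sum_list_distinct_conv_sum_set) (auto simp: atLeast0LessThan)
    finally show ?thesis by (simp add: sum_divide_distrib)
  qed
  have "norm (\<tau> ^ m - (\<Sum>(c, l)\<leftarrow>L. c / of_real (norm (1 - l * \<tau>) ^ (2 * (n + 1))))) \<le> \<epsilon>" if \<tau>: "norm \<tau> \<le> R" for \<tau>
  proof -
    have \<tau>1: "norm \<tau> \<le> 1" using \<tau> R by simp
    define x where "x l = of_real r * \<omega> l * \<tau>" for l
    have x: "norm (x l) \<le> r" for l using \<tau>1 r(1) by (simp add: x_def norm_mult \<omega> mult_left_le)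
    have x2: "norm (x l) \<le> 1/2" for l using x[of l] r(2) by simp
    have filt: "(\<Sum>l<M. cnj (\<omega> l) ^ m * (P (x l) * cnj (P (x l)))) = \<kappa> * \<tau> ^ m"
      using roots_of_unity_filter[of m a r \<tau>] unfolding P_def x_def \<omega>_def M_def \<kappa>_def by (simp add: a_0 mult_ac)
    have "\<tau> ^ m - (\<Sum>(c, l)\<leftarrow>L. c / of_real (norm (1 - l * \<tau>) ^ (2 * (n + 1)))) = (\<Sum>l<M. cnj (\<omega> l) ^ m * (P (x l) * cnj (P (x l)) - p (x l) * cnj (p (x l)))) / \<kappa>"
    proof -
      have "\<tau> ^ m = (\<Sum>l<M. cnj (\<omega> l) ^ m * (P (x l) * cnj (P (x l)))) / \<kappa>" unfolding filt using \<kappa>0 by simp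
      thus ?thesis unfolding SL x_def[symmetric] by (simp add: sum_subtractf right_diff_distrib diff_divide_distrib)
    qed
    also have "norm \<dots> \<le> (\<Sum>l<M. 2 * B * C * r ^ (m + 1)) / norm \<kappa>"
      unfolding norm_divide
    proof (rule divide_right_mono[OF order_trans[OF norm_sum sum_mono]])
      fix l
      have "norm (cnj (\<omega> l) ^ m * (P (x l) * cnj (P (x l)) - p (x l) * cnj (p (x l)))) = norm (p (x l) * cnj (p (x l)) - P (x l) * cnj (P (x l)))"
        by (simp add: norm_mult norm_power \<omega> norm_minus_commute)
      also have "\<dots> \<le> 2 * B * C * norm (x l) ^ (m + 1)" by (rule pP[OF x2])
      also have "\<dots> \<le> 2 * B * C * r ^ (m + 1)" using B0 C(1) x[of l] by (intro mult_left_mono power_mono) auto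
      finally show "norm (cnj (\<omega> l) ^ m * (P (x l) * cnj (P (x l)) - p (x l) * cnj (p (x l)))) \<le> 2 * B * C * r ^ (m + 1)" .
    qed simp
    also have "\<dots> = K * r"
    proof -
      have "norm \<kappa> = real M * (a m * r ^ m)" unfolding \<kappa>_def using \<kappa>pos by (simp only: norm_of_real abs_of_pos)
      moreover have "(\<Sum>l<M. 2 * B * C * r ^ (m + 1)) = real M * (2 * B * C * r ^ (m + 1))" by simp
      moreover have "real M > 0" by (simp add: M_def)
      ultimately show ?thesis using r(1) a_pos[of m] by (simp add: K_def field_simps)
    qed
    finally show ?thesis using r(3) by simp
  qed
  moreover have "\<forall>(c, l)\<in>set L. norm l \<le> 1" using r by (auto simp: L_def norm_mult \<omega>)
  ultimately show "\<exists>L. (\<forall>(c, l)\<in>set L. norm l \<le> 1) \<and> (\<forall>\<tau>::complex. norm \<tau> \<le> R \<longrightarrow> norm (\<tau> ^ m - (\<Sum>(c, l)\<leftarrow>L. c / of_real (norm (1 - l * \<tau>) ^ (2 * (n + 1))))) \<le> \<epsilon>)"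
    by blast
qed

text \<open>The power series of the kernel converges uniformly on the smaller disc, and its partial sums are combinations of
approximable monomials.\<close>

lemma approximable_bergman_kernel:
  assumes R: "0 \<le> R" "R < 1"
  shows "approximable (n + 1) R (\<lambda>\<tau>. 1 / (1 - \<tau>) ^ (n + 1))"
proof (rule approximable_uniform_limit)
  fix \<epsilon> :: real assume \<epsilon>: "\<epsilon> > 0"
  define a where "a k = (fact (n + k) / (fact n * fact k) :: real)" for k :: nat
  have a0: "a k \<ge> 0" for k by (simp add: a_def)
  have ser: "(\<lambda>k. of_real (a k) * x ^ k) sums (1 / (1 - x) ^ (n + 1))" if "norm x < 1" for x :: complex
    unfolding a_def by (rule bergman_kernel_series[OF that])
  have sm: "summable (\<lambda>k. a k * R ^ k)"
  proof -
    have "summable (\<lambda>k. complex_of_real (a k * R ^ k))"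
      using ser[of "of_real R"] R by (simp add: sums_iff)
    thus ?thesis by (simp only: summable_complex_of_real)
  qed
  obtain m where m: "norm (\<Sum>k. a (k + m) * R ^ (k + m)) < \<epsilon>"
    using suminf_exist_split[OF \<epsilon> sm] by blast
  have sm': "summable (\<lambda>k. a (k + m) * R ^ (k + m))" by (rule summable_ignore_initial_segment[OF sm])
  have "norm (1 / (1 - \<tau>) ^ (n + 1) - (\<Sum>k<m. of_real (a k) * \<tau> ^ k)) \<le> \<epsilon>" if \<tau>: "norm \<tau> \<le> R" for \<tau> :: complex
  proof -
    have bnd: "norm (complex_of_real (a (k + m)) * \<tau> ^ (k + m)) \<le> a (k + m) * R ^ (k + m)" for k
      using power_mono[OF \<tau>, of "k + m"] a0[of "k + m"] by (simp add: norm_mult norm_power mult_left_mono)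
    have "1 / (1 - \<tau>) ^ (n + 1) - (\<Sum>k<m. of_real (a k) * \<tau> ^ k) = (\<Sum>k. of_real (a (k + m)) * \<tau> ^ (k + m))"
      using ser[of \<tau>] \<tau> R suminf_split_initial_segment[of "\<lambda>k. of_real (a k) * \<tau> ^ k" m] by (simp add: sums_iff)
    also have "norm \<dots> \<le> (\<Sum>k. a (k + m) * R ^ (k + m))" by (rule norm_suminf_le[OF bnd sm'])
    finally show ?thesis using m by simp
  qed
  moreover have "approximable (n + 1) R (\<lambda>\<tau>. \<Sum>k<m. of_real (a k) * \<tau> ^ k)"
    using R by (intro approximable_sum approximable_cmult approximable_monomial) simp
  ultimately show "\<exists>g. approximable (n + 1) R g \<and> (\<forall>\<tau>::complex. norm \<tau> \<le> R \<longrightarrow> norm (1 / (1 - \<tau>) ^ (n + 1) - g \<tau>) \<le> \<epsilon>)"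
    by blast
qed

section \<open>Off-diagonal decay of the Toeplitz kernel\<close>

lemma AE_bound_integral:
  fixes u g :: "complex^'n \<Rightarrow> complex"
  assumes u: "u \<in> borel_measurable ball_measure" "AE z in ball_measure. norm (u z) \<le> U" and U: "U \<ge> 0"
    and g: "integrable ball_measure g"
  shows "integrable ball_measure (\<lambda>x. u x * g x)"
    and "norm (LINT x|ball_measure. u x * g x) \<le> U * (LINT x|ball_measure. norm (g x))"
proof -
  have ae: "AE x in ball_measure. norm (u x * g x) \<le> U * norm (g x)"
    using u(2) by eventually_elim (simp add: norm_mult mult_right_mono)
  show int: "integrable ball_measure (\<lambda>x. u x * g x)"
  proof (rule Bochner_Integration.integrable_bound[of _ "\<lambda>x. U * norm (g x)"])
    show "AE x in ball_measure. norm (u x * g x) \<le> norm (U * norm (g x))"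
      using ae by eventually_elim (use U in \<open>simp add: abs_mult\<close>)
  qed (use g u in auto)
  have "norm (LINT x|ball_measure. u x * g x) \<le> (LINT x|ball_measure. norm (u x * g x))" by (rule integral_norm_bound)
  also have "\<dots> \<le> (LINT x|ball_measure. U * norm (g x))"
    using ae int g by (intro integral_mono_AE) auto
  finally show "norm (LINT x|ball_measure. u x * g x) \<le> U * (LINT x|ball_measure. norm (g x))" by simp
qed

lemma integrable_bounded_ball:
  fixes g :: "complex^'n \<Rightarrow> 'b::{banach, second_countable_topology}"
  assumes "g \<in> borel_measurable ball_measure" "\<And>x. norm x < 1 \<Longrightarrow> norm (g x) \<le> B"
  shows "integrable ball_measure g"
  by (rule ball_measure.integrable_const_bound[where B = B]) (use assms in \<open>auto intro!: AE_I2\<close>)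

locale bounded_symbol =
  fixes u :: "complex^'n \<Rightarrow> complex" and U :: real
  assumes u_meas [measurable]: "u \<in> borel_measurable ball_measure"
    and u_bound: "AE z in ball_measure. norm (u z) \<le> U" and U_nonneg: "U \<ge> 0"
begin

lemmas u_integral = AE_bound_integral[OF u_meas u_bound U_nonneg]

text \<open>This is \<open>T\<^sub>u K\<^sub>z (w)\<close> for the Bergman kernel \<open>K\<^sub>z\<close>, or the inner product of \<open>T\<^sub>u K\<^sub>z\<close> and \<open>K\<^sub>w\<close>.\<close>

definition toeplitz_kernel :: "complex^'n \<Rightarrow> complex^'n \<Rightarrow> complex" where
  "toeplitz_kernel z w = (LINT x|ball_measure. u x * (1 / ((1 - herm_prod x z) ^ (CARD('n) + 1) * (1 - herm_prod w x) ^ (CARD('n) + 1))))"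

text \<open>The first factor is the Jacobian of \<open>\<phi>\<^sub>z\<close>, so for \<open>x = \<phi>\<^sub>z(y)\<close> this is the mean of
\<open>u(\<phi>\<^sub>z(y)) h(<\<eta>,y>)\<close> over the ball. Written with the density it needs no change of variables in the integral.\<close>

definition mobius_mean :: "complex^'n \<Rightarrow> complex^'n \<Rightarrow> (complex \<Rightarrow> complex) \<Rightarrow> complex" where
  "mobius_mean z \<eta> h = (LINT x|ball_measure. u x * (of_real ((1 - (norm z)\<^sup>2) ^ (CARD('n) + 1) / norm (1 - herm_prod z x) ^ (2 * (CARD('n) + 1))) * h (herm_prod \<eta> (mobius z x))))"

lemma measurable_herm_mobius [measurable]: "(\<lambda>x. herm_prod \<eta> (mobius z x)) \<in> borel_measurable ball_measure"
  unfolding mobius_def herm_prod_smult_right herm_prod_diff_right complex_cnj_divide complex_cnj_diff complex_cnj_one cnj_herm_prod complex_cnj_complex_of_real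
  by measurable

lemma density_bound:
  assumes "norm z < 1" "norm x < 1"
  shows "norm (complex_of_real ((1 - (norm z)\<^sup>2) ^ N / norm (1 - herm_prod z x) ^ (2 * N))) \<le> (1 / (1 - norm z) ^ (2 * N))"
proof -
  have "0 \<le> 1 - (norm z)\<^sup>2" "1 - (norm z)\<^sup>2 \<le> 1" using one_minus_norm2_pos[OF assms(1)] by auto
  hence 1: "\<bar>(1 - (norm z)\<^sup>2) ^ N\<bar> \<le> 1" by (simp add: power_le_one)
  have "norm (1 / (1 - herm_prod z x) ^ (2 * N)) \<le> 1 / (1 - norm z) ^ (2 * N)" by (rule norm_bergman_kernel_le[OF assms])
  hence 2: "1 / norm (1 - herm_prod z x) ^ (2 * N) \<le> 1 / (1 - norm z) ^ (2 * N)" by (simp only: norm_divide norm_power norm_one)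
  have "\<bar>(1 - (norm z)\<^sup>2) ^ N\<bar> * (1 / norm (1 - herm_prod z x) ^ (2 * N)) \<le> 1 * (1 / (1 - norm z) ^ (2 * N))"
    by (rule mult_mono[OF 1 2]) auto
  thus ?thesis unfolding norm_of_real by (simp add: abs_mult)
qed

lemma norm_herm_mobius_le:
  assumes "norm z < 1" "norm x < 1" shows "norm (herm_prod \<eta> (mobius z x)) \<le> norm \<eta>"
  using norm_herm_prod_le[of \<eta> "mobius z x"] norm_mobius_less_1[OF assms] mult_left_le[of "norm (mobius z x)" "norm \<eta>"] by simp

lemma mobius_mean_integrand_integrable:
  fixes h :: "complex \<Rightarrow> complex" and z \<eta> :: "complex^'n"
  assumes z: "norm z < 1" and h [measurable]: "h \<in> borel_measurable borel" and hB: "\<And>\<tau>. norm \<tau> \<le> norm \<eta> \<Longrightarrow> norm (h \<tau>) \<le> B"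
  shows "integrable ball_measure (\<lambda>x. of_real ((1 - (norm z)\<^sup>2) ^ (CARD('n) + 1) / norm (1 - herm_prod z x) ^ (2 * (CARD('n) + 1))) * h (herm_prod \<eta> (mobius z x)))"
proof (rule integrable_bounded_ball)
  fix x :: "complex^'n" assume x: "norm x < 1"
  show "norm (of_real ((1 - (norm z)\<^sup>2) ^ (CARD('n) + 1) / norm (1 - herm_prod z x) ^ (2 * (CARD('n) + 1))) * h (herm_prod \<eta> (mobius z x)))
    \<le> (1 / (1 - norm z) ^ (2 * (CARD('n) + 1))) * B"
    unfolding norm_mult
    using z by (intro mult_mono density_bound[OF z x] hB norm_herm_mobius_le[OF z x]) auto
qed measurable

text \<open>The mass of the density is bounded uniformly in \<open>z\<close> by the Forelli-Rudin estimate with \<open>t = 0\<close> and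
\<open>s = n + 1\<close>.\<close>

lemma mobius_mean_bound:
  obtains C where "C > 0" "\<And>z \<eta> h B. norm z < 1 \<Longrightarrow> h \<in> borel_measurable borel \<Longrightarrow> (\<And>\<tau>. norm \<tau> \<le> norm \<eta> \<Longrightarrow> norm (h \<tau>) \<le> B)
    \<Longrightarrow> norm (mobius_mean z \<eta> h) \<le> C * B"
proof -
  define N where "N = CARD('n) + 1"
  obtain C where C: "C > 0" "\<And>z::complex^'n. norm z < 1 \<Longrightarrow>
    (\<integral>\<^sup>+w. ennreal ((1 - (norm w)\<^sup>2) powr 0 * norm (1 - herm_prod z w) powr (- (real CARD('n) + 1 + 0 + (real CARD('n) + 1)))) \<partial>ball_measure)
      \<le> ennreal (C * (1 - (norm z)\<^sup>2) powr (- (real CARD('n) + 1)))"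
    using forelli_rudin[of 0 "real CARD('n) + 1", where 'n='n] by auto
  have mass: "(LINT x|ball_measure. (1 - (norm z)\<^sup>2) ^ N / norm (1 - herm_prod z x) ^ (2 * N)) \<le> C" if z: "norm z < 1" for z :: "complex^'n"
  proof -
    define d where "d = 1 - (norm z)\<^sup>2"
    have d: "d > 0" unfolding d_def by (rule one_minus_norm2_pos[OF z])
    have int: "integrable ball_measure (\<lambda>x. d ^ N / norm (1 - herm_prod z x) ^ (2 * N))"
    proof (rule integrable_bounded_ball)
      fix x :: "complex^'n" assume "norm x < 1"
      thus "norm (d ^ N / norm (1 - herm_prod z x) ^ (2 * N)) \<le> (1 / (1 - norm z) ^ (2 * N))"
        using density_bound[OF z, of x N] unfolding norm_of_real d_def by simp
    qed measurable
    have "ennreal (LINT x|ball_measure. d ^ N / norm (1 - herm_prod z x) ^ (2 * N)) = (\<integral>\<^sup>+x. ennreal (d ^ N / norm (1 - herm_prod z x) ^ (2 * N)) \<partial>ball_measure)"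
      using d by (intro nn_integral_eq_integral[symmetric] int) auto
    also have "\<dots> = (\<integral>\<^sup>+w. ennreal (d ^ N) * ennreal ((1 - (norm w)\<^sup>2) powr 0 * norm (1 - herm_prod z w) powr (- (real CARD('n) + 1 + 0 + (real CARD('n) + 1)))) \<partial>ball_measure)"
    proof (rule nn_integral_cong)
      fix w :: "complex^'n" assume "w \<in> space ball_measure"
      hence w: "norm w < 1" by simp
      have x: "norm (1 - herm_prod z w) > 0" by (rule norm_one_minus_herm_prod_pos[OF z w])
      have "norm (1 - herm_prod z w) powr (- (real (2 * N))) = 1 / norm (1 - herm_prod z w) powr (real (2 * N))" by (rule powr_minus_divide)
      also have "norm (1 - herm_prod z w) powr (real (2 * N)) = norm (1 - herm_prod z w) ^ (2 * N)" by (rule powr_realpow[OF x])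
      moreover have "- real (2 * N) = - (real CARD('n) + 1 + 0 + (real CARD('n) + 1))" by (simp add: N_def)
      ultimately have "norm (1 - herm_prod z w) powr (- (real CARD('n) + 1 + 0 + (real CARD('n) + 1))) = 1 / norm (1 - herm_prod z w) ^ (2 * N)"
        by (simp only:)
      moreover have "(1 - (norm w)\<^sup>2) powr 0 = 1" using one_minus_norm2_pos[OF w] by simp
      ultimately show "ennreal (d ^ N / norm (1 - herm_prod z w) ^ (2 * N)) = ennreal (d ^ N) * ennreal ((1 - (norm w)\<^sup>2) powr 0 * norm (1 - herm_prod z w) powr (- (real CARD('n) + 1 + 0 + (real CARD('n) + 1))))"
        using d by (simp add: ennreal_mult'[symmetric])
    qed
    also have "\<dots> = ennreal (d ^ N) * (\<integral>\<^sup>+w. ennreal ((1 - (norm w)\<^sup>2) powr 0 * norm (1 - herm_prod z w) powr (- (real CARD('n) + 1 + 0 + (real CARD('n) + 1)))) \<partial>ball_measure)"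
      by (rule nn_integral_cmult) measurable
    also have "\<dots> \<le> ennreal (d ^ N) * ennreal (C * d powr (- (real CARD('n) + 1)))"
      unfolding d_def by (rule mult_left_mono[OF C(2)[OF z]]) simp
    also have "\<dots> = ennreal C"
    proof -
      have "d powr (- (real N)) = 1 / d powr (real N)" by (rule powr_minus_divide)
      also have "d powr (real N) = d ^ N" by (rule powr_realpow[OF d])
      finally have "d powr (- (real CARD('n) + 1)) = 1 / d ^ N" by (simp add: N_def add.commute)
      thus ?thesis using d by (simp add: ennreal_mult'[symmetric])
    qed
    finally show ?thesis using C(1) by (simp add: d_def)
  qed
  show ?thesis
  proof (rule that[of "(U + 1) * C"])
    show "(U + 1) * C > 0" using U_nonneg C(1) by simp
    fix z \<eta> :: "complex^'n" and h :: "complex \<Rightarrow> complex" and B :: real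
    assume z: "norm z < 1" and h [measurable]: "h \<in> borel_measurable borel" and hB: "\<And>\<tau>. norm \<tau> \<le> norm \<eta> \<Longrightarrow> norm (h \<tau>) \<le> B"
    have "norm (h 0) \<le> B" using hB[of 0] by simp
    hence B0: "B \<ge> 0" using norm_ge_zero[of "h 0"] by linarith
    define g where "g x = (1 - (norm z)\<^sup>2) ^ N / norm (1 - herm_prod z x) ^ (2 * N)" for x :: "complex^'n"
    have g0: "g x \<ge> 0" for x using one_minus_norm2_pos[OF z] by (simp add: g_def)
    have intg: "integrable ball_measure g"
      unfolding g_def
    proof (rule integrable_bounded_ball)
      fix x :: "complex^'n" assume "norm x < 1"
      thus "norm ((1 - (norm z)\<^sup>2) ^ N / norm (1 - herm_prod z x) ^ (2 * N)) \<le> (1 / (1 - norm z) ^ (2 * N))"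
        using density_bound[OF z, of x N] unfolding norm_of_real by simp
    qed measurable
    have inth: "integrable ball_measure (\<lambda>x. of_real (g x) * h (herm_prod \<eta> (mobius z x)))"
      unfolding g_def N_def by (rule mobius_mean_integrand_integrable[OF z h hB])
    have "norm (mobius_mean z \<eta> h) \<le> U * (LINT x|ball_measure. norm (of_real (g x) * h (herm_prod \<eta> (mobius z x))))"
      unfolding mobius_mean_def g_def[symmetric] N_def[symmetric] by (rule u_integral(2)[OF inth])
    also have "\<dots> \<le> U * (LINT x|ball_measure. g x * B)"
    proof (intro mult_left_mono integral_mono integrable_norm inth integrable_mult_left intg U_nonneg)
      fix x :: "complex^'n" assume "x \<in> space ball_measure"
      hence "norm x < 1" by simp
      thus "norm (of_real (g x) * h (herm_prod \<eta> (mobius z x))) \<le> g x * B"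
        unfolding norm_mult using g0[of x] by (intro mult_mono hB norm_herm_mobius_le[OF z]) auto
    qed
    also have "\<dots> = U * (LINT x|ball_measure. g x) * B" by simp
    also have "\<dots> \<le> (U + 1) * C * B"
      using mass[OF z] U_nonneg B0 g0 C(1) unfolding g_def[symmetric] by (intro mult_right_mono mult_mono) auto
    finally show "norm (mobius_mean z \<eta> h) \<le> (U + 1) * C * B" .
  qed
qed

text \<open>With \<open>w = \<phi>\<^sub>z(\<eta>)\<close>, \<open>mobius_herm\<close> splits off \<open>1 - <z,x>\<close> from \<open>1 - <w,x>\<close>. This factor combines with the
kernel at \<open>z\<close> into the density, and what remains is constant in \<open>x\<close> except for the function of \<open><\<eta>, \<phi>\<^sub>z(x)>\<close>.\<close>

lemma toeplitz_kernel_eq_mobius_mean: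
  assumes z: "norm z < 1" and \<eta>: "norm \<eta> < 1"
  shows "norm (toeplitz_kernel z (mobius z \<eta>)) = norm (mobius_mean z \<eta> (\<lambda>\<tau>. 1 / (1 - \<tau>) ^ (CARD('n) + 1))) / norm (1 - herm_prod z (mobius z \<eta>)) ^ (CARD('n) + 1)"
proof -
  define N where "N = CARD('n) + 1"
  define d where "d = 1 - (norm z)\<^sup>2"
  have d: "d > 0" unfolding d_def by (rule one_minus_norm2_pos[OF z])
  define e where "e = 1 - herm_prod \<eta> z"
  have e: "e \<noteq> 0" unfolding e_def by (rule one_minus_herm_prod_nonzero(1)) (use z \<eta> in auto)
  have integrand: "1 / ((1 - herm_prod x z) ^ N * (1 - herm_prod (mobius z \<eta>) x) ^ N)
      = (e ^ N / of_real d ^ N) * (of_real (d ^ N / norm (1 - herm_prod z x) ^ (2 * N)) * (1 / (1 - herm_prod \<eta> (mobius z x)) ^ N))"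
    if x: "norm x < 1" for x
  proof -
    have "1 - herm_prod (mobius z \<eta>) x = (1 - herm_prod \<eta> (mobius z x)) * (1 - herm_prod z x) / e"
      unfolding e_def by (rule mobius_herm) (use one_minus_herm_prod_nonzero(1)[of \<eta> z] one_minus_herm_prod_nonzero(1)[of x z] x z \<eta> in auto)
    moreover have "(1 - herm_prod x z) ^ N * (1 - herm_prod z x) ^ N = of_real (norm (1 - herm_prod z x) ^ (2 * N))"
    proof -
      have "(1 - herm_prod x z) * (1 - herm_prod z x) = of_real ((norm (1 - herm_prod z x))\<^sup>2)"
        unfolding complex_norm_square by (simp add: cnj_herm_prod mult.commute)
      thus ?thesis unfolding power_mult_distrib[symmetric] by (simp add: power_mult)
    qed
    ultimately have "(1 - herm_prod x z) ^ N * (1 - herm_prod (mobius z \<eta>) x) ^ N = (1 - herm_prod \<eta> (mobius z x)) ^ N * of_real (norm (1 - herm_prod z x) ^ (2 * N)) / e ^ N"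
      by (simp add: power_divide power_mult_distrib mult_ac)
    thus ?thesis using e d by (simp only: of_real_divide of_real_power) (simp add: divide_simps)
  qed
  have "toeplitz_kernel z (mobius z \<eta>) = (LINT x|ball_measure. (e ^ N / of_real d ^ N) * (u x * (of_real (d ^ N / norm (1 - herm_prod z x) ^ (2 * N)) * (1 / (1 - herm_prod \<eta> (mobius z x)) ^ N))))"
    unfolding toeplitz_kernel_def N_def[symmetric]
    by (intro Bochner_Integration.integral_cong refl) (simp only: integrand space_ball_measure mem_ball_0 mult.left_commute)
  also have "\<dots> = (e ^ N / of_real d ^ N) * mobius_mean z \<eta> (\<lambda>\<tau>. 1 / (1 - \<tau>) ^ N)"
    unfolding mobius_mean_def N_def[symmetric] d_def[symmetric] by (rule integral_mult_right_zero)
  finally have 1: "norm (toeplitz_kernel z (mobius z \<eta>)) = norm e ^ N / d ^ N * norm (mobius_mean z \<eta> (\<lambda>\<tau>. 1 / (1 - \<tau>) ^ N))"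
    using d by (simp add: norm_mult norm_divide norm_power)
  have "norm (1 - herm_prod z (mobius z \<eta>)) = d / norm e"
    unfolding norm_one_minus_herm_prod_commute[of z] mobius_herm_centre[OF z \<eta>] using d
    by (simp add: norm_divide d_def e_def del: of_real_diff)
  thus ?thesis unfolding 1 N_def[symmetric] using e d by (simp add: power_divide)
qed

text \<open>The same substitution as in \<open>toeplitz_kernel_eq_mobius_mean\<close>, with both arguments of the kernel equal to
\<open>\<phi>\<^sub>z(l \<eta>)\<close>. The normalization of the diagonal cancels every factor except \<open>1 - |l \<eta>|^2\<close>.\<close>

lemma toeplitz_kernel_diag_mobius:
  assumes z: "norm z < 1" and \<eta>: "norm \<eta> < 1" and l: "norm l \<le> 1"
  shows "toeplitz_kernel (mobius z (l *s \<eta>)) (mobius z (l *s \<eta>)) * of_real ((1 - (norm (mobius z (l *s \<eta>)))\<^sup>2) ^ (CARD('n) + 1))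
    = of_real ((1 - (norm (l *s \<eta>))\<^sup>2) ^ (CARD('n) + 1)) * mobius_mean z \<eta> (\<lambda>\<tau>. 1 / of_real (norm (1 - l * \<tau>) ^ (2 * (CARD('n) + 1))))"
proof -
  define N where "N = CARD('n) + 1"
  define \<zeta> where "\<zeta> = l *s \<eta>"
  have \<zeta>: "norm \<zeta> < 1" unfolding \<zeta>_def norm_smult using l \<eta> mult_left_le_one_le[of "norm \<eta>" "norm l"] by simp
  define v where "v = mobius z \<zeta>"
  define d where "d = 1 - (norm z)\<^sup>2"
  define dv where "dv = 1 - (norm v)\<^sup>2"
  define d\<zeta> where "d\<zeta> = 1 - (norm \<zeta>)\<^sup>2"
  define e where "e = norm (1 - herm_prod z \<zeta>)"
  have pos: "d > 0" "d\<zeta> > 0" "e > 0"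
    unfolding d_def d\<zeta>_def e_def using one_minus_norm2_pos norm_one_minus_herm_prod_pos z \<zeta> by auto
  have dv: "dv = d * d\<zeta> / e\<^sup>2"
    unfolding dv_def v_def one_minus_norm2_mobius[OF z \<zeta>] rho_def d_def d\<zeta>_def e_def ..
  have integrand: "(1 / ((1 - herm_prod x v) ^ N * (1 - herm_prod v x) ^ N)) * of_real (dv ^ N)
      = of_real (d\<zeta> ^ N) * (of_real (d ^ N / norm (1 - herm_prod z x) ^ (2 * N)) * (1 / of_real (norm (1 - l * herm_prod \<eta> (mobius z x)) ^ (2 * N))))"
    if x: "norm x < 1" for x
  proof -
    define X where "X = norm (1 - herm_prod z x)"
    define T where "T = norm (1 - l * herm_prod \<eta> (mobius z x))"
    have X: "X > 0" unfolding X_def by (rule norm_one_minus_herm_prod_pos[OF z x])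
    have "1 - herm_prod v x = (1 - herm_prod \<zeta> (mobius z x)) * (1 - herm_prod z x) / (1 - herm_prod \<zeta> z)"
      unfolding v_def by (rule mobius_herm) (use one_minus_herm_prod_nonzero(1)[of \<zeta> z] one_minus_herm_prod_nonzero(1)[of x z] x z \<zeta> in auto)
    hence nv: "norm (1 - herm_prod v x) = T * X / e"
      unfolding e_def norm_one_minus_herm_prod_commute[of z \<zeta>] by (simp add: norm_mult norm_divide T_def X_def \<zeta>_def herm_prod_smult_left)
    have "(1 - herm_prod x v) * (1 - herm_prod v x) = of_real ((norm (1 - herm_prod v x))\<^sup>2)"
      unfolding complex_norm_square by (simp add: cnj_herm_prod mult.commute)
    hence "(1 - herm_prod x v) ^ N * (1 - herm_prod v x) ^ N = of_real (((T * X / e)\<^sup>2) ^ N)"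
      unfolding power_mult_distrib[symmetric] nv by simp
    hence "(1 / ((1 - herm_prod x v) ^ N * (1 - herm_prod v x) ^ N)) * of_real (dv ^ N) = of_real (1 / ((T * X / e)\<^sup>2) ^ N * dv ^ N)"
      by simp
    also have "1 / ((T * X / e)\<^sup>2) ^ N * dv ^ N = d\<zeta> ^ N * (d ^ N / X ^ (2 * N) * (1 / T ^ (2 * N)))"
    proof -
      have "1 / ((T * X / e)\<^sup>2) ^ N * dv ^ N = (1 / (T * X / e)\<^sup>2 * dv) ^ N" by (simp add: power_mult_distrib power_divide)
      also have "1 / (T * X / e)\<^sup>2 * dv = d\<zeta> * (d / X\<^sup>2 * (1 / T\<^sup>2))"
        unfolding dv using pos by (simp add: power_mult_distrib power_divide mult.commute)
      finally show ?thesis unfolding power_mult[of _ 2 N] by (simp only: power_mult_distrib power_divide power_one)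
    qed
    finally show ?thesis unfolding X_def T_def by simp
  qed
  have "toeplitz_kernel v v * of_real (dv ^ N) = (LINT x|ball_measure. u x * (1 / ((1 - herm_prod x v) ^ N * (1 - herm_prod v x) ^ N)) * of_real (dv ^ N))"
    unfolding toeplitz_kernel_def N_def[symmetric] by (rule integral_mult_left_zero[symmetric])
  also have "\<dots> = (LINT x|ball_measure. of_real (d\<zeta> ^ N) * (u x * (of_real (d ^ N / norm (1 - herm_prod z x) ^ (2 * N)) * (1 / of_real (norm (1 - l * herm_prod \<eta> (mobius z x)) ^ (2 * N))))))"
    by (intro Bochner_Integration.integral_cong refl) (simp only: integrand space_ball_measure mem_ball_0 mult.left_commute mult.assoc)
  also have "\<dots> = of_real (d\<zeta> ^ N) * mobius_mean z \<eta> (\<lambda>\<tau>. 1 / of_real (norm (1 - l * \<tau>) ^ (2 * N)))"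
    unfolding mobius_mean_def N_def[symmetric] d_def[symmetric] by (rule integral_mult_right_zero)
  finally show ?thesis by (simp only: v_def \<zeta>_def N_def dv_def d\<zeta>_def)
qed

text \<open>Linearity of the mean along the list. Boundedness and measurability of the combination are
carried through the induction because linearity needs integrable summands.\<close>

lemma mobius_mean_sum_list:
  assumes z: "norm z < 1" and \<eta>: "norm \<eta> < 1" and L: "\<forall>(c, l)\<in>set L. norm l \<le> 1"
    and b: "\<And>c l. (c, l) \<in> set L \<Longrightarrow> norm (mobius_mean z \<eta> (\<lambda>\<tau>. 1 / of_real (norm (1 - l * \<tau>) ^ (2 * N)))) \<le> \<beta>"
  shows "norm (mobius_mean z \<eta> (\<lambda>\<tau>. (\<Sum>(c, l)\<leftarrow>L. c / of_real (norm (1 - l * \<tau>) ^ (2 * N))))) \<le> (\<Sum>(c, l)\<leftarrow>L. norm c) * \<beta>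
    \<and> (\<exists>B. \<forall>\<tau>. norm \<tau> \<le> norm \<eta> \<longrightarrow> norm (\<Sum>(c, l)\<leftarrow>L. c / complex_of_real (norm (1 - l * \<tau>) ^ (2 * N))) \<le> B)
    \<and> (\<lambda>\<tau>. (\<Sum>(c, l)\<leftarrow>L. c / complex_of_real (norm (1 - l * \<tau>) ^ (2 * N)))) \<in> borel_measurable borel"
  using L b
proof (induction L)
  case Nil
  show ?case by (auto simp: mobius_mean_def intro: exI[of _ 0])
next
  case (Cons cl L)
  obtain c l where cl: "cl = (c, l)" by (cases cl)
  define S where "S \<tau> = (\<Sum>(c, l)\<leftarrow>L. c / complex_of_real (norm (1 - l * \<tau>) ^ (2 * N)))" for \<tau>
  define h where "h \<tau> = 1 / complex_of_real (norm (1 - l * \<tau>) ^ (2 * N))" for \<tau>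
  have l: "norm l \<le> 1" using Cons.prems cl by auto
  have IH: "norm (mobius_mean z \<eta> S) \<le> (\<Sum>(c, l)\<leftarrow>L. norm c) * \<beta>" "\<exists>B. \<forall>\<tau>. norm \<tau> \<le> norm \<eta> \<longrightarrow> norm (S \<tau>) \<le> B" "S \<in> borel_measurable borel"
    using Cons.IH Cons.prems unfolding S_def[abs_def] by auto
  obtain B where B: "\<And>\<tau>. norm \<tau> \<le> norm \<eta> \<Longrightarrow> norm (S \<tau>) \<le> B" using IH(2) by blast
  have hm [measurable]: "h \<in> borel_measurable borel" unfolding h_def by measurable
  have hB: "norm (h \<tau>) \<le> 1 / (1 - norm \<eta>) ^ (2 * N)" if "norm \<tau> \<le> norm \<eta>" for \<tau>
  proof -
    have "norm (l * \<tau>) \<le> norm \<eta>" using that l mult_left_le_one_le[of "norm \<tau>" "norm l"] by (simp add: norm_mult)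
    hence "1 - norm \<eta> \<le> norm (1 - l * \<tau>)" using norm_triangle_ineq2[of 1 "l * \<tau>"] by simp
    hence "(1 - norm \<eta>) ^ (2 * N) \<le> norm (1 - l * \<tau>) ^ (2 * N)" using \<eta> by (intro power_mono) auto
    hence "1 / norm (1 - l * \<tau>) ^ (2 * N) \<le> 1 / (1 - norm \<eta>) ^ (2 * N)" using \<eta> by (intro frac_le) auto
    thus ?thesis by (simp add: h_def norm_divide norm_power)
  qed
  have eq: "(\<Sum>(c, l)\<leftarrow>cl # L. c / complex_of_real (norm (1 - l * \<tau>) ^ (2 * N))) = c * h \<tau> + S \<tau>" for \<tau>
    by (simp add: cl S_def h_def)
  have J: "mobius_mean z \<eta> (\<lambda>\<tau>. c * h \<tau> + S \<tau>) = c * mobius_mean z \<eta> h + mobius_mean z \<eta> S"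
  proof -
    define D where "D x = complex_of_real ((1 - (norm z)\<^sup>2) ^ (CARD('n) + 1) / norm (1 - herm_prod z x) ^ (2 * (CARD('n) + 1)))" for x
    let ?t = "\<lambda>x. herm_prod \<eta> (mobius z x)"
    have i1: "integrable ball_measure (\<lambda>x. u x * (D x * h (?t x)))"
      unfolding D_def by (rule u_integral(1)[OF mobius_mean_integrand_integrable[OF z hm hB]])
    have i2: "integrable ball_measure (\<lambda>x. u x * (D x * S (?t x)))"
      unfolding D_def by (rule u_integral(1)[OF mobius_mean_integrand_integrable[OF z IH(3) B]])
    have "mobius_mean z \<eta> (\<lambda>\<tau>. c * h \<tau> + S \<tau>) = (LINT x|ball_measure. c * (u x * (D x * h (?t x))) + u x * (D x * S (?t x)))"
      unfolding mobius_mean_def D_def[symmetric] by (intro Bochner_Integration.integral_cong refl) (simp add: algebra_simps)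
    also have "\<dots> = c * (LINT x|ball_measure. u x * (D x * h (?t x))) + (LINT x|ball_measure. u x * (D x * S (?t x)))"
      using i1 i2 by (simp only: Bochner_Integration.integral_add integrable_mult_right integral_mult_right_zero)
    finally show ?thesis unfolding mobius_mean_def D_def[symmetric] .
  qed
  have "norm (mobius_mean z \<eta> (\<lambda>\<tau>. c * h \<tau> + S \<tau>)) \<le> norm c * \<beta> + (\<Sum>(c, l)\<leftarrow>L. norm c) * \<beta>"
    unfolding J
  proof (rule order_trans[OF norm_triangle_ineq], rule add_mono[OF _ IH(1)])
    have "norm (mobius_mean z \<eta> h) \<le> \<beta>" using Cons.prems(2)[of c l] unfolding h_def cl by auto
    thus "norm (c * mobius_mean z \<eta> h) \<le> norm c * \<beta>" unfolding norm_mult by (rule mult_left_mono) simp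
  qed
  moreover have "norm (c * h \<tau> + S \<tau>) \<le> norm c * (1 / (1 - norm \<eta>) ^ (2 * N)) + B" if "norm \<tau> \<le> norm \<eta>" for \<tau>
    by (rule order_trans[OF norm_triangle_ineq], rule add_mono[OF _ B[OF that]]) (unfold norm_mult, rule mult_left_mono[OF hB[OF that]], simp)
  moreover have "(\<lambda>\<tau>. c * h \<tau> + S \<tau>) \<in> borel_measurable borel" using IH(3) by measurable
  ultimately show ?case unfolding eq by (auto simp: cl distrib_right)
qed

text \<open>Off-diagonal values of the Toeplitz kernel are means of \<open>(1 - \<tau>)^(-N)\<close>, diagonal values are means of
\<open>|1 - l \<tau>|^(-2 N)\<close>. Approximating the former by the latter on \<open>|\<tau>| \<le> R\<close> costs a small multiple of the bounded mass, and
the approximating combination is a fixed finite one, so its mean is small as soon as \<open>|z|\<close> is close to 1.\<close>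

theorem toeplitz_kernel_small:
  assumes lim: "\<And>\<epsilon>. \<epsilon> > 0 \<Longrightarrow> \<exists>r<1. \<forall>z. r < norm z \<longrightarrow> norm z < 1 \<longrightarrow> norm (toeplitz_kernel z z * of_real ((1 - (norm z)\<^sup>2) ^ (CARD('n) + 1))) \<le> \<epsilon>"
    and \<delta>: "0 < \<delta>" "\<delta> < 1" and \<epsilon>: "\<epsilon> > 0"
  shows "\<exists>r<1. \<forall>z w. r < norm z \<longrightarrow> norm z < 1 \<longrightarrow> norm w < 1 \<longrightarrow> rho z w \<ge> \<delta> \<longrightarrow> norm (toeplitz_kernel z w) \<le> \<epsilon> * bkernel 0 z w"
proof -
  define N where "N = CARD('n) + 1"
  define R where "R = sqrt (1 - \<delta>)"
  have R: "0 \<le> R" "R < 1" "R\<^sup>2 = 1 - \<delta>" using \<delta> by (auto simp: R_def real_sqrt_lt_1_iff)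
  obtain C where C: "C > 0" "\<And>z \<eta> h B. norm z < 1 \<Longrightarrow> h \<in> borel_measurable borel \<Longrightarrow> (\<And>\<tau>. norm \<tau> \<le> norm \<eta> \<Longrightarrow> norm (h \<tau>) \<le> B)
    \<Longrightarrow> norm (mobius_mean z \<eta> h) \<le> C * B" using mobius_mean_bound by blast
  have "approximable N R (\<lambda>\<tau>. 1 / (1 - \<tau>) ^ N)" unfolding N_def by (rule approximable_bergman_kernel[OF R(1,2)])
  moreover have "\<epsilon> / (2 * C) > 0" using \<epsilon> C(1) by simp
  ultimately obtain L where L: "\<forall>(c, l)\<in>set L. norm l \<le> 1"
    "\<And>\<tau>. norm \<tau> \<le> R \<Longrightarrow> norm (1 / (1 - \<tau>) ^ N - (\<Sum>(c, l)\<leftarrow>L. c / complex_of_real (norm (1 - l * \<tau>) ^ (2 * N)))) \<le> \<epsilon> / (2 * C)"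
    unfolding approximable_def by blast
  define A where "A = (\<Sum>(c, l)\<leftarrow>L. norm c)"
  have A: "A \<ge> 0" unfolding A_def by (induction L) auto
  define \<epsilon>' where "\<epsilon>' = \<delta> ^ N * (\<epsilon> / (2 * (A + 1)))"
  have \<epsilon>': "\<epsilon>' > 0" using \<delta> \<epsilon> A by (simp add: \<epsilon>'_def)
  obtain r0 where r0: "r0 < 1" "\<And>z. r0 < norm z \<Longrightarrow> norm z < 1 \<Longrightarrow> norm (toeplitz_kernel z z * of_real ((1 - (norm z)\<^sup>2) ^ N)) \<le> \<epsilon>'"
    using lim[OF \<epsilon>'] unfolding N_def by blast
  define r1 where "r1 = max r0 0"
  have r1: "0 \<le> r1" "r1 < 1" using r0(1) by (auto simp: r1_def)
  \<comment> \<open>chosen such that \<open>1 - |z|^2 < \<gamma>\<close> forces \<open>|\<phi>\<^sub>z(\<zeta>)| > r1\<close> for all \<open>\<zeta>\<close> of norm at most \<open>R\<close>\<close>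
  define \<gamma> where "\<gamma> = (1 - r1\<^sup>2) * (1 - R)\<^sup>2"
  have r1s: "r1\<^sup>2 < 1" using r1 by (simp add: power_less_one_iff)
  have \<gamma>: "0 < \<gamma>" "\<gamma> \<le> 1"
  proof -
    show "0 < \<gamma>" using r1s R by (simp add: \<gamma>_def)
    have "(1 - R)\<^sup>2 \<le> 1" using R by (intro power_le_one) auto
    thus "\<gamma> \<le> 1" unfolding \<gamma>_def using r1s by (intro mult_le_one) auto
  qed
  define r where "r = sqrt (1 - \<gamma>)"
  have r: "r < 1" "0 \<le> r" "r\<^sup>2 = 1 - \<gamma>" using \<gamma> by (auto simp: r_def real_sqrt_lt_1_iff)
  show ?thesis
  proof (intro exI[of _ r] conjI r(1) allI impI)
    fix z w :: "complex^'n" assume rz: "r < norm z" and z: "norm z < 1" and w: "norm w < 1" and \<rho>: "rho z w \<ge> \<delta>"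
    have dz: "1 - (norm z)\<^sup>2 < \<gamma>"
    proof -
      have "r\<^sup>2 < (norm z)\<^sup>2" using rz r(2) by (intro power_strict_mono) auto
      thus ?thesis using r(3) by simp
    qed
    define \<eta> where "\<eta> = mobius z w"
    have \<eta>1: "norm \<eta> < 1" unfolding \<eta>_def by (rule norm_mobius_less_1[OF z w])
    have w_eq: "w = mobius z \<eta>" unfolding \<eta>_def by (rule mobius_involution[OF z w, symmetric])
    \<comment> \<open>1 - |\<eta>|^2 is rho z w, which is at least \<delta> = 1 - R^2\<close>
    have \<eta>R: "norm \<eta> \<le> R"
    proof -
      have "(norm \<eta>)\<^sup>2 \<le> R\<^sup>2" using one_minus_norm2_mobius[OF z w] \<rho> R(3) by (simp add: \<eta>_def)
      thus ?thesis using R(1) by (simp add: power2_le_iff_abs_le abs_le_square_iff[symmetric])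
    qed
    have diag: "norm (mobius_mean z \<eta> (\<lambda>\<tau>. 1 / of_real (norm (1 - l * \<tau>) ^ (2 * N)))) \<le> \<epsilon>' / \<delta> ^ N" if l: "norm l \<le> 1" for l
    proof -
      define \<zeta> where "\<zeta> = l *s \<eta>"
      have \<zeta>R: "norm \<zeta> \<le> R" unfolding \<zeta>_def norm_smult using l \<eta>R mult_left_le_one_le[of "norm \<eta>" "norm l"] by simp
      hence \<zeta>: "norm \<zeta> < 1" using R by simp
      have d\<zeta>: "1 - (norm \<zeta>)\<^sup>2 \<ge> \<delta>"
        using power_mono[OF \<zeta>R, of 2] R(3) by simp
      define v where "v = mobius z \<zeta>"
      have v1: "norm v < 1" unfolding v_def by (rule norm_mobius_less_1[OF z \<zeta>])
      have "1 - (norm v)\<^sup>2 < 1 - r1\<^sup>2"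
      proof -
        have x: "1 - R \<le> norm (1 - herm_prod z \<zeta>)"
        proof -
          have "norm (herm_prod z \<zeta>) \<le> R" using norm_herm_prod_le[of z \<zeta>] \<zeta>R z mult_left_le_one_le[of "norm \<zeta>" "norm z"] by simp
          thus ?thesis using norm_triangle_ineq2[of 1 "herm_prod z \<zeta>"] by simp
        qed
        have "1 - (norm v)\<^sup>2 = (1 - (norm z)\<^sup>2) * (1 - (norm \<zeta>)\<^sup>2) / (norm (1 - herm_prod z \<zeta>))\<^sup>2"
          unfolding v_def one_minus_norm2_mobius[OF z \<zeta>] rho_def ..
        also have "\<dots> \<le> (1 - (norm z)\<^sup>2) / (1 - R)\<^sup>2"
          using R x one_minus_norm2_pos[OF z] one_minus_norm2_pos[OF \<zeta>] by (intro frac_le power_mono) (auto simp: mult_left_le)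
        also have "\<dots> < \<gamma> / (1 - R)\<^sup>2" using dz R by (intro divide_strict_right_mono) auto
        also have "\<dots> = 1 - r1\<^sup>2" using R by (simp add: \<gamma>_def)
        finally show ?thesis .
      qed
      hence "r1 < norm v" by (intro power_less_imp_less_base[of r1 2]) auto
      hence "norm (toeplitz_kernel v v * of_real ((1 - (norm v)\<^sup>2) ^ N)) \<le> \<epsilon>'" using v1 by (intro r0(2)) (auto simp: r1_def)
      also have "toeplitz_kernel v v * of_real ((1 - (norm v)\<^sup>2) ^ N) = of_real ((1 - (norm \<zeta>)\<^sup>2) ^ N) * mobius_mean z \<eta> (\<lambda>\<tau>. 1 / of_real (norm (1 - l * \<tau>) ^ (2 * N)))"
        unfolding v_def \<zeta>_def N_def by (rule toeplitz_kernel_diag_mobius[OF z \<eta>1 l])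
      finally have "(1 - (norm \<zeta>)\<^sup>2) ^ N * norm (mobius_mean z \<eta> (\<lambda>\<tau>. 1 / of_real (norm (1 - l * \<tau>) ^ (2 * N)))) \<le> \<epsilon>'"
        unfolding norm_mult norm_of_real using one_minus_norm2_pos[OF \<zeta>] by simp
      moreover have "\<delta> ^ N * norm (mobius_mean z \<eta> (\<lambda>\<tau>. 1 / of_real (norm (1 - l * \<tau>) ^ (2 * N)))) \<le> (1 - (norm \<zeta>)\<^sup>2) ^ N * norm (mobius_mean z \<eta> (\<lambda>\<tau>. 1 / of_real (norm (1 - l * \<tau>) ^ (2 * N))))"
        using d\<zeta> \<delta> by (intro mult_right_mono power_mono) auto
      ultimately show ?thesis using \<delta> by (simp add: pos_le_divide_eq mult.commute)
    qed
    define S where "S \<tau> = (\<Sum>(c, l)\<leftarrow>L. c / complex_of_real (norm (1 - l * \<tau>) ^ (2 * N)))" for \<tau>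
    define h where "h \<tau> = 1 / (1 - \<tau>) ^ N" for \<tau> :: complex
    have SL: "norm (mobius_mean z \<eta> S) \<le> A * (\<epsilon>' / \<delta> ^ N)" "\<exists>B. \<forall>\<tau>. norm \<tau> \<le> norm \<eta> \<longrightarrow> norm (S \<tau>) \<le> B" "S \<in> borel_measurable borel"
      using mobius_mean_sum_list[OF z \<eta>1 L(1), of N "\<epsilon>' / \<delta> ^ N"] diag L(1) unfolding S_def[abs_def] A_def by fastforce+
    note SL(3)[measurable]
    have hm [measurable]: "h \<in> borel_measurable borel" unfolding h_def by measurable
    obtain B where B: "\<And>\<tau>. norm \<tau> \<le> norm \<eta> \<Longrightarrow> norm (S \<tau>) \<le> B" using SL(2) by blast
    have hS: "norm (h \<tau> - S \<tau>) \<le> \<epsilon> / (2 * C)" if "norm \<tau> \<le> norm \<eta>" for \<tau>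
      using L(2)[of \<tau>] that \<eta>R by (simp add: h_def S_def)
    have hB: "norm (h \<tau>) \<le> B + \<epsilon> / (2 * C)" if "norm \<tau> \<le> norm \<eta>" for \<tau>
      using hS[OF that] B[OF that] norm_triangle_ineq[of "S \<tau>" "h \<tau> - S \<tau>"] by simp
    have J: "mobius_mean z \<eta> h = mobius_mean z \<eta> (\<lambda>\<tau>. h \<tau> - S \<tau>) + mobius_mean z \<eta> S"
    proof -
      define D where "D x = complex_of_real ((1 - (norm z)\<^sup>2) ^ (CARD('n) + 1) / norm (1 - herm_prod z x) ^ (2 * (CARD('n) + 1)))" for x
      let ?t = "\<lambda>x. herm_prod \<eta> (mobius z x)"
      have i1: "integrable ball_measure (\<lambda>x. u x * (D x * (h (?t x) - S (?t x))))"
        unfolding D_def by (rule u_integral(1)[OF mobius_mean_integrand_integrable[where h = "\<lambda>\<tau>. h \<tau> - S \<tau>", OF z _ hS]]) measurable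
      have i2: "integrable ball_measure (\<lambda>x. u x * (D x * S (?t x)))"
        unfolding D_def by (rule u_integral(1)[OF mobius_mean_integrand_integrable[OF z SL(3) B]])
      have "mobius_mean z \<eta> h = (LINT x|ball_measure. u x * (D x * (h (?t x) - S (?t x))) + u x * (D x * S (?t x)))"
        unfolding mobius_mean_def D_def[symmetric] by (intro Bochner_Integration.integral_cong refl) (simp add: algebra_simps)
      also have "\<dots> = (LINT x|ball_measure. u x * (D x * (h (?t x) - S (?t x)))) + (LINT x|ball_measure. u x * (D x * S (?t x)))"
        by (rule Bochner_Integration.integral_add[OF i1 i2])
      finally show ?thesis unfolding mobius_mean_def D_def[symmetric] .
    qed
    have "norm (mobius_mean z \<eta> (\<lambda>\<tau>. h \<tau> - S \<tau>)) \<le> C * (\<epsilon> / (2 * C))"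
      by (rule C(2)[OF z _ hS]) measurable
    hence J1: "norm (mobius_mean z \<eta> (\<lambda>\<tau>. h \<tau> - S \<tau>)) \<le> \<epsilon> / 2" using C(1) by simp
    have "\<epsilon>' / \<delta> ^ N = \<epsilon> / (2 * (A + 1))" using \<delta> by (simp add: \<epsilon>'_def)
    moreover have "A * (\<epsilon> / (2 * (A + 1))) \<le> (A + 1) * (\<epsilon> / (2 * (A + 1)))" using A \<epsilon> by (intro mult_right_mono) auto
    ultimately have "A * (\<epsilon>' / \<delta> ^ N) \<le> (A + 1) * (\<epsilon> / (2 * (A + 1)))" by simp
    also have "\<dots> = \<epsilon> / 2" using A by (simp add: field_simps)
    finally have J2: "norm (mobius_mean z \<eta> S) \<le> \<epsilon> / 2" using SL(1) by linarith
    have J3: "norm (mobius_mean z \<eta> h) \<le> \<epsilon>" unfolding J using norm_triangle_ineq[of "mobius_mean z \<eta> (\<lambda>\<tau>. h \<tau> - S \<tau>)" "mobius_mean z \<eta> S"] J1 J2 by simp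
    have "norm (toeplitz_kernel z w) = norm (mobius_mean z \<eta> h) / norm (1 - herm_prod z w) ^ N"
      using toeplitz_kernel_eq_mobius_mean[OF z \<eta>1] w_eq[symmetric] unfolding h_def[abs_def] N_def by simp
    also have "\<dots> \<le> \<epsilon> / norm (1 - herm_prod z w) ^ N" using J3 by (rule divide_right_mono) simp
    also have "\<dots> = \<epsilon> * bkernel 0 z w" unfolding bkernel_0[OF z w] N_def by simp
    finally show "norm (toeplitz_kernel z w) \<le> \<epsilon> * bkernel 0 z w" .
  qed
qed

end

section \<open>Weighted Bergman spaces\<close>

text \<open>The p-th power of the norm without the normalizing constant of the weight, as an extended
nonnegative number. It is also applied to real functions that only bound a modulus.\<close>

definition Ip :: "real \<Rightarrow> real \<Rightarrow> (complex^'n \<Rightarrow> 'b::real_normed_vector) \<Rightarrow> ennreal" where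
  "Ip p b f = (\<integral>\<^sup>+z. ennreal (norm (f z) powr p * (1 - (norm z)\<^sup>2) powr b) \<partial>ball_measure)"

lemma Ip_add_le:
  fixes f g :: "complex^'n \<Rightarrow> 'b::real_normed_vector" and h :: "complex^'n \<Rightarrow> 'c::real_normed_vector"
  assumes p: "p > 0" and [measurable]: "(\<lambda>z. norm (f z)) \<in> borel_measurable ball_measure" "(\<lambda>z. norm (g z)) \<in> borel_measurable ball_measure"
    and h: "\<And>z. norm z < 1 \<Longrightarrow> norm (h z) \<le> norm (f z) + norm (g z)"
  shows "Ip p b h \<le> ennreal (2 powr p) * (Ip p b f + Ip p b g)"
proof -
  have pw: "norm (h z) powr p \<le> 2 powr p * (norm (f z) powr p + norm (g z) powr p)" if z: "norm z < 1" for z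
  proof -
    have "norm (h z) \<le> 2 * max (norm (f z)) (norm (g z))" using h[OF z] by simp
    hence "norm (h z) powr p \<le> (2 * max (norm (f z)) (norm (g z))) powr p" using p by (intro powr_mono2) auto
    also have "\<dots> = 2 powr p * (max (norm (f z)) (norm (g z))) powr p" by (simp add: powr_mult)
    also have "\<dots> \<le> 2 powr p * (norm (f z) powr p + norm (g z) powr p)"
      by (intro mult_left_mono) (auto simp: max_def)
    finally show ?thesis .
  qed
  have "Ip p b h \<le> (\<integral>\<^sup>+z. ennreal (2 powr p) * (ennreal (norm (f z) powr p * (1 - (norm z)\<^sup>2) powr b) + ennreal (norm (g z) powr p * (1 - (norm z)\<^sup>2) powr b)) \<partial>ball_measure)"
    unfolding Ip_def
  proof (rule nn_integral_mono)
    fix z :: "complex^'n" assume "z \<in> space ball_measure"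
    hence z: "norm z < 1" by simp
    have "norm (h z) powr p * (1 - (norm z)\<^sup>2) powr b \<le> 2 powr p * (norm (f z) powr p * (1 - (norm z)\<^sup>2) powr b + norm (g z) powr p * (1 - (norm z)\<^sup>2) powr b)"
      using mult_right_mono[OF pw[OF z], of "(1 - (norm z)\<^sup>2) powr b"] by (simp add: algebra_simps)
    thus "ennreal (norm (h z) powr p * (1 - (norm z)\<^sup>2) powr b) \<le> ennreal (2 powr p) * (ennreal (norm (f z) powr p * (1 - (norm z)\<^sup>2) powr b) + ennreal (norm (g z) powr p * (1 - (norm z)\<^sup>2) powr b))"
      by (simp add: ennreal_mult'[symmetric] ennreal_plus[symmetric] ennreal_leI del: ennreal_plus)
  qed
  also have "\<dots> = ennreal (2 powr p) * (Ip p b f + Ip p b g)"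
    unfolding Ip_def by (subst nn_integral_cmult, measurable, subst nn_integral_add) measurable
  finally show ?thesis .
qed

lemma weight_constant_pos:
  assumes "b > -1"
  shows "(LINT w|(ball_measure :: (complex^'n) measure). (1 - (norm w)\<^sup>2) powr b) > 0"
proof -
  have "(LINT w|(ball_measure :: (complex^'n) measure). (1 - (norm w)\<^sup>2) powr b) = fact CARD('n) * Gamma (b + 1) / Gamma (real CARD('n) + b + 1)"
    using integrable_weighted_moment(2)[OF assms, of "0 :: complex^'n" 0] by simp
  thus ?thesis using assms by (simp add: add_nonneg_pos)
qed

lemma weighted_integral_Ip:
  fixes f :: "complex^'n \<Rightarrow> complex"
  assumes b: "b > -1" and p: "p > 0" and [measurable]: "f \<in> borel_measurable ball_measure"
  defines "c \<equiv> (LINT w|(ball_measure :: (complex^'n) measure). (1 - (norm w)\<^sup>2) powr b)"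
  shows "integrable ball_measure (\<lambda>z. norm (f z) powr p * standard_weight b z) \<longleftrightarrow> Ip p b f < \<infinity>"
    and "Ip p b f < \<infinity> \<Longrightarrow> ennreal (c * weighted_norm p (standard_weight b) f powr p) = Ip p b f"
proof -
  have c: "c > 0" unfolding c_def by (rule weight_constant_pos[OF b])
  have sw: "norm (f z) powr p * standard_weight b z = (norm (f z) powr p * (1 - (norm z)\<^sup>2) powr b) / c" for z
    by (simp add: standard_weight_def c_def)
  have i1: "integrable ball_measure (\<lambda>z. norm (f z) powr p * (1 - (norm z)\<^sup>2) powr b) \<longleftrightarrow> Ip p b f < \<infinity>"
    unfolding Ip_def by (subst integrable_iff_bounded) (simp add: abs_mult)
  show "integrable ball_measure (\<lambda>z. norm (f z) powr p * standard_weight b z) \<longleftrightarrow> Ip p b f < \<infinity>"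
  proof -
    let ?X = "\<lambda>z. norm (f z) powr p * (1 - (norm z)\<^sup>2) powr b"
    have "integrable ball_measure ?X" if "integrable ball_measure (\<lambda>z. ?X z / c)"
      using integrable_mult_left[OF that, of c] c by simp
    moreover have "integrable ball_measure (\<lambda>z. ?X z / c)" if "integrable ball_measure ?X"
      by (rule integrable_divide_zero[OF that])
    ultimately have "integrable ball_measure (\<lambda>z. ?X z / c) \<longleftrightarrow> integrable ball_measure ?X" by blast
    thus ?thesis unfolding sw using i1 by (simp only:)
  qed
  assume fin: "Ip p b f < \<infinity>"
  let ?I = "LINT z|ball_measure. norm (f z) powr p * (1 - (norm z)\<^sup>2) powr b"
  have I0: "?I \<ge> 0" by simp
  have "weighted_norm p (standard_weight b) f = (?I / c) powr (1 / p)"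
    unfolding weighted_norm_def sw by simp
  hence "c * weighted_norm p (standard_weight b) f powr p = ?I"
    using p c I0 by (simp add: powr_powr)
  thus "ennreal (c * weighted_norm p (standard_weight b) f powr p) = Ip p b f"
    unfolding Ip_def using i1 fin by (simp add: nn_integral_eq_integral)
qed

locale weight_params =
  fixes p b :: real
  assumes p1: "1 < p" and b1: "-1 < b" and bp: "b < p - 1"
begin

definition q :: real where "q = p / (p - 1)"

lemma exponents: "q > 1" "1 / p + 1 / q = 1" "q > 0" "p > 0"
proof -
  show "p > 0" using p1 by simp
  show "q > 1" using p1 by (simp add: q_def less_divide_eq)
  thus "q > 0" by simp
  show "1 / p + 1 / q = 1" using p1 by (simp add: q_def add_divide_distrib[symmetric])
qed

lemma bergman_space_iff:
  "f \<in> bergman_space p (standard_weight b) \<longleftrightarrow> holomorphic_ball f \<and> Ip p b f < \<infinity>"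
  unfolding bergman_space_def using weighted_integral_Ip(1)[OF b1 exponents(4) holomorphic_ball_measurable[of f]] by blast

text \<open>The weight dual to \<open>(1 - |z|^2)^b\<close> is integrable precisely because \<open>b < p - 1\<close>.\<close>

lemma dual_weight_exponent: "- b * q / p > -1"
proof -
  have "b * q / p = b / (p - 1)" using p1 by (simp add: q_def)
  also have "\<dots> < 1" using p1 bp by (simp add: divide_less_eq)
  finally have "b * q / p < 1" .
  moreover have "- b * q / p = - (b * q / p)" by simp
  ultimately show ?thesis by linarith
qed

text \<open>Hoelder's inequality after distributing the weight as \<open>d^(b/p) d^(-b/p)\<close>.\<close>

lemma Hoelder_Ip:
  fixes f :: "complex^'n \<Rightarrow> 'b::real_normed_vector" and g :: "complex^'n \<Rightarrow> real"
  assumes [measurable]: "(\<lambda>z. norm (f z)) \<in> borel_measurable ball_measure" "g \<in> borel_measurable ball_measure"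
    and g: "\<And>z. g z \<ge> 0"
    and A: "Ip p b f \<le> ennreal A" "A \<ge> 0"
    and B: "(\<integral>\<^sup>+z. ennreal (g z powr q * (1 - (norm z)\<^sup>2) powr (- b * q / p)) \<partial>ball_measure) \<le> ennreal B" "B \<ge> 0"
  shows "(\<integral>\<^sup>+z. ennreal (norm (f z) * g z) \<partial>ball_measure) \<le> ennreal (A powr (1/p) * B powr (1/q))"
proof -
  define d where "d z = 1 - (norm z)\<^sup>2" for z :: "complex^'n"
  have [measurable]: "d \<in> borel_measurable ball_measure" unfolding d_def by measurable
  have dpos: "d z > 0" if "z \<in> space ball_measure" for z
    using that one_minus_norm2_pos[of z] by (simp add: d_def)
  have "(\<integral>\<^sup>+z. ennreal (norm (f z) * g z) \<partial>ball_measure) = (\<integral>\<^sup>+z. ennreal ((norm (f z) * d z powr (b / p)) * (g z * d z powr (- b / p))) \<partial>ball_measure)"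
  proof (rule nn_integral_cong)
    fix z :: "complex^'n" assume "z \<in> space ball_measure"
    hence "d z powr (b / p) * d z powr (- b / p) = 1" using dpos[of z] by (simp add: powr_add[symmetric])
    hence "norm (f z) * g z * (d z powr (b / p) * d z powr (- b / p)) = norm (f z) * g z" by simp
    thus "ennreal (norm (f z) * g z) = ennreal ((norm (f z) * d z powr (b / p)) * (g z * d z powr (- b / p)))"
      by (simp only: mult_ac)
  qed
  also have "\<dots> \<le> ennreal (A powr (1/p) * B powr (1/q))"
  proof (rule nn_integral_Hoelder[OF p1 exponents(1,2)])
    have "(\<integral>\<^sup>+z. ennreal ((norm (f z) * d z powr (b / p)) powr p) \<partial>ball_measure) = Ip p b f"
      unfolding Ip_def d_def[symmetric] using exponents by (intro nn_integral_cong) (simp add: powr_mult powr_powr)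
    thus "(\<integral>\<^sup>+z. ennreal ((norm (f z) * d z powr (b / p)) powr p) \<partial>ball_measure) \<le> ennreal A" using A by simp
    have "(\<integral>\<^sup>+z. ennreal ((g z * d z powr (- b / p)) powr q) \<partial>ball_measure) = (\<integral>\<^sup>+z. ennreal (g z powr q * d z powr (- b * q / p)) \<partial>ball_measure)"
      using exponents g by (intro nn_integral_cong) (simp add: powr_mult powr_powr)
    thus "(\<integral>\<^sup>+z. ennreal ((g z * d z powr (- b / p)) powr q) \<partial>ball_measure) \<le> ennreal B" using B by (simp add: d_def)
  qed (use A B g in auto)
  finally show ?thesis .
qed

lemma L1_embedding:
  obtains C where "C > 0" "\<And>(f :: complex^'n \<Rightarrow> 'b::real_normed_vector) A. (\<lambda>z. norm (f z)) \<in> borel_measurable ball_measure \<Longrightarrow>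
     Ip p b f \<le> ennreal A \<Longrightarrow> A \<ge> 0 \<Longrightarrow> (\<integral>\<^sup>+z. ennreal (norm (f z)) \<partial>ball_measure) \<le> ennreal (C * A powr (1/p))"
proof -
  define B where "B = (LINT z|(ball_measure :: (complex^'n) measure). (1 - (norm z)\<^sup>2) powr (- b * q / p))"
  have B0: "B > 0" unfolding B_def by (rule weight_constant_pos[OF dual_weight_exponent])
  have Beq: "(\<integral>\<^sup>+z. ennreal (1 powr q * (1 - (norm z)\<^sup>2) powr (- b * q / p)) \<partial>(ball_measure :: (complex^'n) measure)) = ennreal B"
  proof -
    have "(\<integral>\<^sup>+z. ennreal ((1 - (norm z)\<^sup>2) powr (- b * q / p)) \<partial>(ball_measure :: (complex^'n) measure)) = ennreal B"
      unfolding B_def by (rule nn_integral_eq_integral[OF integrable_weight[OF dual_weight_exponent]]) simp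
    thus ?thesis by simp
  qed
  show ?thesis
  proof (rule that[of "B powr (1/q)"])
    show "B powr (1/q) > 0" using B0 by simp
    fix f :: "complex^'n \<Rightarrow> 'b" and A
    assume f: "(\<lambda>z. norm (f z)) \<in> borel_measurable ball_measure" "Ip p b f \<le> ennreal A" "A \<ge> 0"
    show "(\<integral>\<^sup>+z. ennreal (norm (f z)) \<partial>ball_measure) \<le> ennreal (B powr (1/q) * A powr (1/p))"
      using Hoelder_Ip[OF f(1) _ _ f(2,3), of "\<lambda>_. 1" B] B0 Beq by (simp add: mult.commute)
  qed
qed

lemma bergman_space_integrable:
  fixes f :: "complex^'n \<Rightarrow> complex"
  assumes f: "f \<in> borel_measurable ball_measure" "Ip p b f < \<infinity>"
  shows "integrable ball_measure f"
proof -
  obtain C where C: "C > 0" "\<And>(f :: complex^'n \<Rightarrow> complex) A. (\<lambda>z. norm (f z)) \<in> borel_measurable ball_measure \<Longrightarrow>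
     Ip p b f \<le> ennreal A \<Longrightarrow> A \<ge> 0 \<Longrightarrow> (\<integral>\<^sup>+z. ennreal (norm (f z)) \<partial>ball_measure) \<le> ennreal (C * A powr (1/p))"
    using L1_embedding[where 'n='n and 'b=complex] by blast
  obtain A where A: "Ip p b f = ennreal A" "A \<ge> 0" using f(2) by (cases "Ip p b f") auto
  have "(\<lambda>z. norm (f z)) \<in> borel_measurable ball_measure" using f(1) by measurable
  from C(2)[OF this, of A] A have "(\<integral>\<^sup>+z. ennreal (norm (f z)) \<partial>ball_measure) < \<infinity>"
    by (auto simp: le_less_trans)
  thus ?thesis using f(1) by (simp add: integrable_iff_bounded)
qed

text \<open>The Schur test needs \<open>0 < s q < 1\<close> and \<open>0 < s p - b < 1\<close>, that is, \<open>s\<close> in the intersection of the intervals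
\<open>(0, 1/q)\<close> and \<open>(b/p, (b+1)/p)\<close>. They meet if and only if \<open>-1 < b < p - 1\<close>. The slack \<open>\<epsilon>\<close> admits the more singular kernels.\<close>

lemma schur_exponent:
  obtains s \<epsilon> where "0 < \<epsilon>" "\<epsilon> < s * q" "\<epsilon> < 1 - s * q" "\<epsilon> < s * p - b" "\<epsilon> < 1 - (s * p - b)"
proof -
  have iq: "1 / q = (p - 1) / p" using p1 by (simp add: q_def)
  have "max 0 (b / p) < min (1 / q) ((b + 1) / p)"
  proof -
    have "0 < (p - 1) / p" "0 < (b + 1) / p" using p1 b1 by auto
    moreover have "b / p < (p - 1) / p" "b / p < (b + 1) / p" using p1 bp by (auto intro: divide_strict_right_mono)
    ultimately show ?thesis unfolding iq by simp
  qed
  then obtain s where s: "max 0 (b / p) < s" "s < min (1 / q) ((b + 1) / p)" using dense by blast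
  have 1: "s * q > 0" "s * q < 1" "s * p - b > 0" "s * p - b < 1"
    using s exponents by (auto simp: field_simps)
  define \<epsilon> where "\<epsilon> = min (min (s * q) (1 - s * q)) (min (s * p - b) (1 - (s * p - b))) / 2"
  have "0 < \<epsilon>" "\<epsilon> < s * q" "\<epsilon> < 1 - s * q" "\<epsilon> < s * p - b" "\<epsilon> < 1 - (s * p - b)"
  proof -
    define m where "m = min (min (s * q) (1 - s * q)) (min (s * p - b) (1 - (s * p - b)))"
    have "0 < m" "m \<le> s * q" "m \<le> 1 - s * q" "m \<le> s * p - b" "m \<le> 1 - (s * p - b)"
      using 1 by (auto simp: m_def min_le_iff_disj)
    moreover have "\<epsilon> = m / 2" by (simp add: \<epsilon>_def m_def)
    ultimately show "0 < \<epsilon>" "\<epsilon> < s * q" "\<epsilon> < 1 - s * q" "\<epsilon> < s * p - b" "\<epsilon> < 1 - (s * p - b)" by linarith+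
  qed
  thus ?thesis by (rule that)
qed

end

lemma schur_bound_mono: "schur_bound \<alpha> M k \<Longrightarrow> M \<le> M' \<Longrightarrow> schur_bound \<alpha> M' k"
  unfolding schur_bound_def by (meson ennreal_leI mult_right_mono order_trans powr_ge_zero)

lemma kcomp_commute:
  assumes "\<And>z w. k z w = k w z" shows "kcomp k k z w = kcomp k k w z"
  unfolding kcomp_def by (intro nn_integral_cong) (metis assms mult.commute)

definition kb :: "real \<Rightarrow> complex^'n \<Rightarrow> complex^'n \<Rightarrow> ennreal" where
  "kb \<epsilon> z w = ennreal (bkernel \<epsilon> z w)"

lemma kb_eq: "kb \<epsilon> = (\<lambda>z w. ennreal (bkernel \<epsilon> z w))"
  by (simp add: kb_def fun_eq_iff)

lemma kb_commute: "kb \<epsilon> z w = kb \<epsilon> w z"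
  by (simp add: kb_def bkernel_commute)

lemma kmeas_kb: "kmeas (kb \<epsilon>)"
  using kmeas_bkernel[of \<epsilon>] by (simp add: kb_def)

context weight_params
begin

text \<open>One exponent \<open>s\<close> and one constant \<open>M\<close> serve the three kernels that occur: the Bergman kernel, its composition with
itself, and the composition of the more singular kernel with itself.\<close>

lemma schur_kernels:
  obtains s \<epsilon> M where "0 < \<epsilon>" "M > 0"
    "\<And>\<alpha>. \<alpha> = s * q \<or> \<alpha> = s * p - b \<Longrightarrow>
      schur_bound \<alpha> M (kb 0 :: complex^'n \<Rightarrow> complex^'n \<Rightarrow> ennreal) \<and>
      schur_bound \<alpha> M (kcomp (kb 0) (kb 0) :: complex^'n \<Rightarrow> complex^'n \<Rightarrow> ennreal) \<and>
      schur_bound \<alpha> M (kcomp (kb \<epsilon>) (kb \<epsilon>) :: complex^'n \<Rightarrow> complex^'n \<Rightarrow> ennreal)"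
proof -
  obtain s \<epsilon> where s: "0 < \<epsilon>" "\<epsilon> < s * q" "\<epsilon> < 1 - s * q" "\<epsilon> < s * p - b" "\<epsilon> < 1 - (s * p - b)"
    by (rule schur_exponent)
  have ex: "\<exists>M>0. schur_bound \<alpha> M (kb 0 :: complex^'n \<Rightarrow> complex^'n \<Rightarrow> ennreal) \<and>
      schur_bound \<alpha> M (kcomp (kb 0) (kb 0) :: complex^'n \<Rightarrow> complex^'n \<Rightarrow> ennreal) \<and>
      schur_bound \<alpha> M (kcomp (kb \<epsilon>) (kb \<epsilon>) :: complex^'n \<Rightarrow> complex^'n \<Rightarrow> ennreal)" if \<alpha>: "\<epsilon> < \<alpha>" "\<epsilon> < 1 - \<alpha>" for \<alpha>
  proof -
    obtain M0 where M0: "M0 > 0" "schur_bound \<alpha> M0 (kb 0 :: complex^'n \<Rightarrow> complex^'n \<Rightarrow> ennreal)"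
      unfolding kb_eq by (rule schur_bound_bkernel[of 0 \<alpha>, where 'n='n]) (use \<alpha> s(1) in auto)
    obtain M1 where M1: "M1 > 0" "schur_bound \<alpha> M1 (kb \<epsilon> :: complex^'n \<Rightarrow> complex^'n \<Rightarrow> ennreal)"
      unfolding kb_eq by (rule schur_bound_bkernel[of \<epsilon> \<alpha>, where 'n='n]) (use \<alpha> s(1) in auto)
    define M where "M = max M0 (max (M0 * M0) (M1 * M1))"
    have "schur_bound \<alpha> (M0 * M0) (kcomp (kb 0) (kb 0) :: complex^'n \<Rightarrow> complex^'n \<Rightarrow> ennreal)"
      "schur_bound \<alpha> (M1 * M1) (kcomp (kb \<epsilon>) (kb \<epsilon>) :: complex^'n \<Rightarrow> complex^'n \<Rightarrow> ennreal)"
      using M0 M1 by (auto intro!: schur_bound_kcomp kmeas_kb)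
    thus ?thesis using M0 by (intro exI[of _ M]) (auto simp: M_def intro: schur_bound_mono)
  qed
  obtain M2 where M2: "M2 > 0" "schur_bound (s * q) M2 (kb 0 :: complex^'n \<Rightarrow> complex^'n \<Rightarrow> ennreal)"
      "schur_bound (s * q) M2 (kcomp (kb 0) (kb 0) :: complex^'n \<Rightarrow> complex^'n \<Rightarrow> ennreal)"
      "schur_bound (s * q) M2 (kcomp (kb \<epsilon>) (kb \<epsilon>) :: complex^'n \<Rightarrow> complex^'n \<Rightarrow> ennreal)" using ex[of "s * q"] s by blast
  obtain M3 where M3: "M3 > 0" "schur_bound (s * p - b) M3 (kb 0 :: complex^'n \<Rightarrow> complex^'n \<Rightarrow> ennreal)"
      "schur_bound (s * p - b) M3 (kcomp (kb 0) (kb 0) :: complex^'n \<Rightarrow> complex^'n \<Rightarrow> ennreal)"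
      "schur_bound (s * p - b) M3 (kcomp (kb \<epsilon>) (kb \<epsilon>) :: complex^'n \<Rightarrow> complex^'n \<Rightarrow> ennreal)" using ex[of "s * p - b"] s by blast
  show ?thesis
  proof (rule that[of \<epsilon> "max M2 M3" s, OF s(1)])
    show "max M2 M3 > 0" using M2(1) by simp
  qed (use M2 M3 in \<open>auto intro: schur_bound_mono\<close>)
qed

text \<open>Integrability for Fubini's theorem. The Schur test applies to real-valued functions, so the inner integral \<open>S\<close>,
which may be infinite at some points, is truncated at \<open>m\<close>; the resulting bound does not depend on \<open>m\<close>.\<close>

lemma kb_integral_finite:
  fixes f :: "complex^'n \<Rightarrow> complex"
  assumes f: "f \<in> borel_measurable ball_measure" "Ip p b f < \<infinity>"
  shows "(\<integral>\<^sup>+x. (\<integral>\<^sup>+z. kb 0 x z * ennreal (norm (f z)) \<partial>ball_measure) \<partial>ball_measure) < \<infinity>"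
proof -
  obtain s \<epsilon> M where M: "M > 0"
    "\<And>\<alpha>. \<alpha> = s * q \<or> \<alpha> = s * p - b \<Longrightarrow> schur_bound \<alpha> M (kb 0 :: complex^'n \<Rightarrow> complex^'n \<Rightarrow> ennreal)"
    by (rule schur_kernels[where 'n='n]) blast
  obtain C where C: "C > 0" "\<And>(f :: complex^'n \<Rightarrow> real) A. (\<lambda>z. norm (f z)) \<in> borel_measurable ball_measure \<Longrightarrow>
     Ip p b f \<le> ennreal A \<Longrightarrow> A \<ge> 0 \<Longrightarrow> (\<integral>\<^sup>+z. ennreal (norm (f z)) \<partial>ball_measure) \<le> ennreal (C * A powr (1/p))"
    using L1_embedding[where 'n='n and 'b=real] by blast
  obtain A where A: "Ip p b f = ennreal A" "A \<ge> 0" using f(2) by (cases "Ip p b f") auto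
  have nf [measurable]: "(\<lambda>z. norm (f z)) \<in> borel_measurable ball_measure" using f(1) by measurable
  define S where "S x = (\<integral>\<^sup>+z. kb 0 x z * ennreal (norm (f z)) \<partial>ball_measure)" for x
  have kf: "(\<lambda>(x, z). kb 0 x z * ennreal (norm (f z))) \<in> borel_measurable (ball_measure \<Otimes>\<^sub>M ball_measure)"
    using kmeas_kb[of 0, where 'a='n] by (simp add: case_prod_unfold)
  hence [measurable]: "S \<in> borel_measurable ball_measure"
    unfolding S_def by (rule ball_measure.borel_measurable_nn_integral)
  define F where "F m x = enn2real (min (of_nat m) (S x))" for m :: nat and x
  have Feq: "ennreal (F m x) = min (of_nat m) (S x)" for m x
  proof -
    have "min (of_nat m) (S x) < top" by (rule le_less_trans[OF min.cobounded1 of_nat_less_top])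
    thus ?thesis unfolding F_def by (rule ennreal_enn2real)
  qed
  have [measurable]: "F m \<in> borel_measurable ball_measure" for m unfolding F_def by measurable
  have F0: "F m x \<ge> 0" for m x by (simp add: F_def)
  have "(\<integral>\<^sup>+x. ennreal (F m x) \<partial>ball_measure) \<le> ennreal (C * (M powr p * A) powr (1/p))" for m
  proof -
    have "(\<integral>\<^sup>+z. ennreal (F m z powr p * (1 - (norm z)\<^sup>2) powr b) \<partial>ball_measure)
      \<le> ennreal (M powr p) * (\<integral>\<^sup>+w. ennreal (norm (f w) powr p * (1 - (norm w)\<^sup>2) powr b) \<partial>ball_measure)"
    proof (rule schur_test[OF kmeas_kb[of 0] kb_commute p1 exponents(1,2)])
      show "schur_bound (s * q) M (kb 0 :: complex^'n \<Rightarrow> complex^'n \<Rightarrow> ennreal)" "schur_bound (s * p - b) M (kb 0 :: complex^'n \<Rightarrow> complex^'n \<Rightarrow> ennreal)"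
        using M(2) by blast+
      show "ennreal (F m z) \<le> (\<integral>\<^sup>+w. kb 0 z w * ennreal (norm (f w)) \<partial>ball_measure)" for z
        unfolding Feq S_def by (rule min.cobounded2)
    qed (use M(1) F0 in auto)
    hence "Ip p b (F m) \<le> ennreal (M powr p * A)"
      using A F0 by (simp add: Ip_def ennreal_mult)
    from C(2)[OF _ this] F0 A show ?thesis by simp
  qed
  hence bound: "(\<integral>\<^sup>+x. min (of_nat m) (S x) \<partial>ball_measure) \<le> ennreal (C * (M powr p * A) powr (1/p))" for m
    unfolding Feq by blast
  have "(\<integral>\<^sup>+x. S x \<partial>ball_measure) = (\<integral>\<^sup>+x. (SUP m. min (of_nat m) (S x)) \<partial>ball_measure)"
  proof (intro nn_integral_cong)
    fix x
    have "(SUP m. min (of_nat m) (S x)) = min (SUP m. of_nat m) (S x)"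
      by (simp add: inf_min[symmetric] inf_SUP[symmetric] SUP_inf)
    thus "S x = (SUP m. min (of_nat m) (S x))" by (simp add: ennreal_SUP_of_nat_eq_top)
  qed
  also have "\<dots> = (SUP m. \<integral>\<^sup>+x. min (of_nat m) (S x) \<partial>ball_measure)"
    by (rule nn_integral_monotone_convergence_SUP) (auto simp: incseq_def le_fun_def min_le_iff_disj intro!: min.mono)
  also have "\<dots> \<le> ennreal (C * (M powr p * A) powr (1/p))" by (rule SUP_least) (rule bound)
  also have "\<dots> < \<infinity>" by simp
  finally show ?thesis by (simp add: S_def)
qed

end

section \<open>Normal families\<close>

lemma holomorphic_ball_cong:
  fixes f g :: "complex^'n \<Rightarrow> complex"
  assumes "holomorphic_ball f" "\<And>z. norm z < 1 \<Longrightarrow> f z = g z"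
  shows "holomorphic_ball g"
  unfolding holomorphic_ball_def
proof
  fix z :: "complex^'n" assume z: "z \<in> ball 0 1"
  then obtain D where D: "(f has_derivative D) (at z)" "\<forall>c v. D (c *s v) = c * D v"
    using assms(1) unfolding holomorphic_ball_def by blast
  have "(g has_derivative D) (at z)"
    by (rule has_derivative_transform_within_open[OF D(1) open_ball z]) (use assms(2) in auto)
  thus "\<exists>D. (g has_derivative D) (at z) \<and> (\<forall>c v. D (c *s v) = c * D v)" using D(2) by blast
qed

lemma holomorphic_ball_diff:
  fixes f g :: "complex^'n \<Rightarrow> complex"
  assumes "holomorphic_ball f" "holomorphic_ball g"
  shows "holomorphic_ball (\<lambda>z. f z - g z)"
  unfolding holomorphic_ball_def
proof
  fix z :: "complex^'n" assume z: "z \<in> ball 0 1"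
  obtain D E where D: "(f has_derivative D) (at z)" "\<forall>c v. D (c *s v) = c * D v"
     and E: "(g has_derivative E) (at z)" "\<forall>c v. E (c *s v) = c * E v"
    using assms z unfolding holomorphic_ball_def by meson
  have "((\<lambda>z. f z - g z) has_derivative (\<lambda>v. D v - E v)) (at z)" by (intro has_derivative_diff D E)
  thus "\<exists>D. ((\<lambda>z. f z - g z) has_derivative D) (at z) \<and> (\<forall>c v. D (c *s v) = c * D v)"
    using D(2) E(2) by (intro exI[of _ "\<lambda>v. D v - E v"]) (simp add: right_diff_distrib)
qed

lemma norm_le_L1:
  fixes f :: "complex^'n \<Rightarrow> complex"
  assumes f: "holomorphic_ball f" "integrable ball_measure f" and z: "norm z < 1"
  shows "norm (f z) \<le> (LINT w|ball_measure. norm (f w)) / (1 - norm z) ^ (CARD('n) + 1)"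
proof -
  define N where "N = CARD('n) + 1"
  have "norm (f z) = norm (LINT w|ball_measure. f w * (1 / (1 - herm_prod z w) ^ N))"
    using bergman_reproducing[OF f z] by (simp add: N_def)
  also have "\<dots> \<le> (LINT w|ball_measure. norm (f w * (1 / (1 - herm_prod z w) ^ N)))" by (rule integral_norm_bound)
  also have "\<dots> \<le> (LINT w|ball_measure. norm (f w) * (1 / (1 - norm z) ^ N))"
  proof (rule integral_mono)
    show "integrable ball_measure (\<lambda>w. norm (f w * (1 / (1 - herm_prod z w) ^ N)))"
      by (rule integrable_norm, rule integrable_mult_bounded[OF f(2), where B = "1 / (1 - norm z) ^ N"])
         (use norm_bergman_kernel_le[OF z] in auto)
    show "norm (f w * (1 / (1 - herm_prod z w) ^ N)) \<le> norm (f w) * (1 / (1 - norm z) ^ N)" if "w \<in> space ball_measure" for w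
      unfolding norm_mult by (rule mult_left_mono[OF norm_bergman_kernel_le[OF z]]) (use that in auto)
  qed (intro integrable_mult_left integrable_norm f(2))
  finally show ?thesis by (simp add: N_def)
qed

text \<open>By the reproducing formula the difference of two values of \<open>f\<close> is an integral of \<open>f\<close> against a
difference of kernels, which is Lipschitz uniformly in \<open>w\<close>. This gives equicontinuity on compact subsets of the ball.\<close>

lemma L1_lipschitz:
  assumes \<rho>: "0 \<le> \<rho>" "\<rho> < 1"
  obtains K where "K \<ge> 0" "\<And>(f :: complex^'n \<Rightarrow> complex) z z'. holomorphic_ball f \<Longrightarrow> integrable ball_measure f \<Longrightarrow> norm z \<le> \<rho> \<Longrightarrow> norm z' \<le> \<rho> \<Longrightarrow>
    norm (f z - f z') \<le> K * norm (z - z') * (LINT w|ball_measure. norm (f w))"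
proof -
  define N where "N = CARD('n) + 1"
  define \<eta> where "\<eta> = 1 - \<rho>"
  have \<eta>: "\<eta> > 0" using \<rho> by (simp add: \<eta>_def)
  define K where "K = real N / \<eta> ^ (N + 1) + (real N * (real N + 1) / \<eta> ^ (N + 2)) * 2"
  have K0: "K \<ge> 0" using \<eta> by (simp add: K_def)
  show ?thesis
  proof (rule that[OF K0])
    fix f :: "complex^'n \<Rightarrow> complex" and z z' :: "complex^'n"
    assume f: "holomorphic_ball f" "integrable ball_measure f" and z: "norm z \<le> \<rho>" "norm z' \<le> \<rho>"
    have z1: "norm z < 1" "norm z' < 1" using z \<rho> by auto
    have kd: "norm (1 / (1 - herm_prod z w) ^ N - 1 / (1 - herm_prod z' w) ^ N) \<le> K * norm (z - z')" if w: "norm w < 1" for w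
    proof -
      define y x where "y = 1 - herm_prod z w" and "x = 1 - herm_prod z' w"
      have re: "Re (1 - herm_prod v w) \<ge> \<eta>" if "norm v \<le> \<rho>" for v
      proof -
        have "Re (herm_prod v w) \<le> norm (herm_prod v w)" by (rule complex_Re_le_cmod)
        also have "\<dots> \<le> norm v" using norm_herm_prod_le[of v w] mult_left_le[of "norm w" "norm v"] w by simp
        finally show ?thesis using that by (simp add: \<eta>_def)
      qed
      have x: "Re x \<ge> \<eta>" and y: "Re y \<ge> \<eta>" unfolding x_def y_def using re z by auto
      have yx: "norm (y - x) \<le> norm (z - z')"
      proof -
        have "y - x = - herm_prod (z - z') w" by (simp add: x_def y_def herm_prod_diff_left)
        thus ?thesis using norm_herm_prod_le[of "z - z'" w] mult_left_le[of "norm w" "norm (z - z')"] w by simp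
      qed
      have "norm (z - z') \<le> 2" using norm_triangle_ineq4[of z z'] z1 by simp
      hence yx2: "norm (y - x) \<le> 2" using yx by simp
      have "\<eta> \<le> norm x" using x complex_Re_le_cmod[of x] by simp
      hence nx: "norm (of_nat N * (y - x) / x ^ (N + 1)) \<le> real N / \<eta> ^ (N + 1) * norm (y - x)"
      proof -
        have "real N * norm (y - x) / norm x ^ (N + 1) \<le> real N * norm (y - x) / \<eta> ^ (N + 1)"
          using \<open>\<eta> \<le> norm x\<close> \<eta> by (intro frac_le power_mono) auto
        thus ?thesis by (simp add: norm_mult norm_divide norm_power)
      qed
      define E where "E = 1 / y ^ N - 1 / x ^ N + of_nat N * (y - x) / x ^ (N + 1)"
      have "norm E \<le> (real N * (real N + 1) / \<eta> ^ (N + 2)) * (norm (y - x))\<^sup>2"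
        unfolding E_def by (rule inverse_power_Taylor_bound[OF \<eta> x y])
      also have "\<dots> \<le> (real N * (real N + 1) / \<eta> ^ (N + 2)) * (2 * norm (y - x))"
        using yx2 \<eta> by (intro mult_left_mono) (auto simp: power2_eq_square intro: mult_right_mono)
      finally have En: "norm E \<le> (real N * (real N + 1) / \<eta> ^ (N + 2)) * (2 * norm (y - x))" .
      have "1 / y ^ N - 1 / x ^ N = E - of_nat N * (y - x) / x ^ (N + 1)" by (simp add: E_def)
      hence "norm (1 / y ^ N - 1 / x ^ N) \<le> norm E + norm (of_nat N * (y - x) / x ^ (N + 1))"
        by (simp only: norm_triangle_ineq4)
      also have "\<dots> \<le> K * norm (y - x)" using En nx by (simp add: K_def algebra_simps)
      also have "\<dots> \<le> K * norm (z - z')" by (rule mult_left_mono[OF yx K0])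
      finally show ?thesis by (simp add: x_def y_def)
    qed
    have i: "integrable ball_measure (\<lambda>w. f w * (1 / (1 - herm_prod v w) ^ N))" if "norm v < 1" for v
      by (rule integrable_mult_bounded[OF f(2), where B = "1 / (1 - norm v) ^ N"]) (use norm_bergman_kernel_le[OF that] in auto)
    have "f z - f z' = (LINT w|ball_measure. f w * (1 / (1 - herm_prod z w) ^ N)) - (LINT w|ball_measure. f w * (1 / (1 - herm_prod z' w) ^ N))"
      using bergman_reproducing[OF f z1(1)] bergman_reproducing[OF f z1(2)] by (simp add: N_def)
    also have "\<dots> = (LINT w|ball_measure. f w * (1 / (1 - herm_prod z w) ^ N) - f w * (1 / (1 - herm_prod z' w) ^ N))"
      by (rule Bochner_Integration.integral_diff[symmetric, OF i[OF z1(1)] i[OF z1(2)]])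
    also have "norm \<dots> \<le> (LINT w|ball_measure. norm (f w * (1 / (1 - herm_prod z w) ^ N) - f w * (1 / (1 - herm_prod z' w) ^ N)))" by (rule integral_norm_bound)
    also have "\<dots> \<le> (LINT w|ball_measure. norm (f w) * (K * norm (z - z')))"
    proof (rule integral_mono)
      show "norm (f w * (1 / (1 - herm_prod z w) ^ N) - f w * (1 / (1 - herm_prod z' w) ^ N)) \<le> norm (f w) * (K * norm (z - z'))" if "w \<in> space ball_measure" for w
        unfolding right_diff_distrib[symmetric] norm_mult by (rule mult_left_mono[OF kd]) (use that in auto)
    qed (intro integrable_mult_left integrable_norm Bochner_Integration.integrable_diff i z1 f(2))+
    finally show "norm (f z - f z') \<le> K * norm (z - z') * (LINT w|ball_measure. norm (f w))" by (simp add: mult_ac)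
  qed
qed

text \<open>Montel's theorem for families bounded in the mean. A diagonal subsequence converges on a countable
dense set, and equicontinuity extends the convergence to the ball. The limit is holomorphic because the reproducing formula for
the dilates, which are uniformly bounded, passes to the limit and represents the limit as an integral against the kernel.\<close>

theorem L1_bounded_pointwise_subsequence:
  fixes f :: "nat \<Rightarrow> complex^'n \<Rightarrow> complex"
  assumes hol: "\<And>k. holomorphic_ball (f k)" and int: "\<And>k. integrable ball_measure (f k)"
    and B: "\<And>k. (LINT w|ball_measure. norm (f k w)) \<le> B"
  obtains r g where "strict_mono r" "holomorphic_ball g" "\<And>z. norm z < 1 \<Longrightarrow> (\<lambda>k. f (r k) z) \<longlonglongrightarrow> g z"
proof -
  define N where "N = CARD('n) + 1"
  have "(LINT w|ball_measure. norm (f 0 w)) \<ge> 0" by simp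
  hence B0: "B \<ge> 0" using B[of 0] by linarith
  obtain D :: "(complex^'n) set" where D: "countable D" "\<And>X. open X \<Longrightarrow> X \<noteq> {} \<Longrightarrow> \<exists>d\<in>D. d \<in> X"
    by (rule countable_dense_setE) blast
  have ptw: "norm (f k z) \<le> B / (1 - norm z) ^ N" if "norm z < 1" for k z
    by (rule order_trans[OF norm_le_L1[OF hol int that]]) (use that B in \<open>auto simp: N_def intro!: divide_right_mono\<close>)
  have cD: "countable (D \<inter> ball 0 1)" using D(1) by blast
  have bd: "norm (f n x * of_real ((1 - norm x) ^ N)) \<le> B" if "x \<in> D \<inter> ball 0 1" for n x
  proof -
    have x: "norm x < 1" using that by simp
    have "norm (f n x) * (1 - norm x) ^ N \<le> B / (1 - norm x) ^ N * (1 - norm x) ^ N"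
      using x by (intro mult_right_mono ptw) auto
    thus ?thesis using x by (simp add: norm_mult norm_power del: of_real_diff of_real_power)
  qed
  obtain r where r: "strict_mono (r :: nat \<Rightarrow> nat)" "\<And>x. x \<in> D \<inter> ball 0 1 \<Longrightarrow> \<exists>l. (\<lambda>n. (f (r n) x * of_real ((1 - norm x) ^ N))) \<longlonglongrightarrow> l"
    using function_convergent_subsequence[where f = "\<lambda>k x. f k x * of_real ((1 - norm x) ^ N)", OF cD bd] by metis
  have convD: "convergent (\<lambda>n. f (r n) x)" if "x \<in> D" "norm x < 1" for x
  proof -
    obtain l where "(\<lambda>n. (f (r n) x * of_real ((1 - norm x) ^ N))) \<longlonglongrightarrow> l" using r(2)[of x] \<open>x \<in> D\<close> \<open>norm x < 1\<close> by auto
    hence "(\<lambda>n. (f (r n) x * of_real ((1 - norm x) ^ N)) * of_real (1 / (1 - norm x) ^ N)) \<longlonglongrightarrow> l * of_real (1 / (1 - norm x) ^ N)"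
      by (intro tendsto_mult tendsto_const)
    moreover have "(f (r n) x * of_real ((1 - norm x) ^ N)) * of_real (1 / (1 - norm x) ^ N) = f (r n) x" for n
    proof -
      have "complex_of_real ((1 - norm x) ^ N) * of_real (1 / (1 - norm x) ^ N) = 1"
        unfolding of_real_mult[symmetric] using \<open>norm x < 1\<close> by simp
      thus ?thesis by (simp only: mult.assoc) simp
    qed
    ultimately show ?thesis by (auto simp: convergent_def)
  qed
  have conv: "convergent (\<lambda>n. f (r n) z)" if z: "norm z < 1" for z
  proof (rule Cauchy_convergent, rule CauchyI)
    fix e :: real assume e: "e > 0"
    define \<rho> where "\<rho> = (1 + norm z) / 2"
    have \<rho>: "0 \<le> \<rho>" "\<rho> < 1" "norm z < \<rho>" using z by (auto simp: \<rho>_def intro: add_nonneg_nonneg)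
    obtain K where K: "K \<ge> 0" "\<And>(f :: complex^'n \<Rightarrow> complex) z z'. holomorphic_ball f \<Longrightarrow> integrable ball_measure f \<Longrightarrow> norm z \<le> \<rho> \<Longrightarrow> norm z' \<le> \<rho> \<Longrightarrow>
      norm (f z - f z') \<le> K * norm (z - z') * (LINT w|ball_measure. norm (f w))" by (rule L1_lipschitz[OF \<rho>(1,2)]) blast
    define \<delta> where "\<delta> = e / (4 * (K * B + 1))"
    have KB: "K * B \<ge> 0" using K(1) B0 by simp
    have \<delta>: "\<delta> > 0" using e KB by (simp add: \<delta>_def)
    have "z \<in> ball z \<delta> \<inter> ball 0 \<rho>" using \<delta> \<rho> by simp
    hence "open (ball z \<delta> \<inter> ball 0 \<rho>)" "ball z \<delta> \<inter> ball 0 \<rho> \<noteq> {}" by (simp add: open_Int, blast)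
    then obtain d where d: "d \<in> D" "d \<in> ball z \<delta> \<inter> ball 0 \<rho>" using D(2) by blast
    have d1: "norm d \<le> \<rho>" "norm d < 1" "norm (z - d) < \<delta>" using d \<rho> by (auto simp: dist_norm)
    have near: "norm (f k z - f k d) \<le> e / 4" for k
    proof -
      have "norm (f k z - f k d) \<le> K * norm (z - d) * (LINT w|ball_measure. norm (f k w))"
        using \<rho> d1 by (intro K(2) hol int) auto
      also have "\<dots> \<le> K * \<delta> * B" using d1 K(1) B[of k] \<delta> by (intro mult_mono) auto
      also have "\<dots> = (K * B) * (e / (4 * (K * B + 1)))" by (simp add: \<delta>_def)
      also have "\<dots> \<le> (K * B + 1) * (e / (4 * (K * B + 1)))" using e KB by (intro mult_right_mono) auto
      also have "\<dots> = e / 4" using KB by (simp add: field_simps)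
      finally show ?thesis .
    qed
    have "Cauchy (\<lambda>n. f (r n) d)" using convD[OF d(1) d1(2)] by (rule convergent_Cauchy)
    moreover have "e / 4 > 0" using e by simp
    ultimately obtain M where M: "\<And>m n. m \<ge> M \<Longrightarrow> n \<ge> M \<Longrightarrow> norm (f (r m) d - f (r n) d) < e / 4"
      unfolding Cauchy_iff by blast
    show "\<exists>M. \<forall>m\<ge>M. \<forall>n\<ge>M. norm (f (r m) z - f (r n) z) < e"
    proof (intro exI[of _ M] allI impI)
      fix m n assume mn: "m \<ge> M" "n \<ge> M"
      have "f (r m) z - f (r n) z = (f (r m) z - f (r m) d) + (f (r m) d - f (r n) d) - (f (r n) z - f (r n) d)" by simp
      also have "norm \<dots> \<le> norm (f (r m) z - f (r m) d) + norm (f (r m) d - f (r n) d) + norm (f (r n) z - f (r n) d)"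
        using norm_triangle_ineq4[of "(f (r m) z - f (r m) d) + (f (r m) d - f (r n) d)" "f (r n) z - f (r n) d"]
          norm_triangle_ineq[of "f (r m) z - f (r m) d" "f (r m) d - f (r n) d"] by linarith
      also have "\<dots> < e" using near[of "r m"] near[of "r n"] M[OF mn] e by linarith
      finally show "norm (f (r m) z - f (r n) z) < e" .
    qed
  qed
  define g where "g z = lim (\<lambda>n. f (r n) z)" for z
  have lim: "(\<lambda>n. f (r n) z) \<longlonglongrightarrow> g z" if "norm z < 1" for z
    unfolding g_def using conv[OF that] by (rule convergent_LIMSEQ_iff[THEN iffD1])
  have gmeas: "(\<lambda>w. g (t *\<^sub>R w)) \<in> borel_measurable ball_measure" if t: "0 < t" "t < 1" for t
  proof (rule borel_measurable_LIMSEQ_metric[where f = "\<lambda>n w. f (r n) (t *\<^sub>R w)"])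
    have tb: "norm (t *\<^sub>R w) < 1" if "norm w < 1" for w :: "complex^'n"
      using t mult_strict_mono[of t 1 "norm w" 1] that by simp
    show "(\<lambda>w. f (r n) (t *\<^sub>R w)) \<in> borel_measurable ball_measure" for n
      by (rule continuous_on_imp_measurable_ball, rule continuous_on_compose2[OF holomorphic_ball_continuous[OF hol]])
         (use tb in \<open>auto intro!: continuous_intros\<close>)
    show "(\<lambda>n. f (r n) (t *\<^sub>R w)) \<longlonglongrightarrow> g (t *\<^sub>R w)" if "w \<in> space ball_measure" for w
      by (rule lim, rule tb) (use that in simp)
  qed
  have "holomorphic_ball g"
    unfolding holomorphic_ball_def
  proof
    fix z :: "complex^'n" assume "z \<in> ball 0 1"
    hence z: "norm z < 1" by simp
    define t where "t = (1 + norm z) / 2"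
    have t: "0 < t" "t < 1" "norm z < t" using z by (auto simp: t_def intro: add_pos_nonneg)
    have tb: "norm (t *\<^sub>R w) < t" if "norm w < 1" for w :: "complex^'n" using t that by simp
    have ft: "norm (f k (t *\<^sub>R w)) \<le> B / (1 - t) ^ N" if "norm w < 1" for k w
    proof -
      have "norm (f k (t *\<^sub>R w)) \<le> B / (1 - norm (t *\<^sub>R w)) ^ N" by (rule ptw) (use tb[OF that] t in linarith)
      also have "\<dots> \<le> B / (1 - t) ^ N" using tb[OF that] t B0 by (intro divide_left_mono power_mono mult_pos_pos zero_less_power) linarith+
      finally show ?thesis .
    qed
    define G where "G w = g (t *\<^sub>R w)" for w
    have [measurable]: "G \<in> borel_measurable ball_measure" unfolding G_def by (rule gmeas[OF t(1,2)])
    have limG: "(\<lambda>n. f (r n) (t *\<^sub>R w)) \<longlonglongrightarrow> G w" if "norm w < 1" for w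
      unfolding G_def by (rule lim) (use tb[OF that] t in linarith)
    have GB: "norm (G w) \<le> B / (1 - t) ^ N" if "norm w < 1" for w
      by (rule LIMSEQ_le_const2[OF tendsto_norm[OF limG[OF that]]]) (use ft[OF that] in auto)
    have intG: "integrable ball_measure G" by (rule integrable_bounded_ball[OF _ GB]) auto
    have repG: "(LINT w|ball_measure. G w / (1 - herm_prod y w) ^ N) = G y" if y: "norm y < 1" for y
    proof -
      have "(\<lambda>n. LINT w|ball_measure. f (r n) (t *\<^sub>R w) / (1 - herm_prod y w) ^ N) \<longlonglongrightarrow> (LINT w|ball_measure. G w / (1 - herm_prod y w) ^ N)"
      proof (rule integral_dominated_convergence[where w = "\<lambda>_. B / (1 - t) ^ N * (1 / (1 - norm y) ^ N)"])
        show "AE w in ball_measure. (\<lambda>n. f (r n) (t *\<^sub>R w) / (1 - herm_prod y w) ^ N) \<longlonglongrightarrow> G w / (1 - herm_prod y w) ^ N"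
          using one_minus_herm_prod_nonzero(1)[OF y] by (intro AE_I2 tendsto_divide limG tendsto_const) auto
        show "AE w in ball_measure. norm (f (r n) (t *\<^sub>R w) / (1 - herm_prod y w) ^ N) \<le> B / (1 - t) ^ N * (1 / (1 - norm y) ^ N)" for n
        proof (rule AE_I2)
          fix w :: "complex^'n" assume "w \<in> space ball_measure"
          hence w: "norm w < 1" by simp
          have "norm (f (r n) (t *\<^sub>R w)) * norm (1 / (1 - herm_prod y w) ^ N) \<le> B / (1 - t) ^ N * (1 / (1 - norm y) ^ N)"
            using B0 t by (intro mult_mono ft[OF w] norm_bergman_kernel_le[OF y w]) auto
          thus "norm (f (r n) (t *\<^sub>R w) / (1 - herm_prod y w) ^ N) \<le> B / (1 - t) ^ N * (1 / (1 - norm y) ^ N)"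
            by (simp add: norm_divide norm_mult)
        qed
        have [measurable]: "(\<lambda>w. f (r n) (t *\<^sub>R w)) \<in> borel_measurable ball_measure" for n
        proof (rule continuous_on_imp_measurable_ball, rule continuous_on_compose2[OF holomorphic_ball_continuous[OF hol]])
          show "(\<lambda>w. t *\<^sub>R w) ` ball 0 1 \<subseteq> ball (0::complex^'n) 1"
          proof (rule image_subsetI)
            fix w :: "complex^'n" assume "w \<in> ball 0 1"
            hence "norm (t *\<^sub>R w) < t" by (intro tb) simp
            hence "norm (t *\<^sub>R w) < 1" using t(2) by linarith
            thus "t *\<^sub>R w \<in> ball 0 1" by (simp only: mem_ball_0)
          qed
        qed (auto intro!: continuous_intros)
        show "(\<lambda>w. f (r n) (t *\<^sub>R w) / (1 - herm_prod y w) ^ N) \<in> borel_measurable ball_measure" for n by measurable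
      qed measurable
      moreover have "(LINT w|ball_measure. f (r n) (t *\<^sub>R w) / (1 - herm_prod y w) ^ N) = f (r n) (t *\<^sub>R y)" for n
        unfolding N_def by (rule reproducing_dilate[OF hol t(1,2) y])
      ultimately show ?thesis using LIMSEQ_unique[OF _ limG[OF y]] by simp
    qed
    have "holomorphic_ball (\<lambda>y. LINT w|ball_measure. G w / (1 - herm_prod y w) ^ N)"
      by (rule holomorphic_ball_integral[OF intG])
    hence "holomorphic_ball G" by (rule holomorphic_ball_cong) (rule repG)
    moreover have "(1 / t) *\<^sub>R z \<in> ball 0 1" using t by simp
    ultimately obtain E where E: "(G has_derivative E) (at ((1 / t) *\<^sub>R z))" "\<forall>c v. E (c *s v) = c * E v"
      unfolding holomorphic_ball_def by blast
    have "((\<lambda>x. (1 / t) *\<^sub>R x) has_derivative (\<lambda>x. (1 / t) *\<^sub>R x)) (at z)" by (auto intro!: derivative_eq_intros)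
    from diff_chain_at[OF this E(1)] have "((\<lambda>x. G ((1 / t) *\<^sub>R x)) has_derivative (\<lambda>v. E ((1 / t) *\<^sub>R v))) (at z)"
      by (simp only: o_def)
    hence "(g has_derivative (\<lambda>v. E ((1 / t) *\<^sub>R v))) (at z)"
      using t by (simp add: G_def)
    moreover have "E ((1 / t) *\<^sub>R (c *s v)) = c * E ((1 / t) *\<^sub>R v)" for c v
      using E(2) by (simp add: scaleR_eq_smult vector_smult_assoc mult.commute)
    ultimately show "\<exists>D. (g has_derivative D) (at z) \<and> (\<forall>c v. D (c *s v) = c * D v)" by blast
  qed
  thus ?thesis using that[OF r(1) _ lim] by blast
qed

section \<open>Toeplitz operators on weighted Bergman spaces\<close>

text \<open>The composition gains a small factor away from the diagonal: by \<open>rho_triangle\<close> the product \<open>rho w x * rho x z\<close> is at most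
\<open>4 \<delta>\<close> for every \<open>x\<close>, so inserting its power \<open>-\<epsilon>\<close> costs at most \<open>(4 \<delta>)^\<epsilon>\<close>.\<close>

lemma kcomp_kb_dominate:
  fixes z w :: "complex^'n"
  assumes z: "norm z < 1" and w: "norm w < 1" and \<delta>: "rho w z < \<delta>" and \<epsilon>: "\<epsilon> > 0"
  shows "kcomp (kb 0) (kb 0) w z \<le> ennreal ((4 * \<delta>) powr \<epsilon>) * kcomp (kb \<epsilon>) (kb \<epsilon>) w z"
proof -
  have \<delta>0: "\<delta> > 0" using rho_pos[OF w z] \<delta> by simp
  have ws: "w \<in> space ball_measure" and zs: "z \<in> space ball_measure" using z w by auto
  have m: "(\<lambda>x. kb \<epsilon> w x * kb \<epsilon> x z) \<in> borel_measurable ball_measure"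
    by (intro borel_measurable_times_ennreal kmeas_slice(1)[OF kmeas_kb ws] kmeas_slice(2)[OF kmeas_kb zs])
  have "kcomp (kb 0) (kb 0) w z \<le> (\<integral>\<^sup>+x. ennreal ((4 * \<delta>) powr \<epsilon>) * (kb \<epsilon> w x * kb \<epsilon> x z) \<partial>ball_measure)"
    unfolding kcomp_def
  proof (rule nn_integral_mono)
    fix x :: "complex^'n" assume "x \<in> space ball_measure"
    hence x: "norm x < 1" by simp
    have r: "rho w x > 0" "rho x z > 0" using rho_pos w x z by auto
    have prod: "rho w x * rho x z \<le> 4 * \<delta>" using rho_triangle[OF x w z] \<delta> by simp
    define A where "A = 1 / norm (1 - herm_prod w x) ^ (CARD('n) + 1) * (1 / norm (1 - herm_prod x z) ^ (CARD('n) + 1))"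
    have A0: "A \<ge> 0" by (simp add: A_def)
    have e0: "bkernel 0 w x * bkernel 0 x z = A" using bkernel_0[OF w x] bkernel_0[OF x z] by (simp add: A_def)
    have e1: "bkernel \<epsilon> w x * bkernel \<epsilon> x z = A * (rho w x * rho x z) powr (- \<epsilon>)"
      using r by (simp add: bkernel_def A_def powr_mult)
    have "(4 * \<delta>) powr (- \<epsilon>) \<le> (rho w x * rho x z) powr (- \<epsilon>)"
      using r prod \<epsilon> by (intro powr_mono2') auto
    hence "(4 * \<delta>) powr \<epsilon> * (4 * \<delta>) powr (- \<epsilon>) \<le> (4 * \<delta>) powr \<epsilon> * (rho w x * rho x z) powr (- \<epsilon>)"
      by (intro mult_left_mono) auto
    hence "1 \<le> (4 * \<delta>) powr \<epsilon> * (rho w x * rho x z) powr (- \<epsilon>)" using \<delta>0 by (simp add: powr_add[symmetric])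
    hence "A * 1 \<le> A * ((4 * \<delta>) powr \<epsilon> * (rho w x * rho x z) powr (- \<epsilon>))" by (rule mult_left_mono[OF _ A0])
    hence "bkernel 0 w x * bkernel 0 x z \<le> (4 * \<delta>) powr \<epsilon> * (bkernel \<epsilon> w x * bkernel \<epsilon> x z)"
      unfolding e0 e1 by (simp add: mult_ac)
    thus "kb 0 w x * kb 0 x z \<le> ennreal ((4 * \<delta>) powr \<epsilon>) * (kb \<epsilon> w x * kb \<epsilon> x z)"
      unfolding kb_def by (simp add: ennreal_mult'[symmetric] bkernel_nonneg ennreal_leI)
  qed
  also have "\<dots> = ennreal ((4 * \<delta>) powr \<epsilon>) * kcomp (kb \<epsilon>) (kb \<epsilon>) w z"
    unfolding kcomp_def by (rule nn_integral_cmult[OF m])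
  finally show ?thesis .
qed

context bounded_symbol
begin

lemma toeplitz_kernel_le:
  assumes z: "norm z < 1" and w: "norm w < 1"
  shows "ennreal (norm (toeplitz_kernel z w)) \<le> ennreal U * kcomp (kb 0) (kb 0) w z"
proof -
  define N where "N = CARD('n) + 1"
  define g where "g x = 1 / ((1 - herm_prod x z) ^ N * (1 - herm_prod w x) ^ N)" for x
  have ng: "norm (g x) = bkernel 0 w x * bkernel 0 x z" if "norm x < 1" for x
    using bkernel_0[OF w that] bkernel_0[OF that z] by (simp add: g_def norm_divide norm_mult norm_power N_def mult.commute)
  have gm [measurable]: "g \<in> borel_measurable ball_measure" unfolding g_def by measurable
  have int: "integrable ball_measure g"
  proof (rule integrable_bounded_ball[OF gm])
    fix x :: "complex^'n" assume x: "norm x < 1"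
    have a: "norm (1 / (1 - herm_prod w x) ^ N) \<le> 1 / (1 - norm w) ^ N" by (rule norm_bergman_kernel_le[OF w x])
    have b: "norm (1 / (1 - herm_prod x z) ^ N) \<le> 1 / (1 - norm z) ^ N"
      using norm_bergman_kernel_le[OF z x, of N] by (simp only: norm_divide norm_power norm_one_minus_herm_prod_commute[of x z])
    have "norm (g x) = norm (1 / (1 - herm_prod x z) ^ N) * norm (1 / (1 - herm_prod w x) ^ N)" by (simp add: g_def norm_mult norm_divide)
    also have "\<dots> \<le> (1 / (1 - norm z) ^ N) * (1 / (1 - norm w) ^ N)" using z by (intro mult_mono a b) auto
    finally show "norm (g x) \<le> (1 / (1 - norm z) ^ N) * (1 / (1 - norm w) ^ N)" .
  qed
  have "norm (toeplitz_kernel z w) \<le> U * (LINT x|ball_measure. norm (g x))"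
    unfolding toeplitz_kernel_def N_def[symmetric] g_def[symmetric] by (rule u_integral(2)[OF int])
  hence "ennreal (norm (toeplitz_kernel z w)) \<le> ennreal U * ennreal (LINT x|ball_measure. norm (g x))"
    using U_nonneg by (simp add: ennreal_mult[symmetric] ennreal_leI)
  also have "ennreal (LINT x|ball_measure. norm (g x)) = (\<integral>\<^sup>+x. ennreal (norm (g x)) \<partial>ball_measure)"
    by (rule nn_integral_eq_integral[symmetric, OF integrable_norm[OF int]]) simp
  also have "\<dots> = kcomp (kb 0) (kb 0) w z"
    unfolding kcomp_def kb_def by (intro nn_integral_cong) (simp add: ng ennreal_mult bkernel_nonneg)
  finally show ?thesis .
qed

lemma toeplitz_holomorphic:
  assumes "integrable ball_measure f" shows "holomorphic_ball (toeplitz u f)"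
proof -
  have "toeplitz u f = (\<lambda>z. LINT w|ball_measure. u w * f w / (1 - herm_prod z w) ^ (CARD('n) + 1))"
    by (rule ext) (simp add: toeplitz_def)
  thus ?thesis using holomorphic_ball_integral[OF u_integral(1)[OF assms], of "CARD('n) + 1"] by simp
qed

text \<open>Insert the reproducing formula for \<open>f\<close> into the Toeplitz integral and exchange the integrals.\<close>

lemma toeplitz_eq_kernel_integral:
  fixes f :: "complex^'n \<Rightarrow> complex"
  assumes f: "holomorphic_ball f" "integrable ball_measure f" and w: "norm w < 1"
    and fin: "(\<integral>\<^sup>+x. (\<integral>\<^sup>+z. kb 0 x z * ennreal (norm (f z)) \<partial>ball_measure) \<partial>ball_measure) < \<infinity>"
  shows "toeplitz u f w = (LINT z|ball_measure. f z * toeplitz_kernel z w)"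
proof -
  define N where "N = CARD('n) + 1"
  define G where "G x z = u x * (1 / (1 - herm_prod w x) ^ N) * (f z * (1 / (1 - herm_prod x z) ^ N))" for x z
  have fm [measurable]: "f \<in> borel_measurable ball_measure" using f(2) by auto
  have Gm: "(\<lambda>(x, z). G x z) \<in> borel_measurable (ball_measure \<Otimes>\<^sub>M ball_measure)"
    unfolding G_def case_prod_unfold by measurable
  have int: "integrable (ball_measure \<Otimes>\<^sub>M ball_measure) (\<lambda>(x, z). G x z)"
  proof (subst integrable_iff_bounded, intro conjI Gm)
    define c where "c = U * (1 / (1 - norm w) ^ N)"
    have c: "c \<ge> 0" using U_nonneg w by (simp add: c_def)
    have ae: "AE x in ball_measure. (\<integral>\<^sup>+z. ennreal (norm (G x z)) \<partial>ball_measure) \<le> ennreal c * (\<integral>\<^sup>+z. kb 0 x z * ennreal (norm (f z)) \<partial>ball_measure)"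
      using u_bound AE_space
    proof eventually_elim
      case (elim x)
      hence x: "norm x < 1" by simp
      have xs: "x \<in> space ball_measure" using elim by simp
      have "(\<integral>\<^sup>+z. ennreal (norm (G x z)) \<partial>ball_measure) \<le> (\<integral>\<^sup>+z. ennreal c * (kb 0 x z * ennreal (norm (f z))) \<partial>ball_measure)"
      proof (rule nn_integral_mono)
        fix z :: "complex^'n" assume "z \<in> space ball_measure"
        hence z: "norm z < 1" by simp
        have uw: "norm (u x) * norm (1 / (1 - herm_prod w x) ^ N) \<le> c"
          unfolding c_def using elim U_nonneg by (intro mult_mono norm_bergman_kernel_le[OF w x]) auto
        have "norm (G x z) = (norm (u x) * norm (1 / (1 - herm_prod w x) ^ N)) * (bkernel 0 x z * norm (f z))"
          unfolding bkernel_0[OF x z] by (simp add: G_def N_def norm_mult norm_divide norm_power)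
        also have "\<dots> \<le> c * (bkernel 0 x z * norm (f z))"
          by (rule mult_right_mono[OF uw]) (simp add: bkernel_nonneg)
        finally show "ennreal (norm (G x z)) \<le> ennreal c * (kb 0 x z * ennreal (norm (f z)))"
          unfolding kb_def using c by (simp add: ennreal_mult'[symmetric] bkernel_nonneg ennreal_leI)
      qed
      also have "\<dots> = ennreal c * (\<integral>\<^sup>+z. kb 0 x z * ennreal (norm (f z)) \<partial>ball_measure)"
        by (intro nn_integral_cmult borel_measurable_times_ennreal kmeas_slice(1)[OF kmeas_kb xs]) measurable
      finally show ?case .
    qed
    have "(\<integral>\<^sup>+p. ennreal (norm (case p of (x, z) \<Rightarrow> G x z)) \<partial>(ball_measure \<Otimes>\<^sub>M ball_measure)) = (\<integral>\<^sup>+x. (\<integral>\<^sup>+z. ennreal (norm (G x z)) \<partial>ball_measure) \<partial>ball_measure)"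
      using Gm by (subst ball_measure.nn_integral_fst[symmetric]) (auto simp: case_prod_unfold)
    also have "\<dots> \<le> (\<integral>\<^sup>+x. ennreal c * (\<integral>\<^sup>+z. kb 0 x z * ennreal (norm (f z)) \<partial>ball_measure) \<partial>ball_measure)"
      by (rule nn_integral_mono_AE[OF ae])
    also have "\<dots> = ennreal c * (\<integral>\<^sup>+x. (\<integral>\<^sup>+z. kb 0 x z * ennreal (norm (f z)) \<partial>ball_measure) \<partial>ball_measure)"
    proof (rule nn_integral_cmult)
      have "(\<lambda>(x, z). kb 0 x z * ennreal (norm (f z))) \<in> borel_measurable (ball_measure \<Otimes>\<^sub>M ball_measure)"
        using kmeas_kb[of 0, where 'a='n] by (simp add: case_prod_unfold)
      thus "(\<lambda>x. \<integral>\<^sup>+z. kb 0 x z * ennreal (norm (f z)) \<partial>ball_measure) \<in> borel_measurable ball_measure"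
        by (rule ball_measure.borel_measurable_nn_integral)
    qed
    also have "\<dots> < \<infinity>" using fin by (simp add: ennreal_mult_less_top)
    finally show "(\<integral>\<^sup>+p. ennreal (norm (case p of (x, z) \<Rightarrow> G x z)) \<partial>(ball_measure \<Otimes>\<^sub>M ball_measure)) < \<infinity>" .
  qed
  have "toeplitz u f w = (LINT x|ball_measure. (LINT z|ball_measure. G x z))"
    unfolding toeplitz_def
  proof (rule Bochner_Integration.integral_cong[OF refl])
    fix x :: "complex^'n" assume "x \<in> space ball_measure"
    hence x: "norm x < 1" by simp
    have "(LINT z|ball_measure. G x z) = u x * (1 / (1 - herm_prod w x) ^ N) * (LINT z|ball_measure. f z * (1 / (1 - herm_prod x z) ^ N))"
      unfolding G_def by (rule integral_mult_right_zero)
    also have "(LINT z|ball_measure. f z * (1 / (1 - herm_prod x z) ^ N)) = f x"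
      using bergman_reproducing[OF f x] by (simp add: N_def)
    finally show "u x * f x / (1 - herm_prod w x) ^ (CARD('n) + 1) = (LINT z|ball_measure. G x z)" by (simp add: N_def)
  qed
  also have "\<dots> = (LINT z|ball_measure. (LINT x|ball_measure. G x z))"
    by (rule ball_pair.Fubini_integral[OF int, symmetric])
  also have "\<dots> = (LINT z|ball_measure. f z * toeplitz_kernel z w)"
  proof (rule Bochner_Integration.integral_cong[OF refl])
    fix z
    have "(LINT x|ball_measure. G x z) = (LINT x|ball_measure. f z * (u x * (1 / ((1 - herm_prod x z) ^ N * (1 - herm_prod w x) ^ N))))"
      by (intro Bochner_Integration.integral_cong refl) (simp add: G_def mult.commute)
    also have "\<dots> = f z * toeplitz_kernel z w" unfolding toeplitz_kernel_def N_def[symmetric] by (rule integral_mult_right_zero)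
    finally show "(LINT x|ball_measure. G x z) = f z * toeplitz_kernel z w" .
  qed
  finally show ?thesis .
qed

end

locale toeplitz_setting = bounded_symbol u U + weight_params p b
  for u :: "complex^'n \<Rightarrow> complex" and U p b
begin

abbreviation X :: "(complex^'n \<Rightarrow> complex) set" where
  "X \<equiv> bergman_space p (standard_weight b)"

lemma XD:
  assumes "f \<in> X"
  shows "holomorphic_ball f" "f \<in> borel_measurable ball_measure" "Ip p b f < \<infinity>" "integrable ball_measure f"
    "(\<integral>\<^sup>+x. (\<integral>\<^sup>+z. kb 0 x z * ennreal (norm (f z)) \<partial>ball_measure) \<partial>ball_measure) < \<infinity>"
proof -
  show 1: "holomorphic_ball f" "Ip p b f < \<infinity>" using assms bergman_space_iff by auto
  show 2: "f \<in> borel_measurable ball_measure" by (rule holomorphic_ball_measurable[OF 1(1)])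
  show "integrable ball_measure f" by (rule bergman_space_integrable[OF 2 1(2)])
  show "(\<integral>\<^sup>+x. (\<integral>\<^sup>+z. kb 0 x z * ennreal (norm (f z)) \<partial>ball_measure) \<partial>ball_measure) < \<infinity>"
    by (rule kb_integral_finite[OF 2 1(2)])
qed

lemma norm_toeplitz_le:
  assumes f: "f \<in> X" and w: "norm w < 1"
  shows "ennreal (norm (toeplitz u f w)) \<le> (\<integral>\<^sup>+z. ennreal (norm (toeplitz_kernel z w)) * ennreal (norm (f z)) \<partial>ball_measure)"
proof -
  have "toeplitz u f w = (LINT z|ball_measure. f z * toeplitz_kernel z w)"
    by (rule toeplitz_eq_kernel_integral[OF XD(1,4)[OF f] w XD(5)[OF f]])
  also have "ennreal (norm \<dots>) \<le> (\<integral>\<^sup>+z. ennreal (norm (f z * toeplitz_kernel z w)) \<partial>ball_measure)"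
  proof (cases "integrable ball_measure (\<lambda>z. f z * toeplitz_kernel z w)")
    case True thus ?thesis by (rule integral_norm_bound_ennreal)
  next
    case False thus ?thesis by (simp add: not_integrable_integral_eq)
  qed
  also have "\<dots> = (\<integral>\<^sup>+z. ennreal (norm (toeplitz_kernel z w)) * ennreal (norm (f z)) \<partial>ball_measure)"
    by (simp add: norm_mult ennreal_mult mult.commute)
  finally show ?thesis .
qed

lemma toeplitz_measurable:
  assumes "f \<in> X" shows "toeplitz u f \<in> borel_measurable ball_measure"
  by (rule holomorphic_ball_measurable[OF toeplitz_holomorphic[OF XD(4)[OF assms]]])

text \<open>At each point \<open>w\<close> at least one of the two integrals is as large as half the modulus of
\<open>T\<^sub>u f (w)\<close>. Splitting the modulus according to which one gives two functions to which the Schur test applies separately. The function \<open>a\<close> will be the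
modulus of \<open>f\<close> cut off outside a compact ball.\<close>

lemma toeplitz_split_estimate:
  fixes KA KB :: "complex^'n \<Rightarrow> complex^'n \<Rightarrow> ennreal"
  assumes f: "f \<in> X"
    and KA: "kmeas KA" "\<And>z w. KA z w = KA w z" "schur_bound (s * q) MA KA" "schur_bound (s * p - b) MA KA" "MA > 0"
    and KB: "kmeas KB" "\<And>z w. KB z w = KB w z" "schur_bound (s * q) MB KB" "schur_bound (s * p - b) MB KB" "MB > 0"
    and a: "a \<in> borel_measurable ball_measure" "\<And>z. a z \<ge> 0"
    and dom: "\<And>z w. norm z < 1 \<Longrightarrow> norm w < 1 \<Longrightarrow> ennreal (norm (toeplitz_kernel z w)) * ennreal (norm (f z)) \<le> KA w z * ennreal (a z) + KB w z * ennreal (norm (f z))"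
  shows "Ip p b (toeplitz u f) \<le> ennreal (4 powr p) * (ennreal (MA powr p) * Ip p b a + ennreal (MB powr p) * Ip p b f)"
proof -
  note [measurable] = XD(2)[OF f] a(1) toeplitz_measurable[OF f]
  define A where "A w = (\<integral>\<^sup>+z. KA w z * ennreal (a z) \<partial>ball_measure)" for w
  define B where "B w = (\<integral>\<^sup>+z. KB w z * ennreal (norm (f z)) \<partial>ball_measure)" for w
  have [measurable]: "A \<in> borel_measurable ball_measure"
    unfolding A_def using KA(1) by (intro ball_measure.borel_measurable_nn_integral) (simp add: case_prod_unfold)
  have [measurable]: "B \<in> borel_measurable ball_measure"
    unfolding B_def using KB(1) by (intro ball_measure.borel_measurable_nn_integral) (simp add: case_prod_unfold)
  define F where "F w = norm (toeplitz u f w) / 2" for w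
  have F0: "F w \<ge> 0" for w by (simp add: F_def)
  have [measurable]: "F \<in> borel_measurable ball_measure" unfolding F_def by measurable
  define F1 where "F1 w = (if ennreal (F w) \<le> A w then F w else 0)" for w
  define F2 where "F2 w = (if ennreal (F w) \<le> B w then F w else 0)" for w
  have [measurable]: "F1 \<in> borel_measurable ball_measure" "F2 \<in> borel_measurable ball_measure"
    unfolding F1_def F2_def by measurable
  have AB: "ennreal (2 * F w) \<le> A w + B w" if w: "norm w < 1" for w
  proof -
    have "ennreal (2 * F w) \<le> (\<integral>\<^sup>+z. ennreal (norm (toeplitz_kernel z w)) * ennreal (norm (f z)) \<partial>ball_measure)"
      using norm_toeplitz_le[OF f w] by (simp add: F_def)
    also have "\<dots> \<le> (\<integral>\<^sup>+z. KA w z * ennreal (a z) + KB w z * ennreal (norm (f z)) \<partial>ball_measure)"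
      by (intro nn_integral_mono dom w) simp
    also have "\<dots> = A w + B w"
      unfolding A_def B_def
      by (intro nn_integral_add borel_measurable_times_ennreal kmeas_slice(1)[OF KA(1)] kmeas_slice(1)[OF KB(1)]) (use w in auto)
    finally show ?thesis .
  qed
  have F12: "F w \<le> F1 w + F2 w" if w: "norm w < 1" for w
  proof (cases "ennreal (F w) \<le> A w \<or> ennreal (F w) \<le> B w")
    case True thus ?thesis using F0 by (auto simp: F1_def F2_def)
  next
    case False
    hence "A w < ennreal (F w)" "B w < ennreal (F w)" by auto
    hence "A w + B w < ennreal (F w) + ennreal (F w)" by (rule add_strict_mono)
    also have "\<dots> = ennreal (2 * F w)" using F0[of w] by (simp flip: ennreal_plus)
    finally show ?thesis using AB[OF w] by simp
  qed
  have I1: "Ip p b F1 \<le> ennreal (MA powr p) * Ip p b a"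
  proof -
    have "(\<integral>\<^sup>+z. ennreal (F1 z powr p * (1 - (norm z)\<^sup>2) powr b) \<partial>ball_measure)
      \<le> ennreal (MA powr p) * (\<integral>\<^sup>+w. ennreal (a w powr p * (1 - (norm w)\<^sup>2) powr b) \<partial>ball_measure)"
    proof (rule schur_test[OF KA(1,2) p1 exponents(1,2) KA(3,4,5)])
      show "F1 w \<ge> 0" for w using F0 by (simp add: F1_def)
      show "ennreal (F1 z) \<le> (\<integral>\<^sup>+w. KA z w * ennreal (a w) \<partial>ball_measure)" for z
        unfolding F1_def A_def[symmetric] by simp
    qed (use a in auto)
    thus ?thesis unfolding Ip_def using a F0 by (simp add: F1_def if_distrib cong: if_cong)
  qed
  have I2: "Ip p b F2 \<le> ennreal (MB powr p) * Ip p b f"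
  proof -
    have "(\<integral>\<^sup>+z. ennreal (F2 z powr p * (1 - (norm z)\<^sup>2) powr b) \<partial>ball_measure)
      \<le> ennreal (MB powr p) * (\<integral>\<^sup>+w. ennreal (norm (f w) powr p * (1 - (norm w)\<^sup>2) powr b) \<partial>ball_measure)"
    proof (rule schur_test[OF KB(1,2) p1 exponents(1,2) KB(3,4,5)])
      show "F2 w \<ge> 0" for w using F0 by (simp add: F2_def)
      show "ennreal (F2 z) \<le> (\<integral>\<^sup>+w. KB z w * ennreal (norm (f w)) \<partial>ball_measure)" for z
        unfolding F2_def B_def[symmetric] by simp
    qed (use a in auto)
    thus ?thesis unfolding Ip_def using F0 by (simp add: F2_def if_distrib cong: if_cong)
  qed
  have "Ip p b (toeplitz u f) \<le> ennreal (2 powr p) * (Ip p b (\<lambda>w. 2 * F1 w) + Ip p b (\<lambda>w. 2 * F2 w))"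
  proof (rule Ip_add_le[OF exponents(4)])
    fix w :: "complex^'n" assume w: "norm w < 1"
    show "norm (toeplitz u f w) \<le> norm (2 * F1 w) + norm (2 * F2 w)"
      using F12[OF w] F0[of w] by (auto simp: F_def F1_def F2_def split: if_splits)
  qed measurable
  also have scale: "Ip p b (\<lambda>w. 2 * H w) = ennreal (2 powr p) * Ip p b H" if [measurable]: "H \<in> borel_measurable ball_measure" for H :: "complex^'n \<Rightarrow> real"
  proof -
    have "Ip p b (\<lambda>w. 2 * H w) = (\<integral>\<^sup>+w. ennreal (2 powr p) * ennreal (norm (H w) powr p * (1 - (norm w)\<^sup>2) powr b) \<partial>ball_measure)"
      unfolding Ip_def by (intro nn_integral_cong) (simp add: abs_mult powr_mult ennreal_mult'[symmetric] mult.assoc)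
    also have "\<dots> = ennreal (2 powr p) * Ip p b H" unfolding Ip_def by (rule nn_integral_cmult) measurable
    finally show ?thesis .
  qed
  finally have "Ip p b (toeplitz u f) \<le> ennreal (2 powr p) * (ennreal (2 powr p) * Ip p b F1 + ennreal (2 powr p) * Ip p b F2)"
    by (simp add: scale)
  also have "\<dots> = ennreal (4 powr p) * (Ip p b F1 + Ip p b F2)"
  proof -
    have "ennreal (2 powr p) * ennreal (2 powr p) = ennreal (4 powr p)"
      by (simp add: ennreal_mult'[symmetric] powr_mult[symmetric])
    thus ?thesis by (simp add: distrib_left mult.assoc[symmetric])
  qed
  also have "\<dots> \<le> ennreal (4 powr p) * (ennreal (MA powr p) * Ip p b a + ennreal (MB powr p) * Ip p b f)"
    by (intro mult_left_mono add_mono I1 I2) simp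
  finally show ?thesis .
qed

lemma toeplitz_in_space:
  assumes f: "f \<in> X" shows "toeplitz u f \<in> X"
proof -
  obtain s \<epsilon> M where M: "M > 0"
    "\<And>\<alpha>. \<alpha> = s * q \<or> \<alpha> = s * p - b \<Longrightarrow> schur_bound \<alpha> M (kcomp (kb 0) (kb 0) :: complex^'n \<Rightarrow> complex^'n \<Rightarrow> ennreal)"
    by (rule schur_kernels[where 'n='n]) blast
  define K where "K z w = ennreal U * kcomp (kb 0) (kb 0) z w + ennreal 1 * kcomp (kb 0) (kb 0) z w" for z w :: "complex^'n"
  have km: "kmeas (kcomp (kb 0) (kb 0) :: complex^'n \<Rightarrow> complex^'n \<Rightarrow> ennreal)" by (intro kmeas_kcomp kmeas_kb)
  have K: "kmeas K" "schur_bound (s * q) (U * M + 1 * M) K" "schur_bound (s * p - b) (U * M + 1 * M) K"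
  proof -
    have Mq: "schur_bound (s * q) M (kcomp (kb 0) (kb 0) :: complex^'n \<Rightarrow> complex^'n \<Rightarrow> ennreal)"
      and Mp: "schur_bound (s * p - b) M (kcomp (kb 0) (kb 0) :: complex^'n \<Rightarrow> complex^'n \<Rightarrow> ennreal)" using M(2) by blast+
    have M0: "M \<ge> 0" using M(1) by simp
    note lq = schur_bound_lincomb[OF km Mq km Mq U_nonneg zero_le_one M0 M0]
    note lp = schur_bound_lincomb[OF km Mp km Mp U_nonneg zero_le_one M0 M0]
    have Keq: "K = (\<lambda>z w. ennreal U * kcomp (kb 0) (kb 0) z w + ennreal 1 * kcomp (kb 0) (kb 0) z w)" by (simp add: K_def fun_eq_iff)
    show "kmeas K" "schur_bound (s * q) (U * M + 1 * M) K" "schur_bound (s * p - b) (U * M + 1 * M) K"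
      unfolding Keq using lq lp by blast+
  qed
  have Ks: "K z w = K w z" for z w
    unfolding K_def by (simp add: kcomp_commute[of "kb 0" z w] kb_commute)
  have "Ip p b (toeplitz u f) \<le> ennreal (4 powr p) * (ennreal ((U * M + 1 * M) powr p) * Ip p b (\<lambda>z. norm (f z)) + ennreal ((U * M + 1 * M) powr p) * Ip p b f)"
  proof (rule toeplitz_split_estimate[OF f K(1) Ks K(2,3) _ K(1) Ks K(2,3)])
    show "U * M + 1 * M > 0" using M U_nonneg by (simp add: add_nonneg_pos)
    thus "U * M + 1 * M > 0" .
    show "(\<lambda>z. norm (f z)) \<in> borel_measurable ball_measure" using XD(2)[OF f] by measurable
    fix z w :: "complex^'n" assume z: "norm z < 1" and w: "norm w < 1"
    have "ennreal (norm (toeplitz_kernel z w)) \<le> K w z"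
      using toeplitz_kernel_le[OF z w] unfolding K_def by (rule order_trans) simp
    thus "ennreal (norm (toeplitz_kernel z w)) * ennreal (norm (f z)) \<le> K w z * ennreal (norm (f z)) + K w z * ennreal (norm (f z))"
      by (meson add_increasing2 mult_right_mono zero_le)
  qed simp
  also have "\<dots> < \<infinity>"
  proof -
    have "Ip p b (\<lambda>z. norm (f z)) = Ip p b f" by (simp add: Ip_def)
    thus ?thesis using XD(3)[OF f] by (simp add: ennreal_mult_less_top)
  qed
  finally show ?thesis using toeplitz_holomorphic[OF XD(4)[OF f]] bergman_space_iff by blast
qed

end

section \<open>Vanishing Berezin transform implies compactness\<close>

context toeplitz_setting
begin

text \<open>The kernel is split into three regions: \<open>z\<close> in a compact ball, \<open>z\<close> near the sphere with \<open>w\<close> close to \<open>z\<close>, and \<open>z\<close> near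
the sphere with \<open>w\<close> far from \<open>z\<close>. On the last two the kernel is dominated by one with Schur bound \<open>\<eta>\<close>, as small as desired. On the first,
\<open>h k\<close> tends to 0 boundedly.\<close>

theorem toeplitz_null_sequence:
  fixes h :: "nat \<Rightarrow> complex^'n \<Rightarrow> complex"
  assumes lim: "\<And>\<epsilon>. \<epsilon> > 0 \<Longrightarrow> \<exists>r<1. \<forall>z. r < norm z \<longrightarrow> norm z < 1 \<longrightarrow> norm (toeplitz_kernel z z * of_real ((1 - (norm z)\<^sup>2) ^ (CARD('n) + 1))) \<le> \<epsilon>"
    and h: "\<And>k. h k \<in> X" and A: "\<And>k. Ip p b (h k) \<le> ennreal A" "A \<ge> 0"
    and ptw: "\<And>z. norm z < 1 \<Longrightarrow> (\<lambda>k. h k z) \<longlonglongrightarrow> 0"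
    and G: "\<And>k z. norm z < 1 \<Longrightarrow> norm (h k z) \<le> G / (1 - norm z) ^ N" "G \<ge> 0"
  shows "(\<lambda>k. Ip p b (toeplitz u (h k))) \<longlonglongrightarrow> 0"
proof -
  obtain s \<epsilon> M where \<epsilon>: "0 < \<epsilon>" and M: "M > 0" "\<And>\<alpha>. \<alpha> = s * q \<or> \<alpha> = s * p - b \<Longrightarrow>
      schur_bound \<alpha> M (kb 0 :: complex^'n \<Rightarrow> complex^'n \<Rightarrow> ennreal) \<and>
      schur_bound \<alpha> M (kcomp (kb 0) (kb 0) :: complex^'n \<Rightarrow> complex^'n \<Rightarrow> ennreal) \<and>
      schur_bound \<alpha> M (kcomp (kb \<epsilon>) (kb \<epsilon>) :: complex^'n \<Rightarrow> complex^'n \<Rightarrow> ennreal)"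
    by (rule schur_kernels[where 'n='n]) blast
  have M0: "M \<ge> 0" using M(1) by simp
  have km0: "kmeas (kb 0 :: complex^'n \<Rightarrow> complex^'n \<Rightarrow> ennreal)"
    and km: "kmeas (kcomp (kb e) (kb e) :: complex^'n \<Rightarrow> complex^'n \<Rightarrow> ennreal)" for e
    by (intro kmeas_kcomp kmeas_kb)+
  define MA where "MA = U * M + 1 * M"
  have MA: "MA > 0" using M(1) U_nonneg by (simp add: MA_def add_nonneg_pos)
  \<comment> \<open>the summand with coefficient 1 keeps the Schur constant MA positive when U = 0\<close>
  define KA where "KA = (\<lambda>z w :: complex^'n. ennreal U * kcomp (kb 0) (kb 0) z w + ennreal 1 * kcomp (kb 0) (kb 0) z w)"
  have KA: "kmeas KA" "\<alpha> = s * q \<or> \<alpha> = s * p - b \<Longrightarrow> schur_bound \<alpha> MA KA" for \<alpha>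
    unfolding KA_def MA_def
    using schur_bound_lincomb(2)[OF km M(2)[of "s * q", THEN conjunct2, THEN conjunct1] km M(2)[of "s * q", THEN conjunct2, THEN conjunct1] U_nonneg zero_le_one M0 M0]
      schur_bound_lincomb(1)[OF km M(2)[of \<alpha>, THEN conjunct2, THEN conjunct1] km M(2)[of \<alpha>, THEN conjunct2, THEN conjunct1] U_nonneg zero_le_one M0 M0]
    by blast+
  have KAs: "KA z w = KA w z" for z w
    unfolding KA_def by (simp add: kcomp_commute[of "kb 0" z w] kb_commute)
  have small: "\<forall>\<^sub>F k in sequentially. Ip p b (toeplitz u (h k)) \<le> ennreal e" if e: "e > 0" for e
  proof -
    \<comment> \<open>the small part may contribute at most e / 2 on sequences bounded by A\<close>
    define \<eta> where "\<eta> = ((e / 2) / (4 powr p * (A + 1))) powr (1 / p)"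
    have \<eta>: "\<eta> > 0" using e A(2) by (simp add: \<eta>_def)
    have \<eta>p: "4 powr p * (\<eta> powr p * A) \<le> e / 2"
    proof -
      have "\<eta> powr p = (e / 2) / (4 powr p * (A + 1))" using e A(2) exponents(4) by (simp add: \<eta>_def powr_powr)
      hence "4 powr p * (\<eta> powr p * A) = (e / 2) * (A / (A + 1))" using A(2) by simp
      also have "\<dots> \<le> (e / 2) * 1" using e A(2) by (intro mult_left_mono) (auto simp: divide_le_eq)
      finally show ?thesis by simp
    qed
    \<comment> \<open>makes U (4 c)^\<epsilon> M at most \<eta> / 2, the share of the region far from the diagonal\<close>
    define c where "c = ((\<eta> / 2) / ((U + 1) * M)) powr (1 / \<epsilon>) / 4"
    have c: "c > 0" using \<eta> U_nonneg M(1) by (simp add: c_def add_nonneg_eq_0_iff)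
    define \<delta> where "\<delta> = min (1/2) c"
    have \<delta>: "0 < \<delta>" "\<delta> < 1" "\<delta> \<le> c" using c by (auto simp: \<delta>_def)
    define \<epsilon>1 where "\<epsilon>1 = \<eta> / (2 * M)"
    have \<epsilon>1: "\<epsilon>1 > 0" using \<eta> M(1) by (simp add: \<epsilon>1_def)
    define b2 where "b2 = U * (4 * \<delta>) powr \<epsilon>"
    have b2: "b2 \<ge> 0" using U_nonneg by (simp add: b2_def)
    have sum: "\<epsilon>1 * M + b2 * M \<le> \<eta>"
    proof -
      have "(4 * \<delta>) powr \<epsilon> \<le> (4 * c) powr \<epsilon>" using \<delta> \<epsilon> by (intro powr_mono2) auto
      also have "\<dots> = (\<eta> / 2) / ((U + 1) * M)" using \<epsilon> \<eta> U_nonneg M(1) by (simp add: c_def powr_powr)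
      finally have "b2 * M \<le> (U + 1) * ((\<eta> / 2) / ((U + 1) * M)) * M"
        unfolding b2_def using U_nonneg M(1) by (intro mult_right_mono mult_mono) auto
      also have "\<dots> = \<eta> / 2" using U_nonneg M(1) by (simp add: add_nonneg_eq_0_iff)
      finally show ?thesis using M(1) by (simp add: \<epsilon>1_def)
    qed
    define KB where "KB = (\<lambda>z w :: complex^'n. ennreal \<epsilon>1 * kb 0 z w + ennreal b2 * kcomp (kb \<epsilon>) (kb \<epsilon>) z w)"
    have KB: "kmeas KB" "\<alpha> = s * q \<or> \<alpha> = s * p - b \<Longrightarrow> schur_bound \<alpha> \<eta> KB" for \<alpha>
    proof -
      show "kmeas KB" unfolding KB_def
        by (rule schur_bound_lincomb(2)[OF km0 M(2)[of "s * q", THEN conjunct1] km M(2)[of "s * q", THEN conjunct2, THEN conjunct2]]) (use \<epsilon>1 b2 M0 in auto)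
      assume \<alpha>: "\<alpha> = s * q \<or> \<alpha> = s * p - b"
      have "schur_bound \<alpha> (\<epsilon>1 * M + b2 * M) KB" unfolding KB_def
        by (rule schur_bound_lincomb(1)[OF km0 M(2)[OF \<alpha>, THEN conjunct1] km M(2)[OF \<alpha>, THEN conjunct2, THEN conjunct2]]) (use \<epsilon>1 b2 M0 in auto)
      thus "schur_bound \<alpha> \<eta> KB" using sum by (rule schur_bound_mono)
    qed
    have KBs: "KB z w = KB w z" for z w
      unfolding KB_def by (simp add: kcomp_commute[of "kb \<epsilon>" z w] kb_commute)
    obtain r0 where r0: "r0 < 1" "\<And>z w. r0 < norm z \<Longrightarrow> norm z < 1 \<Longrightarrow> norm w < 1 \<Longrightarrow> rho z w \<ge> \<delta> \<Longrightarrow> norm (toeplitz_kernel z w) \<le> \<epsilon>1 * bkernel 0 z w"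
      using toeplitz_kernel_small[OF lim \<delta>(1,2) \<epsilon>1] by blast
    define r where "r = max r0 0"
    have r: "0 \<le> r" "r < 1" "r0 \<le> r" using r0(1) by (auto simp: r_def)
    define a where "a k z = (if norm z \<le> r then norm (h k z) else 0)" for k z
    have am [measurable]: "a k \<in> borel_measurable ball_measure" for k
      unfolding a_def using XD(2)[OF h[of k]] by measurable
    have split: "Ip p b (toeplitz u (h k)) \<le> ennreal (4 powr p) * (ennreal (MA powr p) * Ip p b (a k) + ennreal (\<eta> powr p) * Ip p b (h k))" for k
    proof (rule toeplitz_split_estimate[OF h KA(1) KAs KA(2) KA(2) MA KB(1) KBs KB(2) KB(2) \<eta> am])
      fix z w :: "complex^'n" assume z: "norm z < 1" and w: "norm w < 1"
      show "ennreal (norm (toeplitz_kernel z w)) * ennreal (norm (h k z)) \<le> KA w z * ennreal (a k z) + KB w z * ennreal (norm (h k z))"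
      proof (cases "norm z \<le> r")
        case True
        have "ennreal (norm (toeplitz_kernel z w)) \<le> KA w z" using toeplitz_kernel_le[OF z w] unfolding KA_def by (rule order_trans) simp
        hence "ennreal (norm (toeplitz_kernel z w)) * ennreal (norm (h k z)) \<le> KA w z * ennreal (a k z)"
          using True by (simp add: a_def mult_right_mono)
        thus ?thesis by (rule order_trans) simp
      next
        case False
        have "ennreal (norm (toeplitz_kernel z w)) \<le> KB w z"
        proof (cases "rho z w \<ge> \<delta>")
          case True
          have "norm (toeplitz_kernel z w) \<le> \<epsilon>1 * bkernel 0 z w" using False r by (intro r0(2) z w True) auto
          hence "ennreal (norm (toeplitz_kernel z w)) \<le> ennreal \<epsilon>1 * kb 0 w z"
            unfolding kb_def bkernel_commute[of 0 w z] using \<epsilon>1 by (simp add: ennreal_mult'[symmetric] bkernel_nonneg ennreal_leI)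
          thus ?thesis unfolding KB_def by (rule order_trans) simp
        next
          case False
          hence "rho w z < \<delta>" by (simp add: rho_commute[of w z])
          have "ennreal (norm (toeplitz_kernel z w)) \<le> ennreal U * kcomp (kb 0) (kb 0) w z" by (rule toeplitz_kernel_le[OF z w])
          also have "\<dots> \<le> ennreal U * (ennreal ((4 * \<delta>) powr \<epsilon>) * kcomp (kb \<epsilon>) (kb \<epsilon>) w z)"
            by (intro mult_left_mono kcomp_kb_dominate[OF z w \<open>rho w z < \<delta>\<close> \<epsilon>]) simp
          also have "\<dots> = ennreal b2 * kcomp (kb \<epsilon>) (kb \<epsilon>) w z"
            using U_nonneg by (simp add: b2_def ennreal_mult mult.assoc)
          finally show ?thesis unfolding KB_def by (rule order_trans) simp
        qed
        hence "ennreal (norm (toeplitz_kernel z w)) * ennreal (norm (h k z)) \<le> KB w z * ennreal (norm (h k z))" by (rule mult_right_mono) simp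
        thus ?thesis by (rule order_trans) simp
      qed
    qed (auto simp: a_def)
    have "(\<lambda>k. Ip p b (a k)) \<longlonglongrightarrow> (\<integral>\<^sup>+z. 0 \<partial>(ball_measure :: (complex^'n) measure))"
      unfolding Ip_def
    proof (rule nn_integral_dominated_convergence[where w = "\<lambda>z. ennreal ((G / (1 - r) ^ N) powr p * (1 - (norm z)\<^sup>2) powr b)"])
      show "AE z in ball_measure. ennreal (norm (a k z) powr p * (1 - (norm z)\<^sup>2) powr b) \<le> ennreal ((G / (1 - r) ^ N) powr p * (1 - (norm z)\<^sup>2) powr b)" for k
      proof (rule AE_I2)
        fix z :: "complex^'n" assume "z \<in> space ball_measure"
        hence z: "norm z < 1" by simp
        have "norm (a k z) \<le> G / (1 - r) ^ N"
        proof (cases "norm z \<le> r")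
          case True
          have "norm (h k z) \<le> G / (1 - norm z) ^ N" by (rule G(1)[OF z])
          also have "\<dots> \<le> G / (1 - r) ^ N" using True r z G(2) by (intro divide_left_mono power_mono mult_pos_pos zero_less_power) auto
          finally show ?thesis using True by (simp add: a_def)
        qed (use G(2) r in \<open>simp add: a_def\<close>)
        thus "ennreal (norm (a k z) powr p * (1 - (norm z)\<^sup>2) powr b) \<le> ennreal ((G / (1 - r) ^ N) powr p * (1 - (norm z)\<^sup>2) powr b)"
          using exponents(4) by (intro ennreal_leI mult_right_mono powr_mono2) auto
      qed
      have "(\<integral>\<^sup>+z. ennreal ((G / (1 - r) ^ N) powr p * (1 - (norm z)\<^sup>2) powr b) \<partial>(ball_measure :: (complex^'n) measure)) = ennreal (LINT z|(ball_measure :: (complex^'n) measure). (G / (1 - r) ^ N) powr p * (1 - (norm z)\<^sup>2) powr b)"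
        by (rule nn_integral_eq_integral[OF integrable_mult_right[OF integrable_weight[OF b1]]]) simp
      thus "(\<integral>\<^sup>+z. ennreal ((G / (1 - r) ^ N) powr p * (1 - (norm z)\<^sup>2) powr b) \<partial>(ball_measure :: (complex^'n) measure)) < \<infinity>" by simp
      show "AE z in ball_measure. (\<lambda>k. ennreal (norm (a k z) powr p * (1 - (norm z)\<^sup>2) powr b)) \<longlonglongrightarrow> 0"
      proof (rule AE_I2)
        fix z :: "complex^'n" assume "z \<in> space ball_measure"
        hence z: "norm z < 1" by simp
        have "(\<lambda>k. norm (a k z)) \<longlonglongrightarrow> 0"
          using tendsto_norm_zero[OF ptw[OF z]] by (cases "norm z \<le> r") (auto simp: a_def)
        hence "(\<lambda>k. norm (a k z) powr p) \<longlonglongrightarrow> 0"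
          using exponents(4) by (intro tendsto_zero_powrI[OF _ tendsto_const]) auto
        hence "(\<lambda>k. norm (a k z) powr p * (1 - (norm z)\<^sup>2) powr b) \<longlonglongrightarrow> 0" by (rule tendsto_mult_left_zero)
        thus "(\<lambda>k. ennreal (norm (a k z) powr p * (1 - (norm z)\<^sup>2) powr b)) \<longlonglongrightarrow> 0"
          using tendsto_ennrealI by force
      qed
    qed measurable
    hence "(\<lambda>k. ennreal (4 powr p * MA powr p) * Ip p b (a k)) \<longlonglongrightarrow> ennreal (4 powr p * MA powr p) * 0"
      by (intro ennreal_tendsto_cmult) auto
    hence "\<forall>\<^sub>F k in sequentially. ennreal (4 powr p * MA powr p) * Ip p b (a k) < ennreal (e / 2)"
      using e by (intro order_tendstoD(2)[of _ 0]) auto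
    thus ?thesis
    proof eventually_elim
      case (elim k)
      have "Ip p b (toeplitz u (h k)) \<le> ennreal (4 powr p * MA powr p) * Ip p b (a k) + ennreal (4 powr p * \<eta> powr p) * Ip p b (h k)"
        using split[of k] by (simp add: distrib_left ennreal_mult mult.assoc)
      also have "\<dots> \<le> ennreal (e / 2) + ennreal (4 powr p * \<eta> powr p) * ennreal A"
        using elim by (intro add_mono mult_left_mono A(1)) auto
      also have "\<dots> = ennreal (e / 2 + 4 powr p * (\<eta> powr p * A))"
        using e A(2) by (simp add: ennreal_mult'[symmetric] ennreal_plus[symmetric] mult.assoc del: ennreal_plus)
      also have "\<dots> \<le> ennreal e" using \<eta>p by (intro ennreal_leI) simp
      finally show ?case .
    qed
  qed
  show ?thesis
  proof (rule order_tendstoI)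
    fix x :: ennreal assume "x < 0" thus "\<forall>\<^sub>F k in sequentially. x < Ip p b (toeplitz u (h k))" by simp
  next
    fix x :: ennreal assume x: "0 < x"
    obtain e where e: "e > 0" "ennreal e < x"
    proof (cases x)
      case (real y)
      thus ?thesis using x that[of "y / 2"] by (simp add: ennreal_less_iff)
    next
      case top
      thus ?thesis using that[of 1] by simp
    qed
    from small[OF e(1)] show "\<forall>\<^sub>F k in sequentially. Ip p b (toeplitz u (h k)) < x"
      by eventually_elim (rule le_less_trans[OF _ e(2)])
  qed
qed

definition weight_mass :: real where
  "weight_mass = (LINT w|(ball_measure :: (complex^'n) measure). (1 - (norm w)\<^sup>2) powr b)"

lemma weight_mass_pos: "weight_mass > 0"
  unfolding weight_mass_def by (rule weight_constant_pos[OF b1])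

lemma Ip_weighted_norm:
  fixes f :: "complex^'n \<Rightarrow> complex"
  assumes "f \<in> borel_measurable ball_measure" "Ip p b f < \<infinity>"
  shows "Ip p b f = ennreal (weight_mass * weighted_norm p (standard_weight b) f powr p)"
    and "weighted_norm p (standard_weight b) f = (enn2real (Ip p b f) / weight_mass) powr (1 / p)"
proof -
  show 1: "Ip p b f = ennreal (weight_mass * weighted_norm p (standard_weight b) f powr p)"
    unfolding weight_mass_def by (rule weighted_integral_Ip(2)[OF b1 exponents(4) assms, symmetric])
  have "weighted_norm p (standard_weight b) f \<ge> 0" by (simp add: weighted_norm_def)
  thus "weighted_norm p (standard_weight b) f = (enn2real (Ip p b f) / weight_mass) powr (1 / p)"
    unfolding 1 using weight_mass_pos exponents(4) by (simp add: powr_powr)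
qed

lemma weighted_norm_cong:
  assumes "\<And>z. norm z < 1 \<Longrightarrow> f z = g z"
  shows "weighted_norm p (standard_weight b) f = weighted_norm p (standard_weight b) (g :: complex^'n \<Rightarrow> complex)"
proof -
  have "(LINT z|ball_measure. norm (f z) powr p * standard_weight b z) = (LINT z|ball_measure. norm (g z) powr p * standard_weight b z)"
    by (intro Bochner_Integration.integral_cong refl) (simp add: assms)
  thus ?thesis by (simp only: weighted_norm_def)
qed

lemma toeplitz_diff:
  assumes f: "integrable ball_measure f" and g: "integrable ball_measure g" and z: "norm z < 1"
  shows "toeplitz u f z - toeplitz u g z = toeplitz u (\<lambda>w. f w - g w) z"
proof -
  have i: "integrable ball_measure (\<lambda>w. u w * f w / (1 - herm_prod z w) ^ (CARD('n) + 1))" if "integrable ball_measure f" for f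
  proof -
    have "integrable ball_measure (\<lambda>w. u w * f w * (1 / (1 - herm_prod z w) ^ (CARD('n) + 1)))"
      by (rule integrable_mult_bounded[OF u_integral(1)[OF that], where B = "1 / (1 - norm z) ^ (CARD('n) + 1)"])
         (measurable, rule norm_bergman_kernel_le[OF z], simp)
    thus ?thesis by simp
  qed
  show ?thesis unfolding toeplitz_def
    by (subst Bochner_Integration.integral_diff[symmetric, OF i[OF f] i[OF g]])
       (simp add: right_diff_distrib diff_divide_distrib)
qed

lemma X_diff:
  assumes f: "f \<in> X" and g: "g \<in> X"
  shows "(\<lambda>z. f z - g z) \<in> X" "Ip p b (\<lambda>z. f z - g z) \<le> ennreal (2 powr p) * (Ip p b f + Ip p b g)"
proof -
  note [measurable] = XD(2)[OF f] XD(2)[OF g]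
  show 1: "Ip p b (\<lambda>z. f z - g z) \<le> ennreal (2 powr p) * (Ip p b f + Ip p b g)"
    by (rule Ip_add_le[OF exponents(4)]) (auto simp: norm_triangle_ineq4)
  have "Ip p b (\<lambda>z. f z - g z) < \<infinity>"
    using XD(3)[OF f] XD(3)[OF g] by (intro le_less_trans[OF 1]) (simp add: ennreal_mult_less_top)
  thus "(\<lambda>z. f z - g z) \<in> X" using holomorphic_ball_diff[OF XD(1)[OF f] XD(1)[OF g]] bergman_space_iff by blast
qed

text \<open>A bounded sequence has a subsequence that converges pointwise to some \<open>g\<close>, which lies in the space by
Fatou's lemma. The differences are bounded and tend to 0 pointwise, so their images are a null sequence and the images of the subsequence
converge to \<open>T\<^sub>u g\<close>.\<close>

theorem compact_if_diagonal_vanishes: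
  assumes lim: "\<And>\<epsilon>. \<epsilon> > 0 \<Longrightarrow> \<exists>r<1. \<forall>z. r < norm z \<longrightarrow> norm z < 1 \<longrightarrow> norm (toeplitz_kernel z z * of_real ((1 - (norm z)\<^sup>2) ^ (CARD('n) + 1))) \<le> \<epsilon>"
  shows "toeplitz_compact u p b"
  unfolding toeplitz_compact_def compact_operator_on_def
proof (intro conjI ballI allI impI)
  show "toeplitz u f \<in> X" if "f \<in> X" for f by (rule toeplitz_in_space[OF that])
  let ?N = "weighted_norm p (standard_weight b) :: (complex^'n \<Rightarrow> complex) \<Rightarrow> real"
  fix f :: "nat \<Rightarrow> complex^'n \<Rightarrow> complex"
  assume "(\<forall>k. f k \<in> X) \<and> bdd_above (range (\<lambda>k. ?N (f k)))"
  hence f: "\<And>k. f k \<in> X" and bdd: "bdd_above (range (\<lambda>k. ?N (f k)))" by auto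
  obtain B where B: "\<And>k. ?N (f k) \<le> B" using bdd unfolding bdd_above_def by auto
  define A where "A = weight_mass * max B 0 powr p"
  have A0: "A \<ge> 0" using weight_mass_pos by (simp add: A_def)
  have A: "Ip p b (f k) \<le> ennreal A" for k
  proof -
    have "?N (f k) powr p \<le> max B 0 powr p" using B[of k] exponents(4) by (intro powr_mono2) (auto simp: weighted_norm_def)
    thus ?thesis unfolding Ip_weighted_norm(1)[OF XD(2,3)[OF f]] A_def using weight_mass_pos by (intro ennreal_leI mult_left_mono) auto
  qed
  obtain C where C: "C > 0" "\<And>(f :: complex^'n \<Rightarrow> complex) A. (\<lambda>z. norm (f z)) \<in> borel_measurable ball_measure \<Longrightarrow>
     Ip p b f \<le> ennreal A \<Longrightarrow> A \<ge> 0 \<Longrightarrow> (\<integral>\<^sup>+z. ennreal (norm (f z)) \<partial>ball_measure) \<le> ennreal (C * A powr (1/p))"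
    using L1_embedding[where 'n='n and 'b=complex] by blast
  define L where "L = C * A powr (1/p)"
  have L0: "L \<ge> 0" using C(1) by (simp add: L_def)
  have L1: "(LINT w|ball_measure. norm (g w)) \<le> L" if g: "g \<in> X" "Ip p b g \<le> ennreal A" for g
  proof -
    have [measurable]: "g \<in> borel_measurable ball_measure" by (rule XD(2)[OF g(1)])
    have "ennreal (LINT w|ball_measure. norm (g w)) = (\<integral>\<^sup>+w. ennreal (norm (g w)) \<partial>ball_measure)"
      by (rule nn_integral_eq_integral[symmetric, OF integrable_norm[OF XD(4)[OF g(1)]]]) simp
    also have "\<dots> \<le> ennreal L" unfolding L_def by (rule C(2)[OF _ g(2) A0]) measurable
    finally show ?thesis using L0 by simp
  qed
  obtain r g where r: "strict_mono r" and g: "holomorphic_ball g" and conv: "\<And>z. norm z < 1 \<Longrightarrow> (\<lambda>k. f (r k) z) \<longlonglongrightarrow> g z"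
    using L1_bounded_pointwise_subsequence[where f = f and B = L, OF XD(1)[OF f] XD(4)[OF f] L1[OF f A]] by blast
  have gI: "Ip p b g \<le> ennreal A"
  proof -
    have "Ip p b g = (\<integral>\<^sup>+z. liminf (\<lambda>k. ennreal (norm (f (r k) z) powr p * (1 - (norm z)\<^sup>2) powr b)) \<partial>ball_measure)"
      unfolding Ip_def
    proof (intro nn_integral_cong lim_imp_Liminf[symmetric])
      fix z :: "complex^'n" assume "z \<in> space ball_measure"
      hence "(\<lambda>k. norm (f (r k) z)) \<longlonglongrightarrow> norm (g z)" by (intro tendsto_norm conv) simp
      hence "(\<lambda>k. norm (f (r k) z) powr p) \<longlonglongrightarrow> norm (g z) powr p"
        using exponents(4) by (intro tendsto_powr2[OF _ tendsto_const]) auto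
      thus "(\<lambda>k. ennreal (norm (f (r k) z) powr p * (1 - (norm z)\<^sup>2) powr b)) \<longlonglongrightarrow> ennreal (norm (g z) powr p * (1 - (norm z)\<^sup>2) powr b)"
        by (intro tendsto_ennrealI tendsto_mult tendsto_const)
    qed simp
    also have "\<dots> \<le> liminf (\<lambda>k. \<integral>\<^sup>+z. ennreal (norm (f (r k) z) powr p * (1 - (norm z)\<^sup>2) powr b) \<partial>ball_measure)"
      by (rule nn_integral_liminf) (use XD(2)[OF f] in measurable)
    also have "\<dots> = liminf (\<lambda>k. Ip p b (f (r k)))" by (simp add: Ip_def)
    also have "\<dots> \<le> limsup (\<lambda>k. Ip p b (f (r k)))" by (rule Liminf_le_Limsup) simp
    also have "\<dots> \<le> ennreal A" by (rule Limsup_bounded) (intro always_eventually allI A)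
    finally show ?thesis .
  qed
  have gX: "g \<in> X" using g le_less_trans[OF gI ennreal_less_top] bergman_space_iff by auto
  define h where "h k z = f (r k) z - g z" for k z
  have hX: "h k \<in> X" and hI: "Ip p b (h k) \<le> ennreal (2 powr p * (A + A))" for k
  proof -
    show "h k \<in> X" unfolding h_def by (rule X_diff(1)[OF f gX])
    have "Ip p b (h k) \<le> ennreal (2 powr p) * (Ip p b (f (r k)) + Ip p b g)" unfolding h_def by (rule X_diff(2)[OF f gX])
    also have "\<dots> \<le> ennreal (2 powr p) * (ennreal A + ennreal A)" by (intro mult_left_mono add_mono A gI) simp
    also have "\<dots> = ennreal (2 powr p * (A + A))" using A0 by (simp add: ennreal_mult'[symmetric] ennreal_plus[symmetric] del: ennreal_plus)
    finally show "Ip p b (h k) \<le> ennreal (2 powr p * (A + A))" .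
  qed
  have lim_h: "(\<lambda>k. Ip p b (toeplitz u (h k))) \<longlonglongrightarrow> 0"
  proof (rule toeplitz_null_sequence[OF lim hX hI])
    show "2 powr p * (A + A) \<ge> 0" using A0 by simp
    show "(\<lambda>k. h k z) \<longlonglongrightarrow> 0" if "norm z < 1" for z
      unfolding h_def using tendsto_diff[OF conv[OF that] tendsto_const[of "g z"]] by simp
    show "norm (h k z) \<le> (L + L) / (1 - norm z) ^ (CARD('n) + 1)" if z: "norm z < 1" for k z
    proof -
      have b: "norm (v z) \<le> L / (1 - norm z) ^ (CARD('n) + 1)" if "v \<in> X" "Ip p b v \<le> ennreal A" for v
        by (rule order_trans[OF norm_le_L1[OF XD(1,4)[OF that(1)] z]]) (use L1[OF that] z in \<open>auto intro!: divide_right_mono\<close>)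
      have "norm (h k z) \<le> norm (f (r k) z) + norm (g z)" unfolding h_def by (rule norm_triangle_ineq4)
      also have "\<dots> \<le> L / (1 - norm z) ^ (CARD('n) + 1) + L / (1 - norm z) ^ (CARD('n) + 1)"
        by (intro add_mono b f A gX gI)
      finally show ?thesis by (simp add: add_divide_distrib)
    qed
    show "L + L \<ge> 0" using L0 by simp
  qed
  have "(\<lambda>k. ?N (\<lambda>z. toeplitz u (f (r k)) z - toeplitz u g z)) \<longlonglongrightarrow> 0"
  proof -
    have eq: "?N (\<lambda>z. toeplitz u (f (r k)) z - toeplitz u g z) = (enn2real (Ip p b (toeplitz u (h k))) / weight_mass) powr (1 / p)" for k
    proof -
      have "?N (\<lambda>z. toeplitz u (f (r k)) z - toeplitz u g z) = ?N (toeplitz u (h k))"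
        by (rule weighted_norm_cong) (unfold h_def, rule toeplitz_diff[OF XD(4)[OF f] XD(4)[OF gX]])
      thus ?thesis using Ip_weighted_norm(2)[OF XD(2,3)[OF toeplitz_in_space[OF hX]]] by simp
    qed
    have "(\<lambda>k. enn2real (Ip p b (toeplitz u (h k)))) \<longlonglongrightarrow> 0"
      by (rule tendsto_enn2real) (use lim_h in simp_all)
    hence "(\<lambda>k. enn2real (Ip p b (toeplitz u (h k))) / weight_mass) \<longlonglongrightarrow> 0"
      using tendsto_divide[OF _ tendsto_const[of weight_mass]] weight_mass_pos by fastforce
    hence "(\<lambda>k. (enn2real (Ip p b (toeplitz u (h k))) / weight_mass) powr (1 / p)) \<longlonglongrightarrow> 0"
      using exponents(4) weight_mass_pos by (intro tendsto_zero_powrI[OF _ tendsto_const]) auto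
    thus ?thesis unfolding eq .
  qed
  thus "\<exists>r g. strict_mono r \<and> g \<in> X \<and> (\<lambda>k. ?N (\<lambda>z. toeplitz u (f (r k)) z - g z)) \<longlonglongrightarrow> 0"
    using r toeplitz_in_space[OF gX] by blast
qed

end

section \<open>Compactness implies vanishing Berezin transform\<close>

lemma holomorphic_bergman_kernel:
  fixes z :: "complex^'n"
  assumes z: "norm z < 1"
  shows "holomorphic_ball (\<lambda>w. 1 / (1 - herm_prod w z) ^ m)"
  unfolding holomorphic_ball_def
proof
  fix w :: "complex^'n" assume "w \<in> ball 0 1"
  hence w: "norm w < 1" by simp
  have nz: "1 - herm_prod w z \<noteq> 0" by (rule one_minus_herm_prod_nonzero(1)[OF w less_imp_le[OF z]])
  have "((\<lambda>x. 1 / (1 - x) ^ m) has_field_derivative deriv (\<lambda>x. 1 / (1 - x) ^ m) (herm_prod w z)) (at (herm_prod w z))"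
    using nz by (intro DERIV_deriv_iff_field_differentiable[THEN iffD2] derivative_intros) auto
  hence "((\<lambda>w. 1 / (1 - herm_prod w z) ^ m) has_derivative (\<lambda>v. deriv (\<lambda>x. 1 / (1 - x) ^ m) (herm_prod w z) * herm_prod v z)) (at w)"
    using has_derivative_compose[OF bounded_linear_imp_has_derivative[OF bounded_linear_herm_prod_left[of z]] has_field_derivative_imp_has_derivative]
    by fastforce
  thus "\<exists>D. ((\<lambda>w. 1 / (1 - herm_prod w z) ^ m) has_derivative D) (at w) \<and> (\<forall>c v. D (c *s v) = c * D v)"
    by (intro exI conjI) (auto simp: herm_prod_smult_left)
qed

lemma holomorphic_ball_cmult:
  fixes f :: "complex^'n \<Rightarrow> complex"
  assumes "holomorphic_ball f" shows "holomorphic_ball (\<lambda>z. c * f z)"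
  unfolding holomorphic_ball_def
proof
  fix z :: "complex^'n" assume "z \<in> ball 0 1"
  then obtain D where D: "(f has_derivative D) (at z)" "\<forall>c v. D (c *s v) = c * D v"
    using assms unfolding holomorphic_ball_def by blast
  show "\<exists>D. ((\<lambda>z. c * f z) has_derivative D) (at z) \<and> (\<forall>c v. D (c *s v) = c * D v)"
    by (rule exI[of _ "\<lambda>v. c * D v"]) (use D(2) in \<open>simp add: has_derivative_mult_right[OF D(1)]\<close>)
qed

lemma tendsto_0_nonneg:
  fixes a :: "nat \<Rightarrow> real"
  assumes "\<And>e. e > 0 \<Longrightarrow> \<forall>\<^sub>F k in sequentially. a k < e" "\<And>k. a k \<ge> 0"
  shows "a \<longlonglongrightarrow> 0"
  using assms by (auto simp: tendsto_iff)

lemma tendsto_0_boundary_iff: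
  fixes f :: "'a::real_normed_vector \<Rightarrow> complex"
  shows "(f \<longlongrightarrow> 0) (filtercomap norm (at_left 1)) \<longleftrightarrow>
    (\<forall>\<epsilon>>0. \<exists>r<1. \<forall>z. r < norm z \<longrightarrow> norm z < 1 \<longrightarrow> norm (f z) \<le> \<epsilon>)"
proof -
  have ev: "(\<forall>\<^sub>F z in filtercomap norm (at_left 1). norm (f z) < \<epsilon>) \<longleftrightarrow>
      (\<exists>r<1. \<forall>z. r < norm z \<longrightarrow> norm z < 1 \<longrightarrow> norm (f z) < \<epsilon>)" for \<epsilon>
  proof
    assume "\<forall>\<^sub>F z in filtercomap norm (at_left 1). norm (f z) < \<epsilon>"
    then obtain Q where Q: "eventually Q (at_left (1::real))" "\<And>z. Q (norm z) \<Longrightarrow> norm (f z) < \<epsilon>"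
      unfolding eventually_filtercomap by blast
    obtain r where "r < 1" "\<forall>y>r. y < 1 \<longrightarrow> Q y"
      using Q(1) eventually_at_left[of 0 "1::real" Q] by auto
    thus "\<exists>r<1. \<forall>z. r < norm z \<longrightarrow> norm z < 1 \<longrightarrow> norm (f z) < \<epsilon>" using Q(2) by blast
  next
    assume "\<exists>r<1. \<forall>z. r < norm z \<longrightarrow> norm z < 1 \<longrightarrow> norm (f z) < \<epsilon>"
    then obtain r where r: "r < 1" "\<forall>z. r < norm z \<longrightarrow> norm z < 1 \<longrightarrow> norm (f z) < \<epsilon>" by blast
    show "\<forall>\<^sub>F z in filtercomap norm (at_left 1). norm (f z) < \<epsilon>"
      unfolding eventually_filtercomap
    proof (intro exI[of _ "\<lambda>y. r < y \<and> y < 1"] conjI allI impI)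
      show "\<forall>\<^sub>F y in at_left 1. r < y \<and> y < 1" using eventually_at_left[OF r(1)] r(1) by auto
    qed (use r in auto)
  qed
  have half: "\<epsilon> / 2 > 0 \<and> \<epsilon> / 2 < \<epsilon>" if "\<epsilon> > 0" for \<epsilon> :: real using that by simp
  show ?thesis unfolding tendsto_iff dist_norm diff_zero ev
    by (meson half le_less_trans less_imp_le)
qed

context weight_params
begin

lemma bounded_holomorphic_in_bergman_space:
  fixes f :: "complex^'n \<Rightarrow> complex"
  assumes f: "holomorphic_ball f" and B: "\<And>z. norm z < 1 \<Longrightarrow> norm (f z) \<le> B"
  shows "f \<in> bergman_space p (standard_weight b)"
proof -
  have "Ip p b f \<le> (\<integral>\<^sup>+z. ennreal (B powr p * (1 - (norm z)\<^sup>2) powr b) \<partial>(ball_measure :: (complex^'n) measure))"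
    unfolding Ip_def using exponents(4) B by (intro nn_integral_mono ennreal_leI mult_right_mono powr_mono2) auto
  also have "\<dots> = ennreal (LINT z|(ball_measure :: (complex^'n) measure). B powr p * (1 - (norm z)\<^sup>2) powr b)"
    by (rule nn_integral_eq_integral[OF integrable_mult_right[OF integrable_weight[OF b1]]]) simp
  also have "\<dots> < \<infinity>" by simp
  finally show ?thesis using f bergman_space_iff by blast
qed

text \<open>Hoelder's inequality and the Forelli-Rudin estimate for the dual weight. Together with the
reproducing formula this bounds point evaluation by \<open>(1 - |z|^2)^(-\<gamma>)\<close>; the integral on the left is kept because the
estimate is also used for functions that are cut off near the origin and no longer holomorphic.\<close>

lemma kernel_pairing_le:
  defines "\<gamma> \<equiv> (real CARD('n) + 1 + b) / p"
  obtains C where "C > 0" "\<And>(f :: complex^'n \<Rightarrow> complex) A z. f \<in> borel_measurable ball_measure \<Longrightarrow>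
     Ip p b f \<le> ennreal A \<Longrightarrow> A \<ge> 0 \<Longrightarrow> norm z < 1 \<Longrightarrow>
     (\<integral>\<^sup>+w. ennreal (norm (f w) * (1 / norm (1 - herm_prod z w) ^ (CARD('n) + 1))) \<partial>ball_measure)
       \<le> ennreal (C * A powr (1/p) * (1 - (norm z)\<^sup>2) powr (- \<gamma>))"
proof -
  define n where "n = real CARD('n) + 1"
  have n: "n \<ge> 1" by (simp add: n_def)
  have \<gamma>: "\<gamma> > 0" unfolding \<gamma>_def n_def[symmetric] using n b1 exponents(4) by simp
  have s: "q * \<gamma> > 0" using \<gamma> exponents(3) by simp
  \<comment> \<open>so that the kernel to the power q has the Forelli-Rudin exponent with t = - b q / p and s = q \<gamma>\<close>
  have expo: "n + (- b * q / p) + q * \<gamma> = n * q"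
  proof -
    have "q * (1 / p + 1 / q) = q" using exponents(2) by simp
    hence "q / p + 1 = q" using exponents(3) by (simp add: distrib_left)
    hence e1: "n * q = n + n * (q / p)" by (metis add.commute distrib_left mult.right_neutral)
    have e2: "q * ((n + b) / p) = n * (q / p) + b * q / p" by (simp add: distrib_left add_divide_distrib mult.commute)
    have e3: "- b * q / p = - (b * q / p)" by simp
    show ?thesis unfolding \<gamma>_def n_def[symmetric] e1 e2 e3 by simp
  qed
  obtain C where C: "C > 0" "\<And>z::complex^'n. norm z < 1 \<Longrightarrow>
    (\<integral>\<^sup>+w. ennreal ((1 - (norm w)\<^sup>2) powr (- b * q / p) * norm (1 - herm_prod z w) powr (- (real CARD('n) + 1 + (- b * q / p) + q * \<gamma>))) \<partial>ball_measure)
      \<le> ennreal (C * (1 - (norm z)\<^sup>2) powr (- (q * \<gamma>)))"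
    by (rule forelli_rudin[OF dual_weight_exponent s, where 'n='n]) blast
  show ?thesis
  proof (rule that[of "C powr (1/q)"])
    show "C powr (1/q) > 0" using C(1) by simp
    fix f :: "complex^'n \<Rightarrow> complex" and A and z :: "complex^'n"
    assume f [measurable]: "f \<in> borel_measurable ball_measure" and A: "Ip p b f \<le> ennreal A" "A \<ge> 0" and z: "norm z < 1"
    define g where "g w = 1 / norm (1 - herm_prod z w) ^ (CARD('n) + 1)" for w
    have gq: "g w powr q = norm (1 - herm_prod z w) powr (- (n * q))" if "norm w < 1" for w
    proof -
      have "norm (1 - herm_prod z w) > 0" using one_minus_herm_prod_nonzero(1)[OF z less_imp_le[OF that]] by simp
      hence "norm (1 - herm_prod z w) powr n = norm (1 - herm_prod z w) ^ (CARD('n) + 1)"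
        using powr_realpow[of "norm (1 - herm_prod z w)" "CARD('n) + 1"] by (simp add: n_def add.commute)
      hence "g w = norm (1 - herm_prod z w) powr (- n)" by (simp add: g_def powr_minus_divide)
      thus ?thesis by (simp add: powr_powr)
    qed
    have "(\<integral>\<^sup>+w. ennreal (norm (f w) * g w) \<partial>ball_measure)
      \<le> ennreal (A powr (1/p) * (C * (1 - (norm z)\<^sup>2) powr (- (q * \<gamma>))) powr (1/q))"
    proof (rule Hoelder_Ip[OF _ _ _ A])
      have "(\<integral>\<^sup>+w. ennreal (g w powr q * (1 - (norm w)\<^sup>2) powr (- b * q / p)) \<partial>ball_measure) =
        (\<integral>\<^sup>+w. ennreal ((1 - (norm w)\<^sup>2) powr (- b * q / p) * norm (1 - herm_prod z w) powr (- (real CARD('n) + 1 + (- b * q / p) + q * \<gamma>))) \<partial>ball_measure)"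
        unfolding expo[unfolded n_def] by (intro nn_integral_cong) (simp add: gq[unfolded n_def] mult.commute)
      thus "(\<integral>\<^sup>+w. ennreal (g w powr q * (1 - (norm w)\<^sup>2) powr (- b * q / p)) \<partial>ball_measure) \<le> ennreal (C * (1 - (norm z)\<^sup>2) powr (- (q * \<gamma>)))"
        using C(2)[OF z] by simp
      show "g \<in> borel_measurable ball_measure" unfolding g_def by measurable
    qed (use C(1) in \<open>auto simp: g_def\<close>)
    also have "(C * (1 - (norm z)\<^sup>2) powr (- (q * \<gamma>))) powr (1/q) = C powr (1/q) * (1 - (norm z)\<^sup>2) powr (- \<gamma>)"
      using exponents(3) C(1) by (simp add: powr_mult powr_powr)
    finally show "(\<integral>\<^sup>+w. ennreal (norm (f w) * (1 / norm (1 - herm_prod z w) ^ (CARD('n) + 1))) \<partial>ball_measure)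
       \<le> ennreal (C powr (1/q) * A powr (1/p) * (1 - (norm z)\<^sup>2) powr (- \<gamma>))"
      unfolding g_def by (simp add: mult_ac)
  qed
qed

text \<open>The Forelli-Rudin estimate with \<open>t = b\<close> and \<open>s = (n+1) p - (n+1) - b\<close>, which is positive since \<open>b < p - 1\<close>.\<close>

lemma kernel_family_bounded:
  defines "\<gamma> \<equiv> (real CARD('n) + 1 + b) / p"
  obtains C where "C > 0" "\<And>z :: complex^'n. norm z < 1 \<Longrightarrow>
     Ip p b (\<lambda>w. of_real ((1 - (norm z)\<^sup>2) powr (real CARD('n) + 1 - \<gamma>)) * (1 / (1 - herm_prod w z) ^ (CARD('n) + 1)) :: complex) \<le> ennreal C"
proof -
  define n where "n = real CARD('n) + 1"
  define s where "s = n * p - n - b"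
  have s: "s > 0"
  proof -
    have "1 * (p - 1) \<le> n * (p - 1)" using p1 by (intro mult_right_mono) (auto simp: n_def)
    thus ?thesis unfolding s_def using bp by (simp add: right_diff_distrib)
  qed
  have \<gamma>p: "\<gamma> * p = n + b" unfolding \<gamma>_def n_def using exponents(4) by simp
  obtain C where C: "C > 0" "\<And>z::complex^'n. norm z < 1 \<Longrightarrow>
    (\<integral>\<^sup>+w. ennreal ((1 - (norm w)\<^sup>2) powr b * norm (1 - herm_prod z w) powr (- (real CARD('n) + 1 + b + s))) \<partial>ball_measure)
      \<le> ennreal (C * (1 - (norm z)\<^sup>2) powr (- s))"
    by (rule forelli_rudin[OF b1 s, where 'n='n]) blast
  show ?thesis
  proof (rule that[OF C(1)])
    fix z :: "complex^'n" assume z: "norm z < 1"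
    have dz: "1 - (norm z)\<^sup>2 > 0" by (rule one_minus_norm2_pos[OF z])
    have "Ip p b (\<lambda>w. of_real ((1 - (norm z)\<^sup>2) powr (real CARD('n) + 1 - \<gamma>)) * (1 / (1 - herm_prod w z) ^ (CARD('n) + 1)) :: complex)
      = (\<integral>\<^sup>+w. ennreal ((1 - (norm z)\<^sup>2) powr s) * ennreal ((1 - (norm w)\<^sup>2) powr b * norm (1 - herm_prod z w) powr (- (real CARD('n) + 1 + b + s))) \<partial>ball_measure)"
      unfolding Ip_def
    proof (rule nn_integral_cong)
      fix w :: "complex^'n" assume "w \<in> space ball_measure"
      hence w: "norm w < 1" by simp
      have pos: "norm (1 - herm_prod z w) > 0" using one_minus_herm_prod_nonzero(1)[OF z less_imp_le[OF w]] by simp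
      have e1: "(n - \<gamma>) * p = s" unfolding s_def using \<gamma>p by (simp add: left_diff_distrib)
      have e2: "n + b + s = n * p" by (simp add: s_def)
      have "norm (of_real ((1 - (norm z)\<^sup>2) powr (n - \<gamma>)) * (1 / (1 - herm_prod w z) ^ (CARD('n) + 1)) :: complex)
        = (1 - (norm z)\<^sup>2) powr (n - \<gamma>) * norm (1 - herm_prod z w) powr (- n)"
      proof -
        have "norm (1 - herm_prod z w) powr n = norm (1 - herm_prod z w) ^ (CARD('n) + 1)"
          using powr_realpow[OF pos, of "CARD('n) + 1"] by (simp add: n_def add.commute)
        thus ?thesis
          by (simp add: norm_mult norm_divide norm_power norm_one_minus_herm_prod_commute[of w z] powr_minus_divide)
      qed
      hence "norm (of_real ((1 - (norm z)\<^sup>2) powr (n - \<gamma>)) * (1 / (1 - herm_prod w z) ^ (CARD('n) + 1)) :: complex) powr p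
        = (1 - (norm z)\<^sup>2) powr s * norm (1 - herm_prod z w) powr (- (n + b + s))"
        unfolding e2 by (simp add: powr_mult powr_powr e1)
      thus "ennreal (norm (of_real ((1 - (norm z)\<^sup>2) powr (real CARD('n) + 1 - \<gamma>)) * (1 / (1 - herm_prod w z) ^ (CARD('n) + 1)) :: complex) powr p * (1 - (norm w)\<^sup>2) powr b)
        = ennreal ((1 - (norm z)\<^sup>2) powr s) * ennreal ((1 - (norm w)\<^sup>2) powr b * norm (1 - herm_prod z w) powr (- (real CARD('n) + 1 + b + s)))"
        unfolding n_def by (simp only: ennreal_mult'[symmetric] powr_ge_zero mult_ac)
    qed
    also have "\<dots> = ennreal ((1 - (norm z)\<^sup>2) powr s) * (\<integral>\<^sup>+w. ennreal ((1 - (norm w)\<^sup>2) powr b * norm (1 - herm_prod z w) powr (- (real CARD('n) + 1 + b + s))) \<partial>ball_measure)"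
      by (rule nn_integral_cmult) measurable
    also have "\<dots> \<le> ennreal ((1 - (norm z)\<^sup>2) powr s) * ennreal (C * (1 - (norm z)\<^sup>2) powr (- s))"
      by (rule mult_left_mono[OF C(2)[OF z]]) simp
    also have "\<dots> = ennreal C"
      using dz by (simp add: ennreal_mult'[symmetric] powr_minus field_simps)
    finally show "Ip p b (\<lambda>w. of_real ((1 - (norm z)\<^sup>2) powr (real CARD('n) + 1 - \<gamma>)) * (1 / (1 - herm_prod w z) ^ (CARD('n) + 1)) :: complex) \<le> ennreal C" .
  qed
qed

lemma norm_le_kernel_pairing:
  fixes f :: "complex^'n \<Rightarrow> complex"
  assumes f: "holomorphic_ball f" "integrable ball_measure f" and z: "norm z < 1"
  shows "ennreal (norm (f z)) \<le> (\<integral>\<^sup>+w. ennreal (norm (f w) * (1 / norm (1 - herm_prod z w) ^ (CARD('n) + 1))) \<partial>ball_measure)"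
proof -
  have "integrable ball_measure (\<lambda>w. f w * (1 / (1 - herm_prod z w) ^ (CARD('n) + 1)))"
    by (rule integrable_mult_bounded[OF f(2), where B = "1 / (1 - norm z) ^ (CARD('n) + 1)"])
       (measurable, rule norm_bergman_kernel_le[OF z], simp)
  from integral_norm_bound_ennreal[OF this] show ?thesis
    using bergman_reproducing[OF f z] by (simp add: norm_divide norm_power norm_mult)
qed

text \<open>The pairing with the kernel is split at a radius \<open>r\<close>. The part of \<open>f\<close> outside has small norm and contributes little
by \<open>kernel_pairing_le\<close>; inside the kernel is bounded and the factor \<open>(1 - |z|^2)^\<gamma>\<close> tends to 0.\<close>

lemma little_o_at_boundary:
  fixes f :: "complex^'n \<Rightarrow> complex" and z :: "nat \<Rightarrow> complex^'n"
  defines "\<gamma> \<equiv> (real CARD('n) + 1 + b) / p"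
  assumes f: "f \<in> bergman_space p (standard_weight b)"
    and z: "\<And>k. norm (z k) < 1" and lim: "(\<lambda>k. norm (z k)) \<longlonglongrightarrow> 1"
  shows "(\<lambda>k. norm (f (z k)) * (1 - (norm (z k))\<^sup>2) powr \<gamma>) \<longlonglongrightarrow> 0"
proof -
  define N where "N = CARD('n) + 1"
  have hol: "holomorphic_ball f" and If: "Ip p b f < \<infinity>" using f bergman_space_iff by auto
  have fm [measurable]: "f \<in> borel_measurable ball_measure" by (rule holomorphic_ball_measurable[OF hol])
  have int: "integrable ball_measure f" by (rule bergman_space_integrable[OF fm If])
  have \<gamma>: "\<gamma> > 0" unfolding \<gamma>_def using b1 exponents(4) by (simp add: add_nonneg_pos)
  obtain C where C: "C > 0" "\<And>(f :: complex^'n \<Rightarrow> complex) A z. f \<in> borel_measurable ball_measure \<Longrightarrow>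
     Ip p b f \<le> ennreal A \<Longrightarrow> A \<ge> 0 \<Longrightarrow> norm z < 1 \<Longrightarrow>
     (\<integral>\<^sup>+w. ennreal (norm (f w) * (1 / norm (1 - herm_prod z w) ^ N)) \<partial>ball_measure)
       \<le> ennreal (C * A powr (1/p) * (1 - (norm z)\<^sup>2) powr (- \<gamma>))"
    unfolding \<gamma>_def N_def by (rule kernel_pairing_le[where 'n='n]) blast
  define a where "a m w = (if norm w \<le> 1 - 1 / real (Suc m) then 0 else f w)" for m w
  have [measurable]: "a m \<in> borel_measurable ball_measure" for m unfolding a_def by measurable
  have "(\<lambda>m. Ip p b (a m)) \<longlonglongrightarrow> (\<integral>\<^sup>+z. 0 \<partial>(ball_measure :: (complex^'n) measure))"
    unfolding Ip_def
  proof (rule nn_integral_dominated_convergence[where w = "\<lambda>z. ennreal (norm (f z) powr p * (1 - (norm z)\<^sup>2) powr b)"])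
    show "(\<integral>\<^sup>+z. ennreal (norm (f z) powr p * (1 - (norm z)\<^sup>2) powr b) \<partial>ball_measure) < \<infinity>" using If by (simp add: Ip_def)
    show "AE w in ball_measure. (\<lambda>m. ennreal (norm (a m w) powr p * (1 - (norm w)\<^sup>2) powr b)) \<longlonglongrightarrow> 0"
    proof (rule AE_I2)
      fix w :: "complex^'n" assume "w \<in> space ball_measure"
      hence "1 - norm w > 0" by simp
      hence "\<forall>\<^sub>F m in sequentially. 1 / real (Suc m) < 1 - norm w"
        using LIMSEQ_inverse_real_of_nat by (intro order_tendstoD(2)) (auto simp: inverse_eq_divide)
      hence "\<forall>\<^sub>F m in sequentially. ennreal (norm (a m w) powr p * (1 - (norm w)\<^sup>2) powr b) = 0"
        by eventually_elim (simp add: a_def)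
      thus "(\<lambda>m. ennreal (norm (a m w) powr p * (1 - (norm w)\<^sup>2) powr b)) \<longlonglongrightarrow> 0" by (rule tendsto_eventually)
    qed
    show "AE w in ball_measure. ennreal (norm (a m w) powr p * (1 - (norm w)\<^sup>2) powr b) \<le> ennreal (norm (f w) powr p * (1 - (norm w)\<^sup>2) powr b)" for m
      by (rule AE_I2) (simp add: a_def ennreal_leI)
  qed measurable
  hence tail: "(\<lambda>m. Ip p b (a m)) \<longlonglongrightarrow> 0" by simp
  define L where "L = (LINT w|ball_measure. norm (f w))"
  have L0: "L \<ge> 0" by (simp add: L_def)
  show ?thesis
  proof (rule tendsto_0_nonneg)
    fix e :: real assume e: "e > 0"
    define A where "A = (e / 2 / C) powr p"
    have A: "A > 0" "C * A powr (1/p) = e / 2" using e C(1) exponents(4) by (auto simp: A_def powr_powr)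
    have "\<forall>\<^sub>F m in sequentially. Ip p b (a m) < ennreal A" using A(1) by (intro order_tendstoD(2)[OF tail]) simp
    from eventually_happens'[OF sequentially_bot this] obtain m where m: "Ip p b (a m) \<le> ennreal A"
      by (auto intro: less_imp_le)
    define r where "r = 1 - 1 / real (Suc m)"
    have r: "r < 1" by (simp add: r_def)
    define K where "K = L / (1 - r) ^ N"
    have K: "K \<ge> 0" using L0 r by (simp add: K_def)
    have bd: "norm (f x) * (1 - (norm x)\<^sup>2) powr \<gamma> \<le> e / 2 + K * (1 - (norm x)\<^sup>2) powr \<gamma>" if x: "norm x < 1" for x
    proof -
      have dx: "1 - (norm x)\<^sup>2 > 0" by (rule one_minus_norm2_pos[OF x])
      have "ennreal (norm (f x)) \<le> (\<integral>\<^sup>+w. ennreal (norm (f w) * (1 / norm (1 - herm_prod x w) ^ N)) \<partial>ball_measure)"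
        unfolding N_def by (rule norm_le_kernel_pairing[OF hol int x])
      also have "\<dots> \<le> (\<integral>\<^sup>+w. ennreal (norm (a m w) * (1 / norm (1 - herm_prod x w) ^ N)) + ennreal (1 / (1 - r) ^ N) * ennreal (norm (f w)) \<partial>ball_measure)"
      proof (rule nn_integral_mono)
        fix w :: "complex^'n" assume "w \<in> space ball_measure"
        hence w: "norm w < 1" by simp
        show "ennreal (norm (f w) * (1 / norm (1 - herm_prod x w) ^ N)) \<le> ennreal (norm (a m w) * (1 / norm (1 - herm_prod x w) ^ N)) + ennreal (1 / (1 - r) ^ N) * ennreal (norm (f w))"
        proof (cases "norm w \<le> r")
          case True
          have "1 / norm (1 - herm_prod x w) ^ N \<le> 1 / (1 - norm w) ^ N"
            using norm_bergman_kernel_le[OF w x, of N] by (simp add: norm_divide norm_power norm_one_minus_herm_prod_commute[of w x])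
          also have "\<dots> \<le> 1 / (1 - r) ^ N" using True r by (intro divide_left_mono power_mono mult_pos_pos zero_less_power) auto
          finally have "norm (f w) * (1 / norm (1 - herm_prod x w) ^ N) \<le> norm (f w) * (1 / (1 - r) ^ N)" by (rule mult_left_mono) simp
          hence "ennreal (norm (f w) * (1 / norm (1 - herm_prod x w) ^ N)) \<le> ennreal (1 / (1 - r) ^ N) * ennreal (norm (f w))"
            using r by (simp add: ennreal_mult'[symmetric] ennreal_leI)
          thus ?thesis by (rule order_trans) simp
        next
          case False
          hence "a m w = f w" by (simp add: a_def r_def)
          thus ?thesis by simp
        qed
      qed
      also have "\<dots> = (\<integral>\<^sup>+w. ennreal (norm (a m w) * (1 / norm (1 - herm_prod x w) ^ N)) \<partial>ball_measure) + ennreal (1 / (1 - r) ^ N) * (\<integral>\<^sup>+w. ennreal (norm (f w)) \<partial>ball_measure)"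
        by (subst nn_integral_add, measurable, subst nn_integral_cmult) measurable
      also have "(\<integral>\<^sup>+w. ennreal (norm (f w)) \<partial>ball_measure) = ennreal L"
        unfolding L_def by (rule nn_integral_eq_integral[OF integrable_norm[OF int]]) simp
      also have "(\<integral>\<^sup>+w. ennreal (norm (a m w) * (1 / norm (1 - herm_prod x w) ^ N)) \<partial>ball_measure) + ennreal (1 / (1 - r) ^ N) * ennreal L
        \<le> ennreal (C * A powr (1/p) * (1 - (norm x)\<^sup>2) powr (- \<gamma>)) + ennreal (1 / (1 - r) ^ N) * ennreal L"
        using A(1) by (intro add_right_mono C(2) m x) auto
      also have "\<dots> = ennreal (e / 2 * (1 - (norm x)\<^sup>2) powr (- \<gamma>) + K)"
        unfolding A(2) K_def using r L0 e by (simp add: ennreal_mult'[symmetric] ennreal_plus[symmetric] del: ennreal_plus)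
      finally have "norm (f x) \<le> e / 2 * (1 - (norm x)\<^sup>2) powr (- \<gamma>) + K"
        using K e by (subst (asm) ennreal_le_iff) auto
      hence "norm (f x) * (1 - (norm x)\<^sup>2) powr \<gamma> \<le> (e / 2 * (1 - (norm x)\<^sup>2) powr (- \<gamma>) + K) * (1 - (norm x)\<^sup>2) powr \<gamma>"
        by (rule mult_right_mono) simp
      also have "\<dots> = e / 2 + K * (1 - (norm x)\<^sup>2) powr \<gamma>" using dx by (simp add: powr_minus field_simps)
      finally show ?thesis .
    qed
    have "(\<lambda>k. 1 - (norm (z k))\<^sup>2) \<longlonglongrightarrow> 1 - 1\<^sup>2" by (intro tendsto_intros lim)
    hence "(\<lambda>k. (1 - (norm (z k))\<^sup>2) powr \<gamma>) \<longlonglongrightarrow> 0"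
      using \<gamma> one_minus_norm2_pos[OF z] by (intro tendsto_zero_powrI[OF _ tendsto_const]) (auto simp: less_imp_le)
    hence "(\<lambda>k. K * (1 - (norm (z k))\<^sup>2) powr \<gamma>) \<longlonglongrightarrow> 0" by (rule tendsto_mult_right_zero)
    hence "\<forall>\<^sub>F k in sequentially. K * (1 - (norm (z k))\<^sup>2) powr \<gamma> < e / 2" using e by (intro order_tendstoD(2)) auto
    thus "\<forall>\<^sub>F k in sequentially. norm (f (z k)) * (1 - (norm (z k))\<^sup>2) powr \<gamma> < e"
    proof eventually_elim
      case (elim k)
      thus ?case using bd[OF z[of k]] by linarith
    qed
  qed simp
qed

end

context bounded_symbol
begin

lemma toeplitz_of_bergman_kernel: "toeplitz u (\<lambda>x. c * (1 / (1 - herm_prod x z) ^ (CARD('n) + 1))) w = c * toeplitz_kernel z w"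
proof -
  have "toeplitz u (\<lambda>x. c * (1 / (1 - herm_prod x z) ^ (CARD('n) + 1))) w
    = (LINT x|ball_measure. c * (u x * (1 / ((1 - herm_prod x z) ^ (CARD('n) + 1) * (1 - herm_prod w x) ^ (CARD('n) + 1)))))"
    unfolding toeplitz_def by (intro Bochner_Integration.integral_cong refl) (simp add: mult_ac)
  thus ?thesis by (simp only: toeplitz_kernel_def integral_mult_right_zero)
qed

text \<open>The function \<open>T\<^sub>u K\<^sub>z\<close> is holomorphic and square integrable, so pairing it with \<open>K\<^sub>z\<close> evaluates it
at \<open>z\<close>.\<close>

lemma berezin_eq_diagonal:
  assumes z: "norm z < 1"
  shows "berezin u z = toeplitz_kernel z z * of_real ((1 - (norm z)\<^sup>2) ^ (CARD('n) + 1))"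
proof -
  \<comment> \<open>boundedness on the unweighted square integrable functions gives the integrability of \<open>T\<^sub>u K\<^sub>z\<close>\<close>
  interpret L2: toeplitz_setting u U 2 0
    by unfold_locales auto
  define N where "N = CARD('n) + 1"
  define c where "c = complex_of_real ((1 - (norm z)\<^sup>2) powr ((real CARD('n) + 1) / 2))"
  have dz: "1 - (norm z)\<^sup>2 > 0" by (rule one_minus_norm2_pos[OF z])
  have cc: "c * c = of_real ((1 - (norm z)\<^sup>2) ^ N)"
  proof -
    have "(1 - (norm z)\<^sup>2) powr ((real CARD('n) + 1) / 2) * (1 - (norm z)\<^sup>2) powr ((real CARD('n) + 1) / 2) = (1 - (norm z)\<^sup>2) powr (real N)"
      by (simp add: powr_add[symmetric] N_def add.commute)
    also have "\<dots> = (1 - (norm z)\<^sup>2) ^ N" using dz by (rule powr_realpow)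
    finally show ?thesis unfolding c_def of_real_mult[symmetric] by simp
  qed
  have nk: "norm_kernel z = (\<lambda>x. c * (1 / (1 - herm_prod x z) ^ N))"
    by (rule ext) (simp add: norm_kernel_def c_def N_def)
  have KX: "(\<lambda>x. 1 * (1 / (1 - herm_prod x z) ^ N)) \<in> L2.X"
  proof (rule L2.bounded_holomorphic_in_bergman_space)
    show "holomorphic_ball (\<lambda>x. 1 * (1 / (1 - herm_prod x z) ^ N))" using holomorphic_bergman_kernel[OF z] by simp
    show "norm (1 * (1 / (1 - herm_prod x z) ^ N)) \<le> 1 / (1 - norm z) ^ N" if "norm x < 1" for x
      using norm_bergman_kernel_le[OF z that, of N] by (simp add: norm_divide norm_power norm_one_minus_herm_prod_commute[of x z])
  qed
  have "toeplitz_kernel z = toeplitz u (\<lambda>x. 1 * (1 / (1 - herm_prod x z) ^ N))"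
    unfolding N_def by (rule ext) (subst toeplitz_of_bergman_kernel, rule mult_1[symmetric])
  hence tX: "toeplitz_kernel z \<in> L2.X" using L2.toeplitz_in_space[OF KX] by simp
  have "berezin u z = (LINT w|ball_measure. (c * c) * (toeplitz_kernel z w / (1 - herm_prod z w) ^ N))"
    unfolding berezin_def L2_inner_def
  proof (intro Bochner_Integration.integral_cong refl)
    fix w
    have t: "toeplitz u (norm_kernel z) w = c * toeplitz_kernel z w" unfolding nk N_def by (rule toeplitz_of_bergman_kernel)
    have "cnj (norm_kernel z w) = c / (1 - herm_prod z w) ^ N"
      by (simp add: nk c_def cnj_herm_prod)
    thus "toeplitz u (norm_kernel z) w * cnj (norm_kernel z w) = (c * c) * (toeplitz_kernel z w / (1 - herm_prod z w) ^ N)"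
      unfolding t by simp
  qed
  also have "\<dots> = c * c * (LINT w|ball_measure. toeplitz_kernel z w / (1 - herm_prod z w) ^ N)" by (rule integral_mult_right_zero)
  also have "(LINT w|ball_measure. toeplitz_kernel z w / (1 - herm_prod z w) ^ N) = toeplitz_kernel z z"
    unfolding N_def by (rule bergman_reproducing[OF L2.XD(1,4)[OF tX] z])
  finally show ?thesis unfolding cc N_def by (simp add: mult.commute)
qed

end

context toeplitz_setting
begin

text \<open>The test functions \<open>f k\<close> are the kernels at points approaching the sphere, normalized to be bounded in the
space. If the images of a subsequence converge to \<open>g\<close>, the Berezin transform at those points is bounded by the
distance to \<open>g\<close> plus a term that tends to 0 by \<open>little_o_at_boundary\<close>, which is impossible.\<close>

theorem berezin_vanishes_if_compact:
  assumes cpt: "toeplitz_compact u p b"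
  shows "(berezin u \<longlongrightarrow> 0) (filtercomap norm (at_left 1))"
proof (rule ccontr)
  define N where "N = CARD('n) + 1"
  define \<gamma> where "\<gamma> = (real CARD('n) + 1 + b) / p"
  let ?N = "weighted_norm p (standard_weight b) :: (complex^'n \<Rightarrow> complex) \<Rightarrow> real"
  assume "\<not> (berezin u \<longlongrightarrow> 0) (filtercomap norm (at_left 1))"
  then obtain \<epsilon> where \<epsilon>: "\<epsilon> > 0" "\<And>r. r < 1 \<Longrightarrow> \<exists>z. r < norm z \<and> norm z < 1 \<and> norm (berezin u z) > \<epsilon>"
    unfolding tendsto_0_boundary_iff by (meson not_le)
  have "\<forall>k. \<exists>z. 1 - 1 / real (Suc k) < norm z \<and> norm z < 1 \<and> norm (berezin u z) > \<epsilon>"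
    using \<epsilon>(2) by simp
  then obtain z where z: "\<And>k. 1 - 1 / real (Suc k) < norm (z k)" "\<And>k. norm (z k) < 1" "\<And>k. norm (berezin u (z k)) > \<epsilon>"
    by metis
  have zlim: "(\<lambda>k. norm (z k)) \<longlonglongrightarrow> 1"
  proof (rule tendsto_sandwich[OF _ _ _ tendsto_const])
    show "(\<lambda>k. 1 - 1 / real (Suc k)) \<longlonglongrightarrow> 1"
      using tendsto_diff[OF tendsto_const[of "1::real"] LIMSEQ_inverse_real_of_nat] by (simp add: inverse_eq_divide)
  qed (intro always_eventually allI less_imp_le z)+
  define f where "f k w = of_real ((1 - (norm (z k))\<^sup>2) powr (real CARD('n) + 1 - \<gamma>)) * (1 / (1 - herm_prod w (z k)) ^ N)" for k w
  obtain A where A: "A > 0" "\<And>k. Ip p b (f k) \<le> ennreal A"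
    unfolding f_def \<gamma>_def N_def by (rule kernel_family_bounded[where 'n='n]) (use z(2) in blast)
  have fX: "f k \<in> X" for k
  proof -
    define c where "c = complex_of_real ((1 - (norm (z k))\<^sup>2) powr (real CARD('n) + 1 - \<gamma>))"
    have "holomorphic_ball (\<lambda>w. c * (1 / (1 - herm_prod w (z k)) ^ N))"
      by (rule holomorphic_ball_cmult[OF holomorphic_bergman_kernel[OF z(2)]])
    hence "holomorphic_ball (f k)" by (simp add: f_def[abs_def] c_def)
    thus ?thesis using A(2)[of k] le_less_trans[OF A(2)[of k] ennreal_less_top] bergman_space_iff by auto
  qed
  have "?N (f k) \<le> (A / weight_mass) powr (1 / p)" for k
    unfolding Ip_weighted_norm(2)[OF XD(2,3)[OF fX]]
    using A weight_mass_pos exponents(4) by (intro powr_mono2 divide_right_mono enn2real_leI) auto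
  hence "bdd_above (range (\<lambda>k. ?N (f k)))" by (intro bdd_aboveI) auto
  with fX cpt obtain r g where r: "strict_mono (r :: nat \<Rightarrow> nat)" and g: "g \<in> X" and
    conv: "(\<lambda>k. ?N (\<lambda>w. toeplitz u (f (r k)) w - g w)) \<longlonglongrightarrow> 0"
    unfolding toeplitz_compact_def compact_operator_on_def by blast
  define D where "D k w = toeplitz u (f (r k)) w - g w" for k w
  have DX: "D k \<in> X" for k unfolding D_def by (rule X_diff(1)[OF toeplitz_in_space[OF fX] g])
  obtain C where C: "C > 0" "\<And>(f :: complex^'n \<Rightarrow> complex) A z. f \<in> borel_measurable ball_measure \<Longrightarrow>
     Ip p b f \<le> ennreal A \<Longrightarrow> A \<ge> 0 \<Longrightarrow> norm z < 1 \<Longrightarrow>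
     (\<integral>\<^sup>+w. ennreal (norm (f w) * (1 / norm (1 - herm_prod z w) ^ (CARD('n) + 1))) \<partial>ball_measure)
       \<le> ennreal (C * A powr (1/p) * (1 - (norm z)\<^sup>2) powr (- \<gamma>))"
    unfolding \<gamma>_def by (rule kernel_pairing_le[where 'n='n]) blast
  have Dle: "norm (D k x) * (1 - (norm x)\<^sup>2) powr \<gamma> \<le> C * weight_mass powr (1/p) * ?N (D k)" if x: "norm x < 1" for k x
  proof -
    have dx: "1 - (norm x)\<^sup>2 > 0" by (rule one_minus_norm2_pos[OF x])
    have N0: "?N (D k) \<ge> 0" by (simp add: weighted_norm_def)
    have eq: "(weight_mass * ?N (D k) powr p) powr (1/p) = weight_mass powr (1/p) * ?N (D k)"
      using weight_mass_pos N0 exponents(4) by (simp add: powr_mult powr_powr)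
    have "ennreal (norm (D k x)) \<le> ennreal (C * (weight_mass * ?N (D k) powr p) powr (1/p) * (1 - (norm x)\<^sup>2) powr (- \<gamma>))"
      by (rule order_trans[OF norm_le_kernel_pairing[OF XD(1,4)[OF DX] x] C(2)[OF XD(2)[OF DX] _ _ x]])
         (use Ip_weighted_norm(1)[OF XD(2,3)[OF DX]] weight_mass_pos in auto)
    hence "norm (D k x) \<le> C * (weight_mass powr (1/p) * ?N (D k)) * (1 - (norm x)\<^sup>2) powr (- \<gamma>)"
      unfolding eq using C(1) N0 by (simp add: ennreal_le_iff)
    hence "norm (D k x) * (1 - (norm x)\<^sup>2) powr \<gamma> \<le> C * (weight_mass powr (1/p) * ?N (D k)) * (1 - (norm x)\<^sup>2) powr (- \<gamma>) * (1 - (norm x)\<^sup>2) powr \<gamma>"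
      by (rule mult_right_mono) simp
    also have "\<dots> = C * weight_mass powr (1/p) * ?N (D k)" using dx by (simp add: powr_minus field_simps)
    finally show ?thesis .
  qed
  have bz: "norm (berezin u (z (r k))) \<le> C * weight_mass powr (1/p) * ?N (D k) + norm (g (z (r k))) * (1 - (norm (z (r k)))\<^sup>2) powr \<gamma>" for k
  proof -
    define x where "x = z (r k)"
    have x: "norm x < 1" using z(2) by (simp add: x_def)
    have dx: "1 - (norm x)\<^sup>2 > 0" by (rule one_minus_norm2_pos[OF x])
    have "toeplitz u (f (r k)) x = of_real ((1 - (norm x)\<^sup>2) powr (real CARD('n) + 1 - \<gamma>)) * toeplitz_kernel x x"
      unfolding f_def[abs_def] x_def[symmetric] N_def by (rule toeplitz_of_bergman_kernel)
    moreover have "(1 - (norm x)\<^sup>2) ^ N = (1 - (norm x)\<^sup>2) powr (real CARD('n) + 1 - \<gamma>) * (1 - (norm x)\<^sup>2) powr \<gamma>"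
      using dx by (simp add: powr_add[symmetric] powr_realpow[symmetric] N_def add.commute del: power_Suc)
    ultimately have "berezin u x = toeplitz u (f (r k)) x * of_real ((1 - (norm x)\<^sup>2) powr \<gamma>)"
      unfolding berezin_eq_diagonal[OF x] N_def[symmetric] by (simp add: mult_ac)
    also have "norm \<dots> = norm (D k x + g x) * (1 - (norm x)\<^sup>2) powr \<gamma>" by (simp add: D_def norm_mult)
    also have "\<dots> \<le> (norm (D k x) + norm (g x)) * (1 - (norm x)\<^sup>2) powr \<gamma>" by (intro mult_right_mono norm_triangle_ineq) simp
    also have "\<dots> \<le> C * weight_mass powr (1/p) * ?N (D k) + norm (g x) * (1 - (norm x)\<^sup>2) powr \<gamma>"
      using Dle[OF x, of k] by (simp add: distrib_right)
    finally show ?thesis by (simp add: x_def)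
  qed
  have "(\<lambda>k. C * weight_mass powr (1/p) * ?N (D k) + norm (g (z (r k))) * (1 - (norm (z (r k)))\<^sup>2) powr \<gamma>) \<longlonglongrightarrow> C * weight_mass powr (1/p) * 0 + 0"
  proof (intro tendsto_add tendsto_mult tendsto_const)
    show "(\<lambda>k. ?N (D k)) \<longlonglongrightarrow> 0" using conv by (simp add: D_def[abs_def])
    show "(\<lambda>k. norm (g (z (r k))) * (1 - (norm (z (r k)))\<^sup>2) powr \<gamma>) \<longlonglongrightarrow> 0"
      unfolding \<gamma>_def using LIMSEQ_subseq_LIMSEQ[OF zlim r] by (intro little_o_at_boundary[OF g] z(2)) (simp add: o_def)
  qed
  hence "\<forall>\<^sub>F k in sequentially. C * weight_mass powr (1/p) * ?N (D k) + norm (g (z (r k))) * (1 - (norm (z (r k)))\<^sup>2) powr \<gamma> < \<epsilon>"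
    by (rule order_tendstoD(2)) (use \<epsilon>(1) in simp)
  from eventually_happens'[OF sequentially_bot this] obtain k where "C * weight_mass powr (1/p) * ?N (D k) + norm (g (z (r k))) * (1 - (norm (z (r k)))\<^sup>2) powr \<gamma> < \<epsilon>"
    by blast
  with bz[of k] z(3)[of "r k"] show False by linarith
qed

theorem compact_if_berezin_vanishes:
  assumes "(berezin u \<longlongrightarrow> 0) (filtercomap norm (at_left 1))"
  shows "toeplitz_compact u p b"
proof (rule compact_if_diagonal_vanishes)
  fix \<epsilon> :: real assume "\<epsilon> > 0"
  with assms obtain r where "r < 1" "\<forall>z. r < norm z \<longrightarrow> norm z < 1 \<longrightarrow> norm (berezin u z) \<le> \<epsilon>"
    unfolding tendsto_0_boundary_iff by blast
  thus "\<exists>r<1. \<forall>z. r < norm z \<longrightarrow> norm z < 1 \<longrightarrow> norm (toeplitz_kernel z z * of_real ((1 - (norm z)\<^sup>2) ^ (CARD('n) + 1))) \<le> \<epsilon>"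
    using berezin_eq_diagonal by metis
qed

end

section \<open>The equivalence\<close>

theorem corollary1p5:
  fixes u :: "complex^'n \<Rightarrow> complex"
  assumes "u \<in> Linfty_ball"
  shows "((\<exists>p::real. \<exists>b::real. 1 < p \<and> -1 < b \<and> b < p - 1 \<and> toeplitz_compact u p b)
            \<longleftrightarrow> (\<forall>p b::real. 1 < p \<and> -1 < b \<and> b < p - 1 \<longrightarrow> toeplitz_compact u p b))
       \<and> ((\<forall>p b::real. 1 < p \<and> -1 < b \<and> b < p - 1 \<longrightarrow> toeplitz_compact u p b)
            \<longleftrightarrow> (berezin u \<longlongrightarrow> 0) (filtercomap norm (at_left 1)))"
proof -
  obtain C where C: "u \<in> borel_measurable ball_measure" "AE z in ball_measure. norm (u z) \<le> C"
    using assms by (auto simp: Linfty_ball_def)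
  define U where "U = max C 0"
  have "AE z in ball_measure. norm (u z) \<le> U"
    using C(2) by eventually_elim (simp add: U_def)
  hence u: "bounded_symbol u U" using C(1) by (simp add: bounded_symbol_def U_def)
  have setting: "toeplitz_setting u U p b" if "1 < p" "-1 < b" "b < p - 1" for p b
    using u that by (simp add: toeplitz_setting_def weight_params_def)
  have ac: "(berezin u \<longlongrightarrow> 0) (filtercomap norm (at_left 1))"
    if "1 < p" "-1 < b" "b < p - 1" "toeplitz_compact u p b" for p b
    using toeplitz_setting.berezin_vanishes_if_compact[OF setting] that by blast
  have cb: "toeplitz_compact u p b"
    if "(berezin u \<longlongrightarrow> 0) (filtercomap norm (at_left 1))" "1 < p" "-1 < b" "b < p - 1" for p b
    using toeplitz_setting.compact_if_berezin_vanishes[OF setting] that by blast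
  let ?some = "\<exists>p::real. \<exists>b::real. 1 < p \<and> -1 < b \<and> b < p - 1 \<and> toeplitz_compact u p b"
    and ?all = "\<forall>p b::real. 1 < p \<and> -1 < b \<and> b < p - 1 \<longrightarrow> toeplitz_compact u p b"
    and ?vanish = "(berezin u \<longlongrightarrow> 0) (filtercomap norm (at_left 1))"
  have "?all \<Longrightarrow> ?some" by (intro exI[of _ 2] exI[of _ 0]) auto
  moreover have "?some \<Longrightarrow> ?vanish" using ac by (elim exE conjE) blast
  moreover have "?vanish \<Longrightarrow> ?all" by (intro allI impI, elim conjE) (rule cb)
  ultimately show ?thesis by argo
qed

end
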